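(* Let $n$ be an even positive integer and let $K$ be a bounded convex domain in $\mathbb R^n$ with $C^{\infty}$ boundary $\partial K$. For $\xi\in S^{n-1}$ let $I_\xi=\big(h_K^-(\xi),h_K^+(\xi)\big)$. The following are equivalent: (i) For every $\xi \in S^{n-1}$ and $t\in I_\xi$, $A_K(\xi,t)=\sqrt{q(\xi,t)}\,P(\xi,t)$, where $P(\xi,t)$ and $q(\xi,t)$ are continuous in $\xi$ and polynomials in $t$, with $\deg q(\xi,\cdot)=2$ and $q(\xi,t)>0$ for $t\in I_\xi$. (ii) For every $\xi \in S^{n-1}$ and $t\in I_\xi$, $A_K(\xi,t)=\dfrac{P(\xi,t)}{\sqrt{q(\xi,t)}}$, where $P(\xi,t)$ and $q(\xi,t)$ are continuous in $\xi$ and polynomials in $t$, with $\deg q(\xi,\cdot)=2$ and $q(\xi,t)>0$ for $t\in I_\xi$. (iii) There are an integer $N$ and (a priori continuous) functions $b_0,\dots,b_N$ on $S^{n-1}$ such that for each $\xi\in S^{n-1}$, $\mathcal{H}A_K(\xi,t)=\sum_{j=0}^N b_j(\xi)t^j$ for all $t\in I_\xi$, where $\mathcal H$ acts in the variable $t$. (iv) $K$ is an ellipsoid.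
   Context: For a bounded domain $K\subset\mathbb R^n$, the sectional volume function is $A_K(\xi,t)=\int_{K\cap\{x\cdot\xi=t\}}dx$, the $(n-1)$-dimensional volume of the section of $K$ by the hyperplane $\{x\cdot\xi=t\}$, for $\xi\in S^{n-1}$, $t\in\mathbb R$. The support functions are $h_K^+(\xi)=\max_{x\in K}x\cdot\xi$ and $h_K^-(\xi)=\min_{x\in K}x\cdot\xi$ (with $K$ replaced by its closure). The Hilbert transform of a function $f$ on $\mathbb R$ is $\mathcal Hf(t)=\frac1\pi\,\mathrm{p.v.}\int_{\mathbb R}\frac{f(s)}{t-s}\,ds$. *)

theory Defs
  imports "HOL-Analysis.Analysis" "HOL-Computational_Algebra.Polynomial"
begin

text \<open>A real function f is C-infinity on an open set U if there is a family D of
  functions indexed by lists of basis vectors (D vs = iterated partial derivative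
  along the directions in vs) with D [] = f and such that every D vs is
  (Frechet) differentiable on U with partial derivatives given by D (v # vs).\<close>
definition smooth_on :: "'a::euclidean_space set \<Rightarrow> ('a \<Rightarrow> real) \<Rightarrow> bool" where
  "smooth_on U f \<longleftrightarrow> open U \<and>
     (\<exists>D :: 'a list \<Rightarrow> 'a \<Rightarrow> real. D [] = f \<and>
        (\<forall>vs. \<forall>x\<in>U. (D vs has_derivative (\<lambda>h. \<Sum>v\<in>Basis. (h \<bullet> v) * D (v # vs) x)) (at x)))"

definition smooth_boundary :: "'a::euclidean_space set \<Rightarrow> bool" where
  "smooth_boundary K \<longleftrightarrow>
     (\<forall>p\<in>frontier K. \<exists>U f. p \<in> U \<and> smooth_on U f \<and>
        \<not> (f has_derivative (\<lambda>h. 0)) (at p) \<and>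
        K \<inter> U = {x\<in>U. f x < 0})"

definition h_plus :: "'a::euclidean_space set \<Rightarrow> 'a \<Rightarrow> real" where
  "h_plus K \<xi> = Sup ((\<lambda>x. x \<bullet> \<xi>) ` closure K)"

definition h_minus :: "'a::euclidean_space set \<Rightarrow> 'a \<Rightarrow> real" where
  "h_minus K \<xi> = Inf ((\<lambda>x. x \<bullet> \<xi>) ` closure K)"

text \<open>A fixed basis vector e0; the hyperplane {x. x \<bullet> e0 = t} is parametrised by
  the coordinates along the remaining basis vectors, and carries the
  (n-1)-dimensional Lebesgue measure (product of lborel over Basis - {e0}).
  A general hyperplane {x. x \<bullet> \<xi> = t}, \<xi> a unit vector, is the image of
  {x. x \<bullet> e0 = t} under an orthogonal transformation sending e0 to \<xi>.\<close>
definition e0 :: "'a::euclidean_space" where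
  "e0 = (SOME b. b \<in> Basis)"

definition rot_to :: "'a::euclidean_space \<Rightarrow> 'a \<Rightarrow> 'a" where
  "rot_to \<xi> = (SOME T. orthogonal_transformation T \<and> T e0 = \<xi>)"

definition sectional_volume :: "'a::euclidean_space set \<Rightarrow> 'a \<Rightarrow> real \<Rightarrow> real" where
  "sectional_volume K \<xi> t =
     measure (PiM (Basis - {e0}) (\<lambda>_. lborel))
       {y \<in> space (PiM (Basis - {e0}) (\<lambda>_. (lborel::real measure))).
          rot_to \<xi> (t *\<^sub>R e0 + (\<Sum>b\<in>Basis - {e0}. y b *\<^sub>R b)) \<in> K}"

definition has_hilbert_transform :: "(real \<Rightarrow> real) \<Rightarrow> real \<Rightarrow> real \<Rightarrow> bool" where
  "has_hilbert_transform f t v \<longleftrightarrow>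
     (\<forall>\<epsilon>>0. (\<lambda>s. f s / (t - s)) integrable_on {s. \<epsilon> \<le> \<bar>t - s\<bar>}) \<and>
     ((\<lambda>\<epsilon>. (1 / pi) * integral {s. \<epsilon> \<le> \<bar>t - s\<bar>} (\<lambda>s. f s / (t - s))) \<longlongrightarrow> v) (at_right 0)"

definition is_ellipsoid :: "'a::euclidean_space set \<Rightarrow> bool" where
  "is_ellipsoid K \<longleftrightarrow> (\<exists>(T::'a \<Rightarrow> 'a) c. linear T \<and> inj T \<and> K = (\<lambda>x. c + T x) ` ball 0 1)"

end

theory Submission
  imports Defs "HOL-Complex_Analysis.Complex_Analysis" "HOL-Computational_Algebra.Polynomial_Factorial"
    "HOL-Computational_Algebra.Field_as_Ring" "HOL-Computational_Algebra.Fundamental_Theorem_Algebra"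
begin

text \<open>
  If the Hilbert transform of \<open>A = A\<^sub>K(\<xi>, \<cdot>)\<close> is a polynomial on the support \<open>[a, b]\<close> of \<open>A\<close>, then the
  Cauchy transform \<open>F\<close> of \<open>A\<close> satisfies \<open>(F - P)\<^sup>2 = T\<close> off \<open>[a, b]\<close> with polynomials \<open>P\<close>, \<open>T\<close>, and
  positivity of \<open>A\<close> on \<open>(a, b)\<close> makes \<open>a\<close> and \<open>b\<close> the only roots of \<open>T\<close> of odd order.

  The moments of \<open>A\<^sub>K(u + l v, \<cdot>)\<close> (extended homogeneously from the sphere) are polynomials in \<open>l\<close>, so
  \<open>F\<close> is a power series in \<open>1/z\<close> over \<open>\<complex>[l]\<close>. Uncountably many \<open>l\<close> admit a quadratic relation of one
  common degree, hence there is a relation over \<open>\<complex>[l]\<close>. The squarefree part of the odd part of its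
  discriminant has the endpoints as its roots, so their sum and product are rational in \<open>l\<close>; by their
  growth they are polynomials of degree at most 1 and 2. As this holds on every line avoiding the
  origin, \<open>h\<^sup>+ + h\<^sup>-\<close> is linear and \<open>h\<^sup>+ h\<^sup>-\<close> quadratic, that is, \<open>K\<close> is an ellipsoid.

  The two square root representations reduce to polynomial Hilbert transforms once \<open>q\<close> vanishes at
  both endpoints. Smoothness provides a dense set of directions in which \<open>A\<^sup>2\<close> vanishes exactly to
  the order \<open>n - 1\<close>; since \<open>n\<close> is even this order is odd, and it can only come from a root of \<open>q\<close>.
  Conversely, the sections of an ellipsoid are \<open>C (1 - x\<^sup>2)\<^bsup>(n-1)/2\<^esup>\<close> in the rescaled variable \<open>x\<close>, and
  the Hilbert transform of \<open>sqrt (1 - x\<^sup>2)\<close> is \<open>x\<close> on \<open>(-1, 1)\<close>.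
\<close>

text \<open>The passage through complex \<open>l\<close> shapes the argument. Hilbert transforms,
  and hence relations \<open>(F - P)^2 = T\<close>, are available only for real directions. The
  moments, however, are polynomials in \<open>l\<close> and bounded by a constant times
  \<open>(R * (1 + |l|))^k\<close> at complex \<open>l\<close> as well. A relation with coefficients
  in C[l] therefore holds at every complex \<open>l\<close>, where \<open>F\<close> is still
  holomorphic for \<open>|z| > R * (1 + |l|)\<close>. There its discriminant has a holomorphic
  square root, so roots of odd order are confined to that disc. This is the growth that turns
  rational symmetric functions of the endpoints into polynomials. The degree of \<open>P\<close> may
  vary with the direction, because the square root representations bound no degree; sorting the
  uncountably many real \<open>l\<close> by degree recovers a common one. The parity argument for
  the endpoints works only in selected directions, and \<open>q\<close> is continuous only for each
  fixed \<open>t\<close>; density and interpolation in \<open>t\<close> carry the vanishing of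
  \<open>q\<close> to all directions.\<close>

section \<open>Polynomials over \<complex>[l]\<close>

text \<open>Fraction-free Gaussian elimination. A vector is eliminated by cross-multiplying with a
  nonzero pivot, which keeps all entries in C[l]; the finitely many \<open>l\<close> at which the
  pivot vanishes are discarded, so infinitely many dependent specialisations are asked for. Rows
  carry an arbitrary index type, so that all coefficients of a power series can serve as
  rows.\<close>

lemma dependent_specialisation:
  fixes v :: "'b \<Rightarrow> 'i \<Rightarrow> complex poly"
  assumes "finite J" "infinite L"
    and "\<And>l. l \<in> L \<Longrightarrow> \<exists>c. (\<exists>j\<in>J. c j \<noteq> 0) \<and> (\<forall>i. (\<Sum>j\<in>J. c j * poly (v j i) l) = 0)"
  shows "\<exists>c. (\<exists>j\<in>J. c j \<noteq> 0) \<and> (\<forall>i. (\<Sum>j\<in>J. c j * v j i) = 0)"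
  using assms
proof (induction J arbitrary: v L rule: finite_induct)
  case empty
  then have "L \<noteq> {}" by auto
  then obtain l where "l \<in> L" by blast
  with empty(2) show ?case by fastforce
next
  case (insert k J)
  show ?case
  proof (cases "\<forall>i. v k i = 0")
    case True
    show ?thesis
      by (rule exI[of _ "\<lambda>j. if j = k then 1 else 0"])
         (use True insert.hyps in \<open>auto intro!: sum.neutral\<close>)
  next
    case False
    then obtain i0 where i0: "v k i0 \<noteq> 0" by auto
    define w where "w = (\<lambda>j i. v k i0 * v j i - v j i0 * v k i)"
    define M where "M = L - {l. poly (v k i0) l = 0}"
    have "infinite M"
      unfolding M_def using insert.prems(1) poly_roots_finite[OF i0] by (simp add: Diff_infinite_finite)
    moreover have "\<exists>c. (\<exists>j\<in>J. c j \<noteq> 0) \<and> (\<forall>i. (\<Sum>j\<in>J. c j * poly (w j i) l) = 0)"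
      if "l \<in> M" for l
    proof -
      have l: "l \<in> L" "poly (v k i0) l \<noteq> 0" using that by (auto simp: M_def)
      obtain c where c: "\<exists>j\<in>insert k J. c j \<noteq> 0"
          "\<And>i. (\<Sum>j\<in>insert k J. c j * poly (v j i) l) = 0"
        using insert.prems(2)[OF l(1)] by blast
      have eq: "(\<Sum>j\<in>J. c j * poly (v j i) l) = - c k * poly (v k i) l" for i
        using c(2)[of i] insert.hyps by (simp add: eq_neg_iff_add_eq_0 add.commute)
      have "\<exists>j\<in>J. c j \<noteq> 0"
      proof (rule ccontr)
        assume *: "\<not> ?thesis"
        then have "c k \<noteq> 0" using c(1) by auto
        moreover have "(\<Sum>j\<in>J. c j * poly (v j i0) l) = 0" using * by (simp add: sum.neutral)
        ultimately show False using eq[of i0] l(2) by simp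
      qed
      moreover have "(\<Sum>j\<in>J. c j * poly (w j i) l) = 0" for i
      proof -
        have "(\<Sum>j\<in>J. c j * poly (w j i) l) =
            poly (v k i0) l * (\<Sum>j\<in>J. c j * poly (v j i) l)
            - poly (v k i) l * (\<Sum>j\<in>J. c j * poly (v j i0) l)"
          by (simp add: w_def sum_distrib_left algebra_simps flip: sum_subtractf)
        also have "\<dots> = 0" by (simp add: eq)
        finally show ?thesis .
      qed
      ultimately show ?thesis by blast
    qed
    ultimately obtain c where c: "\<exists>j\<in>J. c j \<noteq> 0" "\<And>i. (\<Sum>j\<in>J. c j * w j i) = 0"
      using insert.IH[of M w] by blast
    \<comment> \<open>Undoes the elimination: the multiples of \<open>v k\<close> subtracted in the
      \<open>w j\<close> are collected in the coefficient of \<open>v k\<close>.\<close>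
    define d where "d = (\<lambda>j. if j = k then - (\<Sum>j\<in>J. c j * v j i0) else c j * v k i0)"
    have dJ: "(\<Sum>j\<in>J. d j * v j i) = (\<Sum>j\<in>J. c j * v k i0 * v j i)" for i
      using insert.hyps by (intro sum.cong) (auto simp: d_def)
    have "(\<Sum>j\<in>insert k J. d j * v j i) = 0" for i
    proof -
      have "(\<Sum>j\<in>insert k J. d j * v j i) = (\<Sum>j\<in>J. c j * w j i)"
        using insert.hyps
        by (simp add: dJ) (simp add: d_def w_def sum_distrib_left algebra_simps sum_subtractf)
      then show ?thesis using c(2) by simp
    qed
    moreover have "\<exists>j\<in>insert k J. d j \<noteq> 0"
      using c(1) i0 insert.hyps by (auto simp: d_def)
    ultimately show ?thesis by blast
  qed
qed

text \<open>Convention: the outer variable of a \<open>complex poly poly\<close> is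
  \<open>z\<close>, the inner one is the parameter \<open>l\<close>. Only the parameter receives a
  value.\<close>

definition specialise :: "complex \<Rightarrow> complex poly poly \<Rightarrow> complex poly" where
  "specialise l p = map_poly (\<lambda>c. poly c l) p"

lemma coeff_specialise [simp]: "coeff (specialise l p) n = poly (coeff p n) l"
  by (simp add: specialise_def coeff_map_poly)

lemma specialise_add [simp]: "specialise l (p + q) = specialise l p + specialise l q"
  by (rule poly_eqI) simp

lemma specialise_diff [simp]: "specialise l (p - q) = specialise l p - specialise l q"
  by (rule poly_eqI) simp

lemma specialise_mult [simp]: "specialise l (p * q) = specialise l p * specialise l q"
  by (rule poly_eqI) (simp add: coeff_mult poly_sum)

lemma specialise_0 [simp]: "specialise l 0 = 0"
  by (rule poly_eqI) simp

lemma specialise_1 [simp]: "specialise l 1 = 1"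
  by (rule poly_eqI) (simp add: coeff_1)

lemma specialise_power [simp]: "specialise l (p ^ n) = specialise l p ^ n"
  by (induction n) auto

lemma specialise_sum [simp]: "specialise l (sum f A) = (\<Sum>x\<in>A. specialise l (f x))"
  by (induction A rule: infinite_finite_induct) auto

lemma specialise_monom [simp]: "specialise l (monom c n) = monom (poly c l) n"
  by (rule poly_eqI) simp

lemma specialise_smult [simp]: "specialise l (smult c p) = smult (poly c l) (specialise l p)"
  by (rule poly_eqI) simp

lemma specialise_pderiv: "specialise l (pderiv p) = pderiv (specialise l p)"
  by (rule poly_eqI) (simp add: coeff_pderiv)

lemma degree_specialise_le: "degree (specialise l p) \<le> degree p"
  by (intro degree_le) (auto simp: coeff_eq_0)

lemma degree_specialise: "poly (lead_coeff p) l \<noteq> 0 \<Longrightarrow> degree (specialise l p) = degree p"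
  by (metis coeff_specialise degree_specialise_le le_antisym le_degree)

lemma finite_specialise_0:
  assumes "p \<noteq> 0" shows "finite {l. specialise l p = 0}"
proof -
  have "{l. specialise l p = 0} \<subseteq> {l. poly (lead_coeff p) l = 0}"
    by (metis (mono_tags, lifting) Collect_mono coeff_specialise coeff_0)
  then show ?thesis using poly_roots_finite[of "lead_coeff p"] assms finite_subset by auto
qed

lemma poly_sum_monom_degree:
  fixes p :: "'a::comm_ring_1 poly"
  assumes "degree p < n"
  shows "p = (\<Sum>i<n. monom (coeff p i) i)"
  by (rule poly_eqI) (use assms in \<open>auto simp: coeff_sum coeff_eq_0\<close>)

text \<open>A resultant argument without resultants. A double root of the specialised
  \<open>D\<close> makes its shifts and those of its derivative linearly dependent. If this happened
  for infinitely many \<open>l\<close>, the dependence would lift to C[l] as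
  \<open>U * D + V * pderiv D = 0\<close> with \<open>V\<close> of degree below that of
  \<open>D\<close>, and coprimality forces \<open>V = 0\<close> and \<open>U = 0\<close>.\<close>

lemma finite_common_root:
  fixes D :: "complex poly poly"
  assumes D0: "D \<noteq> 0" and cop: "coprime D (pderiv D)"
  shows "finite {l. \<exists>r. poly (specialise l D) r = 0 \<and> poly (pderiv (specialise l D)) r = 0}"
    (is "finite ?X")
proof (rule ccontr)
  assume inf: "infinite ?X"
  define n where "n = degree D"
  \<comment> \<open>A nonzero leading coefficient keeps the degree equal to \<open>n\<close>, so the
    same \<open>2 * n\<close> columns serve for every \<open>l\<close> in \<open>L\<close>.\<close>
  define L where "L = ?X - {l. poly (lead_coeff D) l = 0}"
  have infL: "infinite L"
    unfolding L_def using inf poly_roots_finite[of "lead_coeff D"] D0 by (simp add: Diff_infinite_finite)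
  define J where "J = (Inl ` {..<n} \<union> Inr ` {..<n} :: (nat + nat) set)"
  \<comment> \<open>The columns of the Sylvester matrix of \<open>D\<close> and
    \<open>pderiv D\<close>, with one additional shift of \<open>D\<close>.\<close>
  define v where "v = (\<lambda>j i. case j of Inl k \<Rightarrow> coeff (monom 1 k * D) i | Inr k \<Rightarrow> coeff (monom 1 k * pderiv D) i)"
  have finJ: "finite J" by (simp add: J_def)
  have sumJ: "(\<Sum>j\<in>J. c j * v' j) = (\<Sum>k<n. c (Inl k) * v' (Inl k)) + (\<Sum>k<n. c (Inr k) * v' (Inr k))"
    for c v' :: "nat + nat \<Rightarrow> 'x::comm_ring_1"
    unfolding J_def by (subst sum.union_disjoint) (auto simp: sum.reindex)
  have "\<exists>c. (\<exists>j\<in>J. c j \<noteq> 0) \<and> (\<forall>i. (\<Sum>j\<in>J. c j * poly (v j i) l) = 0)" if "l \<in> L" for l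
  proof -
    obtain r where r: "poly (specialise l D) r = 0" "poly (pderiv (specialise l D)) r = 0"
      and lc: "poly (lead_coeff D) l \<noteq> 0"
      using \<open>l \<in> L\<close> by (auto simp: L_def)
    define d where "d = specialise l D"
    have d0: "d \<noteq> 0" using lc unfolding d_def
      by (metis coeff_specialise coeff_0)
    have degd: "degree d = n" unfolding d_def n_def by (rule degree_specialise[OF lc])
    obtain X where X: "d = [:-r, 1:] * X" using r(1) by (auto simp: poly_eq_0_iff_dvd d_def)
    obtain Y where Y: "pderiv d = [:-r, 1:] * Y" using r(2) by (auto simp: poly_eq_0_iff_dvd d_def)
    have X0: "X \<noteq> 0" using X d0 by auto
    have degX: "degree X < n"
      using X X0 degd by (metis degree_mult_eq degree_pCons_eq_if lessI mult_zero_left one_neq_zero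
          pCons_eq_0_iff degree_linear_power power_one_right plus_1_eq_Suc)
    have degY: "degree Y < n"
    proof (cases "Y = 0")
      case False
      then have "degree (pderiv d) = degree [:-r, 1:] + degree Y"
        unfolding Y by (intro degree_mult_eq) auto
      then show ?thesis using degree_pderiv[of d] degd by simp
    qed (use degX in auto)
    \<comment> \<open>Exchanging the cofactors of the common linear factor gives a syzygy whose two
      coefficients have degree below \<open>n\<close>.\<close>
    have "d * Y - pderiv d * X = 0" unfolding X Y by (metis X Y mult.assoc mult.commute right_minus_eq)
    then have zero: "Y * d + (-X) * pderiv d = 0" by (simp add: algebra_simps)
    define c where "c = (\<lambda>j. case j of Inl k \<Rightarrow> coeff Y k | Inr k \<Rightarrow> coeff (-X) k)"
    have "\<exists>j\<in>J. c j \<noteq> 0"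
      by (rule bexI[of _ "Inr (degree X)"]) (use X0 degX in \<open>auto simp: c_def J_def\<close>)
    moreover have "(\<Sum>j\<in>J. c j * poly (v j i) l) = 0" for i
    proof -
      have "(\<Sum>j\<in>J. c j * poly (v j i) l)
         = (\<Sum>k<n. coeff Y k * coeff (monom 1 k * d) i) + (\<Sum>k<n. coeff (-X) k * coeff (monom 1 k * pderiv d) i)"
        unfolding sumJ c_def v_def d_def specialise_pderiv[symmetric]
        by (simp flip: coeff_specialise)
      also have "\<dots> = coeff ((\<Sum>k<n. monom (coeff Y k) k) * d + (\<Sum>k<n. monom (coeff (-X) k) k) * pderiv d) i"
        by (auto simp: sum_distrib_right coeff_sum coeff_monom_mult intro!: arg_cong2[where f="(+)"] sum.cong)
      also have "\<dots> = 0"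
        unfolding poly_sum_monom_degree[OF degY, symmetric]
          poly_sum_monom_degree[of "-X" n, unfolded degree_minus, OF degX, symmetric] zero by simp
      finally show ?thesis .
    qed
    ultimately show ?thesis by blast
  qed
  from dependent_specialisation[OF finJ infL this] obtain c
    where c: "\<exists>j\<in>J. c j \<noteq> 0" "\<And>i. (\<Sum>j\<in>J. c j * v j i) = 0" by blast
  define U where "U = (\<Sum>k<n. monom (c (Inl k)) k)"
  define V where "V = (\<Sum>k<n. monom (c (Inr k)) k)"
  have UV: "U * D + V * pderiv D = 0"
  proof (rule poly_eqI)
    fix i
    have "coeff (U * D + V * pderiv D) i = (\<Sum>j\<in>J. c j * v j i)"
      unfolding sumJ U_def V_def v_def
      by (auto simp: sum_distrib_right coeff_sum coeff_monom_mult intro!: arg_cong2[where f="(+)"] sum.cong)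
    then show "coeff (U * D + V * pderiv D) i = coeff 0 i" using c(2) by simp
  qed
  have "D dvd V * pderiv D"
    using UV by (metis add.commute add_eq_0_iff dvd_minus_iff dvd_triv_right)
  then have "D dvd V" using cop by (simp add: coprime_dvd_mult_left_iff)
  moreover have "V = 0 \<or> degree V < n"
  proof (cases "n = 0")
    case False
    have "degree V \<le> n - 1" unfolding V_def
      by (rule degree_sum_le) (auto intro: order.trans[OF degree_monom_le])
    then show ?thesis using False by auto
  qed (simp add: V_def)
  ultimately have V0: "V = 0" by (metis dvd_imp_degree_le leD n_def)
  then have U0: "U = 0" using UV D0 by simp
  have cl: "coeff U k = c (Inl k)" "coeff V k = c (Inr k)" if "k < n" for k
    using that by (simp_all add: U_def V_def coeff_sum)
  show False using c(1) cl U0 V0 by (auto simp: J_def)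
qed

text \<open>\<open>E\<close> is a polynomial of largest degree whose square divides the primitive
  part; a prime dividing both \<open>D\<close> and its derivative would divide \<open>D\<close>
  twice and could be moved into \<open>E\<close>. The content \<open>k\<close> is split off first
  because a prime that is constant in \<open>z\<close> has derivative zero and escapes this
  argument.\<close>

lemma squarefree_decomposition:
  fixes F :: "complex poly poly"
  assumes F0: "F \<noteq> 0"
  obtains k D E where "k \<noteq> 0" "D \<noteq> 0" "E \<noteq> 0" "F = [:k:] * D * E\<^sup>2"
    "finite {l. \<exists>r. poly (specialise l D) r = 0 \<and> poly (pderiv (specialise l D)) r = 0}"
proof -
  define G where "G = primitive_part F"
  have G0: "G \<noteq> 0" using F0 by (simp add: G_def)
  have FG: "F = [:content F:] * G" unfolding G_def by simp
  have contG: "content G = 1" unfolding G_def using F0 by simp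
  define S where "S = {E. E\<^sup>2 dvd G}"
  have bound: "degree E \<le> degree G" if "E \<in> S" for E
  proof -
    have "E dvd G" using that unfolding S_def power2_eq_square by (auto intro: dvd_mult_left)
    then show ?thesis using G0 by (simp add: dvd_imp_degree_le)
  qed
  have "1 \<in> S" by (simp add: S_def)
  then obtain E where E: "E \<in> S" "\<And>E'. E' \<in> S \<Longrightarrow> degree E' \<le> degree E"
    using ex_has_greatest_nat[of "\<lambda>E. E \<in> S" 1 degree "degree G + 1"] bound
    by (metis less_Suc_eq_le Suc_eq_plus1)
  obtain D where D: "G = E\<^sup>2 * D" using E(1) by (auto simp: S_def)
  have D0: "D \<noteq> 0" "E \<noteq> 0" using G0 D by auto
  have "coprime D (pderiv D)"
  proof (rule ccontr)
    assume "\<not> ?thesis"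
    then obtain c where c: "c dvd D" "c dvd pderiv D" "\<not> is_unit c" by (rule not_coprimeE)
    have "c \<noteq> 0" using c D0 by auto
    then obtain p where p: "prime p" "p dvd c" using c(3) prime_divisor_exists by blast
    then have pD: "p dvd D" "p dvd pderiv D" using c by auto
    \<comment> \<open>A prime constant in \<open>z\<close> would divide the content of the primitive
      polynomial \<open>G\<close>.\<close>
    have degp: "degree p \<noteq> 0"
    proof
      assume "degree p = 0"
      then obtain a where a: "p = [:a:]" by (rule degree_eq_zeroE)
      then have "[:a:] dvd G" using pD(1) D by auto
      then have "a dvd content G" by (simp add: const_poly_dvd_iff_dvd_content)
      then have "is_unit a" using contG by simp
      then have "is_unit p" using a by (simp add: is_unit_const_poly_iff)
      then show False using p(1) by auto
    qed
    obtain w where w: "D = p * w" using pD(1) by auto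
    have "p dvd pderiv p * w" using pD(2) unfolding w pderiv_mult
      by (metis dvd_add_right_iff dvd_triv_left mult.commute)
    moreover have "\<not> p dvd pderiv p"
    proof
      assume "p dvd pderiv p"
      moreover have "pderiv p \<noteq> 0" using degp by (simp add: pderiv_eq_0_iff)
      ultimately have "degree p \<le> degree (pderiv p)" by (rule dvd_imp_degree_le)
      then show False using degp by (simp add: degree_pderiv)
    qed
    ultimately have "p dvd w" using p(1) prime_dvd_mult_iff by blast
    then obtain w' where "w = p * w'" by auto
    then have "G = (E * p)\<^sup>2 * w'" using D w by (simp add: power2_eq_square algebra_simps)
    then have "degree (E * p) \<le> degree E" using E(2) by (simp add: S_def)
    moreover have "degree (E * p) = degree E + degree p" using D0 p(1) by (intro degree_mult_eq) auto
    ultimately show False using degp by simp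
  qed
  from finite_common_root[OF D0(1) this] show ?thesis
    using that[of "content F" D E] F0 D0 FG D by (simp add: algebra_simps)
qed

section \<open>Sections and Fubini\<close>

lemma e0_in_Basis: "e0 \<in> (Basis :: 'a::euclidean_space set)"
  unfolding e0_def using nonempty_Basis some_in_eq by blast

lemma norm_e0 [simp]: "norm (e0 :: 'a::euclidean_space) = 1"
  using e0_in_Basis by (rule norm_Basis)

text \<open>The choice in \<open>rot_to\<close> needs a witness. For \<open>\<xi>\<close> different
  from \<open>e0\<close> it is the reflection in the hyperplane orthogonal to
  \<open>e0 - \<xi>\<close>, which exchanges two vectors of equal length.\<close>

lemma rot_to:
  fixes \<xi> :: "'a::euclidean_space"
  assumes "norm \<xi> = 1"
  shows "orthogonal_transformation (rot_to \<xi>)" "rot_to \<xi> e0 = \<xi>"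
proof -
  have "\<exists>T :: 'a \<Rightarrow> 'a. orthogonal_transformation T \<and> T e0 = \<xi>"
  proof (cases "\<xi> = e0")
    case True
    then show ?thesis by (intro exI[of _ "\<lambda>x. x"]) (auto simp: orthogonal_transformation_def)
  next
    case False
    define w where "w = e0 - \<xi>"
    define T where "T = (\<lambda>x. x - (2 * (x \<bullet> w) / (w \<bullet> w)) *\<^sub>R w)"
    have w0: "w \<bullet> w \<noteq> 0" using False by (simp add: w_def)
    have ww: "w \<bullet> w = 2 * (e0 \<bullet> w)"
    proof -
      have "e0 \<bullet> e0 = (1::real)" "\<xi> \<bullet> \<xi> = 1" using assms norm_e0 by (simp_all only: norm_eq_1)
      then show ?thesis by (simp only: w_def inner_diff_left inner_diff_right inner_commute) simp
    qed
    have "linear T" unfolding T_def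
      by (rule linearI) (simp_all add: algebra_simps inner_add_left add_divide_distrib)
    moreover have "T x \<bullet> T y = x \<bullet> y" for x y
    proof -
      have "T x \<bullet> T y = x \<bullet> y - 4 * (x \<bullet> w) * (y \<bullet> w) / (w \<bullet> w)
          + 4 * (x \<bullet> w) * (y \<bullet> w) / (w \<bullet> w) / (w \<bullet> w) * (w \<bullet> w)"
        unfolding T_def by (simp add: algebra_simps inner_commute)
      then show ?thesis using w0 by simp
    qed
    moreover have "T e0 = \<xi>"
    proof -
      have "2 * (e0 \<bullet> w) / (w \<bullet> w) = 1" by (simp only: ww[symmetric] divide_self[OF w0])
      then have "T e0 = e0 - w" unfolding T_def by (simp only: scaleR_one)
      then show ?thesis by (simp add: w_def)
    qed
    ultimately show ?thesis unfolding orthogonal_transformation_def by blast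
  qed
  from someI_ex[OF this] show "orthogonal_transformation (rot_to \<xi>)" "rot_to \<xi> e0 = \<xi>"
    unfolding rot_to_def by auto
qed

section \<open>Lebesgue measure under orthogonal maps and under scaling\<close>

lemma emeasure_lborel_Un_negligible:
  assumes "A \<in> sets borel" "B \<in> sets borel" "A \<subseteq> B" "negligible (B - A)"
  shows "emeasure lborel A = emeasure lborel B"
proof -
  have "B - A \<in> null_sets lborel"
    using assms negligible_iff_null_sets null_sets_completion_iff[of "B - A" lborel] by auto
  then have "emeasure lborel (A \<union> (B - A)) = emeasure lborel A"
    using assms by (intro emeasure_Un_null_set) auto
  then show ?thesis using assms(3) by (simp add: Un_absorb1)
qed

text \<open>Up to a null set an open set is a disjoint union of countably many balls, and
  orthogonal maps send balls to balls of the same radius.\<close>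

lemma distr_lborel_orthogonal:
  fixes T :: "'a::euclidean_space \<Rightarrow> 'a"
  assumes T: "orthogonal_transformation T"
  shows "distr lborel borel T = lborel"
proof -
  have linT: "linear T" using T by (simp add: orthogonal_transformation_linear)
  have cT: "continuous_on UNIV T" using linT by (simp add: linear_continuous_on linear_conv_bounded_linear)
  have mT: "T \<in> borel_measurable borel" using cT by (rule borel_measurable_continuous_onI)
  define S where "S = inv T"
  have S: "orthogonal_transformation S" "T (S x) = x" "S (T x) = x" for x
    using T orthogonal_transformation_inv orthogonal_transformation_inj[OF T]
      orthogonal_transformation_surj[OF T] by (auto simp: S_def surj_f_inv_f)
  have vimage_T: "T -` X = S ` X" for X using S by (auto simp: image_iff) metis
  have dT: "dist (T x) (T y) = dist x y" for x y
    using T by (simp add: orthogonal_transformation_isometry)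
  have vimage_ball: "T -` ball c r = ball (S c) r" for c r
    using dT[of "S c"] S by (auto simp: mem_ball)
  have main: "emeasure lborel (T -` X) = emeasure lborel X" if "open X" for X :: "'a set"
  proof -
    define K where "K = {(x, r::real). 0 < r \<and> ball x r \<subseteq> X}"
    have "\<exists>i. i \<in> K \<and> x \<in> ball (fst i) (snd i) \<and> snd i < d" if "x \<in> X" "0 < d" for x d
    proof -
      obtain e where e: "e > 0" "ball x e \<subseteq> X" using \<open>open X\<close> \<open>x \<in> X\<close> openE by blast
      show ?thesis
        by (rule exI[of _ "(x, min e (d/2))"]) (use e that in \<open>auto simp: K_def\<close>)
    qed
    then obtain C where C: "countable C" "C \<subseteq> K"
       "pairwise (\<lambda>i j. disjnt (ball (fst i) (snd i)) (ball (fst j) (snd j))) C"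
       "negligible (X - (\<Union>i \<in> C. ball (fst i) (snd i)))"
      using Vitali_covering_theorem_balls[of X K fst snd] by blast
    define U where "U = (\<Union>i \<in> C. ball (fst i) (snd i))"
    have UX: "U \<subseteq> X" using C(2) by (fastforce simp: U_def K_def)
    have oU: "open U" by (auto simp: U_def)
    have oTX: "open (T -` X)" "open (T -` U)"
      using cT \<open>open X\<close> oU by (auto intro: open_vimage)
    have negT: "negligible (T -` X - T -` U)"
    proof -
      have "negligible (S ` (X - U))"
      proof (rule negligible_locally_Lipschitz_image)
        show "\<exists>T B. open T \<and> x \<in> T \<and> (\<forall>y\<in>(X - U) \<inter> T. norm (S y - S x) \<le> B * norm (y - x))" for x
          by (rule exI[of _ UNIV], rule exI[of _ 1])
             (use S(1) in \<open>auto simp: orthogonal_transformation_isometry dist_norm[symmetric]\<close>)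
      qed (use C(4) in \<open>auto simp: U_def\<close>)
      then show ?thesis by (simp add: vimage_T[symmetric] vimage_Diff)
    qed
    have disj: "disjoint_family_on (\<lambda>i. ball (fst i) (snd i)) C"
      using C(3) by (auto simp: disjoint_family_on_def pairwise_def disjnt_def)
    have "emeasure lborel X = emeasure lborel U"
      using emeasure_lborel_Un_negligible[of U X] UX oU \<open>open X\<close> C(4) by (simp add: U_def)
    also have "\<dots> = (\<integral>\<^sup>+i. emeasure lborel (ball (fst i) (snd i)) \<partial>count_space C)"
      unfolding U_def using C disj by (intro emeasure_UN_countable) auto
    also have "\<dots> = (\<integral>\<^sup>+i. emeasure lborel (T -` ball (fst i) (snd i)) \<partial>count_space C)"
      using C(2) by (intro nn_integral_cong) (auto simp: vimage_ball emeasure_ball K_def)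
    also have "\<dots> = emeasure lborel (\<Union>i\<in>C. T -` ball (fst i) (snd i))"
      using C(1) disj by (intro emeasure_UN_countable[symmetric])
        (simp_all add: disjoint_family_on_def vimage_ball[symmetric] vimage_Int[symmetric], simp_all add: vimage_ball)
    also have "(\<Union>i\<in>C. T -` ball (fst i) (snd i)) = T -` U" by (auto simp: U_def)
    also have "emeasure lborel (T -` U) = emeasure lborel (T -` X)"
      using emeasure_lborel_Un_negligible[of "T -` U" "T -` X"] UX oTX negT by auto
    finally show ?thesis ..
  qed
  show ?thesis
  proof (rule measure_eqI_generator_eq[where E="Collect open" and \<Omega>=UNIV and A="\<lambda>n::nat. ball 0 (real n)"])
    show "Int_stable (Collect open :: 'a set set)" by (auto simp: Int_stable_def)
    show "emeasure (distr lborel borel T) X = emeasure lborel X" if "X \<in> Collect open" for X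
      using that mT main[of X] by (simp add: emeasure_distr)
    show "sets (distr lborel borel T) = sigma_sets UNIV (Collect open)"
      by (simp add: borel_def)
    show "sets (lborel :: 'a measure) = sigma_sets UNIV (Collect open)"
      by (simp add: borel_def)
    show "(\<Union>i::nat. ball (0::'a) (real i)) = UNIV"
      using reals_Archimedean2 by (auto simp: mem_ball)
    show "emeasure (distr lborel borel T) (ball 0 (real i)) \<noteq> \<infinity>" for i
      using mT main[of "ball 0 (real i)"] emeasure_lborel_ball_finite[of "0::'a" "real i"]
      by (simp add: emeasure_distr)
  qed auto
qed

lemma emeasure_lborel_real_affine:
  fixes c t :: real
  assumes c: "c > 0" and A: "A \<in> sets borel"
  shows "ennreal c * emeasure lborel ((\<lambda>x. t + c * x) -` A) = emeasure lborel A"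
proof -
  have "emeasure lborel A = emeasure (density (distr lborel borel (\<lambda>x. t + c * x)) (\<lambda>_. ennreal c)) A"
    using lborel_real_affine[of c t] c by simp
  also have "\<dots> = ennreal c * emeasure (distr lborel borel (\<lambda>x. t + c * x)) A"
    using A by (subst emeasure_density_const) auto
  also have "emeasure (distr lborel borel (\<lambda>x. t + c * x)) A = emeasure lborel ((\<lambda>x. t + c * x) -` A)"
    using A by (subst emeasure_distr) auto
  finally show ?thesis ..
qed

abbreviation plane_measure :: "'i set \<Rightarrow> ('i \<Rightarrow> real) measure" where
  "plane_measure J \<equiv> PiM J (\<lambda>_. lborel)"

text \<open>Product measures are determined by boxes, and on a box the one-dimensional scaling rule
  applies to each coordinate. This is the source of the exponent \<open>n - 1\<close> whenever
  sections are compared by homotheties.\<close>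

lemma emeasure_plane_affine:
  fixes c :: real and t :: "'i \<Rightarrow> real"
  assumes J: "finite J" and c: "c > 0" and S: "S \<in> sets (plane_measure J)"
  shows "ennreal c ^ card J *
      emeasure (plane_measure J) {y \<in> space (plane_measure J). (\<lambda>i\<in>J. t i + c * y i) \<in> S}
    = emeasure (plane_measure J) S"
proof -
  interpret product_sigma_finite "\<lambda>_::'i. lborel :: real measure" ..
  let ?L = "plane_measure J"
  define g where "g = (\<lambda>y. \<lambda>i\<in>J. t i + c * y i)"
  have g: "g \<in> measurable ?L ?L" unfolding g_def by measurable
  have "scale_measure (ennreal c ^ card J) (distr ?L ?L g) = ?L"
  proof (rule PiM_eqI[OF J])
    fix A :: "'i \<Rightarrow> real set" assume A: "\<And>i. i \<in> J \<Longrightarrow> A i \<in> sets lborel"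
    have "g -` PiE J A \<inter> space ?L = PiE J (\<lambda>i. (\<lambda>x. t i + c * x) -` A i)"
      by (auto simp: g_def space_PiM PiE_iff restrict_def extensional_def split: if_splits)
    moreover have "PiE J A \<in> sets ?L" using A J by (intro sets_PiM_I_finite) auto
    ultimately have "emeasure (distr ?L ?L g) (PiE J A) = emeasure ?L (PiE J (\<lambda>i. (\<lambda>x. t i + c * x) -` A i))"
      using g by (simp add: emeasure_distr)
    also have "\<dots> = (\<Prod>i\<in>J. emeasure lborel ((\<lambda>x. t i + c * x) -` A i))"
    proof (rule emeasure_PiM[OF J])
      fix i assume "i \<in> J"
      have "(\<lambda>x. t i + c * x) \<in> borel_measurable borel" by measurable
      from measurable_sets[OF this, of "A i"] A[OF \<open>i \<in> J\<close>]
      show "(\<lambda>x. t i + c * x) -` A i \<in> sets lborel" by simp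
    qed
    finally have "ennreal c ^ card J * emeasure (distr ?L ?L g) (PiE J A)
        = (\<Prod>i\<in>J. ennreal c * emeasure lborel ((\<lambda>x. t i + c * x) -` A i))"
      by (simp add: prod.distrib)
    also have "\<dots> = (\<Prod>i\<in>J. emeasure lborel (A i))"
      using A c by (intro prod.cong) (auto simp: emeasure_lborel_real_affine)
    finally show "emeasure (scale_measure (ennreal c ^ card J) (distr ?L ?L g)) (PiE J A)
        = (\<Prod>i\<in>J. emeasure lborel (A i))" by simp
  qed auto
  then have "emeasure ?L S = ennreal c ^ card J * emeasure (distr ?L ?L g) S"
    by (metis emeasure_scale_measure)
  also have "emeasure (distr ?L ?L g) S = emeasure ?L {y \<in> space ?L. g y \<in> S}"
    using g S by (subst emeasure_distr) (auto simp: vimage_def Int_def conj_commute)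
  finally show ?thesis unfolding g_def ..
qed

section \<open>Coordinates on hyperplanes and estimates for section volumes\<close>

definition plane_point :: "'a::euclidean_space \<Rightarrow> real \<Rightarrow> ('a \<Rightarrow> real) \<Rightarrow> 'a" where
  "plane_point \<xi> t y = rot_to \<xi> (t *\<^sub>R e0 + (\<Sum>b\<in>Basis - {e0}. y b *\<^sub>R b))"

definition plane_section :: "'a::euclidean_space set \<Rightarrow> 'a \<Rightarrow> real \<Rightarrow> ('a \<Rightarrow> real) set" where
  "plane_section K \<xi> t = {y \<in> space (plane_measure (Basis - {e0})). plane_point \<xi> t y \<in> K}"

lemma sectional_volume_eq:
  "sectional_volume K \<xi> t = measure (plane_measure (Basis - {e0})) (plane_section K \<xi> t)"
  by (simp add: sectional_volume_def plane_section_def plane_point_def)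

lemma Basis_split: "Basis = insert (e0::'a::euclidean_space) (Basis - {e0})"
  using e0_in_Basis by auto

lemma card_Basis_diff: "card (Basis - {e0 :: 'a::euclidean_space}) = DIM('a) - 1"
  by (simp add: card_Diff_singleton e0_in_Basis)

text \<open>Pythagoras in hyperplane coordinates: a ball of radius \<open>\<rho>\<close> around
  \<open>x\<close> cuts the hyperplane in a ball of squared radius
  \<open>\<rho>^2 - (t - x \<bullet> \<xi>)^2\<close>. Both size estimates for sections start from
  this.\<close>

lemma plane_point_coords:
  fixes \<xi> x :: "'a::euclidean_space"
  assumes "norm \<xi> = 1"
  shows "(dist (plane_point \<xi> t y) x)\<^sup>2 = (t - x \<bullet> \<xi>)\<^sup>2 + (\<Sum>b\<in>Basis - {e0}. (y b - x \<bullet> rot_to \<xi> b)\<^sup>2)"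
proof -
  note r = rot_to[OF assms]
  obtain z where z: "x = rot_to \<xi> z"
    using orthogonal_transformation_surj[OF r(1)] by (metis surjD)
  define v where "v = t *\<^sub>R e0 + (\<Sum>b\<in>Basis - {e0}. y b *\<^sub>R (b::'a))"
  have zb: "x \<bullet> rot_to \<xi> b = z \<bullet> b" for b
    using r(1) by (simp add: z orthogonal_transformation_def)
  have ve: "v \<bullet> e0 = t"
    by (auto simp: e0_in_Basis v_def inner_add_left inner_sum_left inner_Basis intro!: sum.neutral)
  have vb: "v \<bullet> b = y b" if "b \<in> Basis - {e0}" for b
  proof -
    have "v \<bullet> b = (\<Sum>b'\<in>Basis - {e0}. y b' * (b' \<bullet> b))"
      using that by (auto simp: e0_in_Basis v_def inner_add_left inner_sum_left inner_Basis)
    also have "\<dots> = (\<Sum>b'\<in>Basis - {e0}. if b' = b then y b else 0)"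
      using that by (intro sum.cong) (auto simp: inner_Basis)
    finally show ?thesis using that by simp
  qed
  have "dist (rot_to \<xi> v) (rot_to \<xi> z) = dist v z"
    using r(1) by (simp add: orthogonal_transformation_isometry)
  then have "(dist (plane_point \<xi> t y) x)\<^sup>2 = (norm (v - z))\<^sup>2"
    by (simp add: plane_point_def v_def[symmetric] z dist_norm[symmetric])
  also have "\<dots> = (\<Sum>b\<in>Basis. ((v - z) \<bullet> b)\<^sup>2)"
    by (subst power2_norm_eq_inner, subst euclidean_inner) (simp add: power2_eq_square)
  also have "\<dots> = ((v - z) \<bullet> e0)\<^sup>2 + (\<Sum>b\<in>Basis - {e0}. ((v - z) \<bullet> b)\<^sup>2)"
    by (subst Basis_split) (simp add: sum.insert_remove)
  finally show ?thesis
    using zb[of e0] zb vb ve by (simp add: r(2) inner_diff_left)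
qed

lemma linear_rot_to: "norm \<xi> = 1 \<Longrightarrow> linear (rot_to \<xi>)"
  using rot_to(1)[of \<xi>] by (simp add: orthogonal_transformation_linear)

lemma plane_point_inner:
  assumes "norm \<xi> = 1"
  shows "plane_point \<xi> t y \<bullet> \<xi> = t"
proof -
  have "plane_point \<xi> t y \<bullet> rot_to \<xi> e0 = (t *\<^sub>R e0 + (\<Sum>b\<in>Basis - {e0}. y b *\<^sub>R b)) \<bullet> e0"
    using rot_to(1)[OF assms] by (simp add: plane_point_def orthogonal_transformation_def)
  also have "\<dots> = t"
    by (auto simp: e0_in_Basis inner_add_left inner_sum_left inner_Basis intro!: sum.neutral)
  finally show ?thesis using rot_to(2)[OF assms] by simp
qed

lemma plane_point_self:
  assumes "norm \<xi> = 1"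
  shows "plane_point \<xi> (x \<bullet> \<xi>) (\<lambda>b. x \<bullet> rot_to \<xi> b) = x"
  using plane_point_coords[OF assms, of "x \<bullet> \<xi>" "\<lambda>b. x \<bullet> rot_to \<xi> b" x] by simp

lemma plane_point_cong: "(\<And>b. b \<in> Basis - {e0} \<Longrightarrow> y b = y' b) \<Longrightarrow> plane_point \<xi> t y = plane_point \<xi> t y'"
  unfolding plane_point_def by (metis (no_types, lifting) sum.cong)

lemma plane_point_combine:
  assumes "norm \<xi> = 1"
  shows "plane_point \<xi> (a * s + c * t) (\<lambda>b. a * y b + c * z b) = a *\<^sub>R plane_point \<xi> s y + c *\<^sub>R plane_point \<xi> t z"
proof -
  interpret linear "rot_to \<xi>" by (rule linear_rot_to[OF assms])
  show ?thesis unfolding plane_point_def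
    by (simp add: add[symmetric] scale[symmetric] scaleR_add_left scaleR_add_right sum.distrib scaleR_sum_right add_ac)
qed

lemma plane_point_measurable_pair:
  assumes "norm \<xi> = 1"
  shows "(\<lambda>(t, y). plane_point \<xi> t y) \<in> borel_measurable (lborel \<Otimes>\<^sub>M plane_measure (Basis - {e0}))"
proof -
  have "rot_to \<xi> \<in> borel_measurable borel"
    using linear_rot_to[OF assms]
    by (intro borel_measurable_continuous_onI) (simp add: linear_continuous_on linear_conv_bounded_linear)
  then show ?thesis unfolding plane_point_def by measurable
qed

lemma plane_point_measurable [measurable]:
  assumes "norm \<xi> = 1"
  shows "plane_point \<xi> t \<in> borel_measurable (plane_measure (Basis - {e0}))"
  using measurable_compose[OF measurable_Pair1' plane_point_measurable_pair[OF assms], of t] by simp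

lemma section_sets:
  assumes "norm \<xi> = 1" "K \<in> sets borel"
  shows "plane_section K \<xi> t \<in> sets (plane_measure (Basis - {e0}))"
  using measurable_sets[OF plane_point_measurable[OF assms(1)] assms(2), of t]
  by (simp add: plane_section_def vimage_def Int_def conj_commute)

text \<open>Rotation invariance reduces the direction \<open>\<xi>\<close> to \<open>e0\<close>,
  where Fubini splits off a single coordinate of the product measure.\<close>

lemma nn_integral_planes:
  fixes f :: "'a::euclidean_space \<Rightarrow> ennreal"
  assumes \<xi>: "norm \<xi> = 1" and f: "f \<in> borel_measurable borel"
  shows "(\<integral>\<^sup>+x. f x \<partial>lborel) = (\<integral>\<^sup>+t. (\<integral>\<^sup>+y. f (plane_point \<xi> t y) \<partial>plane_measure (Basis - {e0})) \<partial>lborel)"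
proof -
  interpret product_sigma_finite "\<lambda>_::'a. lborel :: real measure" ..
  note r = rot_to[OF \<xi>]
  have mr: "rot_to \<xi> \<in> borel_measurable borel"
    using linear_rot_to[OF \<xi>]
    by (intro borel_measurable_continuous_onI) (simp add: linear_continuous_on linear_conv_bounded_linear)
  have lb: "(lborel :: 'a measure) = distr (plane_measure Basis) borel (\<lambda>f. \<Sum>b\<in>Basis. f b *\<^sub>R b)"
    by (simp only: lborel_def[where 'a='a] lborel_eq_real)
  have ins: "(Basis::'a set) = insert e0 (Basis - {e0})" by (rule Basis_split)
  have "(\<integral>\<^sup>+x. f x \<partial>lborel) = (\<integral>\<^sup>+x. f x \<partial>distr lborel borel (rot_to \<xi>))"
    by (simp add: distr_lborel_orthogonal[OF r(1)])
  also have "\<dots> = (\<integral>\<^sup>+x. f (rot_to \<xi> x) \<partial>lborel)"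
    using mr f by (subst nn_integral_distr) auto
  also have "\<dots> = (\<integral>\<^sup>+y. f (rot_to \<xi> (\<Sum>b\<in>Basis. y b *\<^sub>R b)) \<partial>plane_measure Basis)"
    using mr f by (subst lb, subst nn_integral_distr) auto
  also have "\<dots> = (\<integral>\<^sup>+t. (\<integral>\<^sup>+y. f (rot_to \<xi> (\<Sum>b\<in>Basis. (y(e0 := t)) b *\<^sub>R b))
       \<partial>plane_measure (Basis - {e0})) \<partial>lborel)"
  proof -
    have "(\<lambda>y. f (rot_to \<xi> (\<Sum>b\<in>Basis. y b *\<^sub>R b))) \<in> borel_measurable (plane_measure Basis)"
      using mr f by measurable
    then show ?thesis
      by (rule product_nn_integral_insert_rev[of "Basis - {e0}" e0, unfolded ins[symmetric], rotated 2]) simp_all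
  qed
  also have "\<dots> = (\<integral>\<^sup>+t. (\<integral>\<^sup>+y. f (plane_point \<xi> t y) \<partial>plane_measure (Basis - {e0})) \<partial>lborel)"
  proof -
    have "(\<Sum>b\<in>Basis. (y(e0 := t)) b *\<^sub>R b) = t *\<^sub>R e0 + (\<Sum>b\<in>Basis - {e0}. y b *\<^sub>R (b::'a))" for y t
      by (subst ins, subst sum.insert) (auto intro!: sum.cong)
    then show ?thesis by (simp add: plane_point_def)
  qed
  finally show ?thesis .
qed

lemma emeasure_cube:
  assumes "finite J" "s \<ge> 0"
  shows "emeasure (plane_measure J) (PiE J (\<lambda>i. {c i - s..c i + s})) = ennreal ((2 * s) ^ card J)"
    "emeasure (plane_measure J) (PiE J (\<lambda>i. {c i - s<..<c i + s})) = ennreal ((2 * s) ^ card J)"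
proof -
  interpret product_sigma_finite "\<lambda>_::'a. lborel :: real measure" ..
  show "emeasure (plane_measure J) (PiE J (\<lambda>i. {c i - s..c i + s})) = ennreal ((2 * s) ^ card J)"
    using assms by (subst emeasure_PiM) (auto simp: prod_constant ennreal_power)
  show "emeasure (plane_measure J) (PiE J (\<lambda>i. {c i - s<..<c i + s})) = ennreal ((2 * s) ^ card J)"
    using assms by (subst emeasure_PiM) (auto simp: prod_constant ennreal_power)
qed

text \<open>Only the power of \<open>s\<close> matters later, so the section of a ball is enclosed
  in a cube instead of being measured exactly.\<close>

lemma emeasure_section_le:
  fixes K :: "'a::euclidean_space set"
  assumes \<xi>: "norm \<xi> = 1" and K: "K \<subseteq> cball c \<rho>" and s: "s \<ge> 0" "\<rho>\<^sup>2 - (t - c \<bullet> \<xi>)\<^sup>2 \<le> s\<^sup>2"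
  shows "emeasure (plane_measure (Basis - {e0})) (plane_section K \<xi> t) \<le> ennreal ((2 * s) ^ (DIM('a) - 1))"
proof -
  let ?J = "Basis - {e0 :: 'a}"
  let ?Q = "PiE ?J (\<lambda>i. {c \<bullet> rot_to \<xi> i - s..c \<bullet> rot_to \<xi> i + s})"
  have "plane_section K \<xi> t \<subseteq> ?Q"
  proof
    fix y assume y: "y \<in> plane_section K \<xi> t"
    then have "dist (plane_point \<xi> t y) c \<le> \<rho>" using K by (auto simp: plane_section_def dist_commute)
    then have "(dist (plane_point \<xi> t y) c)\<^sup>2 \<le> \<rho>\<^sup>2" by (intro power_mono) auto
    then have *: "(\<Sum>b\<in>?J. (y b - c \<bullet> rot_to \<xi> b)\<^sup>2) \<le> s\<^sup>2"
      using s(2) by (simp add: plane_point_coords[OF \<xi>])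
    have "\<bar>y b - c \<bullet> rot_to \<xi> b\<bar> \<le> s" if "b \<in> ?J" for b
    proof -
      have "(y b - c \<bullet> rot_to \<xi> b)\<^sup>2 \<le> (\<Sum>b\<in>?J. (y b - c \<bullet> rot_to \<xi> b)\<^sup>2)"
        using that by (intro member_le_sum) auto
      also note *
      finally show ?thesis using s(1) abs_le_square_iff[of "y b - c \<bullet> rot_to \<xi> b" s] by simp
    qed
    then have "c \<bullet> rot_to \<xi> b - s \<le> y b \<and> y b \<le> c \<bullet> rot_to \<xi> b + s" if "b \<in> ?J" for b
      using that by (fastforce simp: abs_le_iff)
    moreover have "y \<in> extensional ?J" using y by (auto simp: plane_section_def space_PiM PiE_def)
    ultimately show "y \<in> ?Q" by (auto simp: PiE_iff)
  qed
  then have "emeasure (plane_measure ?J) (plane_section K \<xi> t) \<le> emeasure (plane_measure ?J) ?Q"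
    by (intro emeasure_mono) (auto intro!: sets_PiM_I_finite)
  also have "\<dots> = ennreal ((2 * s) ^ (DIM('a) - 1))"
    using s(1) by (subst emeasure_cube) (simp_all add: card_Basis_diff)
  finally show ?thesis .
qed

text \<open>The matching inscribed cube: with half side \<open>s\<close> in dimension
  \<open>n - 1\<close> its half diagonal is \<open>s * sqrt (n - 1)\<close>, below
  \<open>s * sqrt n\<close>.\<close>

lemma emeasure_section_ge:
  fixes K :: "'a::euclidean_space set"
  assumes \<xi>: "norm \<xi> = 1" and K: "ball c \<rho> \<subseteq> K" "K \<in> sets borel" and \<rho>: "\<rho> > 0"
    and s: "s > 0" "real DIM('a) * s\<^sup>2 \<le> \<rho>\<^sup>2 - (t - c \<bullet> \<xi>)\<^sup>2"
  shows "ennreal ((2 * s) ^ (DIM('a) - 1)) \<le> emeasure (plane_measure (Basis - {e0})) (plane_section K \<xi> t)"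
proof -
  let ?J = "Basis - {e0 :: 'a}"
  let ?Q = "PiE ?J (\<lambda>i. {c \<bullet> rot_to \<xi> i - s<..<c \<bullet> rot_to \<xi> i + s})"
  have "?Q \<subseteq> plane_section K \<xi> t"
  proof
    fix y assume y: "y \<in> ?Q"
    have "(\<Sum>b\<in>?J. (y b - c \<bullet> rot_to \<xi> b)\<^sup>2) \<le> (\<Sum>b\<in>?J. s\<^sup>2)"
    proof (rule sum_mono)
      fix b assume "b \<in> ?J"
      then have "\<bar>y b - c \<bullet> rot_to \<xi> b\<bar> \<le> s" using y by (force simp: PiE_iff abs_le_iff)
      then show "(y b - c \<bullet> rot_to \<xi> b)\<^sup>2 \<le> s\<^sup>2" using s(1) by (metis abs_le_square_iff abs_of_pos)
    qed
    also have "\<dots> = (real DIM('a) - 1) * s\<^sup>2"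
      by (simp add: card_Basis_diff of_nat_diff DIM_positive Suc_leI)
    \<comment> \<open>The step from \<open>n - 1\<close> to \<open>n\<close> supplies the strict
      inequality required by the open ball.\<close>
    also have "\<dots> < real DIM('a) * s\<^sup>2" using s(1) by simp
    finally have "(dist (plane_point \<xi> t y) c)\<^sup>2 < \<rho>\<^sup>2"
      using s(2) by (simp add: plane_point_coords[OF \<xi>])
    then have "dist (plane_point \<xi> t y) c < \<rho>" using \<rho> by (meson less_imp_le power_less_imp_less_base)
    then show "y \<in> plane_section K \<xi> t" using y K(1) by (auto simp: plane_section_def space_PiM dist_commute PiE_iff)
  qed
  then have "emeasure (plane_measure ?J) ?Q \<le> emeasure (plane_measure ?J) (plane_section K \<xi> t)"
    by (intro emeasure_mono section_sets[OF \<xi> K(2)])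
  then show ?thesis using s(1) emeasure_cube(2)[of ?J s "\<lambda>i. c \<bullet> rot_to \<xi> i"] by (simp add: card_Basis_diff)
qed

lemma emeasure_section_finite:
  fixes K :: "'a::euclidean_space set"
  assumes "norm \<xi> = 1" "bounded K"
  shows "emeasure (plane_measure (Basis - {e0})) (plane_section K \<xi> t) < \<infinity>"
proof -
  obtain B where B: "K \<subseteq> cball 0 B" "B > 0" using bounded_subset_ballD[OF assms(2), of 0] ball_subset_cball by (meson order_trans)
  have "B\<^sup>2 - (t - 0 \<bullet> \<xi>)\<^sup>2 \<le> B\<^sup>2" by simp
  from emeasure_section_le[OF assms(1) B(1) less_imp_le[OF B(2)] this] show ?thesis
    by (auto intro: le_less_trans)
qed

lemma emeasure_section_eq:
  assumes "norm \<xi> = 1" "bounded K"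
  shows "emeasure (plane_measure (Basis - {e0})) (plane_section K \<xi> t) = ennreal (sectional_volume K \<xi> t)"
  unfolding sectional_volume_eq
  using emeasure_section_finite[OF assms, of t] by (subst emeasure_eq_ennreal_measure) auto

lemma sectional_volume_le:
  fixes K :: "'a::euclidean_space set"
  assumes "norm \<xi> = 1" "K \<subseteq> cball c \<rho>" "s \<ge> 0" "\<rho>\<^sup>2 - (t - c \<bullet> \<xi>)\<^sup>2 \<le> s\<^sup>2"
  shows "sectional_volume K \<xi> t \<le> (2 * s) ^ (DIM('a) - 1)"
  using emeasure_section_le[OF assms] emeasure_section_eq[OF assms(1), of K t] assms(2,3)
  by (simp add: bounded_subset[OF bounded_cball])

lemma sectional_volume_ge:
  fixes K :: "'a::euclidean_space set"
  assumes "norm \<xi> = 1" "bounded K" "ball c \<rho> \<subseteq> K" "K \<in> sets borel" "\<rho> > 0"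
    and "s > 0" "real DIM('a) * s\<^sup>2 \<le> \<rho>\<^sup>2 - (t - c \<bullet> \<xi>)\<^sup>2"
  shows "(2 * s) ^ (DIM('a) - 1) \<le> sectional_volume K \<xi> t"
  using emeasure_section_ge[OF assms(1,3,4,5,6,7)] emeasure_section_eq[OF assms(1,2), of t]
  by (simp add: sectional_volume_def)

lemma sectional_volume_nonneg [simp]: "sectional_volume K \<xi> t \<ge> 0"
  by (simp add: sectional_volume_def)

text \<open>The contraction by \<open>\<theta>\<close> towards a point \<open>p\<close> of
  \<open>K\<close> maps the convex set \<open>K\<close> into itself, carries the section at height
  \<open>t\<close> into the one at the interpolated height, and scales its volume by the power
  \<open>n - 1\<close>. This elementary comparison takes the place of Brunn-Minkowski.\<close>

lemma sectional_volume_homothety: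
  fixes K :: "'a::euclidean_space set"
  assumes \<xi>: "norm \<xi> = 1" and K: "convex K" "bounded K" "K \<in> sets borel"
    and p: "p \<in> K" and \<theta>: "0 < \<theta>" "\<theta> \<le> 1"
  shows "\<theta> ^ (DIM('a) - 1) * sectional_volume K \<xi> t \<le> sectional_volume K \<xi> ((1 - \<theta>) * (p \<bullet> \<xi>) + \<theta> * t)"
proof -
  let ?J = "Basis - {e0 :: 'a}" and ?u = "(1 - \<theta>) * (p \<bullet> \<xi>) + \<theta> * t"
  let ?L = "plane_measure ?J"
  have sub: "plane_section K \<xi> t \<subseteq> {y \<in> space ?L. (\<lambda>i\<in>?J. (1 - \<theta>) * (p \<bullet> rot_to \<xi> i) + \<theta> * y i) \<in> plane_section K \<xi> ?u}"
    (is "_ \<subseteq> ?R")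
  proof
    fix y assume y: "y \<in> plane_section K \<xi> t"
    have "plane_point \<xi> ?u (\<lambda>i\<in>?J. (1 - \<theta>) * (p \<bullet> rot_to \<xi> i) + \<theta> * y i)
        = plane_point \<xi> ?u (\<lambda>i. (1 - \<theta>) * (p \<bullet> rot_to \<xi> i) + \<theta> * y i)"
      by (rule plane_point_cong) simp
    also have "\<dots> = (1 - \<theta>) *\<^sub>R p + \<theta> *\<^sub>R plane_point \<xi> t y"
      by (simp add: plane_point_combine[OF \<xi>] plane_point_self[OF \<xi>])
    also have "\<dots> \<in> K" using y p \<theta> K(1) by (intro convexD) (auto simp: plane_section_def)
    finally show "y \<in> ?R" using y by (simp add: plane_section_def space_PiM)
  qed
  have "ennreal (\<theta> ^ (DIM('a) - 1)) * ennreal (sectional_volume K \<xi> t)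
     \<le> ennreal \<theta> ^ card ?J * emeasure ?L ?R"
  proof -
    have "(\<lambda>y. \<lambda>i\<in>?J. (1 - \<theta>) * (p \<bullet> rot_to \<xi> i) + \<theta> * y i) \<in> measurable ?L ?L" by measurable
    from measurable_sets[OF this section_sets[OF \<xi> K(3), of ?u]]
    have "?R \<in> sets ?L" by (simp add: vimage_def Int_def conj_commute)
    from emeasure_mono[OF sub this] show ?thesis
      using \<theta> emeasure_section_eq[OF \<xi> K(2), of t]
      by (simp add: card_Basis_diff ennreal_power mult_left_mono)
  qed
  also have "\<dots> = emeasure ?L (plane_section K \<xi> ?u)"
    by (rule emeasure_plane_affine) (use \<theta> section_sets[OF \<xi> K(3)] in auto)
  also have "\<dots> = ennreal (sectional_volume K \<xi> ?u)" by (rule emeasure_section_eq[OF \<xi> K(2)])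
  finally show ?thesis using \<theta> by (simp flip: ennreal_mult)
qed

text \<open>Fubini as a statement about image measures: the section function is the density of
  \<open>x \<bullet> \<xi>\<close> under the uniform measure on \<open>K\<close>. Moments and Cauchy
  transforms of sections thereby become integrals over \<open>K\<close>.\<close>

lemma distr_sections:
  fixes K :: "'a::euclidean_space set"
  assumes \<xi>: "norm \<xi> = 1" and K: "bounded K" "K \<in> sets borel"
  shows "sectional_volume K \<xi> \<in> borel_measurable borel"
    "distr (density lborel (indicator K)) borel (\<lambda>x. x \<bullet> \<xi>) = density lborel (\<lambda>t. ennreal (sectional_volume K \<xi> t))"
proof -
  let ?L = "plane_measure (Basis - {e0 :: 'a})"
  interpret product_sigma_finite "\<lambda>_::'a. lborel :: real measure" ..
  interpret L: sigma_finite_measure ?L by (rule sigma_finite) simp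
  have pm: "(\<lambda>x. plane_point \<xi> (fst x) (snd x)) \<in> borel_measurable (lborel \<Otimes>\<^sub>M ?L)"
    using plane_point_measurable_pair[OF \<xi>] by (simp add: case_prod_unfold)
  have meq: "ennreal (sectional_volume K \<xi> t) = (\<integral>\<^sup>+y. indicator K (plane_point \<xi> t y) \<partial>?L)" for t
  proof -
    have "(\<integral>\<^sup>+y. indicator K (plane_point \<xi> t y) \<partial>?L) = (\<integral>\<^sup>+y. indicator (plane_section K \<xi> t) y \<partial>?L)"
      by (intro nn_integral_cong) (auto simp: plane_section_def indicator_def)
    also have "\<dots> = emeasure ?L (plane_section K \<xi> t)" using section_sets[OF \<xi> K(2)] by simp
    finally show ?thesis using emeasure_section_eq[OF \<xi> K(1)] by simp
  qed
  have "(\<lambda>t. ennreal (sectional_volume K \<xi> t)) \<in> borel_measurable lborel"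
    unfolding meq
    using L.borel_measurable_nn_integral_fst[OF measurable_compose[OF pm borel_measurable_indicator[OF K(2)]]]
    by simp
  then have "(\<lambda>t. enn2real (ennreal (sectional_volume K \<xi> t))) \<in> borel_measurable borel" by measurable
  then show m: "sectional_volume K \<xi> \<in> borel_measurable borel" by simp
  show "distr (density lborel (indicator K)) borel (\<lambda>x. x \<bullet> \<xi>) = density lborel (\<lambda>t. ennreal (sectional_volume K \<xi> t))"
  proof (rule measure_eqI)
    fix X assume "X \<in> sets (distr (density lborel (indicator K)) borel (\<lambda>x. x \<bullet> \<xi>))"
    then have X: "X \<in> sets borel" by simp
    have "emeasure (distr (density lborel (indicator K)) borel (\<lambda>x. x \<bullet> \<xi>)) X
       = (\<integral>\<^sup>+x. indicator K x * indicator X (x \<bullet> \<xi>) \<partial>lborel)"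
      using X K(2) by (subst emeasure_distr; (subst emeasure_density)?)
        (auto intro!: nn_integral_cong measurable_sets_borel[of "\<lambda>x. x \<bullet> \<xi>"] simp: indicator_def)
    also have "\<dots> = (\<integral>\<^sup>+t. (\<integral>\<^sup>+y. indicator K (plane_point \<xi> t y) * indicator X t \<partial>?L) \<partial>lborel)"
      using X K(2) by (subst nn_integral_planes[OF \<xi>]) (auto simp: plane_point_inner[OF \<xi>])
    also have "\<dots> = (\<integral>\<^sup>+t. ennreal (sectional_volume K \<xi> t) * indicator X t \<partial>lborel)"
      unfolding meq using plane_point_measurable[OF \<xi>] K(2) by (subst nn_integral_multc) auto
    also have "\<dots> = emeasure (density lborel (\<lambda>t. ennreal (sectional_volume K \<xi> t))) X"
      using X m by (subst emeasure_density) auto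
    finally show "emeasure (distr (density lborel (indicator K)) borel (\<lambda>x. x \<bullet> \<xi>)) X
       = emeasure (density lborel (\<lambda>t. ennreal (sectional_volume K \<xi> t))) X" .
  qed simp
qed

section \<open>Hilbert and Cauchy transforms\<close>

lemma integrable_indicator_Icc [simp]: "integrable lborel (indicat_real {a..b::real})"
  by (rule integrable_real_indicator) (auto simp: emeasure_lborel_Icc_eq)

lemma integrable_bounded_support:
  fixes g :: "real \<Rightarrow> 'b::{banach, second_countable_topology}"
  assumes "g \<in> borel_measurable borel" "\<And>t. norm (g t) \<le> B" "\<And>t. t \<notin> {a..b} \<Longrightarrow> g t = 0"
  shows "integrable lborel g"
proof (rule Bochner_Integration.integrable_bound)
  show "integrable lborel (\<lambda>t. B * indicator {a..b} t)" by simp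
  show "AE t in lborel. norm (g t) \<le> norm (B * indicator {a..b} t)"
  proof (rule AE_I2)
    fix t show "norm (g t) \<le> norm (B * indicator {a..b} t)"
      using assms(2)[of t] assms(3)[of t] by (cases "t \<in> {a..b}") auto
  qed
qed (use assms(1) in simp)

text \<open>A Lebesgue integral without the factor \<open>1 / pi\<close>, so that Fubini and
  dominated convergence apply directly; \<open>has_hilbert_transform_iff\<close> translates back to
  the gauge integral.\<close>

definition truncated_hilbert :: "(real \<Rightarrow> real) \<Rightarrow> real \<Rightarrow> real \<Rightarrow> real" where
  "truncated_hilbert f \<epsilon> t = (\<integral>s. indicator {s. \<epsilon> \<le> \<bar>t - s\<bar>} s * (f s / (t - s)) \<partial>lborel)"

lemma truncated_hilbert_integrable:
  fixes f :: "real \<Rightarrow> real"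
  assumes "f \<in> borel_measurable borel" "\<And>t. \<bar>f t\<bar> \<le> M" "\<And>t. t \<notin> {a..b} \<Longrightarrow> f t = 0" "\<epsilon> > 0"
  shows "integrable lborel (\<lambda>s. indicator {s. \<epsilon> \<le> \<bar>t - s\<bar>} s * (f s / (t - s)))"
proof (rule integrable_bounded_support[where B="M/\<epsilon>" and a=a and b=b])
  have M: "M \<ge> 0" using assms(2)[of 0] by linarith
  show "norm (indicator {s. \<epsilon> \<le> \<bar>t - s\<bar>} s * (f s / (t - s))) \<le> M / \<epsilon>" for s
    using assms(2)[of s] assms(4) M by (auto simp: indicator_def intro!: frac_le)
qed (use assms in auto)

lemma has_hilbert_transform_iff:
  fixes f :: "real \<Rightarrow> real"
  assumes "f \<in> borel_measurable borel" "\<And>t. \<bar>f t\<bar> \<le> M" "\<And>t. t \<notin> {a..b} \<Longrightarrow> f t = 0"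
  shows "has_hilbert_transform f t v \<longleftrightarrow> ((\<lambda>\<epsilon>. truncated_hilbert f \<epsilon> t) \<longlongrightarrow> pi * v) (at_right 0)"
proof -
  have *: "((\<lambda>s. f s / (t - s)) has_integral truncated_hilbert f \<epsilon> t) {s. \<epsilon> \<le> \<bar>t - s\<bar>}" if "\<epsilon> > 0" for \<epsilon>
  proof -
    have "((\<lambda>s. indicator {s. \<epsilon> \<le> \<bar>t - s\<bar>} s * (f s / (t - s))) has_integral truncated_hilbert f \<epsilon> t) UNIV"
      unfolding truncated_hilbert_def
      by (rule has_integral_integral_lborel[OF truncated_hilbert_integrable[OF assms that]])
    moreover have "(\<lambda>s. indicator {s. \<epsilon> \<le> \<bar>t - s\<bar>} s * (f s / (t - s)))
        = (\<lambda>s. if s \<in> {s. \<epsilon> \<le> \<bar>t - s\<bar>} then f s / (t - s) else 0)"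
      by (auto simp: indicator_def)
    ultimately show ?thesis by (simp only: has_integral_restrict_UNIV)
  qed
  have ev: "\<forall>\<^sub>F \<epsilon> in at_right 0. (1 / pi) * integral {s. \<epsilon> \<le> \<bar>t - s\<bar>} (\<lambda>s. f s / (t - s))
      = (1 / pi) * truncated_hilbert f \<epsilon> t"
    using * by (auto simp: eventually_at_right_field integral_unique intro!: exI[of _ 1])
  have "has_hilbert_transform f t v \<longleftrightarrow>
      ((\<lambda>\<epsilon>. (1 / pi) * integral {s. \<epsilon> \<le> \<bar>t - s\<bar>} (\<lambda>s. f s / (t - s))) \<longlongrightarrow> v) (at_right 0)"
    unfolding has_hilbert_transform_def using * by (auto simp: integrable_on_def)
  also have "\<dots> \<longleftrightarrow> ((\<lambda>\<epsilon>. (1 / pi) * truncated_hilbert f \<epsilon> t) \<longlongrightarrow> v) (at_right 0)"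
    by (rule tendsto_cong[OF ev])
  also have "\<dots> \<longleftrightarrow> ((\<lambda>\<epsilon>. truncated_hilbert f \<epsilon> t) \<longlongrightarrow> pi * v) (at_right 0)"
  proof
    assume "((\<lambda>\<epsilon>. (1 / pi) * truncated_hilbert f \<epsilon> t) \<longlongrightarrow> v) (at_right 0)"
    from tendsto_mult_left[OF this, of pi] show "((\<lambda>\<epsilon>. truncated_hilbert f \<epsilon> t) \<longlongrightarrow> pi * v) (at_right 0)" by simp
  next
    assume "((\<lambda>\<epsilon>. truncated_hilbert f \<epsilon> t) \<longlongrightarrow> pi * v) (at_right 0)"
    from tendsto_mult_left[OF this, of "1/pi"] show "((\<lambda>\<epsilon>. (1 / pi) * truncated_hilbert f \<epsilon> t) \<longlongrightarrow> v) (at_right 0)" by simp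
  qed
  finally show ?thesis .
qed

text \<open>An integrable substitute for the kernel \<open>1 / u\<close>: half of its singularity is
  kept, the other half is paid for by a lower bound on the distance.\<close>

definition inverse_sqrt_on :: "real \<Rightarrow> real \<Rightarrow> real" where
  "inverse_sqrt_on L u = indicator {-L..L} u * (1 / sqrt \<bar>u\<bar>)"

lemma inverse_sqrt_on_integrable: "integrable lborel (inverse_sqrt_on L)"
proof -
  define g where "g = (\<lambda>u::real. indicator {0..L} u * (1 / sqrt u))"
  have g: "integrable lborel g"
  proof (cases "L \<ge> 0")
    case True
    have "(\<lambda>x. x powr (-1/2)) integrable_on {0..L}" by (rule integrable_on_powr_from_0) (use True in auto)
    then have "(\<lambda>x. x powr (-1/2)) absolutely_integrable_on {0..L}"
      by (rule nonnegative_absolutely_integrable_1) auto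
    then have "integrable lebesgue (\<lambda>x. indicator {0..L} x *\<^sub>R x powr (-1/2))"
      by (simp add: set_integrable_def)
    then have "integrable lborel (\<lambda>x. indicator {0..L} x *\<^sub>R x powr (-1/2))"
      by (subst (asm) integrable_completion) auto
    moreover have "(\<lambda>x. indicator {0..L} x *\<^sub>R x powr (-1/2)) = g"
      by (auto simp: g_def indicator_def powr_minus powr_half_sqrt field_simps fun_eq_iff)
    ultimately show ?thesis by simp
  qed (simp add: g_def)
  have g': "integrable lborel (\<lambda>u. g (0 + (-1) * u))"
    using g by (subst lborel_integrable_real_affine_iff) auto
  have "inverse_sqrt_on L = (\<lambda>u. g u + g (0 + (-1) * u))"
    by (auto simp: inverse_sqrt_on_def g_def indicator_def fun_eq_iff)
  then show ?thesis using g g' by simp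
qed

lemma inverse_sqrt_on_nonneg [simp]: "inverse_sqrt_on L u \<ge> 0"
  by (simp add: inverse_sqrt_on_def)

lemma inverse_sqrt_on_shift:
  "integrable lborel (\<lambda>u. inverse_sqrt_on L (u - c))"
  "(\<integral>u. inverse_sqrt_on L (c - u) \<partial>lborel) = (\<integral>u. inverse_sqrt_on L u \<partial>lborel)"
  "integrable lborel (\<lambda>u. inverse_sqrt_on L (c - u))"
  using inverse_sqrt_on_integrable[of L] lborel_integrable_real_affine_iff[of 1 "inverse_sqrt_on L" "-c"]
    lborel_integral_real_affine[of "-1" "inverse_sqrt_on L" c]
    lborel_integrable_real_affine_iff[of "-1" "inverse_sqrt_on L" c]
  by simp_all

text \<open>What the singular integrals use of a section function. The two one-sided slope bounds
  are those produced by homotheties centred near the two ends of the body: each degenerates only at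
  its own end, and together they give a Lipschitz bound in the interior.\<close>

locale section_profile =
  fixes f :: "real \<Rightarrow> real" and a b M C :: real
  assumes ab: "a < b" and f_meas [measurable]: "f \<in> borel_measurable borel"
    and f_nonneg: "\<And>t. 0 \<le> f t" and f_le: "\<And>t. f t \<le> M"
    and f_zero: "\<And>t. t \<notin> {a<..<b} \<Longrightarrow> f t = 0"
    and lip_left: "\<And>t t'. a < t \<Longrightarrow> t < t' \<Longrightarrow> t' < b \<Longrightarrow> f t' - f t \<le> C * (t' - t) / (t' - a)"
    and lip_right: "\<And>t t'. a < t \<Longrightarrow> t < t' \<Longrightarrow> t' < b \<Longrightarrow> f t - f t' \<le> C * (t' - t) / (b - t)"
    and C_nonneg: "C \<ge> 0"
begin

lemma M_nonneg: "M \<ge> 0"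
  using f_nonneg f_le order_trans by blast

lemma f_abs: "\<bar>f t\<bar> \<le> M"
  using f_nonneg[of t] f_le[of t] by simp

lemma f_zero': "t \<notin> {a..b} \<Longrightarrow> f t = 0"
  using f_zero by auto

lemma hilbert_iff:
  "has_hilbert_transform f t v \<longleftrightarrow> ((\<lambda>\<epsilon>. truncated_hilbert f \<epsilon> t) \<longlongrightarrow> pi * v) (at_right 0)"
  by (rule has_hilbert_transform_iff[OF f_meas f_abs f_zero'])

text \<open>A point within \<open>d\<close> of \<open>s\<close> still has distance at least
  \<open>d\<close> from both ends, so the denominators of both slope bounds are at least
  \<open>d\<close>.\<close>

lemma local_lipschitz:
  assumes s: "a + 2 * d \<le> s" "s \<le> b - 2 * d" and d: "d > 0" and t: "\<bar>s - t\<bar> < d"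
  shows "\<bar>f t - f s\<bar> \<le> C / d * \<bar>s - t\<bar>"
proof -
  have *: "C * x / y \<le> C / d * x" if "0 < x" "d \<le> y" for x y
  proof -
    have "C * x / y \<le> C * x / d" using that d C_nonneg by (intro divide_left_mono) auto
    then show ?thesis by simp
  qed
  consider "s < t" | "t < s" | "s = t" by linarith
  then show ?thesis
  proof cases
    case 1
    then have st: "a < s" "t < b" using s d t by auto
    show ?thesis
      using lip_left[OF st(1) 1 st(2)] lip_right[OF st(1) 1 st(2)] *[of "t - s" "t - a"] *[of "t - s" "b - s"] 1 s d
      by (simp add: abs_le_iff)
  next
    case 2
    then have st: "a < t" "s < b" using s d t by auto
    have "d \<le> s - a" "d \<le> b - t" using s d 2 by auto
    then show ?thesis
      using lip_left[OF st(1) 2 st(2)] lip_right[OF st(1) 2 st(2)] *[of "s - t" "s - a"] *[of "s - t" "b - t"] 2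
      by (simp add: abs_le_iff)
  qed simp
qed

text \<open>The kernel \<open>1 / (s - t)\<close> is odd about \<open>s\<close> and integrates to
  zero over the symmetric annulus, so \<open>f t\<close> may be replaced by
  \<open>f t - f s\<close>. The quotient is then at most \<open>C / d\<close> on a set of length at
  most \<open>2 * d\<close>, and the bound depends neither on \<open>d\<close> nor on the
  truncation.\<close>

lemma near_part_bound:
  assumes s: "a + 2 * d \<le> s" "s \<le> b - 2 * d" and d: "d > 0" and \<epsilon>: "\<epsilon> > 0"
  defines "A \<equiv> {t. \<epsilon> \<le> \<bar>s - t\<bar> \<and> \<bar>s - t\<bar> < d}"
  shows "integrable lborel (\<lambda>t. indicator A t * (f t / (s - t)))"
    "\<bar>\<integral>t. indicator A t * (f t / (s - t)) \<partial>lborel\<bar> \<le> 2 * C"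
proof -
  have A: "A \<in> sets borel" unfolding A_def by measurable
  define g where "g = (\<lambda>t. indicator A t * ((f t - f s) / (s - t)))"
  define k where "k = (\<lambda>t. indicator A t * (1 / (s - t)))"
  have gb: "norm (g t) \<le> C / d * indicator {s-d..s+d} t" for t
  proof (cases "t \<in> A")
    case True
    then have t: "\<bar>s - t\<bar> < d" "s \<noteq> t" using \<epsilon> by (auto simp: A_def)
    have "\<bar>f t - f s\<bar> / \<bar>s - t\<bar> \<le> C / d"
      using local_lipschitz[OF s d t(1)] t(2) by (simp add: divide_le_eq)
    then show ?thesis using True t by (auto simp: g_def indicator_def abs_less_iff)
  qed (use C_nonneg d in \<open>auto simp: g_def\<close>)
  have gi: "integrable lborel g"
    by (rule integrable_bounded_support[where B="C/d" and a="s-d" and b="s+d"])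
       (use A gb order_trans[OF gb] C_nonneg d in \<open>auto simp: g_def indicator_def A_def split: if_splits\<close>)
  have ki: "integrable lborel k"
    by (rule integrable_bounded_support[where B="1/\<epsilon>" and a="s-d" and b="s+d"])
       (use A \<epsilon> in \<open>auto simp: k_def indicator_def A_def intro!: frac_le\<close>)
  have "(\<integral>t. k t \<partial>lborel) = (\<integral>t. k (2 * s + (-1) * t) \<partial>lborel)"
    using lborel_integral_real_affine[of "-1" k "2 * s"] by simp
  also have "(\<lambda>t. k (2 * s + (-1) * t)) = (\<lambda>t. - k t)"
    by (auto simp: k_def A_def indicator_def fun_eq_iff abs_minus_commute minus_divide_right)
  finally have k0: "(\<integral>t. k t \<partial>lborel) = 0" by simp
  have eq: "(\<lambda>t. indicator A t * (f t / (s - t))) = (\<lambda>t. g t + f s * k t)"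
    by (auto simp: g_def k_def fun_eq_iff diff_divide_distrib algebra_simps)
  show "integrable lborel (\<lambda>t. indicator A t * (f t / (s - t)))" unfolding eq using gi ki by simp
  have "(\<integral>t. indicator A t * (f t / (s - t)) \<partial>lborel) = (\<integral>t. g t \<partial>lborel)"
    unfolding eq using gi ki k0 by simp
  also have "\<bar>\<dots>\<bar> \<le> (\<integral>t. C / d * indicator {s-d..s+d} t \<partial>lborel)"
    using Bochner_Integration.integral_norm_bound_integral[of lborel g "\<lambda>t. C / d * indicator {s-d..s+d} t"] gi gb by simp
  also have "\<dots> = 2 * C" using d by simp
  finally show "\<bar>\<integral>t. indicator A t * (f t / (s - t)) \<partial>lborel\<bar> \<le> 2 * C" .
qed

text \<open>On \<open>A\<close> the inequality \<open>|s - t| \<ge> sqrt d * sqrt |s - t|\<close>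
  leaves an integrable kernel in \<open>t\<close> and costs only \<open>1 / sqrt d\<close>. With
  \<open>d\<close> comparable to the distance of \<open>s\<close> from the ends this remains
  integrable in \<open>s\<close>, which \<open>1 / d\<close> would not.\<close>

lemma far_part_bound:
  assumes s: "s \<in> {a<..<b}" and d: "d > 0"
    and A: "A \<in> sets borel" "\<And>t. t \<in> A \<Longrightarrow> d \<le> \<bar>s - t\<bar>"
  shows "\<bar>\<integral>t. indicator A t * (f t / (s - t)) \<partial>lborel\<bar>
     \<le> M / sqrt d * (\<integral>u. inverse_sqrt_on (b - a) u \<partial>lborel)"
proof -
  have bound: "norm (indicator A t * (f t / (s - t))) \<le> M / sqrt d * inverse_sqrt_on (b - a) (s - t)" for t
  proof (cases "t \<in> A \<and> t \<in> {a<..<b}")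
    case True
    then have t: "d \<le> \<bar>s - t\<bar>" "s - t \<in> {-(b-a)..b-a}" using A s by auto
    have pos: "\<bar>s - t\<bar> > 0" using t(1) d by linarith
    have "sqrt d * sqrt \<bar>s - t\<bar> \<le> sqrt \<bar>s - t\<bar> * sqrt \<bar>s - t\<bar>"
      using t(1) by (intro mult_right_mono) auto
    then have "sqrt d * sqrt \<bar>s - t\<bar> \<le> \<bar>s - t\<bar>" by simp
    then have "f t / \<bar>s - t\<bar> \<le> M / (sqrt d * sqrt \<bar>s - t\<bar>)"
      using d pos f_le f_nonneg M_nonneg by (intro frac_le) auto
    then show ?thesis using True t f_nonneg by (simp add: inverse_sqrt_on_def abs_mult)
  next
    case False
    then have "indicator A t * (f t / (s - t)) = 0" using f_zero by (auto simp: indicator_def)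
    then show ?thesis using d M_nonneg by (simp only: norm_zero) simp
  qed
  have i: "integrable lborel (\<lambda>t. M / sqrt d * inverse_sqrt_on (b - a) (s - t))"
    using inverse_sqrt_on_shift(3) by simp
  have "integrable lborel (\<lambda>t. indicator A t * (f t / (s - t)))"
    by (rule Bochner_Integration.integrable_bound[OF i])
       (use A bound d M_nonneg in \<open>auto simp: abs_mult\<close>)
  from Bochner_Integration.integral_norm_bound_integral[OF this i bound] show ?thesis
    by (simp add: inverse_sqrt_on_shift(2))
qed

text \<open>Near and far bounds combined into one function of \<open>s\<close>, independent of the
  truncation and with only inverse square root singularities at the two ends. It is the dominating
  function in \<open>cauchy_square\<close>.\<close>

definition majorant :: "real \<Rightarrow> real" where
  "majorant s = 2 * C + 2 * M * (\<integral>u. inverse_sqrt_on (b - a) u \<partial>lborel) *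
     (inverse_sqrt_on (b - a) (s - a) + inverse_sqrt_on (b - a) (b - s))"

lemma majorant_integrable: "integrable lborel (\<lambda>s. indicator {a..b} s * majorant s)"
proof -
  have *: "integrable lborel (\<lambda>s. indicator {a..b} s * inverse_sqrt_on (b - a) (s - a))"
    "integrable lborel (\<lambda>s. indicator {a..b} s * inverse_sqrt_on (b - a) (b - s))"
    using integrable_mult_indicator[OF _ inverse_sqrt_on_shift(1)[of "b - a" a], of "{a..b}"]
      integrable_mult_indicator[OF _ inverse_sqrt_on_shift(3)[of "b - a" b], of "{a..b}"] by auto
  have "(\<lambda>s. indicator {a..b} s * majorant s) = (\<lambda>s. 2 * C * indicator {a..b} s
     + 2 * M * (\<integral>u. inverse_sqrt_on (b - a) u \<partial>lborel) * (indicator {a..b} s * inverse_sqrt_on (b - a) (s - a))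
     + 2 * M * (\<integral>u. inverse_sqrt_on (b - a) u \<partial>lborel) * (indicator {a..b} s * inverse_sqrt_on (b - a) (b - s)))"
    by (simp add: majorant_def algebra_simps)
  then show ?thesis using * by (auto intro!: Bochner_Integration.integrable_add integrable_mult_right)
qed

lemma truncated_hilbert_bound:
  assumes s: "s \<in> {a<..<b}" and \<epsilon>: "\<epsilon> > 0"
  shows "\<bar>truncated_hilbert f \<epsilon> s\<bar> \<le> majorant s"
proof -
  define I where "I = (\<integral>u. inverse_sqrt_on (b - a) u \<partial>lborel)"
  have I0: "I \<ge> 0" unfolding I_def by (rule integral_nonneg_AE) simp
  \<comment> \<open>Half the distance to the nearer end, as \<open>near_part_bound\<close> asks for
    room \<open>2 * d\<close> on both sides.\<close>
  define d where "d = min (s - a) (b - s) / 2"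
  have d: "d > 0" "a + 2 * d \<le> s" "s \<le> b - 2 * d" using s by (auto simp: d_def min_def)
  have near: "\<bar>\<integral>t. indicator {t. \<epsilon> \<le> \<bar>s - t\<bar> \<and> \<bar>s - t\<bar> < d} t * (f t / (s - t)) \<partial>lborel\<bar> \<le> 2 * C"
    by (rule near_part_bound(2)) (use d \<epsilon> in auto)
  define A where "A = {t. \<epsilon> \<le> \<bar>s - t\<bar> \<and> d \<le> \<bar>s - t\<bar>}"
  have A: "A \<in> sets borel" unfolding A_def by measurable
  have far: "\<bar>\<integral>t. indicator A t * (f t / (s - t)) \<partial>lborel\<bar> \<le> M / sqrt d * I"
    unfolding I_def by (rule far_part_bound) (use s d A in \<open>auto simp: A_def\<close>)
  have Ai: "integrable lborel (\<lambda>t. indicator A t * (f t / (s - t)))"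
  proof -
    have "integrable lborel (\<lambda>t. indicator A t *\<^sub>R (indicator {t. \<epsilon> \<le> \<bar>s - t\<bar>} t * (f t / (s - t))))"
      using A by (intro integrable_mult_indicator truncated_hilbert_integrable[OF f_meas f_abs f_zero' \<epsilon>]) auto
    moreover have "(\<lambda>t. indicator A t *\<^sub>R (indicator {t. \<epsilon> \<le> \<bar>s - t\<bar>} t * (f t / (s - t))))
       = (\<lambda>t. indicator A t * (f t / (s - t)))"
      by (auto simp: A_def indicator_def)
    ultimately show ?thesis by simp
  qed
  have "truncated_hilbert f \<epsilon> s = (\<integral>t. indicator {t. \<epsilon> \<le> \<bar>s - t\<bar> \<and> \<bar>s - t\<bar> < d} t * (f t / (s - t))
       + indicator A t * (f t / (s - t)) \<partial>lborel)"
    unfolding truncated_hilbert_def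
    by (intro Bochner_Integration.integral_cong) (auto simp: A_def indicator_def)
  also have "\<dots> = (\<integral>t. indicator {t. \<epsilon> \<le> \<bar>s - t\<bar> \<and> \<bar>s - t\<bar> < d} t * (f t / (s - t)) \<partial>lborel)
       + (\<integral>t. indicator A t * (f t / (s - t)) \<partial>lborel)"
    by (intro Bochner_Integration.integral_add Ai near_part_bound(1)) (use d \<epsilon> in auto)
  finally have "\<bar>truncated_hilbert f \<epsilon> s\<bar> \<le> 2 * C + M / sqrt d * I" using near far by linarith
  also have "M / sqrt d * I \<le> 2 * M * I * (inverse_sqrt_on (b - a) (s - a) + inverse_sqrt_on (b - a) (b - s))"
  proof -
    \<comment> \<open>The exact factor is the square root of 2. Since \<open>2 * d\<close> is the
      distance to the nearer end, one of the two kernels equals \<open>1 / sqrt (2 * d)\<close> and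
      the other is nonnegative.\<close>
    have "1 / sqrt d \<le> 2 * (1 / sqrt (2 * d))" using d(1)
      by (simp add: real_sqrt_mult field_simps) (smt (verit) real_sqrt_pow2 sqrt2_less_2)
    also have "1 / sqrt (2 * d) \<le> inverse_sqrt_on (b - a) (s - a) + inverse_sqrt_on (b - a) (b - s)"
    proof -
      have "2 * d = s - a \<or> 2 * d = b - s" by (auto simp: d_def min_def)
      moreover have "inverse_sqrt_on (b - a) (s - a) = 1 / sqrt (s - a)"
        "inverse_sqrt_on (b - a) (b - s) = 1 / sqrt (b - s)"
        using s by (auto simp: inverse_sqrt_on_def)
      ultimately show ?thesis using s by auto
    qed
    finally have "1 / sqrt d \<le> 2 * (inverse_sqrt_on (b - a) (s - a) + inverse_sqrt_on (b - a) (b - s))" by simp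
    from mult_left_mono[OF this, of "M * I"] show ?thesis
      using M_nonneg I0 by (simp add: mult.assoc mult.left_commute mult.commute)
  qed
  finally show ?thesis by (simp add: majorant_def I_def)
qed

end

section \<open>Parity of root orders\<close>

lemma eq_at_limit_point:
  fixes f g :: "complex \<Rightarrow> complex"
  assumes "open S" "z0 \<in> S" "continuous_on S f" "continuous_on S g"
    and "\<And>z. z \<in> S \<Longrightarrow> z \<noteq> z0 \<Longrightarrow> f z = g z"
  shows "f z0 = g z0"
proof -
  have "(f \<longlongrightarrow> f z0) (at z0)" "(g \<longlongrightarrow> g z0) (at z0)"
    using assms by (auto simp: continuous_on_eq_continuous_at isCont_def)
  moreover have "\<forall>\<^sub>F z in at z0. f z = g z"
    using assms by (auto simp: eventually_at_topological)
  ultimately show ?thesis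
    by (metis (mono_tags, lifting) tendsto_cong tendsto_unique trivial_limit_at)
qed

text \<open>A root of \<open>T\<close> is a root of \<open>g\<close>, and the removable singularity
  theorem lets \<open>g\<close> be divided by \<open>z - z0\<close>. Each such division removes
  exactly two linear factors from \<open>T\<close>.\<close>

lemma even_order_if_holomorphic_square:
  assumes "open S" "z0 \<in> S" "g holomorphic_on S" "T \<noteq> 0" "\<And>z. z \<in> S \<Longrightarrow> (g z)\<^sup>2 = poly T z"
  shows "even (order z0 T)"
  using assms(3-)
proof (induction "degree T" arbitrary: T g rule: less_induct)
  case less
  show ?case
  proof (cases "poly T z0 = 0")
    case False
    then show ?thesis by (simp add: order_root)
  next
    case True
    then obtain T1 where T1: "T = [:-z0, 1:] * T1" by (auto simp: poly_eq_0_iff_dvd)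
    have g0: "g z0 = 0" using less.prems(3)[OF assms(2)] True by simp
    define h where "h = (\<lambda>z. if z = z0 then deriv g z0 else (g z - g z0) / (z - z0))"
    have h: "h holomorphic_on S" unfolding h_def
      by (rule pole_lemma) (use less.prems assms in \<open>auto simp: interior_open\<close>)
    have gh: "g z = (z - z0) * h z" for z using g0 by (simp add: h_def)
    have eq1: "poly T1 z = (z - z0) * (h z)\<^sup>2" if "z \<in> S" "z \<noteq> z0" for z
    proof -
      have "(z - z0) * poly T1 z = (z - z0) * ((z - z0) * (h z)\<^sup>2)"
        using less.prems(3)[OF that(1)] by (simp add: T1 gh power2_eq_square algebra_simps)
      then show ?thesis using that(2) by simp
    qed
    have ch: "continuous_on S h" using h by (rule holomorphic_on_imp_continuous_on)
    have "poly T1 z0 = (z0 - z0) * (h z0)\<^sup>2"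
      by (rule eq_at_limit_point[OF assms(1,2)]) (use eq1 ch in \<open>auto intro!: continuous_intros\<close>)
    then obtain T2 where T2: "T1 = [:-z0, 1:] * T2" by (auto simp: poly_eq_0_iff_dvd)
    have eq2: "poly T2 z = (h z)\<^sup>2" if "z \<in> S" "z \<noteq> z0" for z
    proof -
      have "(z - z0) * poly T2 z = (z - z0) * (h z)\<^sup>2" using eq1[OF that] by (simp add: T2 algebra_simps)
      then show ?thesis using that(2) by simp
    qed
    have "poly T2 z0 = (h z0)\<^sup>2"
      by (rule eq_at_limit_point[OF assms(1,2)]) (use eq2 ch in \<open>auto intro!: continuous_intros\<close>)
    with eq2 have eq3: "(h z)\<^sup>2 = poly T2 z" if "z \<in> S" for z using that by metis
    have T20: "T2 \<noteq> 0" using less.prems(2) T1 T2 by auto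
    have T_eq: "T = [:-z0, 1:] ^ 2 * T2" by (simp only: T1 T2 power2_eq_square mult.assoc)
    have "degree T = 2 + degree T2"
      unfolding T_eq using T20 by (subst degree_mult_eq) (auto simp: degree_linear_power)
    then have "even (order z0 T2)" using less.hyps[OF _ h T20 eq3] by simp
    moreover have "order z0 T = 2 + order z0 T2"
      unfolding T_eq using T20 by (subst order_mult) (auto simp: order_power_n_n)
    ultimately show ?thesis by simp
  qed
qed

text \<open>If the order \<open>n\<close> were even, the factor \<open>u ^ n\<close> would be
  positive on both sides of \<open>c\<close>, so the cofactor would inherit both signs and its value
  at \<open>c\<close> would be zero. The sign \<open>\<sigma>\<close> tells on which side of
  \<open>c\<close> the polynomial is nonpositive.\<close>

lemma odd_order_if_sign_change:
  fixes c \<sigma> :: real and T :: "complex poly"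
  assumes T0: "T \<noteq> 0" and \<sigma>: "\<sigma> \<in> {-1, 1}" and \<delta>: "\<delta> > 0"
    and real: "\<And>x::real. Im (poly T (of_real x)) = 0"
    and neg: "\<And>u. 0 < u \<Longrightarrow> u < \<delta> \<Longrightarrow> Re (poly T (of_real (c + \<sigma> * u))) \<le> 0"
    and pos: "\<And>u. 0 < u \<Longrightarrow> u < \<delta> \<Longrightarrow> Re (poly T (of_real (c - \<sigma> * u))) \<ge> 0"
  shows "odd (order (of_real c) T)"
proof
  assume even: "even (order (of_real c) T)"
  define n where "n = order (complex_of_real c) T"
  obtain R where R: "T = [:- of_real c, 1:] ^ n * R" "\<not> [:- complex_of_real c, 1:] dvd R"
    using order_decomp[OF T0, of "of_real c"] unfolding n_def by blast
  have Rc: "poly R (of_real c) \<noteq> 0" using R(2) by (simp add: poly_eq_0_iff_dvd)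
  have val: "poly T (of_real (c + r * u)) = of_real (u ^ n) * poly R (of_real (c + r * u))"
    if "r \<in> {-1, 1}" for r u :: real
  proof -
    have "(complex_of_real (c + r * u) - of_real c) ^ n = of_real ((r * u) ^ n)" by simp
    also have "(r * u) ^ n = u ^ n" using even that by (auto simp: n_def power_mult_distrib)
    moreover have "poly T (of_real (c + r * u)) = poly ([:- of_real c, 1:] ^ n) (of_real (c + r * u)) * poly R (of_real (c + r * u))"
      by (subst R(1)) (rule poly_mult)
    ultimately show ?thesis by (simp add: poly_power)
  qed
  have lim: "((\<lambda>u. poly R (of_real (c + r * u))) \<longlongrightarrow> poly R (of_real c)) (at_right (0::real))" for r
  proof -
    have "((\<lambda>u. poly R (of_real (c + r * u))) \<longlongrightarrow> poly R (of_real (c + r * 0))) (at_right (0::real))"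
      by (intro tendsto_intros)
    then show ?thesis by simp
  qed
  have ev: "\<forall>\<^sub>F u::real in at_right 0. 0 < u \<and> u < \<delta>"
    using \<delta> by (auto simp: eventually_at_right_field)
  have Im0: "Im (poly R (of_real (c + r * u))) = 0" if "0 < u" "r \<in> {-1,1}" for r u :: real
    using real[of "c + r * u"] val[OF that(2), of u] that(1) by simp
  have \<sigma>': "- \<sigma> \<in> {-1, 1}" using \<sigma> by auto
  have un: "(u ^ n \<le> 0) = False" if "0 < u" for u :: real using that by (simp add: not_le)
  have "Im (poly R (of_real c)) = 0"
  proof (rule tendsto_unique[OF _ tendsto_Im[OF lim[of \<sigma>]]])
    show "((\<lambda>u. Im (poly R (of_real (c + \<sigma> * u)))) \<longlongrightarrow> 0) (at_right (0::real))"
      by (rule tendsto_eventually, rule eventually_mono[OF ev]) (use Im0 \<sigma> in auto)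
  qed simp
  moreover have "Re (poly R (of_real c)) \<le> 0"
  proof (rule tendsto_upperbound[OF tendsto_Re[OF lim[of \<sigma>]]])
    show "\<forall>\<^sub>F u in at_right (0::real). Re (poly R (of_real (c + \<sigma> * u))) \<le> 0"
    proof (rule eventually_mono[OF ev])
      fix u :: real assume u: "0 < u \<and> u < \<delta>"
      have "u ^ n * Re (poly R (of_real (c + \<sigma> * u))) \<le> 0" using neg[of u] u val[OF \<sigma>, of u] by simp
      then show "Re (poly R (of_real (c + \<sigma> * u))) \<le> 0" using u un[of u] by (auto simp: mult_le_0_iff)
    qed
  qed simp
  moreover have "Re (poly R (of_real c)) \<ge> 0"
  proof (rule tendsto_lowerbound[OF tendsto_Re[OF lim[of "-\<sigma>"]]])
    show "\<forall>\<^sub>F u in at_right (0::real). Re (poly R (of_real (c + (-\<sigma>) * u))) \<ge> 0"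
    proof (rule eventually_mono[OF ev])
      fix u :: real assume u: "0 < u \<and> u < \<delta>"
      have "u ^ n * Re (poly R (of_real (c + (-\<sigma>) * u))) \<ge> 0" using pos[of u] u val[OF \<sigma>', of u] by simp
      then show "Re (poly R (of_real (c + (-\<sigma>) * u))) \<ge> 0" using u un[of u] by (auto simp: zero_le_mult_iff)
    qed
  qed simp
  ultimately show False using Rc by (simp add: complex_eq_iff)
qed

lemma poly_map_of_real: "poly (map_poly of_real p) (complex_of_real x) = of_real (poly p x)"
  by (induction p) (auto simp: map_poly_pCons)

section \<open>The Cauchy transform, its square, and its discriminant\<close>

context section_profile
begin

definition cauchy :: "complex \<Rightarrow> complex" where
  "cauchy z = (\<integral>t. of_real (f t) / (z - of_real t) \<partial>lborel)"

abbreviation segment :: "complex set" where "segment \<equiv> of_real ` {a..b}"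

lemma segment_distance:
  assumes "z \<notin> segment"
  obtains \<delta> where "\<delta> > 0" "\<And>t. t \<in> {a..b} \<Longrightarrow> \<delta> \<le> norm (z - of_real t)"
proof -
  have "closed segment"
    by (intro compact_imp_closed compact_continuous_image continuous_intros) auto
  from separate_point_closed[OF this assms] show ?thesis
    using that by (auto simp: dist_norm)
qed

lemma open_Compl_segment: "open (- segment)"
  by (intro open_Compl compact_imp_closed compact_continuous_image continuous_intros) auto

lemma cauchy_integrable:
  assumes "z \<notin> segment" and g: "g \<in> borel_measurable borel" "\<And>t. t \<in> {a..b} \<Longrightarrow> norm (g t :: complex) \<le> B"
  shows "integrable lborel (\<lambda>t. of_real (f t) / (z - of_real t) * g t)"
proof -
  obtain \<delta> where \<delta>: "\<delta> > 0" "\<And>t. t \<in> {a..b} \<Longrightarrow> \<delta> \<le> norm (z - of_real t)"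
    using segment_distance[OF assms(1)] by blast
  have B: "B \<ge> 0" using order_trans[OF norm_ge_zero g(2)[of a]] ab by simp
  show ?thesis
  proof (rule integrable_bounded_support[where B="M / \<delta> * B" and a=a and b=b])
    fix t show "norm (of_real (f t) / (z - of_real t) * g t) \<le> M / \<delta> * B"
    proof (cases "t \<in> {a..b}")
      case True
      have "f t / norm (z - of_real t) \<le> M / \<delta>"
        using \<delta>(1) \<delta>(2)[OF True] f_le f_nonneg M_nonneg by (intro frac_le) auto
      then have "f t / norm (z - of_real t) * norm (g t) \<le> M / \<delta> * B"
        using g(2)[OF True] B M_nonneg \<delta>(1) by (intro mult_mono) auto
      then show ?thesis using f_nonneg by (simp add: norm_mult norm_divide)
    qed (use f_zero'[of t] M_nonneg \<delta>(1) B in auto)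
    show "(\<lambda>t. of_real (f t) / (z - of_real t) * g t) \<in> borel_measurable borel"
      using g(1) by measurable
  qed (simp add: f_zero')
qed

lemma cauchy_integrable': "z \<notin> segment \<Longrightarrow> integrable lborel (\<lambda>t. of_real (f t) / (z - of_real t))"
  using cauchy_integrable[of z "\<lambda>_. 1" 1] by simp

text \<open>Differentiation under the integral sign by an explicit remainder: with
  \<open>u = z - t\<close> and \<open>v = z0 - t\<close> the error of the difference quotient is
  \<open>f t * (u - v) / (u * v^2)\<close>, uniformly of order \<open>|z - z0|\<close>.\<close>

lemma cauchy_has_derivative:
  assumes z0: "z0 \<notin> segment"
  shows "(cauchy has_field_derivative (\<integral>t. of_real (f t) / (z0 - of_real t) * (- 1 / (z0 - of_real t)) \<partial>lborel)) (at z0)"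
proof -
  obtain \<delta> where \<delta>: "\<delta> > 0" "\<And>t. t \<in> {a..b} \<Longrightarrow> \<delta> \<le> norm (z0 - of_real t)"
    using segment_distance[OF z0] by blast
  define D where "D = (\<integral>t. of_real (f t) / (z0 - of_real t) * (- 1 / (z0 - of_real t)) \<partial>lborel)"
  have iD: "integrable lborel (\<lambda>t. of_real (f t) / (z0 - of_real t) * (- 1 / (z0 - of_real t)))"
    by (rule cauchy_integrable[OF z0, where B="1/\<delta>"]) (use \<delta> in \<open>auto simp: norm_divide intro!: frac_le\<close>)
  \<comment> \<open>From \<open>|u| \<ge> \<delta> / 2\<close>, \<open>|v| \<ge> \<delta>\<close>
    and \<open>f \<le> M\<close>, integrated over the segment.\<close>
  define K where "K = M * (2 / \<delta> ^ 3) * (b - a)"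
  have est: "norm ((cauchy z - cauchy z0) / (z - z0) - D) \<le> K * norm (z - z0)"
    if z: "norm (z - z0) < \<delta> / 2" "z \<noteq> z0" for z
  proof -
    have dz: "\<delta> / 2 \<le> norm (z - of_real t)" if "t \<in> {a..b}" for t
    proof -
      have "norm (z0 - of_real t) \<le> norm (z0 - z) + norm (z - of_real t)"
        using norm_triangle_ineq[of "z0 - z" "z - of_real t"] by simp
      then show ?thesis using \<delta>(2)[OF that] z(1) by (simp add: norm_minus_commute)
    qed
    have zs: "z \<notin> segment"
    proof
      assume "z \<in> segment"
      then obtain t where "t \<in> {a..b}" "z = of_real t" by auto
      with dz[of t] \<delta>(1) show False by simp
    qed
    have i: "integrable lborel (\<lambda>t. of_real (f t) / (z - of_real t))"
       "integrable lborel (\<lambda>t. of_real (f t) / (z0 - of_real t))"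
      using cauchy_integrable' zs z0 by auto
    have "(cauchy z - cauchy z0) / (z - z0) - D = (\<integral>t. (of_real (f t) / (z - of_real t) - of_real (f t) / (z0 - of_real t)) / (z - z0)
         - of_real (f t) / (z0 - of_real t) * (- 1 / (z0 - of_real t)) \<partial>lborel)"
      using i iD by (simp add: cauchy_def D_def)
    also have "norm \<dots> \<le> (\<integral>t. (M * (2 / \<delta> ^ 3) * norm (z - z0)) * indicator {a..b} t \<partial>lborel)"
    proof (rule Bochner_Integration.integral_norm_bound_integral)
      fix t
      show "norm ((of_real (f t) / (z - of_real t) - of_real (f t) / (z0 - of_real t)) / (z - z0)
         - of_real (f t) / (z0 - of_real t) * (- 1 / (z0 - of_real t)))
        \<le> (M * (2 / \<delta> ^ 3) * norm (z - z0)) * indicator {a..b} t"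
      proof (cases "t \<in> {a..b}")
        case True
        define u where "u = z - of_real t" define v where "v = z0 - of_real t"
        have u: "norm u \<ge> \<delta> / 2" and v: "norm v \<ge> \<delta>" using dz[OF True] \<delta>(2)[OF True] by (auto simp: u_def v_def)
        then have uv: "u \<noteq> 0" "v \<noteq> 0" using \<delta>(1) by auto
        have zz: "z - z0 = u - v" by (simp add: u_def v_def)
        have "(of_real (f t) / u - of_real (f t) / v) / (z - z0) - of_real (f t) / v * (- 1 / v)
            = of_real (f t) * ((u - v) / (u * v\<^sup>2))"
        proof -
          have *: "(of_real (f t) / u - of_real (f t) / v) / (u - v) = - of_real (f t) / (u * v)"
          proof -
            have "of_real (f t) / u - of_real (f t) / v = - of_real (f t) / (u * v) * (u - v)"
              using uv by (simp add: field_simps)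
            moreover have "u - v \<noteq> 0" using z(2) zz by auto
            ultimately show ?thesis by simp
          qed
          show ?thesis unfolding zz * using uv by (simp add: field_simps power2_eq_square)
        qed
        also have "norm \<dots> = f t * (norm (z - z0) / (norm u * (norm v)\<^sup>2))"
          using f_nonneg by (simp add: norm_mult norm_divide norm_power zz)
        also have "\<dots> \<le> M * (norm (z - z0) / (\<delta> / 2 * \<delta>\<^sup>2))"
          using u v \<delta>(1) f_nonneg f_le M_nonneg by (intro mult_mono frac_le power_mono) auto
        also have "\<dots> = (M * (2 / \<delta> ^ 3) * norm (z - z0)) * indicator {a..b} t"
          using True by (simp add: power2_eq_square power3_eq_cube mult_ac)
        finally show ?thesis by (simp add: u_def v_def)
      qed (use f_zero'[of t] in simp)
    qed (use i iD in \<open>auto intro!: Bochner_Integration.integrable_diff\<close>)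
    also have "\<dots> = K * norm (z - z0)" using ab by (simp add: K_def)
    finally show ?thesis .
  qed
  have "((\<lambda>z. (cauchy z - cauchy z0) / (z - z0) - D) \<longlongrightarrow> 0) (at z0)"
  proof (rule Lim_null_comparison)
    show "\<forall>\<^sub>F z in at z0. norm ((cauchy z - cauchy z0) / (z - z0) - D) \<le> K * norm (z - z0)"
      unfolding eventually_at using est \<delta>(1) by (intro exI[of _ "\<delta>/2"]) (auto simp: dist_norm)
    have "((\<lambda>z. K * norm (z - z0)) \<longlongrightarrow> K * norm (z0 - z0)) (at z0)" by (intro tendsto_intros)
    then show "((\<lambda>z. K * norm (z - z0)) \<longlongrightarrow> 0) (at z0)" by simp
  qed
  then show ?thesis unfolding D_def[symmetric] by (simp add: has_field_derivative_iff LIM_zero_iff)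
qed

lemma cauchy_holomorphic: "cauchy holomorphic_on (- segment)"
  using cauchy_has_derivative by (auto simp: holomorphic_on_open[OF open_Compl_segment])

text \<open>The quotient \<open>(p z - p s) / (z - s)\<close> is a polynomial in \<open>z\<close>
  whose coefficients are polynomials in \<open>s\<close>, so integration against \<open>f\<close>
  yields a polynomial in \<open>z\<close>. Hence the Cauchy transform of \<open>f\<close> times a
  polynomial differs only by a polynomial from the product of the two.\<close>

lemma cauchy_difference_quotient:
  fixes p :: "real poly"
  shows "\<exists>Q :: real poly. \<forall>z. z \<notin> segment \<longrightarrow>
    (\<integral>s. of_real (f s) / (z - of_real s) * (poly (map_poly of_real p) z - of_real (poly p s)) \<partial>lborel)
      = poly (map_poly of_real Q) z"
proof (induction p)
  case 0
  show ?case by (rule exI[of _ 0]) simp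
next
  case (pCons c p)
  then obtain Q where Q: "\<And>z. z \<notin> segment \<Longrightarrow>
     (\<integral>s. of_real (f s) / (z - of_real s) * (poly (map_poly of_real p) z - of_real (poly p s)) \<partial>lborel)
      = poly (map_poly of_real Q) z" by blast
  obtain B where B: "\<And>s. s \<in> {a..b} \<Longrightarrow> \<bar>poly p s\<bar> \<le> B"
  proof -
    have "bounded (poly p ` {a..b})"
      by (intro compact_imp_bounded compact_continuous_image continuous_intros) auto
    then obtain B where "\<forall>x\<in>{a..b}. norm (poly p x) \<le> B" unfolding bounded_iff by auto
    then show ?thesis using that[of B] by auto
  qed
  have [measurable]: "poly p \<in> borel_measurable borel"
    by (intro borel_measurable_continuous_onI continuous_on_poly continuous_on_id)
  have ip: "integrable lborel (\<lambda>s. f s * poly p s)"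
  proof (rule integrable_bounded_support[where B="M * B" and a=a and b=b])
    show "norm (f s * poly p s) \<le> M * B" for s
    proof (cases "s \<in> {a..b}")
      case True
      then show ?thesis using f_le[of s] f_nonneg[of s] B[of s] M_nonneg by (auto simp: abs_mult intro!: mult_mono)
    next
      case False
      have "B \<ge> 0" using B[of a] ab by auto
      then show ?thesis using False f_zero'[of s] M_nonneg by simp
    qed
  qed (use f_zero' in auto)
  show ?case
  proof (intro exI allI impI)
    fix z assume z: "z \<notin> segment"
    have i1: "integrable lborel (\<lambda>s. of_real (f s) / (z - of_real s) * (poly (map_poly of_real p) z - of_real (poly p s)))"
      by (rule cauchy_integrable[OF z, where B="norm (poly (map_poly of_real p) z) + B"])
         (use B in \<open>auto intro!: order_trans[OF norm_triangle_ineq4] add_mono\<close>)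
    \<comment> \<open>Horner step:
      \<open>z * p z - s * p s = z * (p z - p s) + (z - s) * p s\<close>, where the last term
      cancels the denominator.\<close>
    have "(\<integral>s. of_real (f s) / (z - of_real s) * (poly (map_poly of_real (pCons c p)) z - of_real (poly (pCons c p) s)) \<partial>lborel)
       = (\<integral>s. z * (of_real (f s) / (z - of_real s) * (poly (map_poly of_real p) z - of_real (poly p s)))
            + of_real (f s * poly p s) \<partial>lborel)"
    proof (rule Bochner_Integration.integral_cong[OF refl])
      fix s
      show "of_real (f s) / (z - of_real s) * (poly (map_poly of_real (pCons c p)) z - of_real (poly (pCons c p) s))
        = z * (of_real (f s) / (z - of_real s) * (poly (map_poly of_real p) z - of_real (poly p s))) + of_real (f s * poly p s)"
      proof (cases "f s = 0")
        case False
        then have "s \<in> {a..b}" using f_zero' by blast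
        then have "z - of_real s \<noteq> 0" using z by (metis image_eqI right_minus_eq)
        then show ?thesis using z by (simp add: map_poly_pCons field_simps)
      qed simp
    qed
    also have "\<dots> = z * poly (map_poly of_real Q) z + of_real (\<integral>s. f s * poly p s \<partial>lborel)"
      unfolding Bochner_Integration.integral_add[OF integrable_mult_right[OF i1] integrable_of_real[OF ip]]
      by (simp only: integral_mult_right_zero Q[OF z] integral_complex_of_real)
    also have "\<dots> = poly (map_poly of_real (pCons (\<integral>s. f s * poly p s \<partial>lborel) Q)) z"
      by (simp add: map_poly_pCons)
    finally show "(\<integral>s. of_real (f s) / (z - of_real s) * (poly (map_poly of_real (pCons c p)) z - of_real (poly (pCons c p) s)) \<partial>lborel)
       = poly (map_poly of_real (pCons (\<integral>s. f s * poly p s \<partial>lborel) Q)) z" .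
  qed
qed

end

lemma pair_integrable_bounded_support:
  fixes g :: "real \<times> real \<Rightarrow> complex"
  assumes "g \<in> borel_measurable (lborel \<Otimes>\<^sub>M lborel)" "\<And>s t. norm (g (s, t)) \<le> B"
    and "\<And>s t. s \<notin> {a..b} \<or> t \<notin> {a..b} \<Longrightarrow> g (s, t) = 0"
  shows "integrable (lborel \<Otimes>\<^sub>M lborel) g"
proof (rule Bochner_Integration.integrable_bound)
  show "integrable (lborel \<Otimes>\<^sub>M lborel) (\<lambda>p. B * indicator ({a..b} \<times> {a..b}) p)"
  proof (intro integrable_mult_right integrable_real_indicator)
    show "emeasure (lborel \<Otimes>\<^sub>M lborel) ({a..b} \<times> {a..b}) < \<infinity>"
      by (subst lborel.emeasure_pair_measure_Times)
         (auto simp: emeasure_lborel_Icc_eq ennreal_mult_less_top)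
  qed simp
  show "AE p in lborel \<Otimes>\<^sub>M lborel. norm (g p) \<le> norm (B * indicator ({a..b} \<times> {a..b}) p)"
  proof (rule AE_I2)
    fix p show "norm (g p) \<le> norm (B * indicator ({a..b} \<times> {a..b}) p)"
      using assms(2)[of "fst p" "snd p"] assms(3)[of "fst p" "snd p"]
      by (cases p) (auto simp: indicator_def)
  qed
qed (use assms(1) in simp)

context section_profile
begin

text \<open>The identity \<open>1/((z-s)(z-t)) = (1/(z-s) - 1/(z-t))/(s-t)\<close> turns the square of the
  Cauchy transform, with the diagonal cut out, into the Cauchy transform of \<open>f\<close> times its truncated
  Hilbert transform.\<close>

lemma cauchy_square:
  assumes hil: "\<And>t. t \<in> {a<..<b} \<Longrightarrow> has_hilbert_transform f t (poly B t)"
    and z: "z \<notin> segment"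
  shows "(cauchy z)\<^sup>2 = 2 * (\<integral>s. of_real (f s) / (z - of_real s) * of_real (pi * poly B s) \<partial>lborel)"
proof -
  obtain \<delta> where \<delta>: "\<delta> > 0" "\<And>t. t \<in> {a..b} \<Longrightarrow> \<delta> \<le> norm (z - of_real t)"
    using segment_distance[OF z] by blast
  define \<epsilon> where "\<epsilon> = (\<lambda>n. 1 / real (Suc n))"
  have \<epsilon>: "\<epsilon> n > 0" for n by (simp add: \<epsilon>_def)
  have \<epsilon>0: "\<epsilon> \<longlonglongrightarrow> 0" unfolding \<epsilon>_def by real_asymp
  define w where "w = (\<lambda>s. complex_of_real (f s) / (z - of_real s))"
  have w_meas [measurable]: "w \<in> borel_measurable borel" unfolding w_def by measurable
  have w0: "w s = 0" if "s \<notin> {a<..<b}" for s using f_zero[OF that] by (simp add: w_def)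
  have wM: "norm (w s) \<le> M / \<delta>" for s
  proof (cases "s \<in> {a..b}")
    case True
    then have "f s / norm (z - of_real s) \<le> M / \<delta>"
      using \<delta> f_le f_nonneg M_nonneg by (intro frac_le) auto
    then show ?thesis using f_nonneg by (simp add: w_def norm_divide)
  qed (use w0[of s] \<delta>(1) M_nonneg in auto)
  \<comment> \<open>\<open>h\<close> is the full product kernel and \<open>hn n\<close> the same
    kernel without a band around the diagonal; partial fractions split it into \<open>k n\<close>
    and \<open>k' n\<close>, which are exchanged by swapping the variables.\<close>
  define d where "d = (\<lambda>n s t. indicat_real {t. \<epsilon> n \<le> \<bar>s - t\<bar>} t * (f t / (s - t)))"
  define h where "h = (\<lambda>(s, t). w s * w t)"
  define hn where "hn = (\<lambda>n (s, t). of_real (indicator {t. \<epsilon> n \<le> \<bar>s - t\<bar>} t) * (w s * w t))"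
  define k where "k = (\<lambda>n (s, t). w s * of_real (d n s t))"
  define k' where "k' = (\<lambda>n (s, t). w t * of_real (d n t s))"
  have ind_meas: "(\<lambda>p::real \<times> real. indicat_real {t. c \<le> \<bar>fst p - t\<bar>} (snd p)) \<in> borel_measurable (borel \<Otimes>\<^sub>M borel)" for c
  proof -
    have "(\<lambda>p::real \<times> real. indicat_real {t. c \<le> \<bar>fst p - t\<bar>} (snd p))
      = (\<lambda>p. if c \<le> \<bar>fst p - snd p\<bar> then 1 else 0)" by (auto simp: indicator_def)
    then show ?thesis by simp
  qed
  have ind_meas': "(\<lambda>p::real \<times> real. indicat_real {t. c \<le> \<bar>snd p - t\<bar>} (fst p)) \<in> borel_measurable (borel \<Otimes>\<^sub>M borel)" for c
  proof -
    have "(\<lambda>p::real \<times> real. indicat_real {t. c \<le> \<bar>snd p - t\<bar>} (fst p))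
      = (\<lambda>p. if c \<le> \<bar>snd p - fst p\<bar> then 1 else 0)" by (auto simp: indicator_def)
    then show ?thesis by simp
  qed
  have h_meas: "h \<in> borel_measurable (lborel \<Otimes>\<^sub>M lborel)"
    unfolding h_def case_prod_unfold by measurable
  have hn_meas: "hn n \<in> borel_measurable (lborel \<Otimes>\<^sub>M lborel)" for n
    unfolding hn_def case_prod_unfold using ind_meas by measurable
  have k_meas: "k n \<in> borel_measurable (lborel \<Otimes>\<^sub>M lborel)" for n
    unfolding k_def d_def case_prod_unfold using ind_meas by measurable
  have k'_meas: "k' n \<in> borel_measurable (lborel \<Otimes>\<^sub>M lborel)" for n
    unfolding k'_def d_def case_prod_unfold using ind_meas' by measurable
  define m where "m = M / \<delta>"
  have MD: "0 \<le> m" using M_nonneg \<delta>(1) by (simp add: m_def)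
  note wM = wM[folded m_def]
  define e where "e = (\<lambda>n. M / \<epsilon> n)"
  have dM: "\<bar>d n s t\<bar> \<le> e n" for n s t
    using f_abs[of t] \<epsilon>[of n] M_nonneg by (auto simp: d_def e_def indicator_def intro!: frac_le)
  have d0: "d n s t = 0" if "t \<notin> {a<..<b}" for n s t using f_zero[OF that] by (simp add: d_def)

  have h_int: "integrable (lborel \<Otimes>\<^sub>M lborel) h"
    by (rule pair_integrable_bounded_support[OF h_meas, where B="m * m" and a=a and b=b])
       (auto simp: h_def norm_mult w0 intro!: mult_mono wM MD)
  have hn_bound: "norm (hn n (s, t)) \<le> norm (h (s, t))" for n s t
    by (auto simp: hn_def h_def norm_mult indicator_def)
  have k_int: "integrable (lborel \<Otimes>\<^sub>M lborel) (k n)" for n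
    by (rule pair_integrable_bounded_support[OF k_meas, where B="m * e n" and a=a and b=b])
       (auto simp: k_def norm_mult w0 d0 intro!: mult_mono wM MD dM)
  have k'_int: "integrable (lborel \<Otimes>\<^sub>M lborel) (k' n)" for n
    by (rule pair_integrable_bounded_support[OF k'_meas, where B="m * e n" and a=a and b=b])
       (auto simp: k'_def norm_mult w0 d0 intro!: mult_mono wM MD dM)
  have split: "hn n p = k n p + k' n p" for n p
  proof (cases p)
    case (Pair s t)
    show ?thesis
    proof (cases "\<epsilon> n \<le> \<bar>s - t\<bar> \<and> f s \<noteq> 0 \<and> f t \<noteq> 0")
      case True
      then have st: "s \<in> {a..b}" "t \<in> {a..b}" using f_zero' by auto
      have "s \<noteq> t" using True \<epsilon>[of n] by auto
      then have ne: "complex_of_real s - of_real t \<noteq> 0" by (metis of_real_diff of_real_eq_0_iff right_minus_eq)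
      have nz: "z - of_real s \<noteq> 0" "z - of_real t \<noteq> 0" using \<delta>(1) \<delta>(2)[OF st(1)] \<delta>(2)[OF st(2)] by auto
      have *: "1 / ((z - of_real s) * (z - of_real t)) =
          1 / (z - of_real s) * (1 / (of_real s - of_real t)) - 1 / (z - of_real t) * (1 / (of_real s - of_real t))"
        using nz ne by (simp add: divide_simps)
      have "hn n p = of_real (f s) * of_real (f t) * (1 / ((z - of_real s) * (z - of_real t)))"
        using True by (simp add: Pair hn_def w_def)
      also have "\<dots> = of_real (f s) / (z - of_real s) * (of_real (f t) / (of_real s - of_real t))
          + of_real (f t) / (z - of_real t) * (of_real (f s) / (of_real t - of_real s))"
      proof -
        have "of_real (f s) / (of_real t - of_real s) = - (complex_of_real (f s) / (of_real s - of_real t))"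
          by (metis minus_diff_eq minus_divide_right)
        then show ?thesis unfolding * by (simp add: algebra_simps)
      qed
      also have "\<dots> = k n p + k' n p"
        using True by (simp add: Pair k_def k'_def w_def d_def abs_minus_commute)
      finally show ?thesis .
    next
      case False
      then show ?thesis by (auto simp: Pair hn_def k_def k'_def d_def w_def abs_minus_commute)
    qed
  qed
  have dint: "(\<integral>t. d n s t \<partial>lborel) = truncated_hilbert f (\<epsilon> n) s" for n s
    by (simp add: d_def truncated_hilbert_def)
  have cw: "cauchy z = (\<integral>s. w s \<partial>lborel)" by (simp add: cauchy_def w_def)
  have "(cauchy z)\<^sup>2 = (\<integral>s. (\<integral>t. w s * w t \<partial>lborel) \<partial>lborel)"
    by (simp add: cw power2_eq_square)
  also have "\<dots> = integral\<^sup>L (lborel \<Otimes>\<^sub>M lborel) h"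
    using lborel_pair.integral_fst'[OF h_int] by (simp add: h_def)
  finally have sq: "(cauchy z)\<^sup>2 = integral\<^sup>L (lborel \<Otimes>\<^sub>M lborel) h" .
  \<comment> \<open>The diagonal is a null set, so removing a shrinking band loses nothing in the
    limit, and \<open>h\<close> itself dominates.\<close>
  have lim1: "(\<lambda>n. integral\<^sup>L (lborel \<Otimes>\<^sub>M lborel) (hn n)) \<longlonglongrightarrow> integral\<^sup>L (lborel \<Otimes>\<^sub>M lborel) h"
  proof (rule integral_dominated_convergence[where w="\<lambda>p. norm (h p)"])
    have diag: "{p. fst p = snd p} \<in> null_sets (lborel \<Otimes>\<^sub>M lborel :: (real \<times> real) measure)"
    proof -
      have m: "{p::real\<times>real. fst p = snd p} \<in> sets (lborel \<Otimes>\<^sub>M lborel)"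
        unfolding lborel_prod
        by (simp add: borel_closed closed_Collect_eq continuous_on_fst continuous_on_snd)
      have "emeasure (lborel \<Otimes>\<^sub>M lborel) {p::real\<times>real. fst p = snd p}
          = (\<integral>\<^sup>+s. emeasure lborel (Pair s -` {p::real\<times>real. fst p = snd p}) \<partial>lborel)"
        by (rule lborel.emeasure_pair_measure_alt[OF m])
      also have "\<dots> = (\<integral>\<^sup>+(s::real). 0 \<partial>lborel)"
      proof (rule nn_integral_cong)
        fix s :: real
        have "Pair s -` {p::real\<times>real. fst p = snd p} = {s}" by auto
        then show "emeasure lborel (Pair s -` {p::real\<times>real. fst p = snd p}) = 0" by simp
      qed
      finally show ?thesis using m by (auto simp: null_sets_def)
    qed
    show "AE p in lborel \<Otimes>\<^sub>M lborel. (\<lambda>n. hn n p) \<longlonglongrightarrow> h p"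
    proof (rule AE_I'[OF diag], safe)
      fix s t :: real assume nl: "\<not> (\<lambda>n. hn n (s, t)) \<longlonglongrightarrow> h (s, t)"
      show "fst (s, t) = snd (s, t)"
      proof (rule ccontr)
        assume "\<not> ?thesis"
        then have "\<forall>\<^sub>F n in sequentially. \<epsilon> n < \<bar>s - t\<bar>"
          by (intro order_tendstoD(2)[OF \<epsilon>0]) auto
        then have "\<forall>\<^sub>F n in sequentially. hn n (s, t) = h (s, t)"
          by (rule eventually_mono) (auto simp: hn_def h_def)
        then show False using nl by (simp add: tendsto_eventually)
      qed
    qed
    show "AE p in lborel \<Otimes>\<^sub>M lborel. norm (hn n p) \<le> norm (h p)" for n
      by (rule AE_I2) (use hn_bound in auto)
  qed (use h_meas hn_meas h_int in auto)
  \<comment> \<open>With the inner integration taken over the variable of the Hilbert kernel, both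
    halves give the same integral; this is the factor 2.\<close>
  have J: "integral\<^sup>L (lborel \<Otimes>\<^sub>M lborel) (hn n) = 2 * (\<integral>s. w s * of_real (truncated_hilbert f (\<epsilon> n) s) \<partial>lborel)" for n
  proof -
    have "integral\<^sup>L (lborel \<Otimes>\<^sub>M lborel) (hn n) = integral\<^sup>L (lborel \<Otimes>\<^sub>M lborel) (k n) + integral\<^sup>L (lborel \<Otimes>\<^sub>M lborel) (k' n)"
      using Bochner_Integration.integral_add[OF k_int[of n] k'_int[of n]] by (simp flip: split)
    also have "integral\<^sup>L (lborel \<Otimes>\<^sub>M lborel) (k n) = (\<integral>s. (\<integral>t. k n (s, t) \<partial>lborel) \<partial>lborel)"
      by (rule lborel_pair.integral_fst'[OF k_int, symmetric])
    also have "\<dots> = (\<integral>s. w s * of_real (truncated_hilbert f (\<epsilon> n) s) \<partial>lborel)"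
      by (simp add: k_def dint)
    also have "integral\<^sup>L (lborel \<Otimes>\<^sub>M lborel) (k' n) = (\<integral>t. (\<integral>s. k' n (s, t) \<partial>lborel) \<partial>lborel)"
      using lborel_pair.integral_snd[of "\<lambda>s t. k' n (s, t)"] k'_int by simp
    also have "\<dots> = (\<integral>s. w s * of_real (truncated_hilbert f (\<epsilon> n) s) \<partial>lborel)"
      by (simp add: k'_def dint)
    finally show ?thesis by simp
  qed
  have th_meas: "truncated_hilbert f (\<epsilon> n) \<in> borel_measurable lborel" for n
  proof -
    have "(\<lambda>s. \<integral>t. (\<lambda>p. indicat_real {t. \<epsilon> n \<le> \<bar>fst p - t\<bar>} (snd p) * (f (snd p) / (fst p - snd p))) (s, t) \<partial>lborel) \<in> borel_measurable lborel"
      by (rule lborel.borel_measurable_lebesgue_integral)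
         (use ind_meas in \<open>simp add: case_prod_unfold\<close>)
    then show ?thesis by (simp add: truncated_hilbert_def[abs_def])
  qed
  have pB [measurable]: "poly B \<in> borel_measurable borel"
    by (intro borel_measurable_continuous_onI continuous_on_poly continuous_on_id)
  \<comment> \<open>Here the uniform integrable bound on truncated Hilbert transforms is
    used.\<close>
  have lim2: "(\<lambda>n. \<integral>s. w s * of_real (truncated_hilbert f (\<epsilon> n) s) \<partial>lborel)
     \<longlonglongrightarrow> (\<integral>s. w s * of_real (pi * poly B s) \<partial>lborel)"
  proof (rule integral_dominated_convergence[where w="\<lambda>s. m * (indicator {a..b} s * majorant s)"])
    show "integrable lborel (\<lambda>s. m * (indicator {a..b} s * majorant s))"
      using majorant_integrable by (rule integrable_mult_right)
    show "AE s in lborel. (\<lambda>n. w s * of_real (truncated_hilbert f (\<epsilon> n) s)) \<longlonglongrightarrow> w s * of_real (pi * poly B s)"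
    proof (rule AE_I2)
      fix s
      show "(\<lambda>n. w s * of_real (truncated_hilbert f (\<epsilon> n) s)) \<longlonglongrightarrow> w s * of_real (pi * poly B s)"
      proof (cases "s \<in> {a<..<b}")
        case True
        have "filterlim \<epsilon> (at_right 0) sequentially"
          using \<epsilon>0 \<epsilon> by (simp add: filterlim_at less_imp_neq[OF \<epsilon>, symmetric])
        then have "(\<lambda>n. truncated_hilbert f (\<epsilon> n) s) \<longlonglongrightarrow> pi * poly B s"
          using hil[OF True] unfolding hilbert_iff by (rule filterlim_compose[rotated])
        then show ?thesis by (intro tendsto_intros)
      qed (simp add: w0)
    qed
    show "AE s in lborel. norm (w s * of_real (truncated_hilbert f (\<epsilon> n) s)) \<le> m * (indicator {a..b} s * majorant s)" for n
    proof (rule AE_I2)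
      fix s
      show "norm (w s * of_real (truncated_hilbert f (\<epsilon> n) s)) \<le> m * (indicator {a..b} s * majorant s)"
      proof (cases "s \<in> {a<..<b}")
        case True
        then show ?thesis
          using truncated_hilbert_bound[OF True \<epsilon>[of n]] wM[of s] MD
          by (simp add: norm_mult) (intro mult_mono, auto)
      next
        case False
        have "majorant s \<ge> 0" unfolding majorant_def
          using C_nonneg M_nonneg by (intro add_nonneg_nonneg mult_nonneg_nonneg integral_nonneg_AE) auto
        then show ?thesis using w0[OF False] MD by simp
      qed
    qed
    show "(\<lambda>s. w s * of_real (pi * poly B s)) \<in> borel_measurable lborel" by measurable
    show "(\<lambda>s. w s * of_real (truncated_hilbert f (\<epsilon> n) s)) \<in> borel_measurable lborel" for n
      using th_meas[of n] by measurable
  qed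
  have "(\<lambda>n. integral\<^sup>L (lborel \<Otimes>\<^sub>M lborel) (hn n)) \<longlonglongrightarrow> 2 * (\<integral>s. w s * of_real (pi * poly B s) \<partial>lborel)"
    unfolding J by (intro tendsto_intros lim2)
  with lim1 sq show ?thesis unfolding w_def by (metis LIMSEQ_unique)
qed

text \<open>With \<open>b' = pi * B\<close> the square identity reads
  \<open>F^2 = 2 * (F * b' - Q)\<close> for a polynomial \<open>Q\<close>; completing the square
  gives \<open>(F - b')^2 = b'^2 - 2 * Q\<close>.\<close>

lemma cauchy_quadratic:
  assumes hil: "\<And>t. t \<in> {a<..<b} \<Longrightarrow> has_hilbert_transform f t (poly B t)"
  obtains Q :: "real poly" where
    "\<And>z. z \<notin> segment \<Longrightarrow> (cauchy z - poly (map_poly of_real (smult pi B)) z)\<^sup>2 = poly (map_poly of_real Q) z"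
proof -
  define b' where "b' = smult pi B"
  obtain Q where Q: "\<And>z. z \<notin> segment \<Longrightarrow>
    (\<integral>s. of_real (f s) / (z - of_real s) * (poly (map_poly of_real b') z - of_real (poly b' s)) \<partial>lborel)
      = poly (map_poly of_real Q) z" using cauchy_difference_quotient[of b'] by blast
  have pB [measurable]: "poly b' \<in> borel_measurable borel"
    by (intro borel_measurable_continuous_onI continuous_on_poly continuous_on_id)
  have "bounded (poly b' ` {a..b})"
    by (intro compact_imp_bounded compact_continuous_image continuous_intros) auto
  then obtain L where L: "\<forall>x\<in>{a..b}. norm (poly b' x) \<le> L" unfolding bounded_iff by auto
  have poly_hom: "poly (map_poly of_real (b' * b' - smult 2 Q)) z
      = (poly (map_poly of_real b') z)\<^sup>2 - 2 * poly (map_poly of_real Q) (z::complex)" for z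
  proof -
    have mult: "map_poly of_real (p * q) = map_poly complex_of_real p * map_poly of_real q" for p q
      by (rule poly_eqI) (simp add: coeff_map_poly coeff_mult)
    have "map_poly complex_of_real (b' * b' - smult 2 Q) = map_poly of_real (b' * b') - smult 2 (map_poly of_real Q)"
      by (rule poly_eqI) (simp add: coeff_map_poly)
    then show ?thesis by (simp add: mult power2_eq_square)
  qed
  show ?thesis
  proof (rule that[of "b' * b' - smult 2 Q"])
    fix z assume z: "z \<notin> segment"
    have i1: "integrable lborel (\<lambda>s. of_real (f s) / (z - of_real s) * of_real (poly b' s))"
      by (rule cauchy_integrable[OF z, where B=L]) (use L in auto)
    have i2: "integrable lborel (\<lambda>s. of_real (f s) / (z - of_real s) * poly (map_poly of_real b') z)"
      using cauchy_integrable'[OF z] by (rule integrable_mult_left)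
    have "poly (map_poly of_real Q) z = (\<integral>s. of_real (f s) / (z - of_real s) * poly (map_poly of_real b') z \<partial>lborel)
        - (\<integral>s. of_real (f s) / (z - of_real s) * of_real (poly b' s) \<partial>lborel)"
      unfolding Q[OF z, symmetric] right_diff_distrib by (rule Bochner_Integration.integral_diff[OF i2 i1])
    also have "(\<integral>s. of_real (f s) / (z - of_real s) * poly (map_poly of_real b') z \<partial>lborel) = cauchy z * poly (map_poly of_real b') z"
      unfolding cauchy_def by (rule integral_mult_left_zero)
    finally have "(\<integral>s. of_real (f s) / (z - of_real s) * of_real (poly b' s) \<partial>lborel)
        = cauchy z * poly (map_poly of_real b') z - poly (map_poly of_real Q) z" by simp
    moreover have "(cauchy z)\<^sup>2 = 2 * (\<integral>s. of_real (f s) / (z - of_real s) * of_real (poly b' s) \<partial>lborel)"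
      using cauchy_square[OF hil z] by (simp add: b'_def)
    ultimately show "(cauchy z - poly (map_poly of_real (smult pi B)) z)\<^sup>2 = poly (map_poly of_real (b' * b' - smult 2 Q)) z"
      unfolding poly_hom b'_def[symmetric] by (simp add: power2_diff)
  qed
qed

lemma locally_bounded_below:
  assumes x: "x \<in> {a<..<b}" and pos: "f x > 0"
  obtains \<delta> where "\<delta> > 0" "\<And>t. \<bar>x - t\<bar> < \<delta> \<Longrightarrow> f x / 2 \<le> f t"
proof -
  define d where "d = min (x - a) (b - x) / 2"
  have d: "d > 0" "a + 2 * d \<le> x" "x \<le> b - 2 * d" using x by (auto simp: d_def min_def)
  have Cd: "C / d \<ge> 0" using C_nonneg d by simp
  \<comment> \<open>The summand 1 keeps the denominator positive even for
    \<open>C = 0\<close>.\<close>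
  define \<delta> where "\<delta> = min d (f x / 2 / (C / d + 1))"
  have "\<delta> > 0" using d pos Cd by (simp add: \<delta>_def add_nonneg_pos)
  moreover have "f x / 2 \<le> f t" if t: "\<bar>x - t\<bar> < \<delta>" for t
  proof -
    have "\<bar>x - t\<bar> < d" using t by (simp add: \<delta>_def)
    then have "\<bar>f t - f x\<bar> \<le> C / d * \<bar>x - t\<bar>" by (rule local_lipschitz[OF d(2,3,1)])
    also have "\<dots> \<le> (C / d + 1) * (f x / 2 / (C / d + 1))"
      using t Cd by (intro mult_mono) (auto simp: \<delta>_def)
    also have "\<dots> = f x / 2"
    proof -
      have "C / d + 1 \<noteq> 0" using Cd by linarith
      then show ?thesis by (rule nonzero_mult_div_cancel_left[of _ "f x / 2", folded times_divide_eq_right])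
    qed
    finally have "- (f t - f x) \<le> f x / 2" by (rule abs_le_D2)
    then show ?thesis by linarith
  qed
  ultimately show ?thesis using that by blast
qed

text \<open>The imaginary part is minus the integral of \<open>f\<close> against the Poisson-type
  kernel \<open>y / ((x - t)^2 + y^2)\<close>. On the window of length \<open>y\<close> around
  \<open>x\<close> the kernel is at least \<open>1 / (2 * y)\<close> and \<open>f\<close> at least
  \<open>f x / 2\<close>, whence the constant \<open>1 / 4\<close>.\<close>

lemma Im_cauchy_bound:
  assumes x: "x \<in> {a<..<b}" and pos: "f x > 0"
  shows "\<forall>\<^sub>F y in at_right 0. Im (cauchy (Complex x y)) \<le> - f x / 4"
proof -
  obtain \<delta> where \<delta>: "\<delta> > 0" "\<And>t. \<bar>x - t\<bar> < \<delta> \<Longrightarrow> f x / 2 \<le> f t"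
    using locally_bounded_below[OF x pos] by blast
  have "Im (cauchy (Complex x y)) \<le> - f x / 4" if y: "0 < y" "y < \<delta>" for y
  proof -
    have z: "Complex x y \<notin> segment" using y by (auto simp: complex_eq_iff)
    note i = cauchy_integrable'[OF z]
    have Im_eq: "Im (of_real (f t) / (Complex x y - of_real t)) = - (f t * y / ((x - t)\<^sup>2 + y\<^sup>2))" for t
      by (simp add: Im_divide)
    have iI: "integrable lborel (\<lambda>t. f t * y / ((x - t)\<^sup>2 + y\<^sup>2))"
      using integrable_Im[OF i] unfolding Im_eq by simp
    have "Im (cauchy (Complex x y)) = (\<integral>t. Im (of_real (f t) / (Complex x y - of_real t)) \<partial>lborel)"
      unfolding cauchy_def by (rule integral_Im[OF i, symmetric])
    also have "\<dots> = - (\<integral>t. f t * y / ((x - t)\<^sup>2 + y\<^sup>2) \<partial>lborel)" unfolding Im_eq by simp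
    finally have eq: "Im (cauchy (Complex x y)) = - (\<integral>t. f t * y / ((x - t)\<^sup>2 + y\<^sup>2) \<partial>lborel)" .
    have "(\<integral>t. (f x / (4 * y)) * indicator {x - y/2..x + y/2} t \<partial>lborel) \<le> (\<integral>t. f t * y / ((x - t)\<^sup>2 + y\<^sup>2) \<partial>lborel)"
    proof (rule integral_mono[OF _ iI])
      fix t
      show "(f x / (4 * y)) * indicator {x - y/2..x + y/2} t \<le> f t * y / ((x - t)\<^sup>2 + y\<^sup>2)"
      proof (cases "t \<in> {x - y/2..x + y/2}")
        case True
        then have t: "\<bar>x - t\<bar> \<le> y" using y by auto
        have "\<bar>x - t\<bar> < \<delta>" using t y by simp
        then have ft: "f x / 2 \<le> f t" by (rule \<delta>(2))
        have "(x - t)\<^sup>2 \<le> y\<^sup>2" using t y abs_le_square_iff[of "x - t" y] by simp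
        then have "(f x / 2) * y / (2 * y\<^sup>2) \<le> f t * y / ((x - t)\<^sup>2 + y\<^sup>2)"
          using ft y f_nonneg by (intro frac_le mult_right_mono) (auto simp: add_nonneg_pos)
        moreover have "(f x / 2) * y / (2 * y\<^sup>2) = f x / (4 * y)" using y by (simp add: power2_eq_square)
        ultimately show ?thesis using True by simp
      next
        case False
        have "0 \<le> f t * y / ((x - t)\<^sup>2 + y\<^sup>2)" using f_nonneg y by simp
        then show ?thesis using False by simp
      qed
    qed simp
    moreover have "(\<integral>t. (f x / (4 * y)) * indicator {x - y/2..x + y/2} t \<partial>lborel) = f x / 4"
      using y by simp
    ultimately show ?thesis by (simp add: eq)
  qed
  then show ?thesis using \<delta>(1) by (auto simp: eventually_at_right_field)
qed

lemma Im_cauchy_real: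
  assumes "of_real x \<notin> segment"
  shows "Im (cauchy (of_real x)) = 0"
proof -
  have "Im (cauchy (of_real x)) = (\<integral>t. Im (of_real (f t) / (of_real x - of_real t)) \<partial>lborel)"
    unfolding cauchy_def by (rule integral_Im[OF cauchy_integrable'[OF assms], symmetric])
  also have "(\<lambda>t. Im (complex_of_real (f t) / (of_real x - of_real t))) = (\<lambda>t. 0)"
  proof
    fix t
    have "complex_of_real (f t) / (of_real x - of_real t) = of_real (f t / (x - t))" by simp
    then show "Im (complex_of_real (f t) / (of_real x - of_real t)) = 0" by (simp only: Im_complex_of_real)
  qed
  finally show ?thesis by simp
qed

text \<open>On \<open>(a, b)\<close> the discriminant is negative: a nonnegative value would force
  the square root \<open>F - P\<close> to become real at the axis, while the imaginary part of
  \<open>F\<close> stays below a negative constant and that of \<open>P\<close> tends to zero. On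
  the real axis outside \<open>[a, b]\<close> both \<open>F\<close> and \<open>P\<close> are real,
  so it is nonnegative. This gives sign changes at \<open>a\<close> and \<open>b\<close>; at other
  points off the segment \<open>F - P\<close> is a holomorphic root, and inside it there is no
  zero.\<close>

lemma cauchy_discriminant:
  assumes hil: "\<And>t. t \<in> {a<..<b} \<Longrightarrow> has_hilbert_transform f t (poly B t)"
    and pos: "\<And>t. t \<in> {a<..<b} \<Longrightarrow> f t > 0"
  obtains P T :: "complex poly" where "T \<noteq> 0"
    "\<And>z. z \<notin> segment \<Longrightarrow> (cauchy z - poly P z)\<^sup>2 = poly T z"
    "\<And>z. odd (order z T) \<longleftrightarrow> z \<in> {of_real a, of_real b}"
proof -
  define P where "P = map_poly complex_of_real (smult pi B)"
  obtain Q where Q: "\<And>z. z \<notin> segment \<Longrightarrow> (cauchy z - poly P z)\<^sup>2 = poly (map_poly of_real Q) z"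
    using cauchy_quadratic[OF hil] unfolding P_def by blast
  define T where "T = map_poly complex_of_real Q"
  have QT: "(cauchy z - poly P z)\<^sup>2 = poly T z" if "z \<notin> segment" for z using Q[OF that] by (simp add: T_def)
  have neg: "poly Q x < 0" if x: "x \<in> {a<..<b}" for x
  proof (rule ccontr)
    assume "\<not> poly Q x < 0"
    then have Qx: "poly Q x \<ge> 0" by simp
    define z where "z = (\<lambda>y. Complex x y)"
    have z_lim: "(z \<longlongrightarrow> of_real x) (at_right 0)"
    proof -
      have "((\<lambda>y. of_real x + \<i> * of_real y) \<longlongrightarrow> of_real x + \<i> * of_real 0) (at_right 0)"
        by (intro tendsto_intros)
      then show ?thesis by (simp add: z_def Complex_eq)
    qed
    have ev0: "\<forall>\<^sub>F y in at_right 0. z y \<notin> segment"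
    proof -
      have "\<forall>\<^sub>F y::real in at_right 0. y > 0" by (rule eventually_at_right_less)
      then show ?thesis by (rule eventually_mono) (auto simp: z_def complex_eq_iff)
    qed
    have T_lim: "((\<lambda>y. poly T (z y)) \<longlongrightarrow> of_real (poly Q x)) (at_right 0)"
      using tendsto_poly[OF z_lim, of T] by (simp add: T_def poly_map_of_real)
    have P_lim: "((\<lambda>y. Im (poly P (z y))) \<longlongrightarrow> 0) (at_right 0)"
      using tendsto_Im[OF tendsto_poly[OF z_lim, of P]] by (simp add: P_def poly_map_of_real)
    have "((\<lambda>y. norm (poly T (z y)) - Re (poly T (z y))) \<longlongrightarrow> norm (complex_of_real (poly Q x)) - Re (of_real (poly Q x))) (at_right 0)"
      by (intro tendsto_intros T_lim)
    then have lim0: "((\<lambda>y. norm (poly T (z y)) - Re (poly T (z y))) \<longlongrightarrow> 0) (at_right 0)"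
      using Qx by simp
    \<comment> \<open>The identity \<open>|w^2| - Re (w^2) = 2 * (Im w)^2\<close> detects a real
      square root without choosing a branch.\<close>
    have ev1: "\<forall>\<^sub>F y in at_right 0. norm (poly T (z y)) - Re (poly T (z y)) = 2 * (Im (cauchy (z y) - poly P (z y)))\<^sup>2"
    proof (rule eventually_mono[OF ev0])
      fix y assume "z y \<notin> segment"
      define w where "w = cauchy (z y) - poly P (z y)"
      have "poly T (z y) = w\<^sup>2" using QT[OF \<open>z y \<notin> segment\<close>] by (simp add: w_def)
      then have "norm (poly T (z y)) - Re (poly T (z y)) = (norm w)\<^sup>2 - Re (w\<^sup>2)" by (simp add: norm_power)
      also have "\<dots> = 2 * (Im w)\<^sup>2" by (simp add: cmod_power2 Re_power2)
      finally show "norm (poly T (z y)) - Re (poly T (z y)) = 2 * (Im (cauchy (z y) - poly P (z y)))\<^sup>2"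
        by (simp add: w_def)
    qed
    have "((\<lambda>y. 2 * (Im (cauchy (z y) - poly P (z y)))\<^sup>2) \<longlongrightarrow> 0) (at_right 0)"
      using lim0 unfolding tendsto_cong[OF ev1] .
    from tendsto_real_sqrt[OF tendsto_mult_left[OF this, of "1/2"]]
    have "((\<lambda>y. \<bar>Im (cauchy (z y) - poly P (z y))\<bar>) \<longlongrightarrow> 0) (at_right 0)" by simp
    then have "((\<lambda>y. Im (cauchy (z y) - poly P (z y))) \<longlongrightarrow> 0) (at_right 0)" by (rule tendsto_rabs_zero_cancel)
    from tendsto_add[OF this P_lim] have "((\<lambda>y. Im (cauchy (z y))) \<longlongrightarrow> 0) (at_right 0)" by simp
    then have "0 \<le> - f x / 4"
      by (rule tendsto_upperbound) (use Im_cauchy_bound[OF x pos[OF x]] in \<open>auto simp: z_def\<close>)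
    then show False using pos[OF x] by simp
  qed
  have nonneg: "poly Q x \<ge> 0" if x: "x \<notin> {a..b}" for x
  proof -
    have z: "complex_of_real x \<notin> segment" using x by auto
    define w where "w = cauchy (of_real x) - poly P (of_real x)"
    have "Im w = 0" using Im_cauchy_real[OF z] by (simp add: w_def P_def poly_map_of_real)
    then have "Re (w\<^sup>2) \<ge> 0" by (simp add: Re_power2)
    then show ?thesis using QT[OF z] by (simp add: w_def T_def poly_map_of_real)
  qed
  have T0: "T \<noteq> 0"
  proof
    assume "T = 0"
    then have "poly T (of_real ((a + b) / 2)) = 0" by simp
    moreover have "poly Q ((a + b) / 2) < 0" by (rule neg) (use ab in auto)
    ultimately show False unfolding T_def poly_map_of_real by simp
  qed
  have real: "Im (poly T (of_real x)) = 0" for x by (simp add: T_def poly_map_of_real)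
  have Re_T: "Re (poly T (of_real x)) = poly Q x" for x by (simp only: T_def poly_map_of_real Re_complex_of_real)
  \<comment> \<open>The interior, where the discriminant is negative, lies to the right of
    \<open>a\<close> and to the left of \<open>b\<close>, hence the signs \<open>1\<close> and
    \<open>-1\<close>.\<close>
  have odd_a: "odd (order (of_real a) T)"
    by (rule odd_order_if_sign_change[OF T0, of 1 "b - a"])
       (use ab real Re_T less_imp_le[OF neg] nonneg in \<open>simp_all del: of_real_add of_real_diff\<close>)
  have odd_b: "odd (order (of_real b) T)"
    by (rule odd_order_if_sign_change[OF T0, of "-1" "b - a"])
       (use ab real Re_T less_imp_le[OF neg] nonneg in \<open>simp_all del: of_real_add of_real_diff\<close>)
  show ?thesis
  proof (rule that[OF T0 QT])
    fix z
    show "odd (order z T) \<longleftrightarrow> z \<in> {of_real a, of_real b}"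
    proof (cases "z \<in> {of_real a, of_real b}")
      case True
      then show ?thesis using odd_a odd_b by auto
    next
      case z: False
      have "even (order z T)"
      proof (cases "z \<in> segment")
        case True
        then obtain x where x: "z = of_real x" "x \<in> {a..b}" by auto
        then have "x \<in> {a<..<b}" using z by force
        then have "poly T z \<noteq> 0" using neg[of x] Re_T[of x] x(1) by auto
        then show ?thesis by (simp add: order_root)
      next
        case False
        show ?thesis
        proof (rule even_order_if_holomorphic_square[OF open_Compl_segment _ _ T0])
          show "(\<lambda>z. cauchy z - poly P z) holomorphic_on - segment"
            by (intro holomorphic_intros cauchy_holomorphic)
        qed (use False QT in auto)
      qed
      then show ?thesis using z by simp
    qed
  qed auto
qed

end

section \<open>Semicircle profiles\<close>

text \<open>The kernel \<open>ds / (t - s)\<close> is invariant under increasing affine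
  substitutions; only the truncation radius is rescaled.\<close>

lemma truncated_hilbert_affine:
  fixes f :: "real \<Rightarrow> real"
  assumes w: "w > 0"
  shows "truncated_hilbert (\<lambda>t. f ((t - c) / w)) \<epsilon> (c + w * x) = truncated_hilbert f (\<epsilon> / w) x"
proof -
  define g where "g = (\<lambda>s. indicator {s. \<epsilon> \<le> \<bar>c + w * x - s\<bar>} s * (f ((s - c) / w) / (c + w * x - s)))"
  have "truncated_hilbert (\<lambda>t. f ((t - c) / w)) \<epsilon> (c + w * x) = (\<integral>s. g s \<partial>lborel)"
    by (simp add: truncated_hilbert_def g_def)
  also have "\<dots> = (\<integral>s. w * g (c + w * s) \<partial>lborel)"
    using lborel_integral_real_affine[of w g c] w by simp
  also have "\<dots> = truncated_hilbert f (\<epsilon> / w) x"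
    unfolding truncated_hilbert_def
  proof (rule Bochner_Integration.integral_cong[OF refl])
    fix s
    have *: "c + w * x - (c + w * s) = w * (x - s)" by (simp add: algebra_simps)
    have "\<epsilon> \<le> \<bar>w * (x - s)\<bar> \<longleftrightarrow> \<epsilon> / w \<le> \<bar>x - s\<bar>"
      using w by (simp add: abs_mult divide_le_eq mult.commute)
    then have "indicator {s. \<epsilon> \<le> \<bar>c + w * x - s\<bar>} (c + w * s) = indicat_real {s. \<epsilon> / w \<le> \<bar>x - s\<bar>} s"
      unfolding indicator_def mem_Collect_eq * by simp
    then show "w * g (c + w * s)
      = indicator {s. \<epsilon> / w \<le> \<bar>x - s\<bar>} s * (f s / (x - s))"
      using w unfolding g_def * by simp
  qed
  finally show ?thesis .
qed

lemma has_hilbert_transform_affine: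
  fixes f :: "real \<Rightarrow> real"
  assumes f: "f \<in> borel_measurable borel" "\<And>t. \<bar>f t\<bar> \<le> M" "\<And>t. t \<notin> {-1..1} \<Longrightarrow> f t = 0"
    and w: "w > 0" and h: "has_hilbert_transform f x v"
  shows "has_hilbert_transform (\<lambda>t. k * f ((t - c) / w)) (c + w * x) (k * v)"
proof -
  have lim: "((\<lambda>\<epsilon>. truncated_hilbert f \<epsilon> x) \<longlongrightarrow> pi * v) (at_right 0)"
    using h has_hilbert_transform_iff[OF f] by blast
  have "filterlim (\<lambda>\<epsilon>. \<epsilon> / w) (at_right 0) (at_right 0)"
  proof -
    have "((\<lambda>\<epsilon>. \<epsilon> / w) \<longlongrightarrow> 0 / w) (at_right 0)" using w by (intro tendsto_intros) auto
    moreover have "\<forall>\<^sub>F \<epsilon> in at_right 0. \<epsilon> / w \<in> {0<..} \<and> \<epsilon> / w \<noteq> 0"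
      by (rule eventually_mono[OF eventually_at_right_less]) (use w in auto)
    ultimately show ?thesis by (simp add: filterlim_at)
  qed
  then have "((\<lambda>\<epsilon>. truncated_hilbert f (\<epsilon> / w) x) \<longlongrightarrow> pi * v) (at_right 0)"
    using lim by (rule filterlim_compose[rotated])
  then have "((\<lambda>\<epsilon>. k * truncated_hilbert (\<lambda>t. f ((t - c) / w)) \<epsilon> (c + w * x)) \<longlongrightarrow> k * (pi * v)) (at_right 0)"
    unfolding truncated_hilbert_affine[OF w] by (intro tendsto_intros)
  moreover have "truncated_hilbert (\<lambda>t. k * f ((t - c) / w)) \<epsilon> y = k * truncated_hilbert (\<lambda>t. f ((t - c) / w)) \<epsilon> y" for \<epsilon> y
    by (simp add: truncated_hilbert_def mult.left_commute flip: integral_mult_right_zero times_divide_eq_right)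
  ultimately have lim2: "((\<lambda>\<epsilon>. truncated_hilbert (\<lambda>t. k * f ((t - c) / w)) \<epsilon> (c + w * x)) \<longlongrightarrow> pi * (k * v)) (at_right 0)"
    by (simp add: mult.left_commute)
  show ?thesis
  proof (subst has_hilbert_transform_iff[where M="\<bar>k\<bar> * M" and a="c - w" and b="c + w"])
    show "(\<lambda>t. k * f ((t - c) / w)) \<in> borel_measurable borel" using f(1) by measurable
    show "\<bar>k * f ((t - c) / w)\<bar> \<le> \<bar>k\<bar> * M" for t using f(2) by (auto simp: abs_mult intro: mult_left_mono)
    show "k * f ((t - c) / w) = 0" if "t \<notin> {c - w..c + w}" for t
      using that w by (intro mult_eq_0_iff[THEN iffD2] disjI2 f(3)) (auto simp: field_simps)
  qed (rule lim2)
qed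

text \<open>From \<open>s / (x - s) = x / (x - s) - 1\<close>, multiplying a function by its
  variable multiplies the transform by \<open>x\<close> and subtracts a constant, the integral of
  the function over \<open>pi\<close>. Polynomial transforms therefore stay polynomial, by Horner
  induction on the factor.\<close>

lemma has_hilbert_transform_times_poly:
  fixes f :: "real \<Rightarrow> real" and p R0 :: "real poly"
  assumes f [measurable]: "f \<in> borel_measurable borel" and fM: "\<And>t. \<bar>f t\<bar> \<le> M" and f0: "\<And>t. t \<notin> {-1..1} \<Longrightarrow> f t = 0"
    and h: "\<And>x. x \<in> {-1<..<1} \<Longrightarrow> has_hilbert_transform f x (poly R0 x)"
  shows "\<exists>R. \<forall>x\<in>{-1<..<1}. has_hilbert_transform (\<lambda>t. f t * poly p t) x (poly R x)"
proof -
  have [measurable]: "poly q \<in> borel_measurable borel" for q :: "real poly"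
    by (intro borel_measurable_continuous_onI continuous_on_poly continuous_on_id)
  have meas: "(\<lambda>t. f t * poly q t) \<in> borel_measurable borel" for q by measurable
  have M0: "M \<ge> 0" using fM[of 0] by linarith
  have "\<exists>B\<ge>0. \<forall>t. \<bar>f t * poly q t\<bar> \<le> B" for q
  proof -
    have "bounded (poly q ` {-1..1})"
      by (intro compact_imp_bounded compact_continuous_image continuous_intros) auto
    then obtain L where L: "\<forall>x\<in>{-1..1}. norm (poly q x) \<le> L" unfolding bounded_iff by auto
    then have "L \<ge> 0" using order_trans[OF norm_ge_zero, of "poly q 0" L] by simp
    have "\<bar>f t * poly q t\<bar> \<le> M * L" for t
    proof (cases "t \<in> {-1..1}")
      case True
      then show ?thesis using fM[of t] L M0 by (auto simp: abs_mult intro!: mult_mono)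
    qed (use f0[of t] M0 \<open>L \<ge> 0\<close> in simp)
    then show ?thesis using M0 \<open>L \<ge> 0\<close> by (intro exI[of _ "M * L"]) auto
  qed
  then obtain B where B: "\<And>q. B q \<ge> 0" "\<And>q t. \<bar>f t * poly q t\<bar> \<le> B q" by metis
  have supp: "f t * poly q t = 0" if "t \<notin> {-1..1}" for q t using f0[OF that] by simp
  have iff: "has_hilbert_transform (\<lambda>t. f t * poly q t) x v \<longleftrightarrow>
      ((\<lambda>\<epsilon>. truncated_hilbert (\<lambda>t. f t * poly q t) \<epsilon> x) \<longlongrightarrow> pi * v) (at_right 0)" for q x v
    by (rule has_hilbert_transform_iff[OF meas B(2) supp])
  have iff0: "has_hilbert_transform f x v \<longleftrightarrow> ((\<lambda>\<epsilon>. truncated_hilbert f \<epsilon> x) \<longlongrightarrow> pi * v) (at_right 0)" for x v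
    by (rule has_hilbert_transform_iff[OF f fM f0])
  show ?thesis unfolding iff
  proof (induction p)
    case 0
    show ?case by (rule exI[of _ 0]) (simp add: truncated_hilbert_def)
  next
    case (pCons c q)
    then obtain R where R: "\<And>x. x \<in> {-1<..<1} \<Longrightarrow>
        ((\<lambda>\<epsilon>. truncated_hilbert (\<lambda>t. f t * poly q t) \<epsilon> x) \<longlongrightarrow> pi * poly R x) (at_right 0)" by blast
    define g where "g = (\<lambda>t. f t * poly q t)"
    have gi: "integrable lborel g"
      unfolding g_def by (rule integrable_bounded_support[OF meas, where B="B q" and a="-1" and b=1]) (use B f0 in auto)
    have gind: "integrable lborel (\<lambda>s. indicator {s. \<epsilon> \<le> \<bar>x - s\<bar>} s * g s)" for \<epsilon> x
      using integrable_mult_indicator[OF _ gi, of "{s. \<epsilon> \<le> \<bar>x - s\<bar>}"] by simp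
    have lim_g: "((\<lambda>\<epsilon>. \<integral>s. indicator {s. \<epsilon> \<le> \<bar>x - s\<bar>} s * g s \<partial>lborel) \<longlongrightarrow> (\<integral>s. g s \<partial>lborel)) (at_right 0)" for x
    proof -
      have "norm ((\<integral>s. indicator {s. \<epsilon> \<le> \<bar>x - s\<bar>} s * g s \<partial>lborel) - (\<integral>s. g s \<partial>lborel)) \<le> B q * (2 * \<epsilon>)"
        if "\<epsilon> > 0" for \<epsilon>
      proof -
        have "(\<integral>s. indicator {s. \<epsilon> \<le> \<bar>x - s\<bar>} s * g s \<partial>lborel) - (\<integral>s. g s \<partial>lborel)
            = (\<integral>s. indicator {s. \<epsilon> \<le> \<bar>x - s\<bar>} s * g s - g s \<partial>lborel)"
          using gi gind by simp
        also have "norm \<dots> \<le> (\<integral>s. B q * indicator {x-\<epsilon>..x+\<epsilon>} s \<partial>lborel)"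
        proof (rule Bochner_Integration.integral_norm_bound_integral)
          fix s show "norm (indicator {s. \<epsilon> \<le> \<bar>x - s\<bar>} s * g s - g s) \<le> B q * indicator {x-\<epsilon>..x+\<epsilon>} s"
          proof (cases "\<epsilon> \<le> \<bar>x - s\<bar>")
            case False
            then have "s \<in> {x-\<epsilon>..x+\<epsilon>}" by auto
            then show ?thesis using False B(2)[of s q] by (simp add: g_def)
          qed (use B(1)[of q] in simp)
        qed (use gi gind in auto)
        also have "\<dots> = B q * (2 * \<epsilon>)" using that by simp
        finally show ?thesis .
      qed
      then have ev1: "\<forall>\<^sub>F \<epsilon> in at_right 0. norm ((\<integral>s. indicator {s. \<epsilon> \<le> \<bar>x - s\<bar>} s * g s \<partial>lborel) - (\<integral>s. g s \<partial>lborel)) \<le> B q * (2 * \<epsilon>)"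
        by (intro eventually_mono[OF eventually_at_right_less[of 0]]) blast
      have lim1: "((\<lambda>\<epsilon>. B q * (2 * \<epsilon>)) \<longlongrightarrow> B q * (2 * 0)) (at_right 0)" by (intro tendsto_intros)
      have "((\<lambda>\<epsilon>. (\<integral>s. indicator {s. \<epsilon> \<le> \<bar>x - s\<bar>} s * g s \<partial>lborel) - (\<integral>s. g s \<partial>lborel)) \<longlongrightarrow> 0) (at_right 0)"
        by (rule Lim_null_comparison[OF ev1 lim1[unfolded mult_zero_right]])
      then show ?thesis by (simp add: LIM_zero_iff)
    qed
    \<comment> \<open>The three terms come from the constant coefficient \<open>c\<close>, the
      factor \<open>x\<close>, and the constant lost in the Horner step.\<close>
    define R' where "R' = smult c R0 + pCons 0 R - [:(\<integral>s. g s \<partial>lborel) / pi:]"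
    show ?case
    proof (intro exI ballI)
      fix x :: real assume x: "x \<in> {-1<..<1}"
      have split: "truncated_hilbert (\<lambda>t. f t * poly (pCons c q) t) \<epsilon> x
        = c * truncated_hilbert f \<epsilon> x + x * truncated_hilbert g \<epsilon> x - (\<integral>s. indicator {s. \<epsilon> \<le> \<bar>x - s\<bar>} s * g s \<partial>lborel)"
        if "\<epsilon> > 0" for \<epsilon>
      proof -
        have i1: "integrable lborel (\<lambda>s. indicator {s. \<epsilon> \<le> \<bar>x - s\<bar>} s * (f s / (x - s)))"
          by (rule truncated_hilbert_integrable[OF f fM f0 that])
        have i2: "integrable lborel (\<lambda>s. indicator {s. \<epsilon> \<le> \<bar>x - s\<bar>} s * (g s / (x - s)))"
          unfolding g_def by (rule truncated_hilbert_integrable[OF meas B(2) supp that])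
        have "truncated_hilbert (\<lambda>t. f t * poly (pCons c q) t) \<epsilon> x
          = (\<integral>s. c * (indicator {s. \<epsilon> \<le> \<bar>x - s\<bar>} s * (f s / (x - s)))
              + x * (indicator {s. \<epsilon> \<le> \<bar>x - s\<bar>} s * (g s / (x - s)))
              - indicator {s. \<epsilon> \<le> \<bar>x - s\<bar>} s * g s \<partial>lborel)"
          unfolding truncated_hilbert_def
        proof (rule Bochner_Integration.integral_cong[OF refl])
          fix s
          show "indicator {s. \<epsilon> \<le> \<bar>x - s\<bar>} s * (f s * poly (pCons c q) s / (x - s)) =
             c * (indicator {s. \<epsilon> \<le> \<bar>x - s\<bar>} s * (f s / (x - s)))
              + x * (indicator {s. \<epsilon> \<le> \<bar>x - s\<bar>} s * (g s / (x - s)))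
              - indicator {s. \<epsilon> \<le> \<bar>x - s\<bar>} s * g s"
          proof (cases "\<epsilon> \<le> \<bar>x - s\<bar>")
            case True
            then have "x - s \<noteq> 0" using that by auto
            then have "x * (F / (x - s)) - F = s * (F / (x - s))" for F
              by (simp add: divide_simps) (simp add: algebra_simps)
            moreover have "f s * (c + s * poly q s) / (x - s) = c * (f s / (x - s)) + s * (g s / (x - s))"
              by (simp add: g_def algebra_simps add_divide_distrib)
            ultimately show ?thesis using True by (simp add: add_diff_eq[symmetric])
          qed simp
        qed
        also have "\<dots> = c * truncated_hilbert f \<epsilon> x + x * truncated_hilbert g \<epsilon> x - (\<integral>s. indicator {s. \<epsilon> \<le> \<bar>x - s\<bar>} s * g s \<partial>lborel)"
          unfolding truncated_hilbert_def
            Bochner_Integration.integral_diff[OF Bochner_Integration.integrable_add[OF integrable_mult_right[OF i1] integrable_mult_right[OF i2]] gind]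
            Bochner_Integration.integral_add[OF integrable_mult_right[OF i1] integrable_mult_right[OF i2]]
          by (simp only: integral_mult_right_zero)
        finally show ?thesis .
      qed
      have lim3: "((\<lambda>\<epsilon>. c * truncated_hilbert f \<epsilon> x + x * truncated_hilbert g \<epsilon> x - (\<integral>s. indicator {s. \<epsilon> \<le> \<bar>x - s\<bar>} s * g s \<partial>lborel))
          \<longlongrightarrow> c * (pi * poly R0 x) + x * (pi * poly R x) - (\<integral>s. g s \<partial>lborel)) (at_right 0)"
        using h[OF x] R[OF x] lim_g[of x] unfolding iff0 g_def[symmetric] by (intro tendsto_intros)
      have eq3: "c * (pi * poly R0 x) + x * (pi * poly R x) - (\<integral>s. g s \<partial>lborel) = pi * poly R' x"
        by (simp add: R'_def field_simps)
      have ev3: "\<forall>\<^sub>F \<epsilon> in at_right 0. truncated_hilbert (\<lambda>t. f t * poly (pCons c q) t) \<epsilon> x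
        = c * truncated_hilbert f \<epsilon> x + x * truncated_hilbert g \<epsilon> x - (\<integral>s. indicator {s. \<epsilon> \<le> \<bar>x - s\<bar>} s * g s \<partial>lborel)"
        by (rule eventually_mono[OF eventually_at_right_less]) (rule split)
      show "((\<lambda>\<epsilon>. truncated_hilbert (\<lambda>t. f t * poly (pCons c q) t) \<epsilon> x) \<longlongrightarrow> pi * poly R' x) (at_right 0)"
        using lim3 unfolding eq3 tendsto_cong[OF ev3] .
    qed
  qed
qed

definition semicircle :: "real \<Rightarrow> real" where
  "semicircle s = (if \<bar>s\<bar> < 1 then sqrt (1 - s\<^sup>2) else 0)"

lemma semicircle_measurable [measurable]: "semicircle \<in> borel_measurable borel"
  unfolding semicircle_def by measurable

lemma semicircle_bounds: "0 \<le> semicircle s" "\<bar>semicircle s\<bar> \<le> 1" "s \<notin> {-1..1} \<Longrightarrow> semicircle s = 0"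
  by (auto simp: semicircle_def abs_square_le_1)

lemma semicircle_eq: "s \<in> {-1..1} \<Longrightarrow> semicircle s = sqrt (1 - s\<^sup>2)"
  by (cases "\<bar>s\<bar> = 1") (auto simp: semicircle_def abs_if power2_eq_1_iff split: if_splits)

text \<open>An explicit antiderivative on both sides of \<open>t\<close>. Its logarithmic
  singularity is symmetric and cancels between \<open>t - \<epsilon>\<close> and
  \<open>t + \<epsilon>\<close>, its regular part is continuous at \<open>t\<close>, and the arcsine
  contributes \<open>pi * t\<close> from the two ends.\<close>

lemma semicircle_hilbert_transform:
  assumes t: "t \<in> {-1<..<1}"
  shows "has_hilbert_transform semicircle t t"
proof -
  define r where "r = sqrt (1 - t\<^sup>2)"
  have t2: "t\<^sup>2 < 1" using t by (simp add: abs_square_less_1 abs_less_iff)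
  have r: "r > 0" "r\<^sup>2 = 1 - t\<^sup>2" using t2 by (auto simp: r_def)
  define N where "N = (\<lambda>s. 1 - t * s + r * sqrt (1 - s\<^sup>2))"
  have N: "N s > 0" if "s \<in> {-1..1}" for s
  proof -
    have "\<bar>t * s\<bar> < 1"
    proof -
      have "\<bar>t\<bar> * \<bar>s\<bar> \<le> \<bar>t\<bar> * 1" using that by (intro mult_left_mono) auto
      moreover have "\<bar>t\<bar> < 1" using t by auto
      ultimately show ?thesis by (simp add: abs_mult)
    qed
    moreover have "s\<^sup>2 \<le> 1" using that by (simp add: abs_square_le_1 abs_le_iff)
    ultimately show ?thesis using r(1) unfolding N_def by (intro add_pos_nonneg) (auto simp: abs_less_iff)
  qed
  \<comment> \<open>\<open>\<Psi>\<close> is the part of the antiderivative that is continuous on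
    the whole interval; \<open>\<Phi>\<close> adds the logarithm of the distance to
    \<open>t\<close>.\<close>
  define \<Psi> where "\<Psi> = (\<lambda>s. t * arcsin s - sqrt (1 - s\<^sup>2) + r * ln (N s))"
  define \<Phi> where "\<Phi> = (\<lambda>s. \<Psi> s - r * ln \<bar>t - s\<bar>)"
  have cont: "continuous_on {-1..1} \<Psi>"
    unfolding \<Psi>_def using N by (auto simp: N_def intro!: continuous_intros) (metis N N_def atLeastAtMost_iff less_irrefl)
  have deriv: "(\<Phi> has_vector_derivative semicircle s / (t - s)) (at s)" if s: "s \<in> {-1<..<1}" "s \<noteq> t" for s
  proof -
    have s2: "s\<^sup>2 < 1" using s by (simp add: abs_square_less_1 abs_less_iff)
    define c where "c = sqrt (1 - s\<^sup>2)"
    have c: "c > 0" "c\<^sup>2 = 1 - s\<^sup>2" using s2 by (auto simp: c_def)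
    have Ns: "N s > 0" using N s by auto
    have dN: "(N has_field_derivative - t - r * s / c) (at s)"
      unfolding N_def using s2 by (auto intro!: derivative_eq_intros simp: c_def field_simps)
    have dln: "((\<lambda>s. ln \<bar>t - s\<bar>) has_field_derivative - 1 / (t - s)) (at s)"
    proof (cases "s < t")
      case True
      have "((\<lambda>s. ln (t - s)) has_field_derivative - 1 / (t - s)) (at s)"
        using True by (auto intro!: derivative_eq_intros)
      then show ?thesis
        by (rule has_field_derivative_transform_within_open[of _ _ _ "{..<t}"]) (use True in auto)
    next
      case False
      then have "t < s" using s by simp
      then have "((\<lambda>s. ln (s - t)) has_field_derivative - 1 / (t - s)) (at s)"
        by (auto intro!: derivative_eq_intros simp: divide_simps)
      then show ?thesis
        by (rule has_field_derivative_transform_within_open[of _ _ _ "{t<..}"]) (use \<open>t < s\<close> in auto)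
    qed
    have "(\<Phi> has_field_derivative t * (1 / c) + s / c + r * ((- t - r * s / c) / N s) - r * (- 1 / (t - s))) (at s)"
    proof -
      have "(arcsin has_field_derivative 1 / c) (at s)"
        using DERIV_arcsin[of s] s by (simp add: c_def inverse_eq_divide)
      moreover have "((\<lambda>s. sqrt (1 - s\<^sup>2)) has_field_derivative - (s / c)) (at s)"
        using s2 by (auto intro!: derivative_eq_intros simp: c_def field_simps)
      moreover have "((\<lambda>s. ln (N s)) has_field_derivative 1 / N s * (- t - r * s / c)) (at s)"
        by (rule DERIV_chain2[OF DERIV_ln_divide[OF Ns] dN])
      ultimately have "(\<Phi> has_field_derivative t * (1 / c) - - (s / c) + r * (1 / N s * (- t - r * s / c)) - r * (- 1 / (t - s))) (at s)"
        unfolding \<Phi>_def \<Psi>_def by (intro DERIV_diff DERIV_add DERIV_cmult dln)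
      then show ?thesis by simp
    qed
    moreover have "t * (1 / c) + s / c + r * ((- t - r * s / c) / N s) - r * (- 1 / (t - s)) = c / (t - s)"
    proof -
      have ts: "t - s \<noteq> 0" using s by simp
      \<comment> \<open>Both sides agree because \<open>r^2 = 1 - t^2\<close> and
        \<open>c^2 = 1 - s^2\<close>; the identity merges the two logarithmic derivatives into
        \<open>r / (c * (t - s))\<close>.\<close>
      have key: "(- t * c - r * s) * (t - s) + c * N s = r * N s"
      proof -
        have "(- t * c - r * s) * (t - s) + c * N s - r * N s = c * (1 - t\<^sup>2 - r\<^sup>2) + r * (c\<^sup>2 + s\<^sup>2 - 1)"
          unfolding N_def c_def[symmetric] by (simp add: algebra_simps power2_eq_square)
        then show ?thesis using r c by simp
      qed
      have "(- t - r * s / c) / N s + 1 / (t - s) = ((- t * c - r * s) * (t - s) + c * N s) / (c * N s * (t - s))"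
        using ts c Ns by (simp add: field_simps)
      also have "\<dots> = r / (c * (t - s))" unfolding key using Ns by simp
      finally have 1: "(- t - r * s / c) / N s + 1 / (t - s) = r / (c * (t - s))" .
      have "t * (1 / c) + s / c + r * ((- t - r * s / c) / N s) - r * (- 1 / (t - s))
         = (t + s) / c + r * ((- t - r * s / c) / N s + 1 / (t - s))"
        by (simp add: algebra_simps add_divide_distrib)
      also have "\<dots> = (t + s) / c + r\<^sup>2 / (c * (t - s))" unfolding 1 by (simp add: power2_eq_square)
      also have "\<dots> = ((t + s) * (t - s) + r\<^sup>2) / (c * (t - s))" using ts c by (simp add: field_simps)
      also have "(t + s) * (t - s) + r\<^sup>2 = c * c" using r c by (simp add: algebra_simps power2_eq_square)
      finally show ?thesis using c by simp
    qed
    moreover have "semicircle s = c" using s by (simp add: semicircle_eq c_def)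
    ultimately show ?thesis by (simp add: has_real_derivative_iff_has_vector_derivative)
  qed
  have cont\<Phi>: "continuous_on S \<Phi>" if "S \<subseteq> {-1..1}" "t \<notin> S" for S
    unfolding \<Phi>_def using that
    by (intro continuous_intros continuous_on_subset[OF cont]) auto
  \<comment> \<open>At \<open>s = 1\<close> and \<open>s = -1\<close> the square root vanishes and
    \<open>N s = |t - s|\<close>, so the two logarithms cancel.\<close>
  have ends: "\<Phi> 1 = t * (pi / 2)" "\<Phi> (-1) = - t * (pi / 2)"
    using t by (auto simp: \<Phi>_def \<Psi>_def N_def arcsin_minus_1)
  have int: "((\<lambda>s. semicircle s / (t - s)) has_integral (pi * t + \<Psi> (t - \<epsilon>) - \<Psi> (t + \<epsilon>))) {s. \<epsilon> \<le> \<bar>t - s\<bar>}"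
    if \<epsilon>: "0 < \<epsilon>" "\<epsilon> < 1 - \<bar>t\<bar>" for \<epsilon>
  proof -
    have lt: "-1 < t - \<epsilon>" "t + \<epsilon> < 1" using \<epsilon> by (auto simp: abs_if split: if_splits)
    have "((\<lambda>s. semicircle s / (t - s)) has_integral (\<Phi> (t - \<epsilon>) - \<Phi> (-1))) {-1..t - \<epsilon>}"
      by (rule fundamental_theorem_of_calculus_interior)
         (use lt \<epsilon> t in \<open>auto intro!: cont\<Phi> deriv\<close>)
    moreover have "((\<lambda>s. semicircle s / (t - s)) has_integral (\<Phi> 1 - \<Phi> (t + \<epsilon>))) {t + \<epsilon>..1}"
      by (rule fundamental_theorem_of_calculus_interior)
         (use lt \<epsilon> t in \<open>auto intro!: cont\<Phi> deriv\<close>)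
    ultimately have "((\<lambda>s. semicircle s / (t - s)) has_integral (\<Phi> (t - \<epsilon>) - \<Phi> (-1)) + (\<Phi> 1 - \<Phi> (t + \<epsilon>))) ({-1..t - \<epsilon>} \<union> {t + \<epsilon>..1})"
      by (rule has_integral_Un) (use \<epsilon> in auto)
    moreover have "(\<Phi> (t - \<epsilon>) - \<Phi> (-1)) + (\<Phi> 1 - \<Phi> (t + \<epsilon>)) = pi * t + \<Psi> (t - \<epsilon>) - \<Psi> (t + \<epsilon>)"
      using \<epsilon> unfolding ends by (simp add: \<Phi>_def)
    ultimately have U: "((\<lambda>s. semicircle s / (t - s)) has_integral (pi * t + \<Psi> (t - \<epsilon>) - \<Psi> (t + \<epsilon>))) ({-1..t - \<epsilon>} \<union> {t + \<epsilon>..1})" by simp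
    define h where "h = (\<lambda>s. if s \<in> {-1..t - \<epsilon>} \<union> {t + \<epsilon>..1} then semicircle s / (t - s) else 0)"
    have "(h has_integral (pi * t + \<Psi> (t - \<epsilon>) - \<Psi> (t + \<epsilon>))) ({-1..t - \<epsilon>} \<union> {t + \<epsilon>..1})"
      by (rule has_integral_eq[OF _ U]) (simp add: h_def)
    then have "(h has_integral (pi * t + \<Psi> (t - \<epsilon>) - \<Psi> (t + \<epsilon>))) {s. \<epsilon> \<le> \<bar>t - s\<bar>}"
      by (rule has_integral_on_superset) (use \<epsilon> in \<open>auto simp: h_def\<close>)
    then show ?thesis
      by (rule has_integral_eq[rotated]) (auto simp: h_def semicircle_def)
  qed
  have lim: "((\<lambda>\<epsilon>. (1 / pi) * (pi * t + \<Psi> (t - \<epsilon>) - \<Psi> (t + \<epsilon>))) \<longlongrightarrow> t) (at_right 0)"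
  proof -
    have "continuous (at t) \<Psi>" using cont t by (simp add: continuous_on_interior interior_atLeastAtMost_real)
    then have \<Psi>: "(\<Psi> \<longlongrightarrow> \<Psi> t) (nhds t)" by (simp add: continuous_within tendsto_at_within_iff_tendsto_nhds isCont_def)
    have "((\<lambda>\<epsilon>. t - \<epsilon>) \<longlongrightarrow> t - 0) (at_right 0)" "((\<lambda>\<epsilon>. t + \<epsilon>) \<longlongrightarrow> t + 0) (at_right 0)" by (intro tendsto_intros)+
    then have "((\<lambda>\<epsilon>. \<Psi> (t - \<epsilon>)) \<longlongrightarrow> \<Psi> t) (at_right 0)" "((\<lambda>\<epsilon>. \<Psi> (t + \<epsilon>)) \<longlongrightarrow> \<Psi> t) (at_right 0)"
      using filterlim_compose[OF \<Psi>] by auto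
    then have "((\<lambda>\<epsilon>. (1 / pi) * (pi * t + \<Psi> (t - \<epsilon>) - \<Psi> (t + \<epsilon>))) \<longlongrightarrow> (1 / pi) * (pi * t + \<Psi> t - \<Psi> t)) (at_right 0)"
      by (intro tendsto_intros)
    then show ?thesis by simp
  qed
  have ev: "\<forall>\<^sub>F \<epsilon> in at_right 0. (1 / pi) * (pi * t + \<Psi> (t - \<epsilon>) - \<Psi> (t + \<epsilon>))
      = (1 / pi) * integral {s. \<epsilon> \<le> \<bar>t - s\<bar>} (\<lambda>s. semicircle s / (t - s))"
  proof -
    have "1 - \<bar>t\<bar> > 0" using t by auto
    then show ?thesis
      unfolding eventually_at_right_field using integral_unique[OF int] by (intro exI[of _ "1 - \<bar>t\<bar>"]) simp
  qed
  have int_all: "(\<lambda>s. semicircle s / (t - s)) integrable_on {s. \<epsilon> \<le> \<bar>t - s\<bar>}" if "\<epsilon> > 0" for \<epsilon>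
  proof -
    have "integrable lborel (\<lambda>s. indicator {s. \<epsilon> \<le> \<bar>t - s\<bar>} s * (semicircle s / (t - s)))"
      by (rule truncated_hilbert_integrable[OF semicircle_measurable semicircle_bounds(2,3) that])
    then have "(\<lambda>s. indicator {s. \<epsilon> \<le> \<bar>t - s\<bar>} s * (semicircle s / (t - s))) integrable_on UNIV"
      using has_integral_integral_lborel by blast
    moreover have "(\<lambda>s. indicator {s. \<epsilon> \<le> \<bar>t - s\<bar>} s * (semicircle s / (t - s)))
        = (\<lambda>s. if s \<in> {s. \<epsilon> \<le> \<bar>t - s\<bar>} then semicircle s / (t - s) else 0)"
      by (auto simp: indicator_def)
    ultimately show ?thesis by (simp only: integrable_restrict_UNIV)
  qed
  show ?thesis
    unfolding has_hilbert_transform_def using int_all tendsto_cong[OF ev] lim by blast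
qed

section \<open>Quadratic relations for families of moment series\<close>

lemma eventually_not_in_finite:
  fixes x :: "'a::t1_space"
  assumes "finite X" shows "\<forall>\<^sub>F y in at x. y \<notin> X"
proof -
  have "open (- (X - {x}))" using assms by (intro open_Compl finite_imp_closed) auto
  then show ?thesis unfolding eventually_at_topological by (intro exI[of _ "- (X - {x})"]) auto
qed

lemma continuous_zero_off_finite:
  fixes f :: "real \<Rightarrow> complex"
  assumes "finite X" "continuous_on UNIV f" "\<And>x. x \<notin> X \<Longrightarrow> f x = 0"
  shows "f x = 0"
proof (rule tendsto_unique[of "at x"])
  show "(f \<longlongrightarrow> f x) (at x)" using assms(2) by (simp add: continuous_on_def)
  show "(f \<longlongrightarrow> 0) (at x)"
    by (rule tendsto_eventually, rule eventually_mono[OF eventually_not_in_finite[OF assms(1)]]) (use assms(3) in auto)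
qed simp

text \<open>Liouville's theorem; the exceptional finite set is avoided by using the bound only
  outside a large disc.\<close>

lemma polynomial_growth_degree:
  fixes f :: "complex poly"
  assumes "finite X" "\<And>z. z \<notin> X \<Longrightarrow> norm (poly f z) \<le> C * (1 + norm z) ^ k"
  shows "degree f \<le> k"
proof -
  obtain A where A: "\<And>z. z \<in> X \<Longrightarrow> norm z \<le> A"
    using finite_imp_bounded[OF assms(1)] unfolding bounded_iff by blast
  define A' where "A' = max 1 (A + 1)"
  have bound: "norm (poly f z) \<le> (\<bar>C\<bar> * 2 ^ k) * norm z ^ k" if "A' \<le> norm z" for z
  proof -
    have "z \<notin> X" using A that by (fastforce simp: A'_def)
    then have "norm (poly f z) \<le> C * (1 + norm z) ^ k" by (rule assms(2))
    also have "\<dots> \<le> \<bar>C\<bar> * (2 * norm z) ^ k"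
      using that by (intro mult_mono power_mono) (auto simp: A'_def)
    finally show ?thesis by (simp add: power_mult_distrib mult.assoc)
  qed
  have eq: "poly f z = (\<Sum>i\<le>k. (deriv ^^ i) (poly f) 0 / fact i * z ^ i)" for z
    by (rule Liouville_polynomial[where A=A' and B="\<bar>C\<bar> * 2 ^ k"])
       (use bound in \<open>auto intro!: holomorphic_intros\<close>)
  define g where "g = (\<Sum>i\<le>k. monom ((deriv ^^ i) (poly f) 0 / fact i) i)"
  have "poly f = poly g" by (auto simp: fun_eq_iff eq g_def poly_sum poly_monom)
  then have "f = g" by (simp add: poly_eq_poly_eq_iff)
  moreover have "degree g \<le> k" unfolding g_def
    by (rule degree_sum_le) (auto intro: order.trans[OF degree_monom_le])
  ultimately show ?thesis by simp
qed

text \<open>A quotient bounded off a finite set by a power of \<open>1 + |z|\<close> has no poles: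
  at a root of \<open>g\<close> the bound and continuity force \<open>f\<close> to vanish too, so
  linear factors cancel one at a time until Liouville applies.\<close>

lemma polynomial_quotient_bound:
  fixes f g :: "complex poly"
  assumes "g \<noteq> 0" "finite X" "\<And>z. z \<notin> X \<Longrightarrow> norm (poly f z) \<le> C * (1 + norm z) ^ k * norm (poly g z)"
  shows "\<exists>h. f = g * h \<and> degree h \<le> k"
  using assms
proof (induction "degree g" arbitrary: f g X)
  case 0
  then obtain c where c: "g = [:c:]" "c \<noteq> 0" by (metis degree_eq_zeroE pCons_0_0)
  have "norm (poly f z) \<le> (C * norm c) * (1 + norm z) ^ k" if "z \<notin> X" for z
    using 0(4)[OF that] by (simp add: c mult_ac)
  from polynomial_growth_degree[OF 0(3) this] have "degree f \<le> k" .
  then show ?case using c by (intro exI[of _ "smult (inverse c) f"]) simp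
next
  case (Suc n)
  obtain r where r: "poly g r = 0" using alg_closed_imp_poly_has_root[of g] Suc(2) by auto
  have fr: "poly f r = 0"
  proof -
    have "((\<lambda>z. C * (1 + norm z) ^ k * norm (poly g z)) \<longlongrightarrow> C * (1 + norm r) ^ k * norm (poly g r)) (at r)"
      by (intro tendsto_intros)
    then have l: "((\<lambda>z. C * (1 + norm z) ^ k * norm (poly g z)) \<longlongrightarrow> 0) (at r)" by (simp add: r)
    have "(poly f \<longlongrightarrow> 0) (at r)"
      by (rule Lim_null_comparison[OF eventually_mono[OF eventually_not_in_finite[OF Suc(4)] Suc(5)] l])
    moreover have "(poly f \<longlongrightarrow> poly f r) (at r)" by (intro tendsto_intros)
    ultimately show ?thesis by (metis tendsto_unique trivial_limit_at)
  qed
  obtain g1 where g1: "g = [:-r, 1:] * g1" using r by (auto simp: poly_eq_0_iff_dvd)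
  obtain f1 where f1: "f = [:-r, 1:] * f1" using fr by (auto simp: poly_eq_0_iff_dvd)
  have g10: "g1 \<noteq> 0" using Suc(3) g1 by auto
  have "degree g = 1 + degree g1" unfolding g1 using g10 by (subst degree_mult_eq) auto
  then have deg: "n = degree g1" using Suc(2) by simp
  have "norm (poly f1 z) \<le> C * (1 + norm z) ^ k * norm (poly g1 z)" if z: "z \<notin> insert r X" for z
  proof -
    have "norm (z - r) * norm (poly f1 z) \<le> norm (z - r) * (C * (1 + norm z) ^ k * norm (poly g1 z))"
    proof -
      have "poly f z = (z - r) * poly f1 z" "poly g z = (z - r) * poly g1 z"
        by (simp_all add: f1 g1 algebra_simps)
      then show ?thesis using Suc(5)[of z] z by (simp add: norm_mult mult_ac)
    qed
    then show ?thesis using z by simp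
  qed
  then have "\<exists>h. f1 = g1 * h \<and> degree h \<le> k"
    by (intro Suc(1)[OF deg g10, of "insert r X"]) (use Suc(4) in auto)
  then obtain h where "f1 = g1 * h" "degree h \<le> k" by blast
  then show ?case using f1 g1 by (intro exI[of _ h]) (simp only: mult.assoc)
qed

lemma poly_eq_off_ball:
  fixes p q :: "complex poly"
  assumes "\<And>z. norm z > r \<Longrightarrow> poly p z = poly q z"
  shows "p = q"
proof (rule ccontr)
  assume "p \<noteq> q"
  then have "finite {z. poly (p - q) z = 0}" by (intro poly_roots_finite) simp
  moreover have "of_real ` {\<bar>r\<bar><..} \<subseteq> {z. poly (p - q) z = 0}" using assms by auto
  ultimately have "finite (complex_of_real ` {\<bar>r\<bar><..})" by (rule rev_finite_subset)
  then have "finite {\<bar>r\<bar><..}" by (rule finite_imageD) (simp add: inj_on_def)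
  then show False using infinite_Ioi by blast
qed

text \<open>A linear relation for \<open>F\<close> would make \<open>U^2 * T\<close> the square
  \<open>(W + U * P)^2\<close>, which an odd root of \<open>T\<close> forbids. Hence two quadratic
  relations for the same \<open>F\<close> are proportional.\<close>

lemma not_rational:
  fixes U W P T :: "complex poly"
  assumes lin: "\<And>z. norm z > r \<Longrightarrow> poly U z * F z + poly W z = 0"
    and quad: "\<And>z. norm z > r \<Longrightarrow> (F z - poly P z)\<^sup>2 = poly T z"
    and odd: "odd (order z0 T)" and T0: "T \<noteq> 0"
  shows "U = 0" "W = 0"
proof -
  have "U\<^sup>2 * T = (W + U * P)\<^sup>2"
  proof (rule poly_eq_off_ball)
    fix z :: complex assume z: "norm z > r"
    have "poly U z * (F z - poly P z) = - (poly W z + poly U z * poly P z)"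
      using lin[OF z] by (simp add: algebra_simps eq_neg_iff_add_eq_0)
    then have "(poly U z * (F z - poly P z))\<^sup>2 = (poly W z + poly U z * poly P z)\<^sup>2" by (metis power2_minus)
    then show "poly (U\<^sup>2 * T) z = poly ((W + U * P)\<^sup>2) z"
      by (simp add: power_mult_distrib quad[OF z])
  qed
  show U: "U = 0"
  proof (rule ccontr)
    assume U0: "U \<noteq> 0"
    then have nz: "(W + U * P)\<^sup>2 \<noteq> 0" using \<open>U\<^sup>2 * T = _\<close> T0 by (metis mult_eq_0_iff power_not_zero)
    have "order z0 (U\<^sup>2 * T) = order z0 (U\<^sup>2) + order z0 T" using U0 T0 by (intro order_mult) auto
    moreover have "even (order z0 (V\<^sup>2))" if "V\<^sup>2 \<noteq> 0" for V :: "complex poly"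
      using that by (simp add: power2_eq_square order_mult)
    ultimately show False using odd nz U0 \<open>U\<^sup>2 * T = _\<close> by (metis even_add power_not_zero)
  qed
  show "W = 0" by (rule poly_eq_off_ball[of r]) (use lin U in simp)
qed

text \<open>Passes from \<open>z\<close> to \<open>w = 1 / z\<close>: this is the polynomial
  \<open>w^n * p (1 / w)\<close> for \<open>degree p \<le> n\<close>.\<close>

definition reverse_poly :: "nat \<Rightarrow> complex poly \<Rightarrow> complex poly" where
  "reverse_poly n p = (\<Sum>j\<le>n. monom (coeff p (n - j)) j)"

lemma poly_reverse_poly:
  assumes "degree p \<le> n" "w \<noteq> 0"
  shows "poly (reverse_poly n p) w = w ^ n * poly p (1 / w)"
proof -
  have "w ^ n * poly p (1 / w) = (\<Sum>i\<le>n. coeff p i * (w ^ n * (1 / w) ^ i))"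
  proof -
    have "poly p (1 / w) = poly (\<Sum>i\<le>n. monom (coeff p i) i) (1 / w)"
      by (simp only: poly_as_sum_of_monoms'[OF assms(1)])
    then show ?thesis by (simp add: poly_sum poly_monom sum_distrib_left mult.left_commute)
  qed
  also have "\<dots> = (\<Sum>i\<le>n. coeff p i * w ^ (n - i))"
    using assms(2) by (intro sum.cong) (auto simp: power_diff power_one_over divide_simps)
  also have "\<dots> = (\<Sum>j\<le>n. coeff p (n - j) * w ^ j)"
    by (rule sum.reindex_bij_witness[of _ "\<lambda>j. n - j" "\<lambda>j. n - j"]) auto
  finally show ?thesis by (simp add: reverse_poly_def poly_sum poly_monom)
qed

lemma degree_reverse_poly: "degree (reverse_poly n p) \<le> n"
  unfolding reverse_poly_def by (rule degree_sum_le) (auto intro: order.trans[OF degree_monom_le])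

text \<open>What is kept of a body along a line \<open>u + l v\<close>: \<open>M k\<close> is the
  k-th moment, \<open>V\<close> the total mass, and \<open>R * (1 + |l|)\<close> a radius containing
  the support. The moment bound is required for complex \<open>l\<close>, whereas the endpoints
  \<open>a\<close> and \<open>b\<close> are known for real \<open>l\<close> only.\<close>

locale moment_family =
  fixes M :: "nat \<Rightarrow> complex poly" and V R :: real and a b :: "real \<Rightarrow> real"
  assumes R: "R > 0" and V: "V \<ge> 0"
    and M_bound: "\<And>k l. norm (poly (M k) l) \<le> V * (R * (1 + norm l)) ^ k"
    and ab: "\<And>l. a l < b l" "continuous_on UNIV a" "continuous_on UNIV b"
begin

text \<open>The k-th moment is the coefficient of \<open>w^(k+1)\<close>, because
  \<open>1 / (z - s)\<close> is the sum of the \<open>s^k / z^(k+1)\<close>. The constant term is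
  therefore zero.\<close>

definition series :: "complex \<Rightarrow> complex fps" where
  "series l = Abs_fps (\<lambda>k. if k = 0 then 0 else poly (M (k - 1)) l)"

definition poly_series :: "complex poly fps" where
  "poly_series = Abs_fps (\<lambda>k. if k = 0 then 0 else M (k - 1))"

definition radius :: "complex \<Rightarrow> real" where
  "radius l = R * (1 + norm l)"

definition stieltjes :: "complex \<Rightarrow> complex \<Rightarrow> complex" where
  "stieltjes l z = eval_fps (series l) (1 / z)"

lemma radius_pos: "radius l > 0"
  using R by (simp add: radius_def add_pos_nonneg)

lemma conv_radius: "ereal (1 / radius l) \<le> fps_conv_radius (series l)"
  unfolding fps_conv_radius_def
proof (rule conv_radius_geI_ex')
  fix r assume r: "0 < r" "ereal r < ereal (1 / radius l)"
  then have rr: "radius l * r < 1" using radius_pos[of l] by (simp add: field_simps)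
  show "summable (\<lambda>n. fps_nth (series l) n * of_real r ^ n)"
  proof (rule summable_comparison_test')
    show "summable (\<lambda>n. V / radius l * (radius l * r) ^ n)"
      using rr r radius_pos[of l] by (intro summable_mult summable_geometric) auto
    show "norm (fps_nth (series l) n * of_real r ^ n) \<le> V / radius l * (radius l * r) ^ n" if "n \<ge> 0" for n
    proof (cases n)
      case 0
      then show ?thesis using V radius_pos[of l] by (simp add: series_def)
    next
      case (Suc k)
      have "norm (poly (M k) l) * r ^ n \<le> V * radius l ^ k * r ^ n"
        using M_bound[of k l] r by (intro mult_right_mono) (auto simp: radius_def)
      also have "\<dots> = V / radius l * (radius l * r) ^ n"
        using radius_pos[of l] Suc by (simp add: power_mult_distrib field_simps)
      finally show ?thesis using r Suc by (simp add: series_def norm_mult norm_power)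
    qed
  qed
qed

lemma in_conv_radius: "norm w < 1 / radius l \<Longrightarrow> ereal (norm w) < fps_conv_radius (series l)"
  using conv_radius[of l] by (meson ereal_less_eq(3) less_ereal.simps(1) less_le_trans)

lemma inverse_in_conv_radius: "norm (z::complex) > radius l \<Longrightarrow> ereal (norm (1 / z)) < fps_conv_radius (series l)"
  using radius_pos[of l] by (intro in_conv_radius) (auto simp: norm_divide intro!: frac_less2)

lemma stieltjes_holomorphic: "stieltjes l holomorphic_on {z::complex. norm z > radius l}"
  unfolding stieltjes_def
proof (rule holomorphic_on_compose_gen[of "\<lambda>z. 1 / z" _ "eval_fps (series l)" "eball 0 (fps_conv_radius (series l))", unfolded o_def])
  show "(\<lambda>z. 1 / z) holomorphic_on {z::complex. norm z > radius l}"
    using radius_pos[of l] by (intro holomorphic_intros) auto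
  show "eval_fps (series l) holomorphic_on eball 0 (fps_conv_radius (series l))"
    by (intro holomorphic_intros) auto
  show "(\<lambda>z. 1 / z) ` {z::complex. norm z > radius l} \<subseteq> eball 0 (fps_conv_radius (series l))"
    using inverse_in_conv_radius by (auto simp: in_eball_iff)
qed

lemma series_nth: "fps_nth (series l) k = poly (fps_nth poly_series k) l"
  by (simp add: series_def poly_series_def)

lemma series_square_nth: "fps_nth (series l * series l) k = poly (fps_nth (poly_series * poly_series) k) l"
  by (simp add: fps_mult_nth series_nth poly_sum)

text \<open>The columns of the linear system for a quadratic relation of degree \<open>N\<close> over the series:
  \<open>w^N\<close> times its square, \<open>w^j\<close> times the series, and \<open>w^j\<close>, for \<open>j \<le> N\<close>.\<close>

definition columns :: "nat \<Rightarrow> unit + nat + nat \<Rightarrow> nat \<Rightarrow> complex poly" where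
  "columns N x i = (case x of Inl _ \<Rightarrow> fps_nth (fps_X ^ N * (poly_series * poly_series)) i
      | Inr (Inl j) \<Rightarrow> fps_nth (fps_X ^ j * poly_series) i
      | Inr (Inr j) \<Rightarrow> fps_nth (fps_X ^ j) i)"

definition column_index :: "nat \<Rightarrow> (unit + nat + nat) set" where
  "column_index N = insert (Inl ()) ((\<lambda>j. Inr (Inl j)) ` {..N} \<union> (\<lambda>j. Inr (Inr j)) ` {..N})"

lemma sum_column_index:
  fixes h :: "unit + nat + nat \<Rightarrow> 'c::comm_monoid_add"
  shows "(\<Sum>x\<in>column_index N. h x) = h (Inl ()) + ((\<Sum>j\<le>N. h (Inr (Inl j))) + (\<Sum>j\<le>N. h (Inr (Inr j))))"
proof -
  have "(\<Sum>x\<in>column_index N. h x) = h (Inl ()) + sum h ((\<lambda>j. Inr (Inl j)) ` {..N} \<union> (\<lambda>j. Inr (Inr j)) ` {..N})"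
    unfolding column_index_def by (rule sum.insert) auto
  also have "sum h ((\<lambda>j. Inr (Inl j)) ` {..N} \<union> (\<lambda>j. Inr (Inr j)) ` {..N})
     = sum h ((\<lambda>j. Inr (Inl j)) ` {..N}) + sum h ((\<lambda>j. Inr (Inr j)) ` {..N})"
    by (rule sum.union_disjoint) auto
  finally show ?thesis by (simp add: sum.reindex inj_on_def)
qed

definition relation_fps :: "nat \<Rightarrow> (unit + nat + nat \<Rightarrow> complex) \<Rightarrow> complex \<Rightarrow> complex fps" where
  "relation_fps N c l = fps_const (c (Inl ())) * (fps_X ^ N * (series l * series l))
      + (fps_of_poly (\<Sum>j\<le>N. monom (c (Inr (Inl j))) j) * series l
      + fps_of_poly (\<Sum>j\<le>N. monom (c (Inr (Inr j))) j))"

lemma relation_fps_nth: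
  "fps_nth (relation_fps N c l) i = (\<Sum>x\<in>column_index N. c x * poly (columns N x i) l)"
proof -
  have mono: "fps_of_poly (\<Sum>j\<le>N. monom (d j) j) = (\<Sum>j\<le>N. fps_const (d j) * fps_X ^ j)" for d :: "nat \<Rightarrow> complex"
    by (simp add: fps_of_poly_sum fps_of_poly_monom)
  have X: "fps_nth (fps_X ^ j * series l) i = poly (fps_nth (fps_X ^ j * poly_series) i) l" for j
    by (simp add: fps_X_power_mult_nth series_nth)
  have XX: "fps_nth (fps_X ^ N * (series l * series l)) i = poly (fps_nth (fps_X ^ N * (poly_series * poly_series)) i) l"
    by (simp only: fps_X_power_mult_nth series_square_nth) simp
  have X1: "fps_nth (fps_X ^ j :: complex fps) i = poly (fps_nth (fps_X ^ j) i) l" for j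
    by (simp add: fps_X_power_nth)
  show ?thesis
    unfolding relation_fps_def sum_column_index mono
    by (simp only: columns_def fps_add_nth fps_mult_left_const_nth fps_sum_nth sum_distrib_right mult.assoc X XX X1
        sum.case old.sum.case)
qed

lemma eval_relation_fps:
  assumes "norm w < 1 / radius l"
  shows "eval_fps (relation_fps N c l) w = c (Inl ()) * (w ^ N * (eval_fps (series l) w)\<^sup>2)
     + ((\<Sum>j\<le>N. c (Inr (Inl j)) * w ^ j) * eval_fps (series l) w + (\<Sum>j\<le>N. c (Inr (Inr j)) * w ^ j))"
    and "ereal (1 / radius l) \<le> fps_conv_radius (relation_fps N c l)"
proof -
  note conv = conv_radius[of l]
  have "1 / radius l \<le> fps_conv_radius (fps_const (c (Inl ())))" "1 / radius l \<le> fps_conv_radius (fps_X ^ N :: complex fps)"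
    "\<And>p. 1 / radius l \<le> fps_conv_radius (fps_of_poly p :: complex fps)"
    by (simp_all add: fps_conv_radius_const flip: fps_of_poly_monom')
  note conv = conv this
  have m: "ereal (norm w) < r" if "ereal (1 / radius l) \<le> r" for r
    using that assms by (meson less_ereal.simps(1) less_le_trans)
  have c2: "1 / radius l \<le> fps_conv_radius (series l * series l)"
    "1 / radius l \<le> fps_conv_radius (fps_X ^ N * (series l * series l))"
    "1 / radius l \<le> fps_conv_radius (fps_const (c (Inl ())) * (fps_X ^ N * (series l * series l)))"
    "\<And>p. 1 / radius l \<le> fps_conv_radius (fps_of_poly p * series l)"
    "\<And>p q. 1 / radius l \<le> fps_conv_radius (fps_of_poly p * series l + fps_of_poly q)"
    by (intro fps_conv_radius_mult_ge fps_conv_radius_add_ge conv)+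
  show "ereal (1 / radius l) \<le> fps_conv_radius (relation_fps N c l)"
    unfolding relation_fps_def by (intro fps_conv_radius_add_ge c2)
  have eX: "eval_fps (fps_X ^ N :: complex fps) w = w ^ N"
    by (simp flip: fps_of_poly_monom' add: eval_fps_of_poly poly_monom)
  show "eval_fps (relation_fps N c l) w = c (Inl ()) * (w ^ N * (eval_fps (series l) w)\<^sup>2)
     + ((\<Sum>j\<le>N. c (Inr (Inl j)) * w ^ j) * eval_fps (series l) w + (\<Sum>j\<le>N. c (Inr (Inr j)) * w ^ j))"
    unfolding relation_fps_def
    by (simp add: eval_fps_add eval_fps_mult m conv c2 eX eval_fps_of_poly poly_sum poly_monom power2_eq_square)
qed

text \<open>The relation is demanded only outside the convergence radius, where the series defines
  the transform; odd roots of \<open>T\<close> still see the endpoints.\<close>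

definition quadratic_at :: "real \<Rightarrow> complex poly \<Rightarrow> complex poly \<Rightarrow> bool" where
  "quadratic_at l P T \<longleftrightarrow> T \<noteq> 0 \<and>
     (\<forall>z. norm z > radius (of_real l) \<longrightarrow> (stieltjes (of_real l) z - poly P z)\<^sup>2 = poly T z) \<and>
     (\<forall>z. odd (order z T) \<longleftrightarrow> z \<in> {of_real (a l), of_real (b l)})"

text \<open>Expanded and multiplied by \<open>w^N\<close>, the relation \<open>(F - P)^2 = T\<close>
  becomes a linear dependence of the columns with coefficients read off from the reversed
  \<open>-2 * P\<close> and \<open>P^2 - T\<close>. It is nontrivial because the coefficient of the
  squared series is 1.\<close>

lemma dependent_at:
  assumes q: "quadratic_at l P T" and deg: "degree P \<le> N" "degree (P\<^sup>2 - T) \<le> N"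
  shows "\<exists>c. (\<exists>x\<in>column_index N. c x \<noteq> 0) \<and> (\<forall>i. (\<Sum>x\<in>column_index N. c x * poly (columns N x i) (of_real l)) = 0)"
proof -
  define L where "L = complex_of_real l"
  define p q where "p = reverse_poly N (smult (-2) P)" and "q = reverse_poly N (P\<^sup>2 - T)"
  define c where "c = (\<lambda>x :: unit + nat + nat. case x of Inl _ \<Rightarrow> 1 | Inr (Inl j) \<Rightarrow> coeff p j | Inr (Inr j) \<Rightarrow> coeff q j)"
  have sum_p: "(\<Sum>j\<le>N. coeff p j * w ^ j) = poly p w" "(\<Sum>j\<le>N. coeff q j * w ^ j) = poly q w" for w
  proof -
    have "(\<Sum>j\<le>N. coeff r j * w ^ j) = poly (\<Sum>j\<le>N. monom (coeff r j) j) w" for r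
      by (simp add: poly_sum poly_monom)
    then show "(\<Sum>j\<le>N. coeff p j * w ^ j) = poly p w" "(\<Sum>j\<le>N. coeff q j * w ^ j) = poly q w"
      unfolding p_def q_def by (simp_all only: poly_as_sum_of_monoms'[OF degree_reverse_poly])
  qed
  have ev: "eval_fps (relation_fps N c L) w = 0" if w: "norm w < 1 / radius L" "w \<noteq> 0" for w
  proof -
    have zw: "norm (1 / w) > radius L"
      using w radius_pos[of L] by (simp add: norm_divide field_simps)
    have "(stieltjes L (1 / w) - poly P (1 / w))\<^sup>2 = poly T (1 / w)"
      using q zw by (simp add: quadratic_at_def L_def)
    then have "(eval_fps (series L) w - poly P (1 / w))\<^sup>2 = poly T (1 / w)" by (simp add: stieltjes_def)
    then have "(eval_fps (series L) w)\<^sup>2 - 2 * poly P (1 / w) * eval_fps (series L) w + poly (P\<^sup>2 - T) (1 / w) = 0"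
      by (simp add: power2_diff algebra_simps)
    then have zero: "w ^ N * ((eval_fps (series L) w)\<^sup>2 - 2 * poly P (1 / w) * eval_fps (series L) w + poly (P\<^sup>2 - T) (1 / w)) = 0"
      by simp
    have pq: "poly p w = w ^ N * (- 2 * poly P (1 / w))" "poly q w = w ^ N * poly (P\<^sup>2 - T) (1 / w)"
      unfolding p_def q_def
      using poly_reverse_poly[OF order.trans[OF degree_smult_le deg(1)] w(2), of "-2"] poly_reverse_poly[OF deg(2) w(2)]
      by simp_all
    have "eval_fps (relation_fps N c L) w
       = w ^ N * ((eval_fps (series L) w)\<^sup>2 - 2 * poly P (1 / w) * eval_fps (series L) w + poly (P\<^sup>2 - T) (1 / w))"
      unfolding eval_relation_fps(1)[OF w(1)] by (simp add: c_def sum_p pq algebra_simps)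
    with zero show ?thesis by simp
  qed
  have cr: "fps_conv_radius (relation_fps N c L) > 0"
    using eval_relation_fps(2)[of 0 L N c] radius_pos[of L]
    by (metis ereal_less(2) less_le_trans norm_zero zero_less_divide_1_iff)
  \<comment> \<open>At \<open>w = 0\<close> the relation in \<open>1 / w\<close> says nothing; the
    extra factor \<open>fps_X\<close> makes the evaluation vanish there as well.\<close>
  have "fps_X * relation_fps N c L = 0"
  proof (rule eval_fps_eqD)
    show "fps_conv_radius (fps_X * relation_fps N c L) > 0"
      using cr fps_conv_radius_mult[of fps_X "relation_fps N c L"] by (simp add: min_def split: if_splits)
    have "\<forall>\<^sub>F w in nhds (0::complex). norm w < 1 / radius L"
      using radius_pos[of L] by (intro eventually_nhds_metric[THEN iffD2] exI[of _ "1 / radius L"]) (auto simp: dist_norm)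
    then show "\<forall>\<^sub>F w in nhds 0. eval_fps (fps_X * relation_fps N c L) w = eval_fps 0 w"
    proof (rule eventually_mono)
      fix w :: complex assume w: "norm w < 1 / radius L"
      have "ereal (norm w) < fps_conv_radius (relation_fps N c L)"
        using eval_relation_fps(2)[OF w, of N c] w by (meson less_ereal.simps(1) less_le_trans)
      then have "eval_fps (fps_X * relation_fps N c L) w = w * eval_fps (relation_fps N c L) w"
        by (subst eval_fps_mult) (simp_all add: eval_fps_X)
      then show "eval_fps (fps_X * relation_fps N c L) w = eval_fps 0 w"
        using ev[OF w] by (cases "w = 0") auto
    qed
  qed simp
  then have "relation_fps N c L = 0" by simp
  then have "(\<Sum>x\<in>column_index N. c x * poly (columns N x i) L) = 0" for i
    by (metis relation_fps_nth fps_zero_nth)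
  moreover have "c (Inl ()) \<noteq> 0" "Inl () \<in> column_index N" by (auto simp: c_def column_index_def)
  ultimately show ?thesis unfolding L_def by blast
qed

text \<open>A relation over \<open>\<complex>[l]\<close> with coefficients \<open>c\<close>, turned into polynomials in \<open>z = 1/w\<close>.\<close>

definition lin_coeff :: "nat \<Rightarrow> (unit + nat + nat \<Rightarrow> complex poly) \<Rightarrow> complex poly poly" where
  "lin_coeff N c = (\<Sum>j\<le>N. monom (c (Inr (Inl j))) (N - j))"

definition abs_coeff :: "nat \<Rightarrow> (unit + nat + nat \<Rightarrow> complex poly) \<Rightarrow> complex poly poly" where
  "abs_coeff N c = (\<Sum>j\<le>N. monom (c (Inr (Inr j))) (N - j))"

text \<open>Dependence at infinitely many real \<open>l\<close> lifts to C[l]. The resulting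
  relation between power series can then be evaluated at every complex \<open>l\<close>, although
  only real \<open>l\<close> entered.\<close>

lemma generic_relation:
  assumes quad: "\<And>l. \<exists>P T. quadratic_at l P T"
  obtains c2 C1 C0 where "c2 \<noteq> 0 \<or> C1 \<noteq> 0 \<or> C0 \<noteq> 0"
    "\<And>l z. norm z > radius l \<Longrightarrow>
       poly c2 l * (stieltjes l z)\<^sup>2 + poly (specialise l C1) z * stieltjes l z + poly (specialise l C0) z = 0"
proof -
  \<comment> \<open>Every real \<open>l\<close> admits some degree, but no common bound is given.
    Countably many finite sets cannot cover the reals, so one \<open>N\<close> serves infinitely
    many \<open>l\<close>.\<close>
  define A where "A = (\<lambda>N. {l. \<exists>P T. quadratic_at l P T \<and> degree P \<le> N \<and> degree (P\<^sup>2 - T) \<le> N})"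
  have "(\<Union>N. A N) = UNIV"
  proof (intro equalityI subsetI UNIV_I)
    fix l :: real
    obtain P T where PT: "quadratic_at l P T" using quad by blast
    then have "l \<in> A (max (degree P) (degree (P\<^sup>2 - T)))" by (force simp: A_def)
    then show "l \<in> (\<Union>N. A N)" by blast
  qed
  moreover have "uncountable (UNIV :: real set)" by (rule uncountable_UNIV_real)
  ultimately have "\<exists>N. infinite (A N)"
    by (metis countable_UN countable_finite countableI_type)
  then obtain N where N: "infinite (A N)" by blast
  have "infinite (complex_of_real ` A N)" using N by (subst finite_image_iff) (auto simp: inj_on_def)
  moreover have "finite (column_index N)" by (simp add: column_index_def)
  moreover have "\<exists>c. (\<exists>x\<in>column_index N. c x \<noteq> 0) \<and> (\<forall>i. (\<Sum>x\<in>column_index N. c x * poly (columns N x i) L) = 0)"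
    if "L \<in> complex_of_real ` A N" for L
    using that dependent_at by (force simp: A_def)
  ultimately obtain c where c: "\<exists>x\<in>column_index N. c x \<noteq> 0" "\<And>i. (\<Sum>x\<in>column_index N. c x * columns N x i) = 0"
    using dependent_specialisation[of "column_index N" "complex_of_real ` A N" "columns N"] by blast
  have coeffs: "coeff (lin_coeff N c) (N - j) = c (Inr (Inl j))" "coeff (abs_coeff N c) (N - j) = c (Inr (Inr j))"
    if "j \<le> N" for j
  proof -
    have "(\<Sum>i\<le>N. if N - i = N - j then d i else 0) = d j" for d :: "nat \<Rightarrow> complex poly"
    proof -
      have "(\<Sum>i\<le>N. if N - i = N - j then d i else 0) = (\<Sum>i\<le>N. if i = j then d i else 0)"
        using that by (intro sum.cong) auto
      then show ?thesis using that by simp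
    qed
    then show "coeff (lin_coeff N c) (N - j) = c (Inr (Inl j))" "coeff (abs_coeff N c) (N - j) = c (Inr (Inr j))"
      by (simp_all add: lin_coeff_def abs_coeff_def coeff_sum)
  qed
  show ?thesis
  proof (rule that[of "c (Inl ())" "lin_coeff N c" "abs_coeff N c"])
    show "c (Inl ()) \<noteq> 0 \<or> lin_coeff N c \<noteq> 0 \<or> abs_coeff N c \<noteq> 0"
      using c(1) coeffs by (auto simp: column_index_def)
    fix l z :: complex assume z: "norm z > radius l"
    define d where "d = (\<lambda>x. poly (c x) l)"
    have z0: "z \<noteq> 0" using z radius_pos[of l] by auto
    have w: "norm (1 / z) < 1 / radius l" using z radius_pos[of l] by (auto simp: norm_divide intro!: frac_less2)
    have "relation_fps N d l = 0"
    proof (rule fps_ext)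
      fix i
      have "fps_nth (relation_fps N d l) i = poly (\<Sum>x\<in>column_index N. c x * columns N x i) l"
        by (simp add: relation_fps_nth d_def poly_sum)
      then show "fps_nth (relation_fps N d l) i = fps_nth 0 i" by (simp add: c(2))
    qed
    then have zero: "d (Inl ()) * ((1 / z) ^ N * (stieltjes l z)\<^sup>2)
     + ((\<Sum>j\<le>N. d (Inr (Inl j)) * (1 / z) ^ j) * stieltjes l z + (\<Sum>j\<le>N. d (Inr (Inr j)) * (1 / z) ^ j)) = 0"
      using eval_relation_fps(1)[OF w, of N d] by (simp add: stieltjes_def)
    have mult: "z ^ N * (\<Sum>j\<le>N. g j * (1 / z) ^ j) = (\<Sum>j\<le>N. g j * z ^ (N - j))" for g
      unfolding sum_distrib_left
      by (rule sum.cong) (use z0 in \<open>auto simp: power_diff power_one_over divide_simps\<close>)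
    have "poly (specialise l (lin_coeff N c)) z = z ^ N * (\<Sum>j\<le>N. d (Inr (Inl j)) * (1 / z) ^ j)"
      "poly (specialise l (abs_coeff N c)) z = z ^ N * (\<Sum>j\<le>N. d (Inr (Inr j)) * (1 / z) ^ j)"
      unfolding mult lin_coeff_def abs_coeff_def by (simp_all add: d_def poly_sum poly_monom)
    moreover have "z ^ N * (1 / z) ^ N = 1" using z0 by (simp flip: power_mult_distrib)
    ultimately have "poly (c (Inl ())) l * (stieltjes l z)\<^sup>2 + poly (specialise l (lin_coeff N c)) z * stieltjes l z
         + poly (specialise l (abs_coeff N c)) z
      = z ^ N * (d (Inl ()) * ((1 / z) ^ N * (stieltjes l z)\<^sup>2)
     + ((\<Sum>j\<le>N. d (Inr (Inl j)) * (1 / z) ^ j) * stieltjes l z + (\<Sum>j\<le>N. d (Inr (Inr j)) * (1 / z) ^ j)))"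
      by (simp add: d_def distrib_left mult.assoc)
    then show "poly (c (Inl ())) l * (stieltjes l z)\<^sup>2 + poly (specialise l (lin_coeff N c)) z * stieltjes l z
         + poly (specialise l (abs_coeff N c)) z = 0"
      by (simp add: zero)
  qed
qed

lemma infinite_reals_off_finite:
  assumes "finite X" obtains l :: real where "complex_of_real l \<notin> X"
proof -
  have "infinite (range complex_of_real)" using finite_imageD[of complex_of_real UNIV] infinite_UNIV_char_0[where 'a=real] by (auto simp: inj_on_def)
  then have "\<not> range complex_of_real \<subseteq> X" using assms finite_subset by blast
  then show ?thesis using that by auto
qed

text \<open>The lifted relation has \<open>c2 \<noteq> 0\<close>, since otherwise it would make the
  transform rational at some real \<open>l\<close>. Where \<open>c2\<close> does not vanish it is a
  multiple of the relation known at \<open>l\<close>, so its discriminant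
  \<open>C1^2 - 4 * c2 * C0\<close> specialises to \<open>4 * c2^2 * T\<close> and has the same odd
  roots.\<close>

lemma generic_discriminant:
  assumes quad: "\<And>l. \<exists>P T. quadratic_at l P T"
  obtains c2 :: "complex poly" and C1 D :: "complex poly poly"
  where "c2 \<noteq> 0" "D \<noteq> 0"
    "\<And>l z. norm z > radius l \<Longrightarrow>
       (2 * poly c2 l * stieltjes l z + poly (specialise l C1) z)\<^sup>2 = poly (specialise l D) z"
    "\<And>l. poly c2 (of_real l) \<noteq> 0 \<Longrightarrow> specialise (of_real l) D \<noteq> 0 \<and>
       (\<forall>z. odd (order z (specialise (of_real l) D)) \<longleftrightarrow> z \<in> {of_real (a l), of_real (b l)})"
proof -
  obtain c2 C1 C0 where nz: "c2 \<noteq> 0 \<or> C1 \<noteq> 0 \<or> C0 \<noteq> 0" and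
    rel: "\<And>l z. norm z > radius l \<Longrightarrow>
       poly c2 l * (stieltjes l z)\<^sup>2 + poly (specialise l C1) z * stieltjes l z + poly (specialise l C0) z = 0"
    using generic_relation[OF quad] by blast
  define D where "D = C1\<^sup>2 - [:4 * c2:] * C0"
  have spD: "specialise l D = (specialise l C1)\<^sup>2 - smult (4 * poly c2 l) (specialise l C0)" for l
    by (simp add: D_def)
  have c20: "c2 \<noteq> 0"
  proof
    assume c2: "c2 = 0"
    have "finite {l. specialise l C1 = 0 \<and> specialise l C0 = 0}"
    proof (cases "C1 = 0")
      case True
      then have "C0 \<noteq> 0" using nz c2 by simp
      from finite_specialise_0[OF this] show ?thesis by (rule rev_finite_subset) auto
    next
      case False
      from finite_specialise_0[OF this] show ?thesis by (rule rev_finite_subset) auto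
    qed
    then obtain l where l: "specialise (of_real l) C1 \<noteq> 0 \<or> specialise (of_real l) C0 \<noteq> 0"
      using infinite_reals_off_finite[of "{l. specialise l C1 = 0 \<and> specialise l C0 = 0}"] by auto
    obtain P T where PT: "quadratic_at l P T" using quad by blast
    have lin: "poly (specialise (of_real l) C1) z * stieltjes (of_real l) z + poly (specialise (of_real l) C0) z = 0"
      if "norm z > radius (of_real l)" for z using rel[OF that] by (simp add: c2)
    have "odd (order (of_real (a l)) T)" "T \<noteq> 0" using PT by (auto simp: quadratic_at_def)
    moreover have "(stieltjes (of_real l) z - poly P z)\<^sup>2 = poly T z" if "norm z > radius (of_real l)" for z
      using PT that by (simp add: quadratic_at_def)
    ultimately have "specialise (of_real l) C1 = 0 \<and> specialise (of_real l) C0 = 0"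
      using not_rational[where U="specialise (of_real l) C1" and W="specialise (of_real l) C0" and F="stieltjes (of_real l)" and r="radius (of_real l)" and P=P and T=T and ?z0.0="of_real (a l)"] lin
      by blast
    then show False using l by simp
  qed
  have disc: "specialise (of_real l) D \<noteq> 0 \<and>
       (\<forall>z. odd (order z (specialise (of_real l) D)) \<longleftrightarrow> z \<in> {of_real (a l), of_real (b l)})"
    if c2l: "poly c2 (of_real l) \<noteq> 0" for l
  proof -
    define L where "L = complex_of_real l"
    obtain P T where PT: "quadratic_at l P T" using quad by blast
    \<comment> \<open>Subtracting \<open>c2\<close> times the relation known at \<open>l\<close>
      cancels the square and leaves the linear relation with coefficients \<open>U\<close> and
      \<open>W\<close>.\<close>
    define U where "U = specialise L C1 + smult (2 * poly c2 L) P"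
    define W where "W = specialise L C0 + smult (poly c2 L) (T - P\<^sup>2)"
    have q: "(stieltjes L z - poly P z)\<^sup>2 = poly T z" if "norm z > radius L" for z
      using PT that by (simp add: quadratic_at_def L_def)
    have lin: "poly U z * stieltjes L z + poly W z = 0" if z: "norm z > radius L" for z
    proof -
      have "(stieltjes L z)\<^sup>2 = 2 * poly P z * stieltjes L z + (poly T z - (poly P z)\<^sup>2)"
        using q[OF z] by (simp add: power2_diff algebra_simps)
      then have "poly c2 L * (2 * poly P z * stieltjes L z + (poly T z - (poly P z)\<^sup>2))
        + poly (specialise L C1) z * stieltjes L z + poly (specialise L C0) z = 0"
        using rel[OF z] by simp
      then show ?thesis by (simp add: U_def W_def algebra_simps)
    qed
    have T: "odd (order (of_real (a l)) T)" "T \<noteq> 0" using PT by (auto simp: quadratic_at_def)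
    have UW: "U = 0" "W = 0" using not_rational[OF lin q T] by auto
    have C1: "specialise L C1 = - smult (2 * poly c2 L) P"
      using UW(1) by (simp add: U_def add_eq_0_iff2)
    have C0: "specialise L C0 = - smult (poly c2 L) (T - P\<^sup>2)"
      using UW(2) unfolding W_def by (simp only: add_eq_0_iff2)
    have "specialise L D = smult (4 * (poly c2 L)\<^sup>2) T"
      unfolding spD C1 C0
      by (rule poly_eqI) (simp add: power2_eq_square algebra_simps)
    then show ?thesis using c2l PT by (simp add: L_def quadratic_at_def order_smult)
  qed
  have D0: "D \<noteq> 0"
  proof -
    obtain l :: real where "poly c2 (of_real l) \<noteq> 0"
      using infinite_reals_off_finite[OF poly_roots_finite[OF c20]] by auto
    then show ?thesis using disc[of l] by auto
  qed
  show ?thesis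
  proof (rule that[OF c20 D0 _ disc])
    fix l z :: complex assume z: "norm z > radius l"
    have "(2 * poly c2 l * stieltjes l z + poly (specialise l C1) z)\<^sup>2
        = 4 * poly c2 l * (poly c2 l * (stieltjes l z)\<^sup>2 + poly (specialise l C1) z * stieltjes l z + poly (specialise l C0) z)
         + poly (specialise l D) z"
      by (simp add: spD power2_eq_square algebra_simps)
    then show "(2 * poly c2 l * stieltjes l z + poly (specialise l C1) z)\<^sup>2 = poly (specialise l D) z"
      by (simp add: rel[OF z])
  qed
qed

lemma quadratic_from_simple_roots:
  fixes p :: "complex poly"
  assumes "\<And>z. poly p z = 0 \<Longrightarrow> order z p = 1" "p \<noteq> 0" "{z. poly p z = 0} = {x, y}" "x \<noteq> y"
  shows "p = smult (lead_coeff p) ([:-x, 1:] * [:-y, 1:])"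
proof -
  have "p = smult (lead_coeff p) (\<Prod>z|poly p z = 0. [:-z, 1:] ^ order z p)" by (rule complex_poly_decompose[symmetric])
  also have "(\<Prod>z|poly p z = 0. [:-z, 1:] ^ order z p) = (\<Prod>z\<in>{x, y}. [:-z, 1:])"
    unfolding assms(3)[symmetric] by (rule prod.cong) (use assms(1) in auto)
  finally show ?thesis using assms(4) by simp
qed

text \<open>Off a finite set of \<open>l\<close> the squarefree part \<open>D\<close> has exactly
  the odd roots of the discriminant as simple roots. At real \<open>l\<close> these are the two
  endpoints, so sum and product are quotients of coefficients of \<open>D\<close>. The growth bound
  at complex \<open>l\<close> makes these quotients polynomials of degree 1 and 2.\<close>

lemma endpoints_polynomial:
  assumes quad: "\<And>l. \<exists>P T. quadratic_at l P T"
  obtains s p :: "complex poly" where "degree s \<le> 1" "degree p \<le> 2"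
    "\<And>l. of_real (a l + b l) = poly s (of_real l)" "\<And>l. of_real (a l * b l) = poly p (of_real l)"
proof -
  obtain c2 C1 F where c2: "c2 \<noteq> 0" and F0: "F \<noteq> 0" and
    sq: "\<And>l z. norm z > radius l \<Longrightarrow>
       (2 * poly c2 l * stieltjes l z + poly (specialise l C1) z)\<^sup>2 = poly (specialise l F) z" and
    odd_real: "\<And>l. poly c2 (of_real l) \<noteq> 0 \<Longrightarrow> specialise (of_real l) F \<noteq> 0 \<and>
       (\<forall>z. odd (order z (specialise (of_real l) F)) \<longleftrightarrow> z \<in> {of_real (a l), of_real (b l)})"
    by (rule generic_discriminant[OF quad], rule that)
  obtain k D E where kDE: "k \<noteq> 0" "D \<noteq> 0" "E \<noteq> 0" "F = [:k:] * D * E\<^sup>2"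
    and fin: "finite {l. \<exists>r. poly (specialise l D) r = 0 \<and> poly (pderiv (specialise l D)) r = 0}"
    using squarefree_decomposition[OF F0] by blast
  \<comment> \<open>The parameters at which the relation degenerates, the degree of \<open>D\<close>
    drops, a constant or square factor vanishes, or roots of \<open>D\<close> collide.\<close>
  define X where "X = {l. poly c2 l = 0} \<union> {l. poly k l = 0} \<union> {l. poly (lead_coeff D) l = 0}
     \<union> {l. specialise l E = 0} \<union> {l. \<exists>r. poly (specialise l D) r = 0 \<and> poly (pderiv (specialise l D)) r = 0}"
  have X: "finite X"
    unfolding X_def using c2 kDE fin by (intro finite_UnI poly_roots_finite finite_specialise_0) auto
  have good: "poly c2 l \<noteq> 0" "poly k l \<noteq> 0" "poly (lead_coeff D) l \<noteq> 0" "specialise l E \<noteq> 0"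
    "specialise l D \<noteq> 0" "degree (specialise l D) = degree D"
    "\<And>r. poly (specialise l D) r = 0 \<Longrightarrow> order r (specialise l D) = 1"
    "\<And>z. odd (order z (specialise l F)) \<longleftrightarrow> poly (specialise l D) z = 0"
    if l: "l \<notin> X" for l
  proof -
    show g: "poly c2 l \<noteq> 0" "poly k l \<noteq> 0" "poly (lead_coeff D) l \<noteq> 0" "specialise l E \<noteq> 0"
      using l by (auto simp: X_def)
    show D0: "specialise l D \<noteq> 0" using g(3) by (metis coeff_specialise coeff_0)
    show "degree (specialise l D) = degree D" by (rule degree_specialise[OF g(3)])
    show simple: "order r (specialise l D) = 1" if r: "poly (specialise l D) r = 0" for r
    proof -
      have "poly (pderiv (specialise l D)) r \<noteq> 0" using l r by (auto simp: X_def)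
      moreover have "pderiv (specialise l D) \<noteq> 0" using \<open>poly (pderiv _) r \<noteq> 0\<close> by auto
      ultimately show ?thesis using order_pderiv[of "specialise l D" r] r D0 by (simp add: order_root order_0I)
    qed
    fix z
    have FF: "specialise l F = smult (poly k l) (specialise l D * (specialise l E)\<^sup>2)"
      by (simp add: kDE(4) mult.assoc)
    have "order z (specialise l F) = order z (specialise l D) + 2 * order z (specialise l E)"
      unfolding FF using g D0 by (simp add: order_smult order_mult power2_eq_square)
    then have "odd (order z (specialise l F)) \<longleftrightarrow> odd (order z (specialise l D))" by simp
    also have "\<dots> \<longleftrightarrow> poly (specialise l D) z = 0"
      using simple[of z] by (cases "poly (specialise l D) z = 0") (auto simp: order_0I)
    finally show "odd (order z (specialise l F)) \<longleftrightarrow> poly (specialise l D) z = 0" .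
  qed
  have real_fact: "specialise (of_real l) D
      = smult (poly (lead_coeff D) (of_real l)) ([:-of_real (a l), 1:] * [:-of_real (b l), 1:])"
    if l: "of_real l \<notin> X" for l
  proof -
    note g = good[OF l]
    have "{z. poly (specialise (of_real l) D) z = 0} = {of_real (a l), of_real (b l)}"
      using odd_real[OF g(1)] g(8) by auto
    moreover have "complex_of_real (a l) \<noteq> of_real (b l)" using ab(1)[of l] by simp
    ultimately show ?thesis
      using quadratic_from_simple_roots[OF g(7) g(5), of "of_real (a l)" "of_real (b l)"] g(6) by simp
  qed
  \<comment> \<open>A single real \<open>l\<close> outside the exceptional set decides the degree
    for all complex ones.\<close>
  have degD: "degree D = 2"
  proof -
    obtain l where l: "complex_of_real l \<notin> X" using infinite_reals_off_finite[OF X] by blast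
    have "degree (specialise (of_real l) D) = 2"
      unfolding real_fact[OF l] using good(3)[OF l] by (simp add: degree_mult_eq)
    then show ?thesis using good(6)[OF l] by simp
  qed
  define d0 d1 d2 where "d0 = coeff D 0" and "d1 = coeff D 1" and "d2 = coeff D 2"
  have lc: "lead_coeff D = d2" by (simp add: degD d2_def)
  have d20: "d2 \<noteq> 0" using kDE(2) lc by auto
  have coeffs: "poly d1 l = - poly d2 l * (x + y)" "poly d0 l = poly d2 l * (x * y)"
    if "specialise l D = smult (poly (lead_coeff D) l) ([:-x, 1:] * [:-y, 1:])" for l x y
  proof -
    have "poly d1 l = coeff (specialise l D) 1" "poly d0 l = coeff (specialise l D) 0" by (simp_all add: d1_def d0_def)
    then show "poly d1 l = - poly d2 l * (x + y)" "poly d0 l = poly d2 l * (x * y)"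
      unfolding that lc by (simp_all add: algebra_simps)
  qed
  have bounds: "norm (poly d1 l) \<le> (2 * R) * (1 + norm l) ^ 1 * norm (poly d2 l)"
     "norm (poly d0 l) \<le> R\<^sup>2 * (1 + norm l) ^ 2 * norm (poly d2 l)" if l: "l \<notin> X" for l
  proof -
    note g = good[OF l]
    \<comment> \<open>Outside this disc \<open>2 * c2 * F + C1\<close> is a holomorphic square root
      of the discriminant, so all orders are even there. The argument needs no Hilbert transform and
      holds at complex \<open>l\<close>.\<close>
    have small: "norm z \<le> radius l" if z: "poly (specialise l D) z = 0" for z
    proof (rule ccontr)
      assume "\<not> norm z \<le> radius l"
      have op: "open {z::complex. norm z > radius l}"
        by (intro open_Collect_less continuous_intros)
      have "specialise l F \<noteq> 0"
        using g by (simp add: kDE(4))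
      then have "even (order z (specialise l F))"
      proof (rule even_order_if_holomorphic_square[OF op _ _ _ sq, rotated 2])
        show "(\<lambda>z. 2 * poly c2 l * stieltjes l z + poly (specialise l C1) z) holomorphic_on {z. norm z > radius l}"
          by (intro holomorphic_intros stieltjes_holomorphic)
      qed (use \<open>\<not> norm z \<le> radius l\<close> in auto)
      then show False using g(8)[of z] z by blast
    qed
    define p where "p = specialise l D"
    have p: "p \<noteq> 0" "degree p = 2" "\<And>r. poly p r = 0 \<Longrightarrow> order r p = 1" using g degD by (auto simp: p_def)
    have "card {z. poly p z = 0} = 2"
    proof -
      have "degree p = (\<Sum>z|poly p z = 0. order z p)"
      proof -
        have "degree p = degree (smult (lead_coeff p) (\<Prod>z|poly p z = 0. [:-z, 1:] ^ order z p))"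
          by (simp only: complex_poly_decompose)
        also have "\<dots> = (\<Sum>z|poly p z = 0. degree ([:-z, 1:] ^ order z p))"
          using p(1) by (simp add: degree_prod_sum_eq)
        finally show ?thesis by (simp add: degree_linear_power)
      qed
      also have "\<dots> = (\<Sum>z|poly p z = 0. 1)" using p(3) by (intro sum.cong) auto
      finally show ?thesis using p(2) by simp
    qed
    then obtain x y where xy: "{z. poly p z = 0} = {x, y}" "x \<noteq> y" by (meson card_2_iff)
    have pf: "specialise l D = smult (poly (lead_coeff D) l) ([:-x, 1:] * [:-y, 1:])"
      using quadratic_from_simple_roots[OF p(3,1) xy] g(6) by (simp add: p_def)
    have nx: "norm x \<le> radius l" "norm y \<le> radius l" using xy small by (auto simp: p_def)
    have "norm (poly d1 l) = norm (poly d2 l) * norm (x + y)" using coeffs(1)[OF pf] by (simp add: norm_mult)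
    also have "\<dots> \<le> norm (poly d2 l) * (2 * radius l)"
      using nx norm_triangle_ineq[of x y] by (intro mult_left_mono) auto
    finally show "norm (poly d1 l) \<le> (2 * R) * (1 + norm l) ^ 1 * norm (poly d2 l)"
      by (simp add: radius_def mult_ac)
    have "norm (poly d0 l) = norm (poly d2 l) * (norm x * norm y)" using coeffs(2)[OF pf] by (simp add: norm_mult)
    also have "\<dots> \<le> norm (poly d2 l) * (radius l * radius l)"
      using nx radius_pos[of l] by (intro mult_left_mono mult_mono) auto
    finally show "norm (poly d0 l) \<le> R\<^sup>2 * (1 + norm l) ^ 2 * norm (poly d2 l)"
      by (simp add: radius_def power2_eq_square mult_ac)
  qed
  obtain s where s: "d1 = d2 * s" "degree s \<le> 1"
    using polynomial_quotient_bound[OF d20 X bounds(1)] by blast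
  obtain p where p: "d0 = d2 * p" "degree p \<le> 2"
    using polynomial_quotient_bound[OF d20 X bounds(2)] by blast
  have eq: "of_real (a l + b l) = poly (-s) (of_real l)" "of_real (a l * b l) = poly p (of_real l)"
    if l: "complex_of_real l \<notin> X" for l
  proof -
    have nz: "poly d2 (of_real l) \<noteq> 0" using good(3)[OF l] by (simp add: lc)
    have "poly d2 (of_real l) * poly (-s) (of_real l) = poly d2 (of_real l) * of_real (a l + b l)"
      using coeffs(1)[OF real_fact[OF l]] by (simp add: s(1))
    then show "of_real (a l + b l) = poly (-s) (of_real l)" using nz by (metis mult_left_cancel)
    have "poly d2 (of_real l) * poly p (of_real l) = poly d2 (of_real l) * of_real (a l * b l)"
      using coeffs(2)[OF real_fact[OF l]] by (simp add: p(1))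
    then show "of_real (a l * b l) = poly p (of_real l)" using nz by (metis mult_left_cancel)
  qed
  \<comment> \<open>The exceptional real parameters are recovered by continuity of the
    endpoints.\<close>
  have Xr: "finite {l. complex_of_real l \<in> X}"
    using finite_vimageI[OF X, of complex_of_real] by (simp add: vimage_def inj_on_def)
  show ?thesis
  proof (rule that[of "- s" p])
    show "of_real (a l + b l) = poly (-s) (of_real l)" for l
    proof -
      have "of_real (a l + b l) - poly (-s) (of_real l) = 0"
        by (rule continuous_zero_off_finite[OF Xr, where f="\<lambda>l. of_real (a l + b l) - poly (-s) (of_real l)"])
           (use eq(1) ab in \<open>auto intro!: continuous_intros\<close>)
      then show ?thesis by (simp only: right_minus_eq)
    qed
    show "of_real (a l * b l) = poly p (of_real l)" for l
    proof -
      have "of_real (a l * b l) - poly p (of_real l) = 0"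
        by (rule continuous_zero_off_finite[OF Xr, where f="\<lambda>l. of_real (a l * b l) - poly p (of_real l)"])
           (use eq(2) ab in \<open>auto intro!: continuous_intros\<close>)
      then show ?thesis by (simp only: right_minus_eq)
    qed
  qed (use s p in auto)
qed

end

section \<open>Convex bodies and their moments\<close>

locale convex_body =
  fixes K :: "'a::euclidean_space set"
  assumes open_K: "open K" and convex_K: "convex K" and nonempty_K: "K \<noteq> {}" and bounded_K: "bounded K"
begin

lemma compact_closure_K: "compact (closure K)"
  using bounded_K by (simp add: compact_closure)

lemma K_borel [measurable]: "K \<in> sets borel"
  using open_K by simp

lemma h_plus_attained:
  obtains x where "x \<in> closure K" "x \<bullet> \<xi> = h_plus K \<xi>" "\<And>y. y \<in> closure K \<Longrightarrow> y \<bullet> \<xi> \<le> h_plus K \<xi>"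
proof -
  have "\<exists>x\<in>closure K. \<forall>y\<in>closure K. y \<bullet> \<xi> \<le> x \<bullet> \<xi>"
    by (rule continuous_attains_sup[OF compact_closure_K])
       (use nonempty_K in \<open>auto intro!: continuous_intros\<close>)
  then obtain x where x: "x \<in> closure K" "\<And>y. y \<in> closure K \<Longrightarrow> y \<bullet> \<xi> \<le> x \<bullet> \<xi>" by blast
  have "h_plus K \<xi> = x \<bullet> \<xi>" unfolding h_plus_def
    by (rule cSup_eq_maximum) (use x in auto)
  then show ?thesis using that x by metis
qed

lemma h_minus_eq: "h_minus K \<xi> = - h_plus K (- \<xi>)"
  unfolding h_minus_def h_plus_def Inf_real_def by (simp add: image_image)

lemma le_h_plus: "x \<in> closure K \<Longrightarrow> x \<bullet> \<xi> \<le> h_plus K \<xi>"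
  using h_plus_attained[of \<xi>] by metis

lemma h_plus_le: "(\<And>x. x \<in> closure K \<Longrightarrow> x \<bullet> \<xi> \<le> c) \<Longrightarrow> h_plus K \<xi> \<le> c"
  using h_plus_attained[of \<xi>] by metis

lemma h_plus_scale: "c \<ge> 0 \<Longrightarrow> h_plus K (c *\<^sub>R \<xi>) = c * h_plus K \<xi>"
proof (rule antisym)
  assume c: "c \<ge> 0"
  show "h_plus K (c *\<^sub>R \<xi>) \<le> c * h_plus K \<xi>"
    by (rule h_plus_le) (use c le_h_plus in \<open>auto intro!: mult_left_mono\<close>)
  obtain x where "x \<in> closure K" "x \<bullet> \<xi> = h_plus K \<xi>" using h_plus_attained by metis
  then show "c * h_plus K \<xi> \<le> h_plus K (c *\<^sub>R \<xi>)" using le_h_plus[of x "c *\<^sub>R \<xi>"] by simp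
qed

lemma h_minus_scale: "c \<ge> 0 \<Longrightarrow> h_minus K (c *\<^sub>R \<xi>) = c * h_minus K \<xi>"
  using h_plus_scale[of c "-\<xi>"] by (simp add: h_minus_eq)

lemma norm_bound: obtains B where "B > 0" "\<And>x. x \<in> closure K \<Longrightarrow> norm x \<le> B"
  using compact_closure_K compact_imp_bounded bounded_pos by metis

lemma continuous_h_plus: "continuous_on UNIV (h_plus K)"
proof -
  obtain B where B: "B > 0" "\<And>x. x \<in> closure K \<Longrightarrow> norm x \<le> B" using norm_bound by blast
  have le: "h_plus K \<xi> - h_plus K \<eta> \<le> B * norm (\<xi> - \<eta>)" for \<xi> \<eta>
  proof -
    obtain x where x: "x \<in> closure K" "x \<bullet> \<xi> = h_plus K \<xi>" using h_plus_attained by metis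
    have "x \<bullet> (\<xi> - \<eta>) \<le> norm x * norm (\<xi> - \<eta>)" by (rule norm_cauchy_schwarz)
    also have "\<dots> \<le> B * norm (\<xi> - \<eta>)" using B(2)[OF x(1)] by (rule mult_right_mono) simp
    finally show ?thesis using x(2) le_h_plus[OF x(1), of \<eta>] by (simp add: inner_diff_right)
  qed
  have "B-lipschitz_on UNIV (h_plus K)"
  proof (rule lipschitz_onI)
    fix \<xi> \<eta> show "dist (h_plus K \<xi>) (h_plus K \<eta>) \<le> B * dist \<xi> \<eta>"
      using le[of \<xi> \<eta>] le[of \<eta> \<xi>] by (simp add: dist_norm norm_minus_commute abs_le_iff)
  qed (use B in simp)
  then show ?thesis by (rule lipschitz_on_continuous_on)
qed

lemma continuous_h_minus: "continuous_on UNIV (h_minus K)"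
proof -
  have "continuous_on UNIV (\<lambda>\<xi>. - h_plus K (- \<xi>))"
    by (intro continuous_intros continuous_on_compose2[OF continuous_h_plus]) auto
  then show ?thesis by (simp add: h_minus_eq[abs_def])
qed

lemma less_h_plus:
  assumes "x \<in> K" "\<xi> \<noteq> 0" shows "x \<bullet> \<xi> < h_plus K \<xi>"
proof -
  obtain e where e: "e > 0" "ball x e \<subseteq> K" using open_K assms(1) openE by blast
  define d where "d = e / 2 / norm \<xi>"
  have d: "d > 0" using e(1) assms(2) by (simp add: d_def)
  have "x + d *\<^sub>R \<xi> \<in> ball x e" using e assms(2) d by (simp add: dist_norm d_def)
  then have "(x + d *\<^sub>R \<xi>) \<bullet> \<xi> \<le> h_plus K \<xi>" using e(2) by (intro le_h_plus) (use closure_subset in blast)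
  moreover have "d * (\<xi> \<bullet> \<xi>) > 0" using d assms(2) by simp
  ultimately show ?thesis by (simp add: inner_add_left)
qed

lemma h_minus_less: "x \<in> K \<Longrightarrow> \<xi> \<noteq> 0 \<Longrightarrow> h_minus K \<xi> < x \<bullet> \<xi>"
  using less_h_plus[of x "-\<xi>"] by (simp add: h_minus_eq)

lemma h_minus_less_h_plus: "\<xi> \<noteq> 0 \<Longrightarrow> h_minus K \<xi> < h_plus K \<xi>"
  using nonempty_K less_h_plus h_minus_less by (metis ex_in_conv less_trans)

lemma exists_above: "t < h_plus K \<xi> \<Longrightarrow> \<exists>x\<in>K. t < x \<bullet> \<xi>"
proof (rule ccontr)
  assume t: "t < h_plus K \<xi>" and "\<not> (\<exists>x\<in>K. t < x \<bullet> \<xi>)"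
  then have "K \<subseteq> {x. x \<bullet> \<xi> \<le> t}" by auto
  moreover have "closed {x. x \<bullet> \<xi> \<le> t}" by (intro closed_Collect_le continuous_intros)
  ultimately have "closure K \<subseteq> {x. x \<bullet> \<xi> \<le> t}" by (rule closure_minimal)
  then have "h_plus K \<xi> \<le> t" by (intro h_plus_le) auto
  then show False using t by simp
qed

lemma exists_between:
  assumes t: "t \<in> {h_minus K \<xi><..<h_plus K \<xi>}"
  shows "\<exists>x\<in>K. x \<bullet> \<xi> = t"
proof -
  obtain y where y: "y \<in> K" "t < y \<bullet> \<xi>" using exists_above[of t \<xi>] t by auto
  obtain x where x: "x \<in> K" "x \<bullet> \<xi> < t" using exists_above[of "-t" "-\<xi>"] t by (auto simp: h_minus_eq)
  define \<theta> where "\<theta> = (t - x \<bullet> \<xi>) / (y \<bullet> \<xi> - x \<bullet> \<xi>)"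
  have \<theta>: "0 \<le> \<theta>" "\<theta> \<le> 1" "\<theta> * (y \<bullet> \<xi> - x \<bullet> \<xi>) = t - x \<bullet> \<xi>" using x y by (auto simp: \<theta>_def)
  have "(1 - \<theta>) *\<^sub>R x + \<theta> *\<^sub>R y \<in> K" using convex_K x y \<theta> by (intro convexD) auto
  moreover have "((1 - \<theta>) *\<^sub>R x + \<theta> *\<^sub>R y) \<bullet> \<xi> = t" using \<theta>(3) by (simp add: inner_add_left algebra_simps)
  ultimately show ?thesis by blast
qed

lemma sectional_volume_zero:
  assumes "norm \<xi> = 1" "t \<notin> {h_minus K \<xi><..<h_plus K \<xi>}"
  shows "sectional_volume K \<xi> t = 0"
proof -
  have "plane_section K \<xi> t = {}"
  proof (rule ccontr)
    assume "plane_section K \<xi> t \<noteq> {}"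
    then obtain y where "plane_point \<xi> t y \<in> K" by (auto simp: plane_section_def)
    moreover have "\<xi> \<noteq> 0" using assms(1) by auto
    ultimately show False
      using less_h_plus[of "plane_point \<xi> t y" \<xi>] h_minus_less[of "plane_point \<xi> t y" \<xi>] assms(2)
      by (simp add: plane_point_inner[OF assms(1)])
  qed
  then show ?thesis by (simp add: sectional_volume_eq)
qed

lemma sectional_volume_pos:
  assumes \<xi>: "norm \<xi> = 1" and t: "t \<in> {h_minus K \<xi><..<h_plus K \<xi>}"
  shows "sectional_volume K \<xi> t > 0"
proof -
  obtain x where x: "x \<in> K" "x \<bullet> \<xi> = t" using exists_between[OF t] by blast
  obtain e where e: "e > 0" "ball x e \<subseteq> K" using open_K x(1) openE by blast
  define s where "s = e / real DIM('a)"
  have n: "real DIM('a) \<ge> 1" using DIM_positive[where 'a='a] by linarith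
  have s: "s > 0" using e(1) n by (simp add: s_def)
  have "real DIM('a) * s\<^sup>2 = e\<^sup>2 / real DIM('a)" using n by (simp add: s_def power2_eq_square)
  also have "\<dots> \<le> e\<^sup>2" using n e(1) by (simp add: divide_le_eq mult_left_mono[of 1, simplified])
  finally have "real DIM('a) * s\<^sup>2 \<le> e\<^sup>2 - (t - x \<bullet> \<xi>)\<^sup>2" using x(2) by simp
  from sectional_volume_ge[OF \<xi> bounded_K e(2) K_borel e(1) s this] show ?thesis
    using s by (meson less_le_trans mult_pos_pos zero_less_numeral zero_less_power)
qed

definition volume_bound :: real where
  "volume_bound = (SOME M. \<forall>\<xi> t. norm \<xi> = 1 \<longrightarrow> sectional_volume K \<xi> t \<le> M)"

lemma sectional_volume_bound: "norm \<xi> = 1 \<Longrightarrow> sectional_volume K \<xi> t \<le> volume_bound"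
proof -
  obtain B where B: "B > 0" "\<And>x. x \<in> closure K \<Longrightarrow> norm x \<le> B" using norm_bound by blast
  have sub: "K \<subseteq> cball 0 B" using B(2) closure_subset[of K] by (auto simp: dist_norm subset_iff)
  have "\<exists>M. \<forall>\<xi> t. norm \<xi> = 1 \<longrightarrow> sectional_volume K \<xi> t \<le> M"
    using sectional_volume_le[OF _ sub, of _ B] B(1) by (intro exI[of _ "(2 * B) ^ (DIM('a) - 1)"]) simp
  from someI_ex[OF this] show "norm \<xi> = 1 \<Longrightarrow> sectional_volume K \<xi> t \<le> volume_bound"
    unfolding volume_bound_def by blast
qed

text \<open>Bernoulli's inequality turns the factor \<open>\<theta>^(n-1)\<close> into a bound
  linear in \<open>1 - \<theta>\<close>, so the homothety comparison becomes a slope bound.\<close>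

lemma homothety_estimate:
  assumes \<xi>: "norm \<xi> = 1" and s: "s \<in> {h_minus K \<xi><..<h_plus K \<xi>}" and \<theta>: "0 < \<theta>" "\<theta> \<le> 1"
  shows "sectional_volume K \<xi> t - sectional_volume K \<xi> ((1 - \<theta>) * s + \<theta> * t)
    \<le> volume_bound * real (DIM('a) - 1) * (1 - \<theta>)"
proof -
  define m where "m = DIM('a) - 1"
  obtain p where p: "p \<in> K" "p \<bullet> \<xi> = s" using exists_between[OF s] by blast
  have "\<theta> ^ m * sectional_volume K \<xi> t \<le> sectional_volume K \<xi> ((1 - \<theta>) * s + \<theta> * t)"
    using sectional_volume_homothety[OF \<xi> convex_K bounded_K K_borel p(1) \<theta>] p(2) by (simp add: m_def)
  then have "sectional_volume K \<xi> t - sectional_volume K \<xi> ((1 - \<theta>) * s + \<theta> * t) \<le> sectional_volume K \<xi> t * (1 - \<theta> ^ m)"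
    by (simp add: algebra_simps)
  also have "\<dots> \<le> volume_bound * (real m * (1 - \<theta>))"
  proof (rule mult_mono)
    show "1 - \<theta> ^ m \<le> real m * (1 - \<theta>)"
      using Bernoulli_inequality[of "\<theta> - 1" m] \<theta> by (simp add: algebra_simps)
    show "0 \<le> volume_bound" using sectional_volume_bound[OF \<xi>, of 0] sectional_volume_nonneg[of K \<xi> 0] by linarith
  qed (use \<theta> sectional_volume_bound[OF \<xi>] in \<open>auto simp: power_le_one\<close>)
  finally show ?thesis by (simp add: m_def)
qed

lemma section_profile_K:
  assumes \<xi>: "norm \<xi> = 1"
  shows "section_profile (sectional_volume K \<xi>) (h_minus K \<xi>) (h_plus K \<xi>) volume_bound
     (volume_bound * real (DIM('a) - 1))"
proof
  define C where "C = volume_bound * real (DIM('a) - 1)"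
  have \<xi>0: "\<xi> \<noteq> 0" using \<xi> by auto
  show "h_minus K \<xi> < h_plus K \<xi>" by (rule h_minus_less_h_plus[OF \<xi>0])
  show "sectional_volume K \<xi> \<in> borel_measurable borel" by (rule distr_sections(1)[OF \<xi> bounded_K K_borel])
  show "sectional_volume K \<xi> t \<le> volume_bound" for t by (rule sectional_volume_bound[OF \<xi>])
  show "sectional_volume K \<xi> t = 0" if "t \<notin> {h_minus K \<xi><..<h_plus K \<xi>}" for t
    by (rule sectional_volume_zero[OF \<xi> that])
  have V0: "0 \<le> volume_bound" using sectional_volume_bound[OF \<xi>, of 0] sectional_volume_nonneg[of K \<xi> 0] by linarith
  then show "0 \<le> volume_bound * real (DIM('a) - 1)" by simp
  show "sectional_volume K \<xi> t' - sectional_volume K \<xi> t \<le> volume_bound * real (DIM('a) - 1) * (t' - t) / (t' - h_minus K \<xi>)"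
    if t: "h_minus K \<xi> < t" "t < t'" "t' < h_plus K \<xi>" for t t'
  proof -
    \<comment> \<open>A centre of homothety must lie in the open set \<open>K\<close>, whose heights
      never reach the end; the bound is proved for heights \<open>s\<close> inside and the limit
      towards the end is taken afterwards.\<close>
    have est: "sectional_volume K \<xi> t' - sectional_volume K \<xi> t \<le> C * (t' - t) / (t' - s)" if s: "h_minus K \<xi> < s" "s < t" for s
    proof -
      define \<theta> where "\<theta> = (t - s) / (t' - s)"
      have \<theta>: "0 < \<theta>" "\<theta> \<le> 1" "1 - \<theta> = (t' - t) / (t' - s)" "\<theta> * (t' - s) = t - s"
        using t s by (auto simp: \<theta>_def field_simps)
      have "(1 - \<theta>) * s + \<theta> * t' = t" using \<theta>(4) by (simp add: algebra_simps)
      then show ?thesis using homothety_estimate[OF \<xi>, of s \<theta> t'] \<theta> s t by (simp add: C_def)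
    qed
    have "((\<lambda>s. C * (t' - t) / (t' - s)) \<longlongrightarrow> C * (t' - t) / (t' - h_minus K \<xi>)) (at_right (h_minus K \<xi>))"
      by (intro tendsto_intros) (use t in auto)
    moreover have "\<forall>\<^sub>F s in at_right (h_minus K \<xi>). sectional_volume K \<xi> t' - sectional_volume K \<xi> t \<le> C * (t' - t) / (t' - s)"
      unfolding eventually_at_right_field using est t by (intro exI[of _ t]) auto
    ultimately show ?thesis unfolding C_def by (rule tendsto_lowerbound) simp
  qed
  show "sectional_volume K \<xi> t - sectional_volume K \<xi> t' \<le> volume_bound * real (DIM('a) - 1) * (t' - t) / (h_plus K \<xi> - t)"
    if t: "h_minus K \<xi> < t" "t < t'" "t' < h_plus K \<xi>" for t t'
  proof -
    have est: "sectional_volume K \<xi> t - sectional_volume K \<xi> t' \<le> C * (t' - t) / (s - t)" if s: "t' < s" "s < h_plus K \<xi>" for s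
    proof -
      define \<theta> where "\<theta> = (s - t') / (s - t)"
      have \<theta>: "0 < \<theta>" "\<theta> \<le> 1" "1 - \<theta> = (t' - t) / (s - t)" "\<theta> * (s - t) = s - t'"
        using t s by (auto simp: \<theta>_def field_simps)
      have "(1 - \<theta>) * s + \<theta> * t = t'" using \<theta>(4) by (simp add: algebra_simps)
      then show ?thesis using homothety_estimate[OF \<xi>, of s \<theta> t] \<theta> s t by (simp add: C_def)
    qed
    have "((\<lambda>s. C * (t' - t) / (s - t)) \<longlongrightarrow> C * (t' - t) / (h_plus K \<xi> - t)) (at_left (h_plus K \<xi>))"
      by (intro tendsto_intros) (use t in auto)
    moreover have "\<forall>\<^sub>F s in at_left (h_plus K \<xi>). sectional_volume K \<xi> t - sectional_volume K \<xi> t' \<le> C * (t' - t) / (s - t)"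
      unfolding eventually_at_left_field using est t by (intro exI[of _ t']) auto
    ultimately show ?thesis unfolding C_def by (rule tendsto_lowerbound) simp
  qed
qed simp

end

text \<open>Needed to pass from a unit vector to a general direction, which rescales the variable of
  the discriminant.\<close>

lemma order_pcompose_scale:
  fixes T :: "complex poly" and c :: complex
  assumes T: "T \<noteq> 0" and c: "c \<noteq> 0"
  shows "order z (pcompose T [:0, c:]) = order (c * z) T" "pcompose T [:0, c:] \<noteq> 0"
proof -
  define n where "n = order (c * z) T"
  obtain R where R: "T = [:- (c * z), 1:] ^ n * R" "\<not> [:- (c * z), 1:] dvd R"
    using order_decomp[OF T, of "c * z"] unfolding n_def by blast
  have pw: "pcompose (p ^ m) q = pcompose p q ^ m" for p q :: "complex poly" and m
    by (induction m) (simp_all add: pcompose_mult pcompose_1)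
  have "pcompose [:- (c * z), 1:] [:0, c:] = smult c [:- z, 1:]" by (simp add: pcompose_pCons)
  then have eq: "pcompose T [:0, c:] = smult (c ^ n) ([:- z, 1:] ^ n * pcompose R [:0, c:])"
    by (simp only: R(1) pcompose_mult pw smult_power mult_smult_left)
  show nz: "pcompose T [:0, c:] \<noteq> 0" using T c by (simp add: pcompose_eq_0_iff)
  have nz': "[:- z, 1:] ^ n * pcompose R [:0, c:] \<noteq> 0" using nz eq by auto
  have "poly (pcompose R [:0, c:]) z \<noteq> 0"
    using R(2) by (simp add: poly_pcompose poly_eq_0_iff_dvd mult.commute)
  then have "order z (pcompose R [:0, c:]) = 0" by (rule order_0I)
  moreover have "order z (pcompose T [:0, c:]) = order z ([:- z, 1:] ^ n * pcompose R [:0, c:])"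
    unfolding eq using c by (simp add: order_smult)
  moreover have "order z ([:- z, 1:] ^ n * pcompose R [:0, c:]) = n + order z (pcompose R [:0, c:])"
    using order_mult[OF nz'] by (simp add: order_power_n_n)
  ultimately show "order z (pcompose T [:0, c:]) = order (c * z) T" by (simp add: n_def)
qed

section \<open>Moments of the body along a line of directions\<close>

context convex_body
begin

abbreviation K_measure :: "'a measure" where "K_measure \<equiv> density lborel (indicator K)"

lemma finite_K_measure: "finite_measure K_measure"
proof
  have "emeasure K_measure (space K_measure) = emeasure lborel K"
    by (simp add: emeasure_density)
  then show "emeasure K_measure (space K_measure) \<noteq> \<infinity>"
    using emeasure_bounded_finite[OF bounded_K] by simp
qed

lemma AE_K_measure: "(\<And>x. x \<in> K \<Longrightarrow> P x) \<Longrightarrow> AE x in K_measure. P x"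
  by (subst AE_density) (auto simp: indicator_def)

lemma integral_sections:
  fixes g :: "real \<Rightarrow> 'b::{banach, second_countable_topology}"
  assumes "norm \<xi> = 1" and g [measurable]: "g \<in> borel_measurable borel"
  shows "(\<integral>x. g (x \<bullet> \<xi>) \<partial>K_measure) = (\<integral>t. sectional_volume K \<xi> t *\<^sub>R g t \<partial>lborel)"
proof -
  note d = distr_sections[OF assms(1) bounded_K K_borel]
  have [measurable]: "sectional_volume K \<xi> \<in> borel_measurable borel" by (rule d(1))
  have "(\<integral>x. g (x \<bullet> \<xi>) \<partial>K_measure) = (\<integral>t. g t \<partial>distr K_measure borel (\<lambda>x. x \<bullet> \<xi>))"
    by (rule integral_distr[symmetric]) auto
  also have "\<dots> = (\<integral>t. sectional_volume K \<xi> t *\<^sub>R g t \<partial>lborel)"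
    unfolding d(2) by (rule integral_density) auto
  finally show ?thesis .
qed

lemma bounded_integrable:
  fixes g :: "'a \<Rightarrow> 'b::{banach, second_countable_topology}"
  assumes "g \<in> borel_measurable borel" "\<And>x. x \<in> K \<Longrightarrow> norm (g x) \<le> B"
  shows "integrable K_measure g"
  by (rule finite_measure.integrable_const_bound[OF finite_K_measure, of _ B])
     (use assms AE_K_measure in auto)

lemma integral_norm_le:
  fixes g :: "'a \<Rightarrow> real"
  assumes "g \<in> borel_measurable borel" "\<And>x. x \<in> K \<Longrightarrow> \<bar>g x\<bar> \<le> B"
  shows "\<bar>\<integral>x. g x \<partial>K_measure\<bar> \<le> measure K_measure UNIV * B"
proof -
  interpret finite_measure K_measure by (rule finite_K_measure)
  have i: "integrable K_measure g" by (rule bounded_integrable[OF assms(1)]) (use assms(2) in auto)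
  have "\<bar>\<integral>x. g x \<partial>K_measure\<bar> \<le> (\<integral>x. \<bar>g x\<bar> \<partial>K_measure)" by (rule integral_abs_bound)
  also have "\<dots> \<le> (\<integral>x. B \<partial>K_measure)"
    by (rule integral_mono_AE) (use i assms AE_K_measure in auto)
  finally show ?thesis by simp
qed

text \<open>The binomial expansion of the integral of \<open>(x \<bullet> (u + l v))^k\<close> over
  \<open>K\<close>, written as a polynomial so that complex \<open>l\<close> make sense.\<close>

definition moment_poly :: "'a \<Rightarrow> 'a \<Rightarrow> nat \<Rightarrow> complex poly" where
  "moment_poly u v k = (\<Sum>i\<le>k. monom (of_real (real (k choose i) * (\<integral>x. (x \<bullet> u) ^ (k - i) * (x \<bullet> v) ^ i \<partial>K_measure))) i)"

definition coordinate_bound :: "'a \<Rightarrow> 'a \<Rightarrow> real" where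
  "coordinate_bound u v = (SOME R. R > 0 \<and> (\<forall>x\<in>closure K. \<bar>x \<bullet> u\<bar> \<le> R \<and> \<bar>x \<bullet> v\<bar> \<le> R))"

lemma coordinate_bound:
  "coordinate_bound u v > 0"
  "x \<in> closure K \<Longrightarrow> \<bar>x \<bullet> u\<bar> \<le> coordinate_bound u v" "x \<in> closure K \<Longrightarrow> \<bar>x \<bullet> v\<bar> \<le> coordinate_bound u v"
proof -
  obtain B where B: "B > 0" "\<And>x. x \<in> closure K \<Longrightarrow> norm x \<le> B" using norm_bound by blast
  define R where "R = B * (1 + norm u + norm v)"
  have "R > 0" using B(1) by (simp add: R_def add_pos_nonneg)
  moreover have "\<bar>x \<bullet> w\<bar> \<le> R" if "x \<in> closure K" "w \<in> {u, v}" for x w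
  proof -
    have "\<bar>x \<bullet> w\<bar> \<le> norm x * norm w" by (rule Cauchy_Schwarz_ineq2)
    also have "\<dots> \<le> B * (1 + norm u + norm v)" using B that by (intro mult_mono) auto
    finally show ?thesis by (simp add: R_def)
  qed
  ultimately have "\<exists>R. R > 0 \<and> (\<forall>x\<in>closure K. \<bar>x \<bullet> u\<bar> \<le> R \<and> \<bar>x \<bullet> v\<bar> \<le> R)" by blast
  from someI_ex[OF this]
  show "coordinate_bound u v > 0"
    "x \<in> closure K \<Longrightarrow> \<bar>x \<bullet> u\<bar> \<le> coordinate_bound u v" "x \<in> closure K \<Longrightarrow> \<bar>x \<bullet> v\<bar> \<le> coordinate_bound u v"
    unfolding coordinate_bound_def by auto
qed

lemma K_coordinate_bound:
  "x \<in> K \<Longrightarrow> \<bar>x \<bullet> u\<bar> \<le> coordinate_bound u v" "x \<in> K \<Longrightarrow> \<bar>x \<bullet> v\<bar> \<le> coordinate_bound u v"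
  using coordinate_bound closure_subset by (metis subsetD)+

lemma line_bound:
  assumes "x \<in> closure K"
  shows "\<bar>x \<bullet> (u + l *\<^sub>R v)\<bar> \<le> coordinate_bound u v * (1 + \<bar>l\<bar>)"
proof -
  have "\<bar>x \<bullet> (u + l *\<^sub>R v)\<bar> \<le> \<bar>x \<bullet> u\<bar> + \<bar>l\<bar> * \<bar>x \<bullet> v\<bar>"
    by (simp add: inner_add_right abs_mult[symmetric] abs_triangle_ineq)
  also have "\<dots> \<le> coordinate_bound u v + \<bar>l\<bar> * coordinate_bound u v"
    using coordinate_bound(2,3)[OF assms] by (intro add_mono mult_left_mono) auto
  finally show ?thesis by (simp add: algebra_simps)
qed

text \<open>Each coefficient is estimated separately, so that complex \<open>l\<close> are covered;
  the binomial theorem reassembles the power of \<open>1 + |l|\<close>.\<close>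

lemma moment_poly_bound:
  "norm (poly (moment_poly u v k) l) \<le> measure K_measure UNIV * (coordinate_bound u v * (1 + norm l)) ^ k"
proof -
  let ?R = "coordinate_bound u v" and ?V = "measure K_measure UNIV"
  have int: "\<bar>\<integral>x. (x \<bullet> u) ^ (k - i) * (x \<bullet> v) ^ i \<partial>K_measure\<bar> \<le> ?V * ?R ^ k" if "i \<le> k" for i
  proof (rule integral_norm_le)
    fix x assume x: "x \<in> K"
    have "\<bar>(x \<bullet> u) ^ (k - i) * (x \<bullet> v) ^ i\<bar> = \<bar>x \<bullet> u\<bar> ^ (k - i) * \<bar>x \<bullet> v\<bar> ^ i" by (simp add: abs_mult power_abs)
    also have "\<dots> \<le> ?R ^ (k - i) * ?R ^ i"
      using K_coordinate_bound[OF x, where u=u and v=v] coordinate_bound(1)[of u v]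
      by (intro mult_mono power_mono) auto
    also have "\<dots> = ?R ^ k" using that by (simp flip: power_add)
    finally show "\<bar>(x \<bullet> u) ^ (k - i) * (x \<bullet> v) ^ i\<bar> \<le> ?R ^ k" .
  qed simp
  have "norm (poly (moment_poly u v k) l) \<le> (\<Sum>i\<le>k. real (k choose i) * (?V * ?R ^ k) * norm l ^ i)"
    unfolding moment_poly_def poly_sum poly_monom
  proof (rule sum_norm_le)
    fix i assume "i \<in> {..k}"
    then show "norm (of_real (real (k choose i) * (\<integral>x. (x \<bullet> u) ^ (k - i) * (x \<bullet> v) ^ i \<partial>K_measure)) * l ^ i)
       \<le> real (k choose i) * (?V * ?R ^ k) * norm l ^ i"
      using int[of i] unfolding norm_mult norm_of_real norm_power
      by (intro mult_right_mono) (auto simp: abs_mult intro!: mult_left_mono)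
  qed
  also have "\<dots> = ?V * ?R ^ k * (norm l + 1) ^ k"
    by (simp add: binomial_ring sum_distrib_left mult_ac)
  finally show ?thesis by (simp add: power_mult_distrib add.commute mult.assoc)
qed

lemma moment_poly_real:
  "poly (moment_poly u v k) (of_real l) = of_real (\<integral>x. (x \<bullet> (u + l *\<^sub>R v)) ^ k \<partial>K_measure)"
proof -
  have i: "integrable K_measure (\<lambda>x. (x \<bullet> u) ^ (k - i) * (x \<bullet> v) ^ i)" for i
  proof (rule bounded_integrable)
    fix x assume x: "x \<in> K"
    show "norm ((x \<bullet> u) ^ (k - i) * (x \<bullet> v) ^ i) \<le> coordinate_bound u v ^ (k - i) * coordinate_bound u v ^ i"
      unfolding real_norm_def abs_mult power_abs
      using K_coordinate_bound[OF x, where u=u and v=v] coordinate_bound(1)[of u v]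
      by (intro mult_mono power_mono) auto
  qed simp
  have "(\<integral>x. (x \<bullet> (u + l *\<^sub>R v)) ^ k \<partial>K_measure)
     = (\<integral>x. (\<Sum>i\<le>k. (real (k choose i) * l ^ i) * ((x \<bullet> u) ^ (k - i) * (x \<bullet> v) ^ i)) \<partial>K_measure)"
  proof (rule Bochner_Integration.integral_cong[OF refl])
    fix x
    have "(x \<bullet> (u + l *\<^sub>R v)) ^ k = (l * (x \<bullet> v) + x \<bullet> u) ^ k" by (simp add: inner_add_right add.commute)
    then show "(x \<bullet> (u + l *\<^sub>R v)) ^ k = (\<Sum>i\<le>k. (real (k choose i) * l ^ i) * ((x \<bullet> u) ^ (k - i) * (x \<bullet> v) ^ i))"
      by (simp add: binomial_ring power_mult_distrib mult_ac)
  qed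
  also have "\<dots> = (\<Sum>i\<le>k. (real (k choose i) * l ^ i) * (\<integral>x. (x \<bullet> u) ^ (k - i) * (x \<bullet> v) ^ i \<partial>K_measure))"
    by (subst Bochner_Integration.integral_sum) (use i in auto)
  finally show ?thesis by (simp add: moment_poly_def poly_sum poly_monom mult_ac)
qed

end

section \<open>The Stieltjes transform along a line avoiding the origin\<close>

locale body_line = convex_body +
  fixes u v :: 'a
  assumes nonzero: "\<And>l. u + l *\<^sub>R v \<noteq> 0"
begin

sublocale moment_family "moment_poly u v" "measure K_measure UNIV" "coordinate_bound u v"
  "\<lambda>l. h_minus K (u + l *\<^sub>R v)" "\<lambda>l. h_plus K (u + l *\<^sub>R v)"
proof
  show "0 < coordinate_bound u v" by (rule coordinate_bound(1))
  show "norm (poly (moment_poly u v k) l) \<le> measure K_measure UNIV * (coordinate_bound u v * (1 + norm l)) ^ k" for k l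
    by (rule moment_poly_bound)
  show "h_minus K (u + l *\<^sub>R v) < h_plus K (u + l *\<^sub>R v)" for l
    by (rule h_minus_less_h_plus[OF nonzero])
  show "continuous_on UNIV (\<lambda>l. h_minus K (u + l *\<^sub>R v))"
    by (intro continuous_on_compose2[OF continuous_h_minus] continuous_intros) auto
  show "continuous_on UNIV (\<lambda>l. h_plus K (u + l *\<^sub>R v))"
    by (intro continuous_on_compose2[OF continuous_h_plus] continuous_intros) auto
qed simp

text \<open>Termwise integration of the geometric series for \<open>1 / (z - s)\<close>, which
  converges uniformly on \<open>K\<close> because \<open>|s|\<close> is bounded by
  \<open>radius\<close>.\<close>

lemma stieltjes_integral:
  assumes z: "norm z > radius (of_real l)"
  shows "stieltjes (of_real l) z = (\<integral>x. 1 / (z - of_real (x \<bullet> (u + l *\<^sub>R v))) \<partial>K_measure)"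
proof -
  interpret finite_measure K_measure by (rule finite_K_measure)
  define \<xi> where "\<xi> = u + l *\<^sub>R v"
  define r where "r = radius (of_real l)"
  have r: "r > 0" unfolding r_def by (rule radius_pos)
  have xr: "\<bar>x \<bullet> \<xi>\<bar> \<le> r" if "x \<in> K" for x
    using line_bound[of x u l v] that closure_subset[of K] by (auto simp: r_def radius_def \<xi>_def)
  define w where "w = 1 / z"
  have z0: "z \<noteq> 0" using z r by (auto simp: r_def)
  have w: "r * norm w < 1" using z r by (simp add: w_def norm_divide r_def divide_less_eq)
  define g where "g = (\<lambda>k x. complex_of_real ((x \<bullet> \<xi>) ^ k) * w ^ Suc k)"
  have gb: "norm (g k x) \<le> norm w * (r * norm w) ^ k" if "x \<in> K" for k x
  proof -
    have "\<bar>x \<bullet> \<xi>\<bar> ^ k \<le> r ^ k" using xr[OF that] by (intro power_mono) auto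
    then have "\<bar>x \<bullet> \<xi>\<bar> ^ k * norm w ^ Suc k \<le> r ^ k * norm w ^ Suc k" by (rule mult_right_mono) simp
    then show ?thesis by (simp add: g_def norm_mult norm_power power_abs power_mult_distrib mult_ac)
  qed
  have g_meas: "g k \<in> borel_measurable borel" for k unfolding g_def by measurable
  have geo: "summable (\<lambda>k. c * (norm w * (r * norm w) ^ k))" for c
    using w r by (intro summable_mult summable_geometric) auto
  have gi: "integrable K_measure (g k)" for k by (rule bounded_integrable[OF g_meas gb])
  have sum_g: "(\<Sum>k. g k x) = 1 / (z - of_real (x \<bullet> \<xi>))" if "x \<in> K" for x
  proof -
    define y where "y = complex_of_real (x \<bullet> \<xi>) * w"
    have "norm y \<le> r * norm w" using xr[OF that] by (simp add: y_def norm_mult mult_right_mono)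
    then have ny: "norm y < 1" using w by simp
    have "(\<Sum>k. g k x) = (\<Sum>k. w * y ^ k)" by (simp add: g_def y_def power_mult_distrib mult_ac)
    also have "\<dots> = w * (1 / (1 - y))" using ny by (simp add: suminf_mult suminf_geometric summable_geometric)
    also have "\<dots> = 1 / (z - of_real (x \<bullet> \<xi>))"
      using z0 by (simp add: y_def w_def divide_simps)
    finally show ?thesis .
  qed
  have "(\<lambda>k. \<integral>x. g k x \<partial>K_measure) sums (\<integral>x. (\<Sum>k. g k x) \<partial>K_measure)"
  proof (rule sums_integral[OF gi])
    show "AE x in K_measure. summable (\<lambda>k. norm (g k x))"
      by (rule AE_K_measure) (use gb in \<open>auto intro!: summable_comparison_test'[OF geo[of 1]]\<close>)
    show "summable (\<lambda>k. \<integral>x. norm (g k x) \<partial>K_measure)"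
    proof (rule summable_comparison_test'[OF geo[of "measure K_measure UNIV"]])
      fix k
      have "\<bar>\<integral>x. norm (g k x) \<partial>K_measure\<bar> \<le> measure K_measure UNIV * (norm w * (r * norm w) ^ k)"
        by (rule integral_norm_le) (use g_meas gb in auto)
      then show "norm (\<integral>x. norm (g k x) \<partial>K_measure) \<le> measure K_measure UNIV * (norm w * (r * norm w) ^ k)" by simp
    qed
  qed
  also have "(\<integral>x. (\<Sum>k. g k x) \<partial>K_measure) = (\<integral>x. 1 / (z - of_real (x \<bullet> \<xi>)) \<partial>K_measure)"
  proof (rule integral_cong_AE)
    show "AE x in K_measure. (\<Sum>k. g k x) = 1 / (z - of_real (x \<bullet> \<xi>))"
      by (rule AE_K_measure) (rule sum_g)
  qed (use g_meas in measurable)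
  also have "(\<lambda>k. \<integral>x. g k x \<partial>K_measure) = (\<lambda>k. poly (moment_poly u v k) (of_real l) * w ^ Suc k)"
    by (simp only: g_def moment_poly_real \<xi>_def integral_mult_left_zero integral_complex_of_real)
  finally have "(\<lambda>k. fps_nth (series (of_real l)) (Suc k) * w ^ Suc k) sums (\<integral>x. 1 / (z - of_real (x \<bullet> \<xi>)) \<partial>K_measure)"
    by (simp add: series_def)
  then have "(\<lambda>k. fps_nth (series (of_real l)) k * w ^ k) sums (\<integral>x. 1 / (z - of_real (x \<bullet> \<xi>)) \<partial>K_measure)"
    by (rule sums_Suc_imp[rotated]) (simp add: series_def)
  then show ?thesis by (simp add: stieltjes_def eval_fps_def sums_iff w_def \<xi>_def)
qed

text \<open>For \<open>\<xi> = N * \<eta>\<close> with \<open>\<eta>\<close> a unit vector and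
  \<open>c = 1 / N\<close>, the transform at \<open>\<xi>\<close> is \<open>c * F (c * z)\<close>
  with \<open>F\<close> the Cauchy transform at \<open>\<eta>\<close>. The relation for
  \<open>\<eta>\<close> is transported by this substitution, and the roots are scaled by
  \<open>N\<close>, in agreement with the homogeneity of the support functions.\<close>

lemma quadratic_at_line:
  assumes hil: "\<And>\<xi>. norm \<xi> = 1 \<Longrightarrow> \<exists>B. \<forall>t\<in>{h_minus K \<xi><..<h_plus K \<xi>}.
     has_hilbert_transform (sectional_volume K \<xi>) t (poly B t)"
  shows "\<exists>P T. quadratic_at l P T"
proof -
  define \<xi> where "\<xi> = u + l *\<^sub>R v"
  define N where "N = norm \<xi>"
  have N: "N > 0" using nonzero by (simp add: N_def \<xi>_def)
  define \<eta> where "\<eta> = \<xi> /\<^sub>R N"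
  have \<eta>: "norm \<eta> = 1" "\<xi> = N *\<^sub>R \<eta>" using N by (auto simp: \<eta>_def N_def)
  interpret section_profile "sectional_volume K \<eta>" "h_minus K \<eta>" "h_plus K \<eta>" volume_bound
     "volume_bound * real (DIM('a) - 1)"
    by (rule section_profile_K[OF \<eta>(1)])
  obtain B where B: "\<forall>t\<in>{h_minus K \<eta><..<h_plus K \<eta>}. has_hilbert_transform (sectional_volume K \<eta>) t (poly B t)"
    using hil[OF \<eta>(1)] by blast
  obtain P T where PT: "T \<noteq> 0" "\<And>z. z \<notin> segment \<Longrightarrow> (cauchy z - poly P z)\<^sup>2 = poly T z"
    "\<And>z. odd (order z T) \<longleftrightarrow> z \<in> {of_real (h_minus K \<eta>), of_real (h_plus K \<eta>)}"
    by (rule cauchy_discriminant[OF bspec[OF B] sectional_volume_pos[OF \<eta>(1)]], assumption, assumption, rule that)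
  define c where "c = complex_of_real (1 / N)"
  have c: "c \<noteq> 0" using N by (simp add: c_def)
  define P' where "P' = smult c (pcompose P [:0, c:])"
  define T' where "T' = smult (c\<^sup>2) (pcompose T [:0, c:])"
  have st: "stieltjes (of_real l) z = c * cauchy (c * z)" if z: "norm z > radius (of_real l)" for z
  proof -
    have "stieltjes (of_real l) z = (\<integral>x. 1 / (z - of_real (N * (x \<bullet> \<eta>))) \<partial>K_measure)"
      using stieltjes_integral[OF z] by (simp add: \<xi>_def[symmetric] \<eta>(2))
    also have "\<dots> = (\<integral>t. sectional_volume K \<eta> t *\<^sub>R (1 / (z - of_real (N * t))) \<partial>lborel)"
      by (rule integral_sections[OF \<eta>(1)]) measurable
    also have "\<dots> = (\<integral>t. c * (of_real (sectional_volume K \<eta> t) / (c * z - of_real t)) \<partial>lborel)"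
    proof (rule Bochner_Integration.integral_cong[OF refl])
      fix t
      have "z - of_real (N * t) = (c * z - of_real t) / c" using N by (simp add: c_def field_simps)
      then show "sectional_volume K \<eta> t *\<^sub>R (1 / (z - of_real (N * t))) = c * (of_real (sectional_volume K \<eta> t) / (c * z - of_real t))"
        by (simp add: scaleR_conv_of_real)
    qed
    finally show ?thesis unfolding cauchy_def by (simp only: integral_mult_right_zero)
  qed
  have hN: "h_minus K \<xi> = N * h_minus K \<eta>" "h_plus K \<xi> = N * h_plus K \<eta>"
    using N by (simp_all add: \<eta>(2) h_minus_scale h_plus_scale)
  \<comment> \<open>All values \<open>x \<bullet> \<xi>\<close> on the closure, in particular both
    ends, are at most \<open>radius\<close> in modulus.\<close>
  have off: "c * z \<notin> segment" if z: "norm z > radius (of_real l)" for z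
  proof
    assume "c * z \<in> segment"
    then obtain t where t: "c * z = of_real t" "t \<in> {h_minus K \<eta>..h_plus K \<eta>}" by auto
    have zt: "z = of_real (N * t)" using t(1) N by (simp add: c_def field_simps)
    obtain x where x: "x \<in> closure K" "x \<bullet> \<xi> = h_plus K \<xi>" using h_plus_attained by metis
    obtain y where y: "y \<in> closure K" "y \<bullet> (-\<xi>) = h_plus K (-\<xi>)" using h_plus_attained by metis
    have "\<bar>N * t\<bar> \<le> coordinate_bound u v * (1 + \<bar>l\<bar>)"
    proof -
      have "N * h_minus K \<eta> \<le> N * t" "N * t \<le> N * h_plus K \<eta>" using t(2) N by auto
      then show ?thesis
        using line_bound[OF x(1), of u l v] line_bound[OF y(1), of u l v] x(2) y(2) hN
        by (simp add: \<xi>_def[symmetric] h_minus_eq abs_le_iff)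
    qed
    then have "norm z \<le> radius (of_real l)" unfolding zt norm_of_real by (simp add: radius_def)
    then show False using z by simp
  qed
  have "quadratic_at l P' T'"
    unfolding quadratic_at_def
  proof (intro conjI allI impI)
    show "T' \<noteq> 0" unfolding T'_def using c order_pcompose_scale(2)[OF PT(1) c] by simp
    fix z
    show "odd (order z T') \<longleftrightarrow> z \<in> {of_real (h_minus K (u + l *\<^sub>R v)), of_real (h_plus K (u + l *\<^sub>R v))}"
    proof -
      have "order z T' = order (c * z) T"
        unfolding T'_def using c order_pcompose_scale(1)[OF PT(1) c, of z] by (simp add: order_smult)
      moreover have "c * z = of_real t \<longleftrightarrow> z = of_real (N * t)" for t
        using N by (auto simp: c_def field_simps)
      ultimately show ?thesis using PT(3)[of "c * z"] by (simp add: \<xi>_def[symmetric] hN)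
    qed
    assume z: "norm z > radius (of_real l)"
    have "(stieltjes (of_real l) z - poly P' z)\<^sup>2 = c\<^sup>2 * (cauchy (c * z) - poly P (c * z))\<^sup>2"
      unfolding st[OF z] P'_def by (simp add: poly_pcompose mult.commute flip: power_mult_distrib right_diff_distrib)
    also have "\<dots> = poly T' z" using PT(2)[OF off[OF z]] by (simp add: T'_def poly_pcompose mult.commute)
    finally show "(stieltjes (of_real l) z - poly P' z)\<^sup>2 = poly T' z" .
  qed
  then show ?thesis by blast
qed

lemma endpoints_along_line:
  assumes hil: "\<And>\<xi>. norm \<xi> = 1 \<Longrightarrow> \<exists>B. \<forall>t\<in>{h_minus K \<xi><..<h_plus K \<xi>}.
     has_hilbert_transform (sectional_volume K \<xi>) t (poly B t)"
  shows "\<exists>c d. \<forall>l. h_minus K (u + l *\<^sub>R v) + h_plus K (u + l *\<^sub>R v) = c + l * d"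
    "\<exists>c d e. \<forall>l. h_minus K (u + l *\<^sub>R v) * h_plus K (u + l *\<^sub>R v) = c + l * d + l\<^sup>2 * e"
proof -
  obtain s p :: "complex poly" where sp: "degree s \<le> 1" "degree p \<le> 2"
    "\<And>l. of_real (h_minus K (u + l *\<^sub>R v) + h_plus K (u + l *\<^sub>R v)) = poly s (of_real l)"
    "\<And>l. of_real (h_minus K (u + l *\<^sub>R v) * h_plus K (u + l *\<^sub>R v)) = poly p (of_real l)"
    using endpoints_polynomial[OF quadratic_at_line[OF hil]] by blast
  have s: "poly s z = coeff s 0 + coeff s 1 * z" for z
  proof -
    have "poly s z = poly (\<Sum>i\<le>1. monom (coeff s i) i) z" using sp(1) by (simp only: poly_as_sum_of_monoms')
    then show ?thesis by (simp add: poly_monom)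
  qed
  have p: "poly p z = coeff p 0 + coeff p 1 * z + coeff p 2 * z\<^sup>2" for z
  proof -
    have "poly p z = poly (\<Sum>i\<le>2. monom (coeff p i) i) z" using sp(2) by (simp only: poly_as_sum_of_monoms')
    then show ?thesis by (simp add: poly_monom numeral_2_eq_2)
  qed
  have "h_minus K (u + l *\<^sub>R v) + h_plus K (u + l *\<^sub>R v) = Re (coeff s 0) + l * Re (coeff s 1)" for l
    using arg_cong[OF sp(3)[of l], of Re] by (simp add: s mult.commute)
  then show "\<exists>c d. \<forall>l. h_minus K (u + l *\<^sub>R v) + h_plus K (u + l *\<^sub>R v) = c + l * d" by blast
  have "h_minus K (u + l *\<^sub>R v) * h_plus K (u + l *\<^sub>R v) = Re (coeff p 0) + l * Re (coeff p 1) + l\<^sup>2 * Re (coeff p 2)" for l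
    using arg_cong[OF sp(4)[of l], of Re] by (simp add: p mult.commute flip: of_real_power)
  then show "\<exists>c d e. \<forall>l. h_minus K (u + l *\<^sub>R v) * h_plus K (u + l *\<^sub>R v) = c + l * d + l\<^sup>2 * e" by blast
qed

end

section \<open>Quadratic support functions\<close>

text \<open>Quadratic behaviour along every line, with \<open>W\<close> itself as top coefficient,
  forces \<open>W\<close> to be a quadratic form. In the application \<open>W\<close> is the squared
  half-width.\<close>

locale positive_quadratic =
  fixes W :: "'a::euclidean_space \<Rightarrow> real"
  assumes line: "\<And>u v. \<exists>\<beta>. \<forall>l. W (u + l *\<^sub>R v) = W u + l * \<beta> + l\<^sup>2 * W v"
    and pos: "\<And>u. u \<noteq> 0 \<Longrightarrow> W u > 0" and zero: "W 0 = 0"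
begin

definition polar :: "'a \<Rightarrow> 'a \<Rightarrow> real" where
  "polar u v = W (u + v) - W u - W v"

lemma W_line: "W (u + l *\<^sub>R v) = W u + l * polar u v + l\<^sup>2 * W v"
proof -
  obtain \<beta> where \<beta>: "\<And>l. W (u + l *\<^sub>R v) = W u + l * \<beta> + l\<^sup>2 * W v" using line by blast
  have "polar u v = \<beta>" using \<beta>[of 1] by (simp add: polar_def)
  then show ?thesis using \<beta> by simp
qed

lemma W_scale: "W (c *\<^sub>R v) = c\<^sup>2 * W v"
  using W_line[of 0 c v] by (simp add: zero polar_def)

lemma parallelogram: "W (u + v) + W (u - v) = 2 * W u + 2 * W v"
  using W_line[of u 1 v] W_line[of u "-1" v] by simp

lemma polar_commute: "polar u v = polar v u"
  by (simp add: polar_def add.commute)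

text \<open>The Jordan-von Neumann argument: additivity is a linear combination of four instances of
  the parallelogram law.\<close>

lemma polar_add: "polar u (v + w) = polar u v + polar u w"
  using parallelogram[of "u + v" w] parallelogram[of u "v - w"] parallelogram[of "u + w" v] parallelogram[of v w]
  by (simp add: polar_def algebra_simps)

lemma polar_scale: "polar u (c *\<^sub>R v) = c * polar u v"
  using W_line[of u c v] by (simp add: polar_def W_scale)

lemma polar_self: "polar u u = 2 * W u"
  using W_scale[of 2 u] by (simp add: polar_def scaleR_2)

lemma polar_linear: "linear (polar u)"
  by (rule linearI) (simp_all add: polar_add polar_scale)

text \<open>Gram-Schmidt for the form \<open>polar\<close>. The normalisation is 2 because
  \<open>polar u u = 2 * W u\<close>.\<close>

lemma orthonormal_family:
  assumes "finite J" "independent J"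
  shows "\<exists>e. (\<forall>i\<in>J. e i \<in> span J) \<and> (\<forall>i\<in>J. \<forall>j\<in>J. polar (e i) (e j) = (if i = j then 2 else 0))"
  using assms
proof (induction J rule: finite_induct)
  case (insert b J)
  then have indJ: "independent J" and b: "b \<notin> span J" using insert.prems insert.hyps(2) independent_insert[of b J] by simp_all
  obtain e where e: "\<And>i. i \<in> J \<Longrightarrow> e i \<in> span J"
    "\<And>i j. i \<in> J \<Longrightarrow> j \<in> J \<Longrightarrow> polar (e i) (e j) = (if i = j then 2 else 0)"
    using insert.IH[OF indJ] by blast
  define w where "w = b - (\<Sum>j\<in>J. (polar b (e j) / 2) *\<^sub>R e j)"
  have sJ: "(\<Sum>j\<in>J. (polar b (e j) / 2) *\<^sub>R e j) \<in> span J" using e(1) by (intro span_sum span_scale) auto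
  have w0: "w \<noteq> 0" using b sJ by (auto simp: w_def)
  have mono: "span J \<subseteq> span (insert b J)" by (rule span_mono) auto
  have ws: "w \<in> span (insert b J)"
    unfolding w_def by (intro span_diff subsetD[OF mono sJ] span_base) simp
  have we: "polar (e i) w = 0" if "i \<in> J" for i
  proof -
    interpret linear "polar (e i)" by (rule polar_linear)
    have "polar (e i) w = polar (e i) b - (\<Sum>j\<in>J. (polar b (e j) / 2) * polar (e i) (e j))"
      by (simp add: w_def diff sum scale)
    also have "(\<Sum>j\<in>J. (polar b (e j) / 2) * polar (e i) (e j)) = (\<Sum>j\<in>J. if j = i then polar b (e i) else 0)"
      by (rule sum.cong) (use e(2)[OF that] in auto)
    finally show ?thesis using that insert.hyps(1) by (simp add: polar_commute)
  qed
  define r where "r = 1 / sqrt (W w)"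
  have Ww: "W w > 0" by (rule pos[OF w0])
  define e' where "e' = e(b := r *\<^sub>R w)"
  have "polar (e' i) (e' j) = (if i = j then 2 else 0)" if ij: "i \<in> insert b J" "j \<in> insert b J" for i j
  proof -
    have rr: "polar (r *\<^sub>R w) (r *\<^sub>R w) = 2"
    proof -
      have "polar (r *\<^sub>R w) (r *\<^sub>R w) = 2 * (r\<^sup>2 * W w)" by (simp add: polar_self W_scale)
      also have "r\<^sup>2 * W w = 1" using Ww by (simp add: r_def power_divide)
      finally show ?thesis by simp
    qed
    consider "i \<in> J" "j \<in> J" | "i = b" "j \<in> J" | "i \<in> J" "j = b" | "i = b" "j = b" using ij by blast
    then show ?thesis
    proof cases
      case 1 then show ?thesis using e(2) insert.hyps(2) by (auto simp: e'_def)
    next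
      case 2 then show ?thesis using we[of j] insert.hyps(2) by (auto simp: e'_def polar_commute[of "r *\<^sub>R w"] polar_scale)
    next
      case 3 then show ?thesis using we[of i] insert.hyps(2) by (auto simp: e'_def polar_scale)
    next
      case 4 then show ?thesis using rr by (simp add: e'_def)
    qed
  qed
  moreover have "e' i \<in> span (insert b J)" if "i \<in> insert b J" for i
    using that ws e(1) mono by (auto simp: e'_def intro: span_scale)
  ultimately show ?case by blast
qed auto

lemma isometry_exists:
  obtains G :: "'a \<Rightarrow> 'a" where "linear G" "\<And>x. W (G x) = (norm x)\<^sup>2"
proof -
  obtain e :: "'a \<Rightarrow> 'a" where e: "\<And>i j. i \<in> Basis \<Longrightarrow> j \<in> Basis \<Longrightarrow> polar (e i) (e j) = (if i = j then 2 else 0)"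
    using orthonormal_family[OF finite_Basis independent_Basis] by blast
  define G where "G = (\<lambda>x::'a. \<Sum>b\<in>Basis. (x \<bullet> b) *\<^sub>R e b)"
  have "linear G" unfolding G_def
    by (rule linearI) (simp_all add: inner_add_left scaleR_add_left sum.distrib scaleR_sum_right)
  moreover have "W (G x) = (norm x)\<^sup>2" for x
  proof -
    have lin: "polar (\<Sum>b\<in>Basis. f b *\<^sub>R e b) y = (\<Sum>b\<in>Basis. f b * polar (e b) y)" for f y
    proof -
      interpret linear "polar y" by (rule polar_linear)
      show ?thesis by (simp add: polar_commute[of _ y] sum scale)
    qed
    have "2 * W (G x) = (\<Sum>b\<in>Basis. (x \<bullet> b) * polar (e b) (G x))"
      by (simp add: polar_self[symmetric]) (simp add: G_def lin)
    also have "\<dots> = (\<Sum>b\<in>Basis. (x \<bullet> b) * (\<Sum>c\<in>Basis. (x \<bullet> c) * polar (e c) (e b)))"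
      by (simp add: polar_commute[of _ "G x"]) (simp add: G_def lin)
    also have "\<dots> = (\<Sum>b\<in>Basis. (x \<bullet> b) * (\<Sum>c\<in>Basis. if c = b then 2 * (x \<bullet> b) else 0))"
      by (intro sum.cong refl arg_cong2[where f="(*)"]) (simp add: e)
    also have "\<dots> = 2 * (\<Sum>b\<in>Basis. (x \<bullet> b) * (x \<bullet> b))"
      by (simp add: sum_distrib_left mult.left_commute)
    also have "(\<Sum>b\<in>Basis. (x \<bullet> b) * (x \<bullet> b)) = (norm x)\<^sup>2"
      unfolding power2_norm_eq_inner by (rule euclidean_inner[symmetric])
    finally show ?thesis by simp
  qed
  ultimately show ?thesis using that by blast
qed

end

lemma dependent_pair:
  fixes u v :: "'a::real_vector"
  assumes "\<not> (\<forall>l. u + l *\<^sub>R v \<noteq> 0)" obtains c where "u = c *\<^sub>R v"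
proof -
  obtain l where "u + l *\<^sub>R v = 0" using assms by blast
  then have "u = (- l) *\<^sub>R v" by (simp add: eq_neg_iff_add_eq_0)
  then show ?thesis by (rule that)
qed

text \<open>Comparing \<open>g (u + l v)\<close> with \<open>l^n g (v + u/l)\<close> as \<open>l \<rightarrow> \<infinity>\<close> identifies the top coefficient.\<close>

lemma homogeneous_top_coefficient:
  fixes g :: "'a::euclidean_space \<Rightarrow> real"
  assumes cont: "continuous_on UNIV g" and hom: "\<And>c x. c > 0 \<Longrightarrow> g (c *\<^sub>R x) = c ^ n * g x"
    and q: "((\<lambda>l. q l / l ^ n) \<longlongrightarrow> d) at_top" and eq: "\<And>l. g (u + l *\<^sub>R v) = q l"
  shows "d = g v"
proof -
  have "((\<lambda>l::real. inverse l *\<^sub>R u + v) \<longlongrightarrow> 0 *\<^sub>R u + v) at_top"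
    by (intro tendsto_intros tendsto_inverse_0_at_top filterlim_ident)
  then have "((\<lambda>l::real. g (inverse l *\<^sub>R u + v)) \<longlongrightarrow> g (0 *\<^sub>R u + v)) at_top"
    using cont by (intro isCont_tendsto_compose[of _ g]) (auto simp: continuous_on_eq_continuous_at)
  moreover have "\<forall>\<^sub>F l in at_top. g (inverse l *\<^sub>R u + v) = q l / l ^ n"
  proof (rule eventually_mono[OF eventually_gt_at_top[of 0]])
    fix l :: real assume l: "0 < l"
    have "g (l *\<^sub>R (inverse l *\<^sub>R u + v)) = l ^ n * g (inverse l *\<^sub>R u + v)" by (rule hom[OF l])
    moreover have "l *\<^sub>R (inverse l *\<^sub>R u + v) = u + l *\<^sub>R v" using l by (simp add: scaleR_add_right)
    ultimately show "g (inverse l *\<^sub>R u + v) = q l / l ^ n" using l eq[of l] by simp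
  qed
  ultimately have "((\<lambda>l. q l / l ^ n) \<longlongrightarrow> g v) at_top" using tendsto_cong by fastforce
  with q show ?thesis by (rule tendsto_unique[rotated]) simp
qed

context convex_body
begin

text \<open>A point outside \<open>K\<close> is at least weakly separated from it by a hyperplane,
  and the strict inequality in that direction excludes even this.\<close>

lemma mem_if_below_support:
  assumes "\<And>\<xi>. \<xi> \<noteq> 0 \<Longrightarrow> x \<bullet> \<xi> < h_plus K \<xi>"
  shows "x \<in> K"
proof (rule ccontr)
  assume "x \<notin> K"
  have "convex ((\<lambda>y. y - x) ` K)" using convex_K by (simp add: convex_translation_subtract_eq)
  moreover have "0 \<notin> (\<lambda>y. y - x) ` K" using \<open>x \<notin> K\<close> by auto
  ultimately obtain a where a: "a \<noteq> 0" "\<And>y. y \<in> K \<Longrightarrow> 0 \<le> a \<bullet> (y - x)"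
    using separating_hyperplane_set_0 by (metis imageI)
  have "h_plus K (-a) \<le> x \<bullet> (-a)"
  proof (rule ccontr)
    assume "\<not> ?thesis"
    then obtain y where "y \<in> K" "x \<bullet> (-a) < y \<bullet> (-a)" using exists_above by (meson not_le)
    then show False using a(2)[of y] by (simp add: inner_diff_right inner_commute)
  qed
  then show False using assms[of "-a"] a(1) by simp
qed

text \<open>The linear function \<open>h_minus + h_plus\<close> is twice the inner product with a
  centre \<open>x0\<close>, and the squared half-width is a positive definite form. In coordinates
  \<open>G\<close> that make this form the squared norm, the support function minus
  \<open>x0\<close> is the norm of the coordinate vector, which is the support function of a linear
  image of the ball.\<close>

lemma ellipsoid_if_quadratic_support:
  assumes lin: "\<And>u v. (\<And>l. u + l *\<^sub>R v \<noteq> 0) \<Longrightarrow>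
      \<exists>c d. \<forall>l. h_minus K (u + l *\<^sub>R v) + h_plus K (u + l *\<^sub>R v) = c + l * d"
    and quad: "\<And>u v. (\<And>l. u + l *\<^sub>R v \<noteq> 0) \<Longrightarrow>
      \<exists>c d e. \<forall>l. h_minus K (u + l *\<^sub>R v) * h_plus K (u + l *\<^sub>R v) = c + l * d + l\<^sup>2 * e"
  shows "is_ellipsoid K"
proof -
  define s where "s = (\<lambda>\<xi>. h_minus K \<xi> + h_plus K \<xi>)"
  define W where "W = (\<lambda>\<xi>. ((h_plus K \<xi> - h_minus K \<xi>) / 2)\<^sup>2)"
  have neg: "h_minus K (- \<xi>) = - h_plus K \<xi>" "h_plus K (- \<xi>) = - h_minus K \<xi>" for \<xi>
    by (simp_all add: h_minus_eq)
  have h0: "h_plus K 0 = 0" "h_minus K 0 = 0" using h_plus_scale[of 0 0] h_minus_scale[of 0 0] by auto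
  have s_scale: "s (c *\<^sub>R \<xi>) = c * s \<xi>" for c \<xi>
  proof (cases "c \<ge> 0")
    case False
    then have "h_plus K ((-c) *\<^sub>R (-\<xi>)) = (-c) * h_plus K (-\<xi>)" "h_minus K ((-c) *\<^sub>R (-\<xi>)) = (-c) * h_minus K (-\<xi>)"
      by (intro h_plus_scale h_minus_scale; simp)+
    then show ?thesis by (simp add: s_def neg algebra_simps)
  qed (simp add: s_def h_plus_scale h_minus_scale algebra_simps)
  have W_scale: "W (c *\<^sub>R \<xi>) = c\<^sup>2 * W \<xi>" for c \<xi>
  proof (cases "c \<ge> 0")
    case True
    then show ?thesis by (simp add: W_def h_plus_scale h_minus_scale power_divide flip: right_diff_distrib power_mult_distrib)
  next
    case False
    then have "h_plus K ((-c) *\<^sub>R (-\<xi>)) = (-c) * h_plus K (-\<xi>)" "h_minus K ((-c) *\<^sub>R (-\<xi>)) = (-c) * h_minus K (-\<xi>)"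
      by (intro h_plus_scale h_minus_scale; simp)+
    then have "h_plus K (c *\<^sub>R \<xi>) = c * h_minus K \<xi>" "h_minus K (c *\<^sub>R \<xi>) = c * h_plus K \<xi>" by (simp_all add: neg)
    then show ?thesis by (simp add: W_def power_divide power2_commute[of "h_plus K \<xi>"] flip: right_diff_distrib power_mult_distrib)
  qed
  have cont: "continuous_on UNIV s" "continuous_on UNIV W"
    unfolding s_def W_def by (intro continuous_intros continuous_h_plus continuous_h_minus; simp)+
  \<comment> \<open>Lines through the origin are not covered by \<open>lin\<close>; there
    \<open>u\<close> is a multiple of \<open>v\<close> and homogeneity suffices.\<close>
  have s_add: "s (u + v) = s u + s v" for u v
  proof (cases "\<forall>l. u + l *\<^sub>R v \<noteq> 0")
    case True
    then obtain c d where cd: "\<And>l. s (u + l *\<^sub>R v) = c + l * d" using lin[of u v] by (auto simp: s_def)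
    have "d = s v"
    proof (rule homogeneous_top_coefficient[OF cont(1), of 1])
      show "((\<lambda>l. (c + l * d) / l ^ 1) \<longlongrightarrow> d) at_top" by real_asymp
    qed (use cd s_scale in auto)
    then show ?thesis using cd[of 0] cd[of 1] by simp
  next
    case False
    then obtain c where "u = c *\<^sub>R v" by (rule dependent_pair)
    then have "u + v = (c + 1) *\<^sub>R v" by (simp add: scaleR_add_left)
    then show ?thesis using \<open>u = c *\<^sub>R v\<close> by (simp only: s_scale) (simp add: algebra_simps)
  qed
  have W_line: "\<exists>\<beta>. \<forall>l. W (u + l *\<^sub>R v) = W u + l * \<beta> + l\<^sup>2 * W v" for u v
  proof (cases "\<forall>l. u + l *\<^sub>R v \<noteq> 0")
    case True
    then obtain c d e where cde: "\<And>l. h_minus K (u + l *\<^sub>R v) * h_plus K (u + l *\<^sub>R v) = c + l * d + l\<^sup>2 * e"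
      using quad[of u v] by blast
    \<comment> \<open>A quarter of \<open>(p - m)^2\<close> is a quarter of \<open>(p + m)^2\<close>
      minus \<open>p * m\<close>, so \<open>W\<close> is expressed through the sum and the
      product.\<close>
    have Weq: "W \<xi> = (s \<xi>)\<^sup>2 / 4 - h_minus K \<xi> * h_plus K \<xi>" for \<xi>
      by (simp add: W_def s_def power2_eq_square field_simps)
    define A B D where "A = (s u)\<^sup>2 / 4 - c" and "B = s u * s v / 2 - d" and "D = (s v)\<^sup>2 / 4 - e"
    have eq: "W (u + l *\<^sub>R v) = A + l * B + l\<^sup>2 * D" for l
      unfolding Weq cde s_add s_scale A_def B_def D_def by (simp add: power2_eq_square field_simps)
    have "D = W v"
    proof (rule homogeneous_top_coefficient[OF cont(2), of 2])
      show "((\<lambda>l. (A + l * B + l\<^sup>2 * D) / l ^ 2) \<longlongrightarrow> D) at_top" by real_asymp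
    qed (use eq W_scale in auto)
    moreover have "A = W u" using eq[of 0] by simp
    ultimately show ?thesis using eq by blast
  next
    case False
    then obtain c where u: "u = c *\<^sub>R v" by (rule dependent_pair)
    have "W (u + l *\<^sub>R v) = W u + l * (2 * c * W v) + l\<^sup>2 * W v" for l
    proof -
      have "u + l *\<^sub>R v = (c + l) *\<^sub>R v" by (simp add: u scaleR_add_left)
      then show ?thesis by (simp only: u W_scale) (simp add: power2_eq_square algebra_simps)
    qed
    then show ?thesis by blast
  qed
  interpret positive_quadratic W
  proof
    show "W u > 0" if "u \<noteq> 0" for u using h_minus_less_h_plus[OF that] by (simp add: W_def)
    show "W 0 = 0" by (simp add: W_def h0)
  qed (rule W_line)
  obtain G :: "'a \<Rightarrow> 'a" where G: "linear G" "\<And>x. W (G x) = (norm x)\<^sup>2" using isometry_exists by blast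
  have "inj G"
    using linear_injective_0[OF G(1)] G(2) pos zero by (metis norm_eq_zero zero_eq_power2)
  then have surjG: "surj G" using linear_injective_imp_surjective[OF G(1)] by blast
  \<comment> \<open>Support functions transform by the adjoint: \<open>S\<close> takes
    \<open>K - x0\<close> to the unit ball.\<close>
  define S where "S = adjoint G"
  have S: "linear S" "\<And>x y. S y \<bullet> x = y \<bullet> G x"
    using adjoint_linear[OF G(1)] adjoint_works[OF G(1)] by (auto simp: S_def inner_commute)
  have "inj S"
  proof (subst linear_injective_0[OF S(1)], intro allI impI)
    fix y assume "S y = 0"
    then have "y \<bullet> G x = 0" for x using S(2)[of y x] by simp
    moreover obtain x where "G x = y" using surjG by (metis surjD)
    ultimately show "y = 0" by (metis inner_eq_zero_iff)
  qed
  then obtain T where T: "linear T" "\<And>x. T (S x) = x" "\<And>x. S (T x) = x"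
    using linear_injective_isomorphism[OF S(1)] by blast
  define x0 where "x0 = (\<Sum>b\<in>Basis. (s b / 2) *\<^sub>R b)"
  have x0: "x0 \<bullet> \<xi> = s \<xi> / 2" for \<xi>
  proof -
    have "linear s" by (rule linearI) (simp_all add: s_add s_scale)
    then interpret linear s .
    have "s \<xi> = s (\<Sum>b\<in>Basis. (\<xi> \<bullet> b) *\<^sub>R b)" by (simp only: euclidean_representation)
    also have "\<dots> = (\<Sum>b\<in>Basis. (\<xi> \<bullet> b) * s b)" by (simp add: sum scale)
    finally have "s \<xi> = (\<Sum>b\<in>Basis. (\<xi> \<bullet> b) * s b)" .
    moreover have "x0 \<bullet> \<xi> = (\<Sum>b\<in>Basis. (\<xi> \<bullet> b) * s b) / 2"
      by (simp add: x0_def inner_sum_left sum_divide_distrib inner_commute[of \<xi>] mult.commute)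
    ultimately show ?thesis by simp
  qed
  have h_eq: "h_plus K (G \<eta>) - x0 \<bullet> G \<eta> = norm \<eta>" for \<eta>
  proof -
    have le: "h_minus K (G \<eta>) \<le> h_plus K (G \<eta>)"
      using h_minus_less_h_plus[of "G \<eta>"] h0 by (cases "G \<eta> = 0") auto
    have "h_plus K (G \<eta>) - x0 \<bullet> G \<eta> = (h_plus K (G \<eta>) - h_minus K (G \<eta>)) / 2"
      unfolding x0 by (simp add: s_def field_simps)
    also have "\<dots> = sqrt (W (G \<eta>))" using le by (simp add: W_def)
    finally show ?thesis by (simp add: G(2))
  qed
  have "x \<in> K \<longleftrightarrow> norm (S (x - x0)) < 1" for x
  proof
    assume x: "x \<in> K"
    show "norm (S (x - x0)) < 1"
    proof (cases "S (x - x0) = 0")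
      case False
      define \<eta> where "\<eta> = S (x - x0)"
      have "G \<eta> \<noteq> 0" using False \<open>inj G\<close> linear_injective_0[OF G(1)] by (auto simp: \<eta>_def)
      then have "x \<bullet> G \<eta> < h_plus K (G \<eta>)" by (rule less_h_plus[OF x])
      then have "(x - x0) \<bullet> G \<eta> < norm \<eta>" using h_eq[of \<eta>] by (simp add: inner_diff_left)
      then have "\<eta> \<bullet> \<eta> < norm \<eta>" using S(2)[of "x - x0" \<eta>] by (simp add: \<eta>_def)
      then show ?thesis using False by (simp add: \<eta>_def dot_square_norm power2_eq_square)
    qed simp
  next
    assume n: "norm (S (x - x0)) < 1"
    show "x \<in> K"
    proof (rule mem_if_below_support)
      fix \<xi> :: 'a assume "\<xi> \<noteq> 0"
      obtain \<eta> where \<eta>: "\<xi> = G \<eta>" using surjG by (metis surjD)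
      have \<eta>0: "\<eta> \<noteq> 0" using \<open>\<xi> \<noteq> 0\<close> \<eta> linear_0[OF G(1)] by auto
      have "(x - x0) \<bullet> \<xi> = S (x - x0) \<bullet> \<eta>" by (simp add: \<eta> S(2))
      also have "\<dots> \<le> norm (S (x - x0)) * norm \<eta>" by (rule norm_cauchy_schwarz)
      also have "\<dots> < norm \<eta>" using n \<eta>0 by simp
      finally show "x \<bullet> \<xi> < h_plus K \<xi>" using h_eq[of \<eta>] by (simp add: \<eta> inner_diff_left)
    qed
  qed
  then have mem: "x \<in> K \<longleftrightarrow> S (x - x0) \<in> ball 0 1" for x by (simp add: dist_norm)
  have "K = (\<lambda>x. x0 + T x) ` ball 0 1"
  proof (intro equalityI subsetI)
    fix x assume "x \<in> K"
    moreover have "x = x0 + T (S (x - x0))" by (simp add: T(2))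
    ultimately show "x \<in> (\<lambda>x. x0 + T x) ` ball 0 1" using mem by (metis imageI)
  next
    fix x assume "x \<in> (\<lambda>x. x0 + T x) ` ball 0 1"
    then obtain y where "y \<in> ball 0 1" "x = x0 + T y" by blast
    then show "x \<in> K" by (simp add: mem T(3))
  qed
  moreover have "inj T" using T(3) by (metis injI)
  ultimately show ?thesis unfolding is_ellipsoid_def using T(1) by blast
qed

end

section \<open>Sections of an ellipsoid\<close>

text \<open>The homothety has to respect membership in \<open>K\<close> only on one hyperplane; it
  need not preserve \<open>K\<close>.\<close>

lemma sectional_volume_similar:
  fixes K :: "'a::euclidean_space set"
  assumes \<xi>: "norm \<xi> = 1" and K: "bounded K" "K \<in> sets borel" and \<rho>: "\<rho> > 0"
    and sim: "\<And>z. z \<bullet> \<xi> = s \<Longrightarrow> z \<in> K \<longleftrightarrow> d + \<rho> *\<^sub>R z \<in> K" and t: "t = d \<bullet> \<xi> + \<rho> * s"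
  shows "sectional_volume K \<xi> t = \<rho> ^ (DIM('a) - 1) * sectional_volume K \<xi> s"
proof -
  let ?J = "Basis - {e0 :: 'a}"
  let ?L = "plane_measure ?J"
  have eq: "plane_section K \<xi> s = {y \<in> space ?L. (\<lambda>i\<in>?J. d \<bullet> rot_to \<xi> i + \<rho> * y i) \<in> plane_section K \<xi> t}"
  proof -
    have "plane_point \<xi> t (\<lambda>i\<in>?J. d \<bullet> rot_to \<xi> i + \<rho> * y i) = d + \<rho> *\<^sub>R plane_point \<xi> s y" for y
    proof -
      have "plane_point \<xi> t (\<lambda>i\<in>?J. d \<bullet> rot_to \<xi> i + \<rho> * y i)
          = plane_point \<xi> (1 * (d \<bullet> \<xi>) + \<rho> * s) (\<lambda>i. 1 * (d \<bullet> rot_to \<xi> i) + \<rho> * y i)"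
        unfolding t by (simp, rule plane_point_cong) simp
      also have "\<dots> = 1 *\<^sub>R d + \<rho> *\<^sub>R plane_point \<xi> s y"
        unfolding plane_point_combine[OF \<xi>] plane_point_self[OF \<xi>] ..
      finally show ?thesis by simp
    qed
    then show ?thesis
      using sim[OF plane_point_inner[OF \<xi>]] by (auto simp: plane_section_def space_PiM)
  qed
  have "ennreal \<rho> ^ card ?J * emeasure ?L (plane_section K \<xi> s) = emeasure ?L (plane_section K \<xi> t)"
    unfolding eq by (rule emeasure_plane_affine) (use \<rho> section_sets[OF \<xi> K(2)] in auto)
  then have "ennreal (\<rho> ^ (DIM('a) - 1) * sectional_volume K \<xi> s) = ennreal (sectional_volume K \<xi> t)"
    using \<rho> by (simp add: emeasure_section_eq[OF \<xi> K(1)] card_Basis_diff ennreal_power ennreal_mult)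
  then show ?thesis using \<rho> by (subst (asm) ennreal_inj) auto
qed

text \<open>Horner induction: every coefficient of \<open>R\<close> at an affine argument is a
  polynomial expression in \<open>\<alpha>\<close> and \<open>\<beta>\<close>. This provides the
  continuous functions \<open>b\<close> of the Hilbert transform representation.\<close>

lemma continuous_coeff_pcompose:
  fixes \<alpha> \<beta> :: "'x::topological_space \<Rightarrow> real"
  assumes "continuous_on S \<alpha>" "continuous_on S \<beta>"
  shows "continuous_on S (\<lambda>\<xi>. coeff (pcompose R [:\<alpha> \<xi>, \<beta> \<xi>:]) j)"
proof (induction R arbitrary: j)
  case (pCons a R)
  have "coeff (pcompose (pCons a R) [:\<alpha> \<xi>, \<beta> \<xi>:]) j = (if j = 0 then a else 0)
     + \<alpha> \<xi> * coeff (pcompose R [:\<alpha> \<xi>, \<beta> \<xi>:]) j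
     + (if j = 0 then 0 else \<beta> \<xi> * coeff (pcompose R [:\<alpha> \<xi>, \<beta> \<xi>:]) (j - 1))" for \<xi>
    by (cases j) (simp_all add: pcompose_pCons)
  then show ?case using assms pCons.IH by (auto intro!: continuous_intros)
qed simp

context convex_body
begin

definition mid :: "'a \<Rightarrow> real" where "mid \<xi> = (h_minus K \<xi> + h_plus K \<xi>) / 2"
definition half_width :: "'a \<Rightarrow> real" where "half_width \<xi> = (h_plus K \<xi> - h_minus K \<xi>) / 2"

lemma half_width_pos: "\<xi> \<noteq> 0 \<Longrightarrow> half_width \<xi> > 0"
  using h_minus_less_h_plus by (simp add: half_width_def)

lemma continuous_mid: "continuous_on S mid" and continuous_half_width: "continuous_on S half_width"
proof -
  have "continuous_on UNIV mid" "continuous_on UNIV half_width"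
    unfolding mid_def half_width_def by (intro continuous_intros continuous_h_plus continuous_h_minus; simp)+
  then show "continuous_on S mid" "continuous_on S half_width" using continuous_on_subset by blast+
qed

lemma interval_rescaled:
  assumes "\<xi> \<noteq> 0"
  shows "t \<in> {h_minus K \<xi><..<h_plus K \<xi>} \<longleftrightarrow> (t - mid \<xi>) / half_width \<xi> \<in> {-1<..<1}"
  using half_width_pos[OF assms] by (auto simp: field_simps mid_def half_width_def)

text \<open>Parallel sections of an ellipsoid are similar, with ratio \<open>sqrt (1 - x^2)\<close>
  to the central one. The central volume is found without determinants: integrating over all heights
  gives the volume of \<open>K\<close>, so it is a constant divided by the half-width.\<close>

lemma ellipsoid_sectional_volume:
  assumes ell: "is_ellipsoid K" and dim: "DIM('a) \<ge> 2"
  obtains C where "\<And>\<xi> t. norm \<xi> = 1 \<Longrightarrow>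
     sectional_volume K \<xi> t = C / half_width \<xi> * semicircle ((t - mid \<xi>) / half_width \<xi>) ^ (DIM('a) - 1)"
proof -
  define m where "m = DIM('a) - 1"
  \<comment> \<open>Outside the interval the formula relies on a positive power of zero being
    zero.\<close>
  have m: "m > 0" using dim by (simp add: m_def)
  obtain T :: "'a \<Rightarrow> 'a" and c where T: "linear T" "inj T" "K = (\<lambda>x. c + T x) ` ball 0 1"
    using ell by (auto simp: is_ellipsoid_def)
  obtain S where S: "linear S" "\<And>x. S (T x) = x" "\<And>x. T (S x) = x"
    using linear_injective_isomorphism[OF T(1,2)] by blast
  have memK: "x \<in> K \<longleftrightarrow> norm (S (x - c)) < 1" for x
  proof
    assume "norm (S (x - c)) < 1"
    then have "S (x - c) \<in> ball 0 1" by simp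
    moreover have "x = c + T (S (x - c))" by (simp add: S(3))
    ultimately show "x \<in> K" unfolding T(3) by (metis imageI)
  qed (auto simp: T(3) S(2))
  have profile: "sectional_volume K \<xi> t = sectional_volume K \<xi> (mid \<xi>) * semicircle ((t - mid \<xi>) / half_width \<xi>) ^ m"
    if \<xi>: "norm \<xi> = 1" for \<xi> t
  proof -
    have \<xi>0: "\<xi> \<noteq> 0" using \<xi> by auto
    \<comment> \<open>Heights become inner products with \<open>g\<close> on the unit ball, so the
      half-width is the norm of \<open>g\<close>, and \<open>c + e\<close> is the point of contact
      with the upper supporting hyperplane.\<close>
    define g where "g = adjoint T \<xi>"
    have g: "g \<bullet> x = \<xi> \<bullet> T x" for x
      unfolding g_def using adjoint_works[OF T(1), of x \<xi>] by (simp add: inner_commute)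
    define \<omega> where "\<omega> = norm g"
    have "\<omega> > 0"
    proof -
      have "g \<bullet> S \<xi> = \<xi> \<bullet> \<xi>" by (simp add: g S(3))
      then have "g \<noteq> 0" using \<xi>0 by auto
      then show ?thesis by (simp add: \<omega>_def)
    qed
    define e where "e = T ((1 / \<omega>) *\<^sub>R g)"
    have e\<xi>: "e \<bullet> \<xi> = \<omega>"
    proof -
      have "e \<bullet> \<xi> = g \<bullet> ((1 / \<omega>) *\<^sub>R g)" by (simp only: g e_def inner_commute)
      then show ?thesis using \<open>\<omega> > 0\<close> by (simp add: \<omega>_def dot_square_norm power2_eq_square)
    qed
    have Se: "S e = (1 / \<omega>) *\<^sub>R g" by (simp add: e_def S(2))
    have val: "x \<bullet> \<xi> - c \<bullet> \<xi> = g \<bullet> S (x - c)" for x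
      by (simp add: g S(3) inner_diff_right inner_commute)
    have up: "h_plus K \<xi> = c \<bullet> \<xi> + \<omega>"
    proof (rule antisym)
      have le: "x \<bullet> \<xi> \<le> c \<bullet> \<xi> + \<omega>" if "x \<in> K" for x
      proof -
        have "g \<bullet> S (x - c) \<le> norm g * norm (S (x - c))" by (rule norm_cauchy_schwarz)
        also have "\<dots> \<le> \<omega> * 1" using that memK[of x] \<open>\<omega> > 0\<close> by (intro mult_mono) (auto simp: \<omega>_def)
        finally show ?thesis using val[of x] by simp
      qed
      show "h_plus K \<xi> \<le> c \<bullet> \<xi> + \<omega>"
        using exists_above[of "c \<bullet> \<xi> + \<omega>" \<xi>] le by (meson not_le)
      show "c \<bullet> \<xi> + \<omega> \<le> h_plus K \<xi>"
      proof (rule ccontr)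
        assume "\<not> c \<bullet> \<xi> + \<omega> \<le> h_plus K \<xi>"
        then have lt: "h_plus K \<xi> - c \<bullet> \<xi> < \<omega>" by simp
        define r where "r = max 0 ((h_plus K \<xi> - c \<bullet> \<xi>) / \<omega>)"
        have r: "0 \<le> r" "r < 1" "h_plus K \<xi> - c \<bullet> \<xi> \<le> r * \<omega>"
          using lt \<open>\<omega> > 0\<close> by (auto simp: r_def max_def field_simps)
        have "norm (S (c + r *\<^sub>R e - c)) = r"
          using r \<open>\<omega> > 0\<close> by (simp add: linear_cmul[OF S(1)] Se \<omega>_def)
        then have "c + r *\<^sub>R e \<in> K" using memK r by simp
        from less_h_plus[OF this \<xi>0] show False using r(3) by (simp add: inner_add_left e\<xi>)
      qed
    qed
    have up': "h_plus K (-\<xi>) = - (c \<bullet> \<xi>) + \<omega>"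
    proof (rule antisym)
      have le: "x \<bullet> (-\<xi>) \<le> - (c \<bullet> \<xi>) + \<omega>" if "x \<in> K" for x
      proof -
        have "- (g \<bullet> S (x - c)) \<le> norm g * norm (S (x - c))"
          using norm_cauchy_schwarz[of "-g" "S (x - c)"] by simp
        also have "\<dots> \<le> \<omega> * 1" using that memK[of x] \<open>\<omega> > 0\<close> by (intro mult_mono) (auto simp: \<omega>_def)
        finally show ?thesis using val[of x] by simp
      qed
      show "h_plus K (-\<xi>) \<le> - (c \<bullet> \<xi>) + \<omega>"
        using exists_above[of "- (c \<bullet> \<xi>) + \<omega>" "-\<xi>"] le by (meson not_le)
      show "- (c \<bullet> \<xi>) + \<omega> \<le> h_plus K (-\<xi>)"
      proof (rule ccontr)
        assume "\<not> - (c \<bullet> \<xi>) + \<omega> \<le> h_plus K (-\<xi>)"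
        then have lt: "h_plus K (-\<xi>) + c \<bullet> \<xi> < \<omega>" by simp
        define r where "r = max 0 ((h_plus K (-\<xi>) + c \<bullet> \<xi>) / \<omega>)"
        have r: "0 \<le> r" "r < 1" "h_plus K (-\<xi>) + c \<bullet> \<xi> \<le> r * \<omega>"
          using lt \<open>\<omega> > 0\<close> by (auto simp: r_def max_def field_simps)
        have "norm (S (c + (-r) *\<^sub>R e - c)) = r"
          using r \<open>\<omega> > 0\<close> by (simp add: linear_cmul[OF S(1)] linear_neg[OF S(1)] Se \<omega>_def)
        then have "c + (-r) *\<^sub>R e \<in> K" using memK r by simp
        from less_h_plus[OF this, of "-\<xi>"] show False using r(3) \<xi>0 by (simp add: inner_add_left inner_diff_left e\<xi>)
      qed
    qed
    have mid: "mid \<xi> = c \<bullet> \<xi>" and hw: "half_width \<xi> = \<omega>"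
      using up up' by (simp_all add: mid_def half_width_def h_minus_eq)
    define x where "x = (t - mid \<xi>) / half_width \<xi>"
    show ?thesis
    proof (cases "\<bar>x\<bar> < 1")
      case True
      define \<rho> where "\<rho> = sqrt (1 - x\<^sup>2)"
      have x2: "x\<^sup>2 < 1" using True by (simp add: abs_square_less_1)
      have \<rho>: "\<rho> > 0" "\<rho>\<^sup>2 = 1 - x\<^sup>2" using x2 by (auto simp: \<rho>_def)
      \<comment> \<open>The homothety takes the centre \<open>c\<close> of the central section to
        \<open>c + x *\<^sub>R e\<close>, the centre of the section at \<open>t\<close>. The central
        section lies orthogonally to \<open>g\<close> in the coordinates \<open>S\<close>, so
        Pythagoras gives \<open>x^2 + \<rho>^2 * |S (z - c)|^2\<close>, which is below 1 exactly
        when \<open>|S (z - c)| < 1\<close>.\<close>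
      have "sectional_volume K \<xi> t = \<rho> ^ (DIM('a) - 1) * sectional_volume K \<xi> (mid \<xi>)"
      proof (rule sectional_volume_similar[OF \<xi> bounded_K K_borel \<rho>(1), of _ "c + x *\<^sub>R e - \<rho> *\<^sub>R c"])
        show "t = (c + x *\<^sub>R e - \<rho> *\<^sub>R c) \<bullet> \<xi> + \<rho> * mid \<xi>"
          using \<open>\<omega> > 0\<close> by (simp add: inner_add_left inner_diff_left e\<xi> mid x_def hw)
        fix z assume z: "z \<bullet> \<xi> = mid \<xi>"
        have orth: "g \<bullet> S (z - c) = 0" using val[of z] z mid by simp
        have eqn: "c + x *\<^sub>R e - \<rho> *\<^sub>R c + \<rho> *\<^sub>R z - c = x *\<^sub>R e + \<rho> *\<^sub>R (z - c)" by (simp add: algebra_simps)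
        have "S (c + x *\<^sub>R e - \<rho> *\<^sub>R c + \<rho> *\<^sub>R z - c) = (x / \<omega>) *\<^sub>R g + \<rho> *\<^sub>R S (z - c)"
          unfolding eqn by (simp only: linear_add[OF S(1)] linear_cmul[OF S(1)] Se) simp
        moreover have "(norm (r *\<^sub>R g + \<rho> *\<^sub>R y))\<^sup>2 = r\<^sup>2 * (g \<bullet> g) + \<rho>\<^sup>2 * (y \<bullet> y)" if "g \<bullet> y = 0" for r y
          unfolding power2_norm_eq_inner using that
          by (simp add: inner_add_left inner_add_right inner_commute[of y g] power2_eq_square)
        ultimately have "(norm (S (c + x *\<^sub>R e - \<rho> *\<^sub>R c + \<rho> *\<^sub>R z - c)))\<^sup>2 = (x / \<omega>)\<^sup>2 * (g \<bullet> g) + \<rho>\<^sup>2 * (norm (S (z - c)))\<^sup>2"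
          using orth by (simp only: power2_norm_eq_inner)
        also have "(x / \<omega>)\<^sup>2 * (g \<bullet> g) = x\<^sup>2" using \<open>\<omega> > 0\<close> by (simp add: \<omega>_def dot_square_norm power_divide)
        finally have n: "(norm (S (c + x *\<^sub>R e - \<rho> *\<^sub>R c + \<rho> *\<^sub>R z - c)))\<^sup>2 = x\<^sup>2 + \<rho>\<^sup>2 * (norm (S (z - c)))\<^sup>2" .
        have sq: "norm y < 1 \<longleftrightarrow> (norm y)\<^sup>2 < 1" for y :: 'a by (simp add: power_less_one_iff abs_square_less_1)
        have "norm (S (z - c)) < 1 \<longleftrightarrow> \<rho>\<^sup>2 * (norm (S (z - c)))\<^sup>2 < \<rho>\<^sup>2 * 1"
          using \<rho>(1) by (subst mult_less_cancel_left_pos) (auto simp: sq)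
        also have "\<dots> \<longleftrightarrow> norm (S (c + x *\<^sub>R e - \<rho> *\<^sub>R c + \<rho> *\<^sub>R z - c)) < 1"
          unfolding sq n \<rho>(2) by (auto simp: algebra_simps)
        finally show "z \<in> K \<longleftrightarrow> c + x *\<^sub>R e - \<rho> *\<^sub>R c + \<rho> *\<^sub>R z \<in> K" by (simp only: memK)
      qed
      then show ?thesis using True by (simp add: x_def[symmetric] semicircle_def \<rho>_def m_def mult.commute)
    next
      case False
      then have "x \<notin> {-1<..<1}" by (auto simp: abs_less_iff)
      then have "t \<notin> {h_minus K \<xi><..<h_plus K \<xi>}" unfolding interval_rescaled[OF \<xi>0] x_def .
      then have "sectional_volume K \<xi> t = 0" by (rule sectional_volume_zero[OF \<xi>])
      then show ?thesis using False m by (simp add: x_def[symmetric] semicircle_def)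
    qed
  qed
  \<comment> \<open>The total mass of the normalised profile; its positivity allows the volume
    identity to be solved for the central section.\<close>
  define \<kappa> where "\<kappa> = (\<integral>x. semicircle x ^ m \<partial>lborel)"
  have sc_int: "integrable lborel (\<lambda>x. semicircle x ^ m)"
    by (rule integrable_bounded_support[where B=1 and a="-1" and b=1])
       (use semicircle_bounds m in \<open>auto simp: power_abs power_le_one\<close>)
  have "\<kappa> > 0"
  proof -
    have "(\<integral>x. (1/2::real) ^ m * indicator {-1/2..1/2::real} x \<partial>lborel) \<le> \<kappa>"
      unfolding \<kappa>_def
    proof (rule integral_mono[OF _ sc_int])
      fix x :: real
      show "(1/2::real) ^ m * indicator {-1/2..1/2} x \<le> semicircle x ^ m"
      proof (cases "x \<in> {-1/2..1/2}")
        case True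
        then have "\<bar>x\<bar> \<le> 1/2" by (auto simp: abs_le_iff)
        then have "x\<^sup>2 \<le> (1/2)\<^sup>2" using abs_le_square_iff[of x "1/2"] by simp
        then have "(1/2)\<^sup>2 \<le> 1 - x\<^sup>2" by (simp add: power2_eq_square)
        then have "1/2 \<le> sqrt (1 - x\<^sup>2)" by (rule real_le_rsqrt)
        then have "1/2 \<le> semicircle x" using \<open>\<bar>x\<bar> \<le> 1/2\<close> by (simp add: semicircle_def)
        then have "(1/2::real) ^ m \<le> semicircle x ^ m" by (rule power_mono) simp
        then show ?thesis using True by simp
      qed (use semicircle_bounds(1)[of x] in simp)
    qed simp
    moreover have "(\<integral>x. (1/2::real) ^ m * indicator {-1/2..1/2::real} x \<partial>lborel) = (1/2::real) ^ m" by simp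
    ultimately show ?thesis by (smt (verit) zero_less_power divide_pos_pos zero_less_numeral zero_less_one)
  qed
  show ?thesis
  proof (rule that[of "measure K_measure UNIV / \<kappa>"])
    fix \<xi> :: 'a and t assume \<xi>: "norm \<xi> = 1"
    then have w: "half_width \<xi> > 0" by (intro half_width_pos) auto
    have "measure K_measure UNIV = (\<integral>x. (1::real) \<partial>K_measure)" by simp
    also have "\<dots> = (\<integral>t. sectional_volume K \<xi> t *\<^sub>R (1::real) \<partial>lborel)"
      using integral_sections[OF \<xi>, of "\<lambda>_. 1::real"] by simp
    also have "\<dots> = (\<integral>t. sectional_volume K \<xi> (mid \<xi>) * semicircle ((t - mid \<xi>) / half_width \<xi>) ^ m \<partial>lborel)"
    proof (rule Bochner_Integration.integral_cong[OF refl])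
      fix t
      show "sectional_volume K \<xi> t *\<^sub>R (1::real)
        = sectional_volume K \<xi> (mid \<xi>) * semicircle ((t - mid \<xi>) / half_width \<xi>) ^ m"
        using profile[OF \<xi>, of t] by (simp only: scaleR_conv_of_real of_real_eq_id id_apply mult_1_right)
    qed
    also have "\<dots> = sectional_volume K \<xi> (mid \<xi>) * (\<integral>t. semicircle ((t - mid \<xi>) / half_width \<xi>) ^ m \<partial>lborel)"
      by (rule integral_mult_right_zero)
    also have "(\<integral>t. semicircle ((t - mid \<xi>) / half_width \<xi>) ^ m \<partial>lborel) = half_width \<xi> * \<kappa>"
      using lborel_integral_real_affine[of "half_width \<xi>" "\<lambda>t. semicircle ((t - mid \<xi>) / half_width \<xi>) ^ m" "mid \<xi>"] w
      by (simp add: \<kappa>_def)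
    finally have "sectional_volume K \<xi> (mid \<xi>) = measure K_measure UNIV / \<kappa> / half_width \<xi>"
      using w \<open>\<kappa> > 0\<close> by (simp add: field_simps)
    with profile[OF \<xi>, of t]
    show "sectional_volume K \<xi> t = measure K_measure UNIV / \<kappa> / half_width \<xi> * semicircle ((t - mid \<xi>) / half_width \<xi>) ^ (DIM('a) - 1)"
      by (simp only: m_def)
  qed
qed

end

section \<open>Growth of sections at smooth boundary points\<close>

text \<open>At a boundary point where the domain is locally \<open>{f < 0}\<close>, the second-order bound
  \<open>f x \<le> g \<bullet> (x - p) + C |x - p|\<^sup>2\<close> only needs the first partial derivatives to be
  differentiable at \<open>p\<close>.\<close>

lemma smooth_on_quadratic_bound:
  fixes f :: "'a::euclidean_space \<Rightarrow> real"
  assumes f: "smooth_on U f" and p: "p \<in> U"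
  obtains g C \<delta> where "(f has_derivative (\<lambda>h. g \<bullet> h)) (at p)" "C \<ge> 0" "\<delta> > 0" "ball p \<delta> \<subseteq> U"
    "\<And>x. x \<in> ball p \<delta> \<Longrightarrow> f x \<le> f p + g \<bullet> (x - p) + C * (norm (x - p))\<^sup>2"
proof -
  obtain D where D: "D [] = f" and
    deriv: "\<And>vs x. x \<in> U \<Longrightarrow> (D vs has_derivative (\<lambda>h. \<Sum>v\<in>Basis. (h \<bullet> v) * D (v # vs) x)) (at x)"
    and U: "open U"
    using f unfolding smooth_on_def by blast
  define g where "g = (\<Sum>v\<in>Basis. D [v] p *\<^sub>R v)"
  have g: "(\<Sum>v\<in>Basis. (h \<bullet> v) * D [v] p) = g \<bullet> h" for h
    unfolding g_def inner_sum_left by (rule sum.cong) (auto simp: inner_commute)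
  have fp: "(f has_derivative (\<lambda>h. g \<bullet> h)) (at p)"
    using deriv[OF p, of "[]"] by (simp add: D g)
  have "\<exists>C. C \<ge> 0 \<and> (\<forall>\<^sub>F x in nhds p. \<bar>D [v] x - D [v] p\<bar> \<le> C * norm (x - p))" for v
  proof -
    define L where "L = (\<lambda>h. \<Sum>w\<in>Basis. (h \<bullet> w) * D [w, v] p)"
    have L: "(D [v] has_derivative L) (at p)" using deriv[OF p, of "[v]"] by (simp add: L_def)
    then obtain B where B: "\<And>h. norm (L h) \<le> norm h * B" "B > 0"
      using bounded_linear.pos_bounded[OF has_derivative_bounded_linear[OF L]] by blast
    obtain d where d: "d > 0" "\<And>y. norm (y - p) < d \<Longrightarrow> norm (D [v] y - D [v] p - L (y - p)) \<le> 1 * norm (y - p)"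
      using L unfolding has_derivative_at_alt by (meson zero_less_one)
    have "\<bar>D [v] x - D [v] p\<bar> \<le> (B + 1) * norm (x - p)" if "norm (x - p) < d" for x
    proof -
      have "\<bar>D [v] x - D [v] p\<bar> \<le> norm (D [v] x - D [v] p - L (x - p)) + norm (L (x - p))" by simp
      then show ?thesis using d(2)[OF that] B(1)[of "x - p"] by (simp add: algebra_simps)
    qed
    then have "\<forall>\<^sub>F x in nhds p. \<bar>D [v] x - D [v] p\<bar> \<le> (B + 1) * norm (x - p)"
      using d(1) unfolding eventually_nhds_metric dist_norm by blast
    then show ?thesis using B(2) by (intro exI[of _ "B + 1"]) auto
  qed
  then obtain C where C: "\<And>v. C v \<ge> 0" "\<And>v. \<forall>\<^sub>F x in nhds p. \<bar>D [v] x - D [v] p\<bar> \<le> C v * norm (x - p)" by metis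
  have "\<forall>\<^sub>F x in nhds p. \<forall>v\<in>Basis. \<bar>D [v] x - D [v] p\<bar> \<le> C v * norm (x - p)"
    using C(2) by (simp add: eventually_ball_finite)
  moreover have "\<forall>\<^sub>F x in nhds p. x \<in> U" using U p by (rule eventually_nhds_in_open)
  ultimately have "\<forall>\<^sub>F x in nhds p. x \<in> U \<and> (\<forall>v\<in>Basis. \<bar>D [v] x - D [v] p\<bar> \<le> C v * norm (x - p))"
    by eventually_elim simp
  then obtain \<delta> where \<delta>: "\<delta> > 0"
    "\<And>x. dist x p < \<delta> \<Longrightarrow> x \<in> U \<and> (\<forall>v\<in>Basis. \<bar>D [v] x - D [v] p\<bar> \<le> C v * norm (x - p))"
    unfolding eventually_nhds_metric by blast
  show ?thesis
  proof (rule that[OF fp _ \<delta>(1), of "\<Sum>v\<in>Basis. C v"])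
    show "(\<Sum>v\<in>Basis. C v) \<ge> 0" using C(1) by (simp add: sum_nonneg)
    show "ball p \<delta> \<subseteq> U" using \<delta>(2) by (auto simp: dist_commute)
    fix x assume "x \<in> ball p \<delta>"
    then have x: "norm (x - p) < \<delta>" by (simp add: dist_norm norm_minus_commute)
    define y where "y = (\<lambda>s::real. p + s *\<^sub>R (x - p))"
    have yd: "norm (y s - p) \<le> norm (x - p)" if "s \<in> {0..1}" for s
      using that by (simp add: y_def mult_left_le_one_le)
    have yU: "y s \<in> U" if "s \<in> {0..1}" for s
      using yd[OF that] x \<delta>(2)[of "y s"] by (simp add: dist_norm)
    have "((\<lambda>s. f (y s)) has_derivative (\<lambda>h. \<Sum>v\<in>Basis. ((h *\<^sub>R (x - p)) \<bullet> v) * D [v] (y s))) (at s within {0..1})"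
      if "s \<in> {0..1}" for s
    proof -
      have yd: "(y has_derivative (\<lambda>h. h *\<^sub>R (x - p))) (at s within {0..1})"
        unfolding y_def by (auto intro!: derivative_eq_intros)
      have "(f has_derivative (\<lambda>h. \<Sum>v\<in>Basis. (h \<bullet> v) * D [v] (y s))) (at (y s))"
        using deriv[OF yU[OF that], of "[]"] by (simp add: D)
      from has_derivative_compose[of y _ s "{0..1}" f, OF yd this] show ?thesis .
    qed
    \<comment> \<open>Mean value theorem along the segment from \<open>p\<close> to
      \<open>x\<close>: a single intermediate point carries all partial derivatives, which differ
      from those at \<open>p\<close> by at most a multiple of \<open>norm (x - p)\<close>.\<close>
    then obtain s where s: "s \<in> {0..1}" "f (y 1) - f (y 0) = (\<Sum>v\<in>Basis. (((1 - 0) *\<^sub>R (x - p)) \<bullet> v) * D [v] (y s))"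
      using mvt_very_simple[of 0 1 "\<lambda>s. f (y s)" "\<lambda>s h. \<Sum>v\<in>Basis. ((h *\<^sub>R (x - p)) \<bullet> v) * D [v] (y s)"] by auto
    have "f x - f p = (\<Sum>v\<in>Basis. ((x - p) \<bullet> v) * D [v] p) + (\<Sum>v\<in>Basis. ((x - p) \<bullet> v) * (D [v] (y s) - D [v] p))"
      using s(2) by (simp add: y_def sum.distrib[symmetric] algebra_simps)
    also have "(\<Sum>v\<in>Basis. ((x - p) \<bullet> v) * (D [v] (y s) - D [v] p)) \<le> (\<Sum>v\<in>Basis. C v * (norm (x - p))\<^sup>2)"
    proof (rule sum_mono)
      fix v :: 'a assume v: "v \<in> Basis"
      have "norm (y s - p) < \<delta>" using yd[OF s(1)] x by simp
      then have "\<bar>D [v] (y s) - D [v] p\<bar> \<le> C v * norm (y s - p)" using \<delta>(2)[of "y s"] v by (simp add: dist_norm)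
      also have "\<dots> \<le> C v * norm (x - p)" using yd[OF s(1)] C(1) by (rule mult_left_mono)
      finally have 1: "\<bar>D [v] (y s) - D [v] p\<bar> \<le> C v * norm (x - p)" .
      have "((x - p) \<bullet> v) * (D [v] (y s) - D [v] p) \<le> \<bar>(x - p) \<bullet> v\<bar> * \<bar>D [v] (y s) - D [v] p\<bar>"
        by (metis abs_ge_self abs_mult)
      also have "\<dots> \<le> norm (x - p) * (C v * norm (x - p))"
        using 1 Basis_le_norm[OF v, of "x - p"] by (intro mult_mono) auto
      finally show "((x - p) \<bullet> v) * (D [v] (y s) - D [v] p) \<le> C v * (norm (x - p))\<^sup>2"
        by (simp add: power2_eq_square mult_ac)
    qed
    finally show "f x \<le> f p + g \<bullet> (x - p) + (\<Sum>v\<in>Basis. C v) * (norm (x - p))\<^sup>2"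
      by (simp add: g sum_distrib_right)
  qed
qed

text \<open>After dividing by the smaller power of \<open>u\<close>, an order above \<open>k\<close>
  would push the lower bound to zero, and an order below \<open>k\<close> would make the cofactor
  vanish at \<open>h\<close>.\<close>

lemma order_from_growth:
  fixes W :: "real poly"
  assumes s: "s \<in> {-1, 1}" and c: "c > 0" and \<delta>: "\<delta> > 0"
    and lower: "\<And>u. 0 < u \<Longrightarrow> u < \<delta> \<Longrightarrow> c * u ^ k \<le> \<bar>poly W (h + s * u)\<bar>"
    and upper: "\<And>u. 0 < u \<Longrightarrow> u < \<delta> \<Longrightarrow> \<bar>poly W (h + s * u)\<bar> \<le> C * u ^ k"
  shows "W \<noteq> 0" "order h W = k"
proof -
  show W0: "W \<noteq> 0"
  proof
    assume "W = 0"
    then have "c * (\<delta> / 2) ^ k \<le> 0" using lower[of "\<delta> / 2"] \<delta> by simp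
    moreover have "c * (\<delta> / 2) ^ k > 0" using c \<delta> by simp
    ultimately show False by simp
  qed
  define j where "j = order h W"
  obtain R where R: "W = [:- h, 1:] ^ j * R" "\<not> [:- h, 1:] dvd R"
    using order_decomp[OF W0, of h] unfolding j_def by blast
  have Rh: "poly R h \<noteq> 0" using R(2) by (simp add: poly_eq_0_iff_dvd)
  have val: "\<bar>poly W (h + s * u)\<bar> = u ^ j * \<bar>poly R (h + s * u)\<bar>" if "u > 0" for u
  proof -
    have "poly W (h + s * u) = (s * u) ^ j * poly R (h + s * u)" by (simp add: R(1) poly_power)
    moreover have "\<bar>(s * u) ^ j\<bar> = u ^ j" using s that by (auto simp: power_abs abs_mult)
    ultimately show ?thesis by (simp add: abs_mult)
  qed
  have ev: "\<forall>\<^sub>F u::real in at_right 0. 0 < u \<and> u < \<delta>"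
    using \<delta> by (auto simp: eventually_at_right_field)
  have Rlim: "((\<lambda>u. \<bar>poly R (h + s * u)\<bar>) \<longlongrightarrow> \<bar>poly R (h + s * 0)\<bar>) (at_right (0::real))"
    by (intro tendsto_intros)
  have pow0: "((\<lambda>u::real. u ^ i) \<longlongrightarrow> 0) (at_right 0)" if "i > 0" for i
  proof -
    have "((\<lambda>u::real. u ^ i) \<longlongrightarrow> 0 ^ i) (at_right 0)" by (intro tendsto_intros)
    then show ?thesis using that by (simp add: power_0_left)
  qed
  have "\<not> k < j"
  proof
    assume kj: "k < j"
    have "((\<lambda>u. u ^ (j - k) * \<bar>poly R (h + s * u)\<bar>) \<longlongrightarrow> 0 * \<bar>poly R (h + s * 0)\<bar>) (at_right 0)"
      using kj by (intro tendsto_mult pow0 Rlim) auto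
    then have "c \<le> 0 * \<bar>poly R (h + s * 0)\<bar>"
    proof (rule tendsto_lowerbound)
      show "\<forall>\<^sub>F u in at_right 0. c \<le> u ^ (j - k) * \<bar>poly R (h + s * u)\<bar>"
      proof (rule eventually_mono[OF ev])
        fix u :: real assume u: "0 < u \<and> u < \<delta>"
        have "u ^ k * c \<le> u ^ k * (u ^ (j - k) * \<bar>poly R (h + s * u)\<bar>)"
          using lower[of u] val[of u] u kj by (simp add: mult.commute mult.left_commute flip: power_add mult.assoc)
        then show "c \<le> u ^ (j - k) * \<bar>poly R (h + s * u)\<bar>" using u by simp
      qed
    qed simp
    then show False using c by simp
  qed
  moreover have "\<not> j < k"
  proof
    assume jk: "j < k"
    have "((\<lambda>u. C * u ^ (k - j)) \<longlongrightarrow> C * 0) (at_right 0)"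
      using jk by (intro tendsto_mult pow0 tendsto_const) auto
    then have "\<bar>poly R (h + s * 0)\<bar> \<le> C * 0"
    proof (rule tendsto_le[OF _ _ Rlim, rotated])
      show "\<forall>\<^sub>F u in at_right 0. \<bar>poly R (h + s * u)\<bar> \<le> C * u ^ (k - j)"
      proof (rule eventually_mono[OF ev])
        fix u :: real assume u: "0 < u \<and> u < \<delta>"
        have "u ^ j * \<bar>poly R (h + s * u)\<bar> \<le> u ^ j * (C * u ^ (k - j))"
          using upper[of u] val[of u] u jk by (simp add: mult.commute mult.left_commute flip: power_add mult.assoc)
        then show "\<bar>poly R (h + s * u)\<bar> \<le> C * u ^ (k - j)" using u by simp
      qed
    qed simp
    then show False using Rh by simp
  qed
  ultimately show "order h W = k" by (simp add: j_def)
qed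

section \<open>Tangent balls from inside and outside\<close>

context convex_body
begin

text \<open>Directions in which the defining function decreases enter \<open>K\<close> and so cannot
  increase \<open>x \<bullet> \<xi>\<close>; this makes the gradient a positive multiple of the
  outer normal. The quadratic upper bound on the defining function then contains a ball tangent at
  \<open>p\<close> in \<open>K\<close>.\<close>

lemma interior_ball:
  assumes smooth: "smooth_boundary K" and p: "p \<in> closure K" and \<xi>: "norm \<xi> = 1" and top: "p \<bullet> \<xi> = h_plus K \<xi>"
  obtains r where "r > 0" "ball (p - r *\<^sub>R \<xi>) r \<subseteq> K"
proof -
  have \<xi>0: "\<xi> \<noteq> 0" using \<xi> by auto
  have pK: "p \<notin> K" using less_h_plus[of p \<xi>] \<xi>0 top by auto
  then have "p \<in> frontier K" using p open_K by (simp add: frontier_def interior_open)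
  then obtain U f where U: "p \<in> U" "smooth_on U f" "\<not> (f has_derivative (\<lambda>h. 0)) (at p)" "K \<inter> U = {x \<in> U. f x < 0}"
    using smooth unfolding smooth_boundary_def by blast
  obtain g C \<delta> where g: "(f has_derivative (\<lambda>h. g \<bullet> h)) (at p)" and C: "C \<ge> 0" and \<delta>: "\<delta> > 0" "ball p \<delta> \<subseteq> U"
    and bound: "\<And>x. x \<in> ball p \<delta> \<Longrightarrow> f x \<le> f p + g \<bullet> (x - p) + C * (norm (x - p))\<^sup>2"
    using smooth_on_quadratic_bound[OF U(2,1)] by blast
  have g0: "g \<noteq> 0" using g U(3) by auto
  have fp: "f p \<le> 0"
  proof (rule ccontr)
    assume "\<not> f p \<le> 0"
    moreover have "isCont f p" using g by (rule has_derivative_continuous)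
    ultimately have "\<forall>\<^sub>F x in nhds p. f x > 0"
      unfolding isCont_def tendsto_at_iff_tendsto_nhds by (intro order_tendstoD(1)) auto
    moreover have "\<forall>\<^sub>F x in nhds p. x \<in> U" using U(1,2) by (intro eventually_nhds_in_open) (auto simp: smooth_on_def)
    ultimately have "\<forall>\<^sub>F x in nhds p. x \<notin> K" by eventually_elim (use U(4) in force)
    then obtain V where "open V" "p \<in> V" "\<And>x. x \<in> V \<Longrightarrow> x \<notin> K" unfolding eventually_nhds by blast
    then show False using p by (meson closure_iff_nhds_not_empty disjoint_iff open_Int_closure_eq_empty IntI empty_iff)
  qed
  have inK: "x \<in> K" if "x \<in> ball p \<delta>" "g \<bullet> (x - p) + C * (norm (x - p))\<^sup>2 < 0" for x
  proof -
    have "f x < 0" using bound[OF that(1)] that(2) fp by linarith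
    then show ?thesis using U(4) \<delta>(2) that(1) by blast
  qed
  \<comment> \<open>The step length \<open>e\<close> keeps \<open>p + e w\<close> in the
    neighbourhood and lets the linear term dominate the quadratic one.\<close>
  have dir: "w \<bullet> \<xi> \<le> 0" if w: "g \<bullet> w < 0" for w
  proof -
    have w0: "norm w > 0" using w by auto
    define e where "e = min (\<delta> / 2 / norm w) (- (g \<bullet> w) / 2 / ((C + 1) * (norm w)\<^sup>2))"
    have "- (g \<bullet> w) / 2 / ((C + 1) * (norm w)\<^sup>2) > 0"
      using w w0 C by (intro divide_pos_pos mult_pos_pos) auto
    then have e: "e > 0" using w0 \<delta>(1) by (simp add: e_def)
    have "e * norm w \<le> \<delta> / 2" using w0 by (simp add: e_def min_def field_simps)
    then have "p + e *\<^sub>R w \<in> ball p \<delta>" using e \<delta>(1) by (simp add: dist_norm)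
    moreover have "g \<bullet> (p + e *\<^sub>R w - p) + C * (norm (p + e *\<^sub>R w - p))\<^sup>2 < 0"
    proof -
      have "e * ((C + 1) * (norm w)\<^sup>2) \<le> - (g \<bullet> w) / 2"
      proof -
        have "(C + 1) * (norm w)\<^sup>2 > 0" using C w0 by simp
        moreover have "e \<le> - (g \<bullet> w) / 2 / ((C + 1) * (norm w)\<^sup>2)" by (simp add: e_def)
        ultimately show ?thesis by (metis pos_le_divide_eq)
      qed
      moreover have "e * (C * (norm w)\<^sup>2) \<le> e * ((C + 1) * (norm w)\<^sup>2)" using e by (intro mult_left_mono mult_right_mono) auto
      ultimately have "g \<bullet> w + e * (C * (norm w)\<^sup>2) < 0" using w by linarith
      then have "e * (g \<bullet> w + e * (C * (norm w)\<^sup>2)) < 0" using e by (simp add: mult_pos_neg)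
      then show ?thesis using e by (simp add: power_mult_distrib power2_eq_square algebra_simps)
    qed
    ultimately have "p + e *\<^sub>R w \<in> K" by (rule inK)
    from less_h_plus[OF this \<xi>0] have "e * (w \<bullet> \<xi>) < 0" using top by (simp add: inner_add_left)
    then show ?thesis using e by (simp add: mult_less_0_iff)
  qed
  define y where "y = \<xi> - (g \<bullet> \<xi> / (g \<bullet> g)) *\<^sub>R g"
  have gg: "g \<bullet> g > 0" using g0 by simp
  have gy: "g \<bullet> y = 0" using gg by (simp add: y_def inner_diff_right)
  have y\<xi>: "y \<bullet> \<xi> = y \<bullet> y"
  proof -
    have "y \<bullet> y = y \<bullet> \<xi> - (g \<bullet> \<xi> / (g \<bullet> g)) * (y \<bullet> g)" by (subst (2) y_def) (simp add: inner_diff_right)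
    then show ?thesis using gy by (simp add: inner_commute)
  qed
  have y0: "y = 0"
  proof (rule ccontr)
    assume "y \<noteq> 0"
    then have yy: "y \<bullet> y > 0" by simp
    \<comment> \<open>If the component \<open>y\<close> of \<open>\<xi>\<close> orthogonal to
      \<open>g\<close> were nonzero, the inward direction \<open>- g + n *\<^sub>R y\<close> would
      have inner product exactly 1 with \<open>\<xi>\<close>.\<close>
    define n where "n = (g \<bullet> \<xi> + 1) / (y \<bullet> y)"
    have "g \<bullet> (- g + n *\<^sub>R y) < 0" using gg gy by (simp add: inner_add_right inner_diff_right)
    from dir[OF this] have "- (g \<bullet> \<xi>) + n * (y \<bullet> y) \<le> 0" by (simp add: inner_add_left inner_diff_left y\<xi>)
    moreover have "n * (y \<bullet> y) = g \<bullet> \<xi> + 1" using yy by (simp add: n_def)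
    ultimately show False by simp
  qed
  then have \<xi>g: "\<xi> = (g \<bullet> \<xi> / (g \<bullet> g)) *\<^sub>R g" by (simp add: y_def)
  have "g \<bullet> \<xi> \<ge> 0" using dir[of "-g"] gg by simp
  moreover have "g \<bullet> \<xi> \<noteq> 0" using \<xi>g \<xi>0 by (metis div_0 scale_zero_left)
  ultimately have g\<xi>: "g \<bullet> \<xi> > 0" by simp
  define \<gamma> where "\<gamma> = (g \<bullet> g) / (g \<bullet> \<xi>)"
  have \<gamma>: "\<gamma> > 0" using gg g\<xi> by (simp add: \<gamma>_def)
  have g_eq: "g = \<gamma> *\<^sub>R \<xi>"
  proof -
    have "\<gamma> *\<^sub>R \<xi> = \<gamma> *\<^sub>R ((g \<bullet> \<xi> / (g \<bullet> g)) *\<^sub>R g)" using \<xi>g by metis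
    also have "\<dots> = g" using gg g\<xi> by (simp add: \<gamma>_def)
    finally show ?thesis ..
  qed
  \<comment> \<open>With \<open>v = x - p\<close>, the tangent ball is
    \<open>|v|^2 + 2 * r * (\<xi> \<bullet> v) < 0\<close>. This implies
    \<open>\<gamma> * (\<xi> \<bullet> v) + C * |v|^2 < 0\<close> once
    \<open>2 * r * C \<le> \<gamma>\<close>; \<open>\<delta> / 2\<close> keeps the ball in the
    neighbourhood, and \<open>C + 1\<close> avoids division by zero.\<close>
  define r where "r = min (\<delta> / 2) (\<gamma> / (2 * (C + 1)))"
  have r: "r > 0" using \<delta>(1) \<gamma> C by (simp add: r_def)
  show ?thesis
  proof (rule that[OF r], rule subsetI)
    fix x assume "x \<in> ball (p - r *\<^sub>R \<xi>) r"
    then have nx: "norm (x - p + r *\<^sub>R \<xi>) < r" by (simp add: dist_norm norm_minus_commute algebra_simps)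
    have "norm (x - p) \<le> norm (x - p + r *\<^sub>R \<xi>) + norm (r *\<^sub>R \<xi>)"
      using norm_triangle_ineq4[of "x - p + r *\<^sub>R \<xi>" "r *\<^sub>R \<xi>"] by simp
    then have "norm (x - p) < 2 * r" using nx r \<xi> by simp
    then have xb: "x \<in> ball p \<delta>" by (simp add: dist_norm norm_minus_commute r_def)
    have "(norm (x - p + r *\<^sub>R \<xi>))\<^sup>2 < r\<^sup>2" using nx r by (intro power_strict_mono) auto
    moreover have "(norm (x - p + r *\<^sub>R \<xi>))\<^sup>2 = (norm (x - p))\<^sup>2 + 2 * r * (\<xi> \<bullet> (x - p)) + r\<^sup>2"
      using \<xi> by (simp only: power2_norm_eq_inner inner_add_left inner_add_right inner_scaleR_left inner_scaleR_right norm_eq_1)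
        (simp add: inner_commute power2_eq_square distrib_left)
    ultimately have q: "(norm (x - p))\<^sup>2 + 2 * r * (\<xi> \<bullet> (x - p)) < 0" by simp
    have r2: "2 * r * (C + 1) \<le> \<gamma>"
    proof -
      have "r \<le> \<gamma> / (2 * (C + 1))" by (simp add: r_def)
      then show ?thesis using C by (simp add: pos_le_divide_eq mult_ac)
    qed
    have "2 * r * (g \<bullet> (x - p) + C * (norm (x - p))\<^sup>2) = \<gamma> * (2 * r * (\<xi> \<bullet> (x - p))) + 2 * r * C * (norm (x - p))\<^sup>2"
      by (simp add: g_eq algebra_simps)
    also have "\<dots> < \<gamma> * (- (norm (x - p))\<^sup>2) + 2 * r * C * (norm (x - p))\<^sup>2"
      using q \<gamma> by (intro add_strict_right_mono mult_strict_left_mono) auto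
    also have "\<dots> = (2 * r * C - \<gamma>) * (norm (x - p))\<^sup>2" by (simp add: algebra_simps)
    also have "\<dots> \<le> 0" using r2 r by (intro mult_nonpos_nonneg) (auto simp: algebra_simps)
    finally have "g \<bullet> (x - p) + C * (norm (x - p))\<^sup>2 < 0" using r by (simp add: mult_less_0_iff)
    with xb show "x \<in> K" by (rule inK)
  qed
qed

text \<open>The point of \<open>closure K\<close> farthest from a remote centre \<open>-R \<eta>\<close> has outer normal close to \<open>\<eta>\<close>.\<close>

lemma enclosing_ball_dense:
  assumes \<eta>: "norm \<eta> = 1" and \<epsilon>: "\<epsilon> > 0"
  obtains \<xi> c \<rho> where "norm \<xi> = 1" "norm (\<xi> - \<eta>) < \<epsilon>" "\<rho> > 0" "K \<subseteq> cball c \<rho>"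
    "c + \<rho> *\<^sub>R \<xi> \<in> closure K" "c \<bullet> \<xi> + \<rho> = h_plus K \<xi>"
proof -
  obtain B where B: "B > 0" "\<And>x. x \<in> closure K \<Longrightarrow> norm x \<le> B" using norm_bound by blast
  \<comment> \<open>The farthest distance satisfies
    \<open>\<rho> \<ge> R - B > 2 * B / \<epsilon>\<close>, while
    \<open>\<rho> * norm (\<xi> - \<eta>) \<le> 2 * B\<close>.\<close>
  define R where "R = B + 2 * B / \<epsilon> + 1"
  define c where "c = - R *\<^sub>R \<eta>"
  have "\<exists>p\<in>closure K. \<forall>x\<in>closure K. dist c x \<le> dist c p"
    by (rule continuous_attains_sup[OF compact_closure_K])
       (use nonempty_K in \<open>auto intro!: continuous_intros\<close>)
  then obtain p where p: "p \<in> closure K" "\<And>x. x \<in> closure K \<Longrightarrow> dist c x \<le> dist c p" by blast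
  define \<rho> where "\<rho> = norm (p - c)"
  have "2 * B / \<epsilon> > 0" using B(1) \<epsilon> by simp
  then have Rp: "R > B" by (simp add: R_def)
  have nc: "norm c = R" using \<eta> Rp B(1) by (simp add: c_def)
  have \<rho>R: "R - B \<le> \<rho>" "\<bar>\<rho> - R\<bar> \<le> B"
  proof -
    have "\<bar>norm (p - c) - norm c\<bar> \<le> norm p"
      using norm_triangle_ineq3[of "p - c" "-c"] by simp
    then show "\<bar>\<rho> - R\<bar> \<le> B" using B(2)[OF p(1)] by (simp add: \<rho>_def nc)
    then show "R - B \<le> \<rho>" by linarith
  qed
  have \<rho>: "\<rho> > 0" using \<rho>R(1) Rp by simp
  define \<xi> where "\<xi> = (1 / \<rho>) *\<^sub>R (p - c)"
  have n\<xi>: "norm \<xi> = 1" using \<rho> by (simp add: \<xi>_def \<rho>_def)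
  have pc: "p = c + \<rho> *\<^sub>R \<xi>" using \<rho> by (simp add: \<xi>_def)
  have sub: "closure K \<subseteq> cball c \<rho>" using p(2) by (auto simp: \<rho>_def dist_norm norm_minus_commute)
  show ?thesis
  proof (rule that[OF n\<xi> _ \<rho>])
    show "K \<subseteq> cball c \<rho>" using sub closure_subset by blast
    show "c + \<rho> *\<^sub>R \<xi> \<in> closure K" using p(1) pc by simp
    show "c \<bullet> \<xi> + \<rho> = h_plus K \<xi>"
    proof (rule antisym)
      have "c \<bullet> \<xi> + \<rho> = p \<bullet> \<xi>" using n\<xi> by (simp add: pc inner_add_left dot_square_norm)
      then show "c \<bullet> \<xi> + \<rho> \<le> h_plus K \<xi>" using le_h_plus[OF p(1), of \<xi>] by simp
      show "h_plus K \<xi> \<le> c \<bullet> \<xi> + \<rho>"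
      proof (rule h_plus_le)
        fix x assume "x \<in> closure K"
        then have "norm (x - c) \<le> \<rho>" using sub by (auto simp: dist_norm norm_minus_commute)
        then show "x \<bullet> \<xi> \<le> c \<bullet> \<xi> + \<rho>" using norm_cauchy_schwarz[of "x - c" \<xi>] n\<xi> by (simp add: inner_diff_left)
      qed
    qed
    have "\<rho> *\<^sub>R (\<xi> - \<eta>) = p + (R - \<rho>) *\<^sub>R \<eta>" using pc by (simp add: c_def algebra_simps)
    then have "\<rho> * norm (\<xi> - \<eta>) = norm (p + (R - \<rho>) *\<^sub>R \<eta>)" using \<rho> by (metis norm_scaleR abs_of_pos)
    also have "\<dots> \<le> norm p + \<bar>R - \<rho>\<bar>" using norm_triangle_ineq[of p "(R - \<rho>) *\<^sub>R \<eta>"] \<eta> by simp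
    also have "\<dots> \<le> 2 * B" using B(2)[OF p(1)] \<rho>R(2) by (simp add: abs_minus_commute)
    finally have *: "\<rho> * norm (\<xi> - \<eta>) \<le> 2 * B" .
    have "2 * B / \<epsilon> < \<rho>" using \<rho>R(1) by (simp add: R_def)
    then have "2 * B < \<rho> * \<epsilon>" using \<epsilon> by (simp add: divide_less_eq)
    with * have "\<rho> * norm (\<xi> - \<eta>) < \<rho> * \<epsilon>" by linarith
    then show "norm (\<xi> - \<eta>) < \<epsilon>" using \<rho> by simp
  qed
qed

end

section \<open>The equivalence\<close>

text \<open>Continuity of \<open>q\<close> in the direction is known only at fixed \<open>t\<close>,
  but \<open>q\<close> has to be evaluated at an endpoint that moves with the direction.
  Interpolation expresses that value through \<open>q\<close> at \<open>0\<close>, \<open>1\<close>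
  and \<open>-1\<close>.\<close>

lemma quadratic_through_three_points:
  fixes p :: "real poly"
  assumes "degree p = 2"
  shows "poly p t = poly p 0 + t * ((poly p 1 - poly p (-1)) / 2) + t\<^sup>2 * ((poly p 1 + poly p (-1)) / 2 - poly p 0)"
proof -
  have "poly p x = coeff p 0 + coeff p 1 * x + coeff p 2 * x\<^sup>2" for x
  proof -
    have "degree p \<le> 2" using assms by simp
    then have "poly p x = poly (\<Sum>i\<le>2. monom (coeff p i) i) x" by (simp only: poly_as_sum_of_monoms')
    then show ?thesis by (simp add: poly_monom numeral_2_eq_2)
  qed
  then show ?thesis by (simp add: algebra_simps)
qed

lemma quadratic_factor:
  fixes p :: "real poly"
  assumes "degree p = 2" "poly p a = 0" "poly p b = 0" "a \<noteq> b"
  shows "poly p t = lead_coeff p * ((t - a) * (t - b))"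
proof -
  obtain q where q: "p = [:-a, 1:] * q" using assms(2) by (auto simp: poly_eq_0_iff_dvd)
  have "poly q b = 0" using assms(3,4) by (simp add: q)
  then obtain r where r: "q = [:-b, 1:] * r" by (auto simp: poly_eq_0_iff_dvd)
  have "r \<noteq> 0" using assms(1) q r by auto
  then have "degree p = 2 + degree r" unfolding q r by (simp add: degree_mult_eq del: mult_pCons_left)
  then obtain c where c: "r = [:c:]" using assms(1) degree_eq_zeroE by auto
  have "lead_coeff p = c" using \<open>r \<noteq> 0\<close> unfolding q r lead_coeff_mult by (simp add: c)
  then show ?thesis by (simp add: q r c algebra_simps)
qed

text \<open>One \<open>R\<close> serves all factors, centres and widths, so the dependence on the
  direction enters only through quantities known to be continuous.\<close>

lemma hilbert_transform_semicircle_poly: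
  obtains R :: "real poly" where "\<And>k c w x. w > 0 \<Longrightarrow> x \<in> {-1<..<1} \<Longrightarrow>
    has_hilbert_transform (\<lambda>t. k * (semicircle ((t - c) / w) * poly p ((t - c) / w))) (c + w * x) (k * poly R x)"
proof -
  define f where "f = (\<lambda>x. semicircle x * poly p x)"
  have "has_hilbert_transform semicircle x (poly [:0, 1:] x)" if "x \<in> {-1<..<1}" for x
    using semicircle_hilbert_transform[OF that] by simp
  from has_hilbert_transform_times_poly[OF semicircle_measurable semicircle_bounds(2,3) this, of p]
  obtain R where R: "\<And>x. x \<in> {-1<..<1} \<Longrightarrow> has_hilbert_transform f x (poly R x)"
    unfolding f_def by blast
  have [measurable]: "poly p \<in> borel_measurable borel"
    by (intro borel_measurable_continuous_onI continuous_on_poly continuous_on_id)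
  have f_meas: "f \<in> borel_measurable borel" unfolding f_def by measurable
  have f_zero: "f x = 0" if "x \<notin> {-1..1}" for x using semicircle_bounds(3)[OF that] by (simp add: f_def)
  have "bounded (poly p ` {-1..1})"
    by (intro compact_imp_bounded compact_continuous_image continuous_intros) auto
  then obtain L where L: "\<forall>x\<in>{-1..1}. norm (poly p x) \<le> L" unfolding bounded_iff by auto
  have f_bound: "\<bar>f x\<bar> \<le> \<bar>L\<bar>" for x
  proof (cases "x \<in> {-1..1}")
    case True
    have "\<bar>poly p x\<bar> \<le> \<bar>L\<bar>" using bspec[OF L True] by simp
    then have "\<bar>semicircle x\<bar> * \<bar>poly p x\<bar> \<le> 1 * \<bar>L\<bar>"
      using semicircle_bounds(2)[of x] by (intro mult_mono) auto
    then show ?thesis by (simp add: f_def abs_mult)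
  qed (simp add: f_zero)
  show ?thesis
  proof (rule that[of R])
    fix k c w x :: real assume "w > 0" "x \<in> {-1<..<1}"
    then show "has_hilbert_transform (\<lambda>t. k * (semicircle ((t - c) / w) * poly p ((t - c) / w))) (c + w * x) (k * poly R x)"
      using has_hilbert_transform_affine[OF f_meas f_bound f_zero _ R, of w x k c] by (simp add: f_def)
  qed
qed

context convex_body
begin

text \<open>In these directions an enclosing ball and an interior ball touch the boundary at the
  same point, so the section at depth \<open>u\<close> lies between two balls of radius of order
  \<open>sqrt u\<close>. Squaring gives the integer power \<open>n - 1\<close>. The sign
  \<open>s\<close> describes the same hyperplane from either side, with different coordinates
  \<open>rot_to\<close>.\<close>

lemma two_sided_growth:
  assumes smooth: "smooth_boundary K" and \<eta>: "norm \<eta> = 1" and \<epsilon>: "\<epsilon> > 0"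
  obtains \<zeta> C c \<delta> where "norm \<zeta> = 1" "norm (\<zeta> - \<eta>) < \<epsilon>" "c > 0" "\<delta> > 0"
    "\<And>s u. s \<in> {-1, 1} \<Longrightarrow> 0 < u \<Longrightarrow> u < \<delta> \<Longrightarrow>
       c * u ^ (DIM('a) - 1) \<le> (sectional_volume K (s *\<^sub>R \<zeta>) (s * (h_plus K \<zeta> - u)))\<^sup>2 \<and>
       (sectional_volume K (s *\<^sub>R \<zeta>) (s * (h_plus K \<zeta> - u)))\<^sup>2 \<le> C * u ^ (DIM('a) - 1)"
proof -
  define m where "m = DIM('a) - 1"
  obtain \<zeta> y \<rho> where \<zeta>: "norm \<zeta> = 1" "norm (\<zeta> - \<eta>) < \<epsilon>" and \<rho>: "\<rho> > 0" and sub: "K \<subseteq> cball y \<rho>"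
    and p: "y + \<rho> *\<^sub>R \<zeta> \<in> closure K" and top: "y \<bullet> \<zeta> + \<rho> = h_plus K \<zeta>"
    by (rule enclosing_ball_dense[OF \<eta> \<epsilon>], rule that)
  have \<zeta>\<zeta>: "\<zeta> \<bullet> \<zeta> = 1" using \<zeta>(1) by (simp add: norm_eq_1)
  define q where "q = y + \<rho> *\<^sub>R \<zeta>"
  have q\<zeta>: "q \<bullet> \<zeta> = h_plus K \<zeta>" using top by (simp add: q_def inner_add_left \<zeta>\<zeta>)
  obtain r where r: "r > 0" "ball (q - r *\<^sub>R \<zeta>) r \<subseteq> K"
    using interior_ball[OF smooth p[folded q_def] \<zeta>(1) q\<zeta>] by blast
  define n where "n = real DIM('a)"
  have n: "n > 0" by (simp add: n_def)
  \<comment> \<open>The squared sides of the comparison cubes: half side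
    \<open>sqrt (r * u / n)\<close> for the inscribed and \<open>sqrt (2 * \<rho> * u)\<close> for
    the enclosing one.\<close>
  define c where "c = (4 * r / n) ^ m"
  define C where "C = (8 * \<rho>) ^ m"
  have main: "c * u ^ m \<le> (sectional_volume K (s *\<^sub>R \<zeta>) (s * (h_plus K \<zeta> - u)))\<^sup>2 \<and>
       (sectional_volume K (s *\<^sub>R \<zeta>) (s * (h_plus K \<zeta> - u)))\<^sup>2 \<le> C * u ^ m"
    if s: "s \<in> {-1, 1}" and u: "0 < u" "u < r" for s u
  proof
    let ?A = "sectional_volume K (s *\<^sub>R \<zeta>) (s * (h_plus K \<zeta> - u))"
    have ss: "s\<^sup>2 = 1" using s by auto
    have n1: "norm (s *\<^sub>R \<zeta>) = 1" using s \<zeta>(1) by auto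
    have off: "(s * (h_plus K \<zeta> - u) - x \<bullet> (s *\<^sub>R \<zeta>))\<^sup>2 = (h_plus K \<zeta> - u - x \<bullet> \<zeta>)\<^sup>2" for x
    proof -
      have "(s * (h_plus K \<zeta> - u) - x \<bullet> (s *\<^sub>R \<zeta>))\<^sup>2 = s\<^sup>2 * (h_plus K \<zeta> - u - x \<bullet> \<zeta>)\<^sup>2"
        by (simp add: right_diff_distrib flip: power_mult_distrib)
      then show ?thesis by (simp add: ss)
    qed
    have "\<rho>\<^sup>2 - (s * (h_plus K \<zeta> - u) - y \<bullet> (s *\<^sub>R \<zeta>))\<^sup>2 = \<rho>\<^sup>2 - (\<rho> - u)\<^sup>2"
      unfolding off by (simp add: top[symmetric] algebra_simps)
    also have "\<dots> \<le> (sqrt (2 * \<rho> * u))\<^sup>2" using u \<rho> by (simp add: power2_diff)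
    finally have "?A \<le> (2 * sqrt (2 * \<rho> * u)) ^ m"
      unfolding m_def using u \<rho> by (intro sectional_volume_le[OF n1 sub]) auto
    then have "?A\<^sup>2 \<le> ((2 * sqrt (2 * \<rho> * u)) ^ m)\<^sup>2" by (intro power_mono) auto
    also have "\<dots> = ((2 * sqrt (2 * \<rho> * u))\<^sup>2) ^ m" by (simp only: power_mult[symmetric] mult.commute)
    also have "(2 * sqrt (2 * \<rho> * u))\<^sup>2 = 8 * \<rho> * u" using u \<rho> by (simp add: power_mult_distrib)
    finally show "?A\<^sup>2 \<le> C * u ^ m" by (simp add: C_def power_mult_distrib)
    define w where "w = sqrt (r * u / n)"
    have w: "w > 0" "w\<^sup>2 = r * u / n" using u r(1) n by (auto simp: w_def)
    have "real DIM('a) * w\<^sup>2 = r * u" using n by (simp add: w(2) n_def)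
    also have "\<dots> \<le> r\<^sup>2 - (r - u)\<^sup>2"
    proof -
      have "r\<^sup>2 - (r - u)\<^sup>2 = r * u + u * (r - u)" by (simp add: power2_eq_square algebra_simps)
      then show ?thesis using u by simp
    qed
    also have "(r - u)\<^sup>2 = (s * (h_plus K \<zeta> - u) - (q - r *\<^sub>R \<zeta>) \<bullet> (s *\<^sub>R \<zeta>))\<^sup>2"
      unfolding off by (simp add: inner_diff_left q\<zeta> \<zeta>\<zeta>)
    finally have "(2 * w) ^ m \<le> ?A"
      unfolding m_def by (intro sectional_volume_ge[OF n1 bounded_K r(2) K_borel r(1) w(1)])
    then have "((2 * w) ^ m)\<^sup>2 \<le> ?A\<^sup>2" using w(1) by (intro power_mono) auto
    moreover have "((2 * w) ^ m)\<^sup>2 = c * u ^ m"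
    proof -
      have "((2 * w) ^ m)\<^sup>2 = ((2 * w)\<^sup>2) ^ m" by (simp only: power_mult[symmetric] mult.commute)
      also have "(2 * w)\<^sup>2 = (4 * r / n) * u" using w(2) by (simp add: power_mult_distrib)
      finally show ?thesis by (simp only: c_def power_mult_distrib)
    qed
    ultimately show "c * u ^ m \<le> ?A\<^sup>2" by simp
  qed
  have "c > 0" using r(1) n by (simp add: c_def)
  then show ?thesis by (rule that[OF \<zeta> _ r(1) main[unfolded m_def]])
qed

text \<open>Near the end of the support in a direction with two-sided growth the square of the section
  function has odd vanishing order \<open>DIM('a) - 1\<close>, which \<open>P\<^sup>2\<close> alone cannot produce.\<close>

lemma quadratic_vanishes_at_ends:
  fixes q P :: "'a \<Rightarrow> real \<Rightarrow> real"
  assumes smooth: "smooth_boundary K" and even: "even DIM('a)" and s: "s \<in> {-1, 1}"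
    and cont: "\<And>t. continuous_on (sphere 0 1) (\<lambda>\<xi>. q \<xi> t)"
    and P: "\<And>\<xi>. \<xi> \<in> sphere 0 1 \<Longrightarrow> \<exists>p. \<forall>t. P \<xi> t = poly p t"
    and q: "\<And>\<xi>. \<xi> \<in> sphere 0 1 \<Longrightarrow> \<exists>p. degree p = 2 \<and> (\<forall>t. q \<xi> t = poly p t)"
    and A: "\<And>\<xi> t. \<xi> \<in> sphere 0 1 \<Longrightarrow> t \<in> {h_minus K \<xi><..<h_plus K \<xi>} \<Longrightarrow> q \<xi> t > 0 \<and>
        ((sectional_volume K \<xi> t)\<^sup>2 = q \<xi> t * (P \<xi> t)\<^sup>2 \<or> (sectional_volume K \<xi> t)\<^sup>2 = (P \<xi> t)\<^sup>2 / q \<xi> t)"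
    and \<xi>: "norm \<xi> = 1"
  shows "q \<xi> (s * h_plus K (s *\<^sub>R \<xi>)) = 0"
proof -
  have n2: "DIM('a) \<ge> 2" 
  proof -
    have "DIM('a) \<noteq> 1" using even by auto
    then show ?thesis using DIM_positive[where 'a='a] by linarith
  qed
  \<comment> \<open>The value of \<open>q\<close> at an end of the support, the upper one for
    \<open>s = 1\<close> and the lower one for \<open>s = -1\<close>, in the interpolated form whose
    continuity is evident.\<close>
  define E where "E = (\<lambda>\<xi>. q \<xi> 0 + (s * h_plus K (s *\<^sub>R \<xi>)) * ((q \<xi> 1 - q \<xi> (-1)) / 2)
     + (s * h_plus K (s *\<^sub>R \<xi>))\<^sup>2 * ((q \<xi> 1 + q \<xi> (-1)) / 2 - q \<xi> 0))"
  have E: "E \<xi> = q \<xi> (s * h_plus K (s *\<^sub>R \<xi>))" if \<xi>: "\<xi> \<in> sphere 0 1" for \<xi>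
  proof -
    obtain p where "degree p = 2" "\<forall>t. q \<xi> t = poly p t" using q[OF \<xi>] by blast
    then show ?thesis unfolding E_def by (simp add: quadratic_through_three_points[of p "s * h_plus K (s *\<^sub>R \<xi>)"])
  qed
  have contE: "continuous_on (sphere 0 1) E"
    unfolding E_def
    by (intro continuous_intros cont continuous_on_compose2[OF continuous_h_plus]) auto
  have dense: "\<exists>\<zeta>\<in>sphere 0 1. norm (\<zeta> - \<eta>) < \<epsilon> \<and> E \<zeta> = 0" if \<eta>: "norm \<eta> = 1" and \<epsilon>: "\<epsilon> > 0" for \<eta> \<epsilon>
  proof -
    have ss: "s * s = 1" using s by auto
    have s\<eta>: "norm (s *\<^sub>R \<eta>) = 1" using s \<eta> by auto
    obtain \<zeta> C c \<delta> where \<zeta>: "norm \<zeta> = 1" "norm (\<zeta> - s *\<^sub>R \<eta>) < \<epsilon>" and c: "c > 0" and \<delta>: "\<delta> > 0" and growth: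
      "\<And>s u. s \<in> {-1, 1} \<Longrightarrow> 0 < u \<Longrightarrow> u < \<delta> \<Longrightarrow>
       c * u ^ (DIM('a) - 1) \<le> (sectional_volume K (s *\<^sub>R \<zeta>) (s * (h_plus K \<zeta> - u)))\<^sup>2 \<and>
       (sectional_volume K (s *\<^sub>R \<zeta>) (s * (h_plus K \<zeta> - u)))\<^sup>2 \<le> C * u ^ (DIM('a) - 1)"
      by (rule two_sided_growth[OF smooth s\<eta> \<epsilon>], rule that)
    define \<nu> where "\<nu> = s *\<^sub>R \<zeta>"
    have \<nu>: "norm \<nu> = 1" "\<nu> \<in> sphere 0 1" using s \<zeta>(1) by (auto simp: \<nu>_def)
    have s\<nu>: "s *\<^sub>R \<nu> = \<zeta>" using ss by (simp add: \<nu>_def)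
    have near: "norm (\<nu> - \<eta>) < \<epsilon>"
    proof -
      have "\<nu> - \<eta> = s *\<^sub>R (\<zeta> - s *\<^sub>R \<eta>)" using ss by (simp add: \<nu>_def scaleR_diff_right)
      then show ?thesis using \<zeta>(2) s by auto
    qed
    define k where "k = DIM('a) - 1"
    have oddk: "odd k" using even n2 by (simp add: k_def)
    define h where "h = s * h_plus K \<zeta>"
    define d where "d = min \<delta> (h_plus K \<zeta> - h_minus K \<zeta>)"
    have \<zeta>0: "\<zeta> \<noteq> 0" using \<zeta>(1) by auto
    have d: "d > 0" using \<delta> h_minus_less_h_plus[OF \<zeta>0] by (simp add: d_def)
    have inI: "h + (-s) * u \<in> {h_minus K \<nu><..<h_plus K \<nu>}" if u: "0 < u" "u < d" for u
    proof -
      have "u < h_plus K \<zeta> - h_minus K \<zeta>" using u by (simp add: d_def)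
      then show ?thesis using s u by (auto simp: h_def \<nu>_def h_minus_eq)
    qed
    have Ag: "c * u ^ k \<le> (sectional_volume K \<nu> (h + (-s) * u))\<^sup>2" "(sectional_volume K \<nu> (h + (-s) * u))\<^sup>2 \<le> C * u ^ k"
      if u: "0 < u" "u < d" for u
    proof -
      have "u < \<delta>" using u by (simp add: d_def)
      moreover have "h + (-s) * u = s * (h_plus K \<zeta> - u)" by (simp add: h_def algebra_simps)
      ultimately show "c * u ^ k \<le> (sectional_volume K \<nu> (h + (-s) * u))\<^sup>2" "(sectional_volume K \<nu> (h + (-s) * u))\<^sup>2 \<le> C * u ^ k"
        using growth[OF s u(1)] by (auto simp: \<nu>_def k_def)
    qed
    obtain p where p: "\<And>t. P \<nu> t = poly p t" using P[OF \<nu>(2)] by blast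
    obtain g where g: "degree g = 2" "\<And>t. q \<nu> t = poly g t" using q[OF \<nu>(2)] by blast
    \<comment> \<open>Otherwise \<open>g\<close> is bounded and bounded away from zero near
      \<open>h\<close>, so the square of \<open>p\<close> inherits the growth \<open>u^k\<close> and
      has odd order \<open>k\<close> at \<open>h\<close>.\<close>
    have "poly g h = 0"
    proof (rule ccontr)
      assume gh: "poly g h \<noteq> 0"
      have glim: "((\<lambda>u. poly g (h + (-s) * u)) \<longlongrightarrow> poly g (h + (-s) * 0)) (at_right 0)" by (intro tendsto_intros)
      have gpos: "poly g (h + (-s) * u) > 0" if "0 < u" "u < d" for u
        using A[OF \<nu>(2) inI[OF that]] by (simp add: g(2))
      have evd: "\<forall>\<^sub>F u in at_right 0. 0 < u \<and> u < d" using d by (auto simp: eventually_at_right_field)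
      have "0 \<le> poly g (h + (-s) * 0)"
      proof (rule tendsto_lowerbound[OF glim])
        show "\<forall>\<^sub>F u in at_right 0. 0 \<le> poly g (h + (-s) * u)"
          by (rule eventually_mono[OF evd]) (use gpos in \<open>auto intro: less_imp_le\<close>)
      qed simp
      then have gh0: "poly g h > 0" using gh by simp
      have "\<forall>\<^sub>F u in at_right 0. poly g (h + (-s) * u) > poly g h / 2"
        by (rule order_tendstoD(1)[OF glim]) (use gh0 in simp)
      moreover have "\<forall>\<^sub>F u in at_right 0. poly g (h + (-s) * u) < 2 * poly g h"
        by (rule order_tendstoD(2)[OF glim]) (use gh0 in simp)
      ultimately have "\<forall>\<^sub>F u in at_right 0. poly g h / 2 < poly g (h + (-s) * u) \<and> poly g (h + (-s) * u) < 2 * poly g h"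
        by eventually_elim simp
      then obtain d1 where d1: "d1 > 0" "\<And>u. 0 < u \<Longrightarrow> u < d1 \<Longrightarrow> poly g h / 2 < poly g (h + (-s) * u) \<and> poly g (h + (-s) * u) < 2 * poly g h"
        unfolding eventually_at_right_field by auto
      define G where "G = poly g h"
      \<comment> \<open>\<open>lo\<close> and \<open>hi\<close> bound both \<open>Q\<close> and
        \<open>1 / Q\<close> for \<open>Q\<close> between \<open>G / 2\<close> and
        \<open>2 * G\<close>, so the two possible representations are treated at once.\<close>
      define lo where "lo = min (1 / (2 * G)) (G / 2)"
      define hi where "hi = max (2 / G) (2 * G)"
      have lohi: "lo > 0" "hi > 0" using gh0 by (auto simp: lo_def hi_def G_def)
      have "poly (p\<^sup>2) (h + (-s) * u) \<ge> lo * c * u ^ k \<and> poly (p\<^sup>2) (h + (-s) * u) \<le> hi * C * u ^ k"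
        if u: "0 < u" "u < min d d1" for u
      proof -
        define A2 where "A2 = (sectional_volume K \<nu> (h + (-s) * u))\<^sup>2"
        define Q where "Q = poly g (h + (-s) * u)"
        define P2 where "P2 = poly (p\<^sup>2) (h + (-s) * u)"
        have Q: "G / 2 < Q" "Q < 2 * G" "0 < Q" using d1(2)[of u] u gh0 by (auto simp: Q_def G_def)
        have cases: "A2 = Q * P2 \<or> A2 = P2 / Q"
          using A[OF \<nu>(2) inI[of u]] u by (simp add: A2_def Q_def P2_def p g(2))
        have A0: "A2 \<ge> 0" by (simp add: A2_def)
        have G0: "G > 0" using gh0 by (simp add: G_def)
        have "lo * A2 \<le> P2 \<and> P2 \<le> hi * A2"
        proof -
          have 1: "P2 = A2 * (1 / Q) \<or> P2 = A2 * Q" using cases Q(3) by auto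
          have "1 / (2 * G) \<le> 1 / Q" by (rule frac_le) (use Q in auto)
          moreover have "1 / Q \<le> 1 / (G / 2)" by (rule frac_le) (use Q G0 in auto)
          ultimately have 2: "lo \<le> 1 / Q" "1 / Q \<le> hi" by (auto simp: lo_def hi_def)
          have 3: "lo \<le> Q" "Q \<le> hi" using Q by (auto simp: lo_def hi_def)
          show ?thesis using 1
          proof
            assume "P2 = A2 * (1 / Q)"
            then show ?thesis using mult_left_mono[OF 2(1) A0] mult_left_mono[OF 2(2) A0] by (simp add: mult.commute)
          next
            assume "P2 = A2 * Q"
            then show ?thesis using mult_left_mono[OF 3(1) A0] mult_left_mono[OF 3(2) A0] by (simp add: mult.commute)
          qed
        qed
        moreover have "lo * (c * u ^ k) \<le> lo * A2" "hi * A2 \<le> hi * (C * u ^ k)"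
          using Ag[of u] u lohi by (auto simp: A2_def intro!: mult_left_mono)
        ultimately show ?thesis unfolding P2_def[symmetric] by (simp add: mult.assoc)
      qed
      then have b: "lo * c * u ^ k \<le> \<bar>poly (p\<^sup>2) (h + (-s) * u)\<bar>" "\<bar>poly (p\<^sup>2) (h + (-s) * u)\<bar> \<le> hi * C * u ^ k"
        if u: "0 < u" "u < min d d1" for u
        using u by (auto simp: poly_power)
      have s': "- s \<in> {-1, 1}" using s by auto
      have "0 < lo * c" "0 < min d d1" using lohi(1) c d d1(1) by auto
      note ord = order_from_growth[OF s' this b]
      have "p\<^sup>2 \<noteq> 0" "order h (p\<^sup>2) = k" by (rule ord, assumption+)+
      moreover have "even (order h (p\<^sup>2))" using \<open>p\<^sup>2 \<noteq> 0\<close> by (simp add: power2_eq_square order_mult)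
      ultimately show False using oddk by simp
    qed
    then have "E \<nu> = 0" using E[OF \<nu>(2)] by (simp add: g(2) s\<nu> h_def)
    then show ?thesis using \<nu>(2) near by blast
  qed
  \<comment> \<open>A continuous function on the sphere that vanishes on a dense set vanishes
    everywhere.\<close>
  have "E \<xi> = 0"
  proof (rule ccontr)
    assume "E \<xi> \<noteq> 0"
    have "\<xi> \<in> sphere 0 1" using \<xi> by simp
    then obtain \<epsilon> where \<epsilon>: "\<epsilon> > 0" "\<And>\<zeta>. \<zeta> \<in> sphere 0 1 \<Longrightarrow> dist \<zeta> \<xi> < \<epsilon> \<Longrightarrow> dist (E \<zeta>) (E \<xi>) < \<bar>E \<xi>\<bar>"
      using contE[unfolded continuous_on_iff, rule_format, of \<xi> "\<bar>E \<xi>\<bar>"] \<open>E \<xi> \<noteq> 0\<close> by auto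
    obtain \<zeta> where "\<zeta> \<in> sphere 0 1" "norm (\<zeta> - \<xi>) < \<epsilon>" "E \<zeta> = 0" using dense[OF \<xi> \<epsilon>(1)] by blast
    then show False using \<epsilon>(2)[of \<zeta>] by (simp add: dist_norm)
  qed
  then show ?thesis using E[of \<xi>] \<xi> by simp
qed

section \<open>From vanishing endpoints to polynomial Hilbert transforms\<close>

lemma sqrt_eq_semicircle:
  assumes "\<xi> \<noteq> 0" "t \<in> {h_minus K \<xi><..<h_plus K \<xi>}"
  shows "sqrt ((t - h_minus K \<xi>) * (h_plus K \<xi> - t)) = half_width \<xi> * semicircle ((t - mid \<xi>) / half_width \<xi>)"
proof -
  define w where "w = half_width \<xi>"
  have w: "w > 0" unfolding w_def by (rule half_width_pos[OF assms(1)])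
  define x where "x = (t - mid \<xi>) / w"
  have x: "x \<in> {-1..1}" using interval_rescaled[OF assms(1), of t] assms(2) by (auto simp: x_def w_def)
  have t: "t = mid \<xi> + w * x" using w by (simp add: x_def)
  have ends: "h_minus K \<xi> = mid \<xi> - w" "h_plus K \<xi> = mid \<xi> + w" by (simp_all add: w_def mid_def half_width_def field_simps)
  have "(t - h_minus K \<xi>) * (h_plus K \<xi> - t) = w\<^sup>2 * (1 - x\<^sup>2)"
    unfolding t ends by (simp add: power2_eq_square algebra_simps)
  then show ?thesis using w x by (simp add: real_sqrt_mult semicircle_eq x_def[symmetric] w_def[symmetric])
qed

lemma polynomial_hilbert_transform:
  assumes \<xi>: "norm \<xi> = 1" and A: "\<And>t. t \<in> {h_minus K \<xi><..<h_plus K \<xi>} \<Longrightarrow>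
      sectional_volume K \<xi> t = semicircle ((t - mid \<xi>) / half_width \<xi>) * poly p t"
  shows "\<exists>B. \<forall>t\<in>{h_minus K \<xi><..<h_plus K \<xi>}. has_hilbert_transform (sectional_volume K \<xi>) t (poly B t)"
proof -
  define c where "c = mid \<xi>"
  define w where "w = half_width \<xi>"
  have \<xi>0: "\<xi> \<noteq> 0" using \<xi> by auto
  have w: "w > 0" unfolding w_def by (rule half_width_pos[OF \<xi>0])
  define p' where "p' = pcompose p [:c, w:]"
  have feq: "(\<lambda>t. 1 * (semicircle ((t - c) / w) * poly p' ((t - c) / w))) = sectional_volume K \<xi>"
  proof
    fix t
    show "1 * (semicircle ((t - c) / w) * poly p' ((t - c) / w)) = sectional_volume K \<xi> t"
    proof (cases "t \<in> {h_minus K \<xi><..<h_plus K \<xi>}")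
      case True
      then show ?thesis using A[OF True] w by (simp add: p'_def poly_pcompose c_def w_def)
    next
      case False
      have "(t - c) / w \<notin> {-1<..<1}" using interval_rescaled[OF \<xi>0, of t] False unfolding c_def w_def by blast
      then have "semicircle ((t - c) / w) = 0" unfolding semicircle_def abs_less_iff by auto
      then show ?thesis using sectional_volume_zero[OF \<xi> False] by simp
    qed
  qed
  obtain R where R: "\<And>k c w x. w > 0 \<Longrightarrow> x \<in> {-1<..<1} \<Longrightarrow>
    has_hilbert_transform (\<lambda>t. k * (semicircle ((t - c) / w) * poly p' ((t - c) / w))) (c + w * x) (k * poly R x)"
    using hilbert_transform_semicircle_poly[of p'] by blast
  show ?thesis
  proof (intro exI ballI)
    fix t assume t: "t \<in> {h_minus K \<xi><..<h_plus K \<xi>}"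
    define x where "x = (t - c) / w"
    have x: "x \<in> {-1<..<1}" using t interval_rescaled[OF \<xi>0, of t] unfolding x_def c_def w_def by blast
    have tx: "c + w * x = t" using w by (simp add: x_def)
    have "poly R x = poly (pcompose R [:- c / w, 1 / w:]) t"
      using w by (simp add: poly_pcompose x_def diff_divide_distrib)
    then show "has_hilbert_transform (sectional_volume K \<xi>) t (poly (pcompose R [:- c / w, 1 / w:]) t)"
      using R[OF w x, of 1 c] unfolding feq tx by simp
  qed
qed

lemma ellipsoid_if_polynomial_hilbert_transform:
  assumes "\<And>\<xi>. norm \<xi> = 1 \<Longrightarrow> \<exists>B. \<forall>t\<in>{h_minus K \<xi><..<h_plus K \<xi>}.
     has_hilbert_transform (sectional_volume K \<xi>) t (poly B t)"
  shows "is_ellipsoid K"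
proof (rule ellipsoid_if_quadratic_support)
  fix u v :: 'a assume "\<And>l. u + l *\<^sub>R v \<noteq> 0"
  then interpret body_line K u v by unfold_locales
  show "\<exists>c d. \<forall>l. h_minus K (u + l *\<^sub>R v) + h_plus K (u + l *\<^sub>R v) = c + l * d"
    "\<exists>c d e. \<forall>l. h_minus K (u + l *\<^sub>R v) * h_plus K (u + l *\<^sub>R v) = c + l * d + l\<^sup>2 * e"
    using endpoints_along_line[OF assms] by auto
qed

lemma vanishing_quadratic:
  assumes \<xi>: "norm \<xi> = 1" and r: "degree r = 2" "poly r (h_minus K \<xi>) = 0" "poly r (h_plus K \<xi>) = 0"
    and pos: "\<And>t. t \<in> {h_minus K \<xi><..<h_plus K \<xi>} \<Longrightarrow> poly r t > 0"
  obtains k where "k > 0" "\<And>t. t \<in> {h_minus K \<xi><..<h_plus K \<xi>} \<Longrightarrow>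
    sqrt (poly r t) = k * semicircle ((t - mid \<xi>) / half_width \<xi>)"
proof -
  have \<xi>0: "\<xi> \<noteq> 0" using \<xi> by auto
  have ab: "h_minus K \<xi> < h_plus K \<xi>" by (rule h_minus_less_h_plus[OF \<xi>0])
  have r_eq: "poly r t = - lead_coeff r * ((t - h_minus K \<xi>) * (h_plus K \<xi> - t))" for t
    using quadratic_factor[OF r] ab by (simp add: algebra_simps)
  have "mid \<xi> \<in> {h_minus K \<xi><..<h_plus K \<xi>}" using ab by (simp add: mid_def)
  moreover from this have "(mid \<xi> - h_minus K \<xi>) * (h_plus K \<xi> - mid \<xi>) > 0" by simp
  ultimately have neg: "- lead_coeff r > 0" using pos[of "mid \<xi>"] unfolding r_eq by (blast intro: zero_less_mult_pos2)
  show ?thesis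
  proof (rule that[of "sqrt (- lead_coeff r) * half_width \<xi>"])
    show "sqrt (- lead_coeff r) * half_width \<xi> > 0" using neg half_width_pos[OF \<xi>0] by simp
    show "sqrt (poly r t) = sqrt (- lead_coeff r) * half_width \<xi> * semicircle ((t - mid \<xi>) / half_width \<xi>)"
      if "t \<in> {h_minus K \<xi><..<h_plus K \<xi>}" for t
      unfolding r_eq real_sqrt_mult[of "- lead_coeff r"] sqrt_eq_semicircle[OF \<xi>0 that] by simp
  qed
qed

text \<open>The section function is bounded, so its product with the square root, which is
  \<open>p\<close>, tends to zero where \<open>r\<close> does.\<close>

lemma poly_zero_at_end:
  fixes p r :: "real poly"
  assumes \<xi>: "norm \<xi> = 1" and s: "s = h_minus K \<xi> \<or> s = h_plus K \<xi>" and r: "poly r s = 0"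
    and A: "\<And>t. t \<in> {h_minus K \<xi><..<h_plus K \<xi>} \<Longrightarrow> poly r t > 0 \<and> sectional_volume K \<xi> t = poly p t / sqrt (poly r t)"
  shows "poly p s = 0"
proof -
  have ab: "h_minus K \<xi> < h_plus K \<xi>" using \<xi> by (intro h_minus_less_h_plus) auto
  define G where "G = at s within {h_minus K \<xi><..<h_plus K \<xi>}"
  have nontriv: "G \<noteq> bot" unfolding G_def trivial_limit_within using ab s
    by (auto simp: islimpt_greaterThanLessThan1 islimpt_greaterThanLessThan2)
  have "((\<lambda>t. volume_bound * sqrt (poly r t)) \<longlongrightarrow> volume_bound * sqrt (poly r s)) G"
    unfolding G_def by (intro tendsto_intros)
  then have lim: "((\<lambda>t. volume_bound * sqrt (poly r t)) \<longlongrightarrow> 0) G" by (simp add: r)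
  have "\<forall>\<^sub>F t in G. norm (poly p t) \<le> volume_bound * sqrt (poly r t)"
    unfolding G_def eventually_at_filter
  proof (rule always_eventually, intro allI impI)
    fix t assume t: "t \<in> {h_minus K \<xi><..<h_plus K \<xi>}"
    have "poly p t = sectional_volume K \<xi> t * sqrt (poly r t)" using A[OF t] by simp
    moreover have "sectional_volume K \<xi> t * sqrt (poly r t) \<le> volume_bound * sqrt (poly r t)"
      by (intro mult_right_mono sectional_volume_bound[OF \<xi>]) (use A[OF t] in simp)
    moreover have "sectional_volume K \<xi> t * sqrt (poly r t) \<ge> 0"
      by (intro mult_nonneg_nonneg less_imp_le[OF sectional_volume_pos[OF \<xi> t]]) (use A[OF t] in simp)
    ultimately show "norm (poly p t) \<le> volume_bound * sqrt (poly r t)" by simp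
  qed
  from Lim_null_comparison[OF this lim] have "((\<lambda>t. poly p t) \<longlongrightarrow> 0) G" .
  moreover have "((\<lambda>t. poly p t) \<longlongrightarrow> poly p s) G" unfolding G_def by (intro tendsto_intros)
  ultimately show ?thesis using tendsto_unique[OF nontriv] by blast
qed

text \<open>Both representations enter the endpoint argument through the square of the section
  function. Once \<open>q\<close> vanishes at both ends its square root is a multiple of the
  rescaled semicircle, and each form becomes semicircle times polynomial.\<close>

lemma ellipsoid_if_sqrt_times_poly:
  fixes P q :: "'a \<Rightarrow> real \<Rightarrow> real"
  assumes smooth: "smooth_boundary K" and even: "even DIM('a)"
    and cont: "\<And>t. continuous_on (sphere 0 1) (\<lambda>\<xi>. q \<xi> t)"
    and P: "\<And>\<xi>. \<xi> \<in> sphere 0 1 \<Longrightarrow> \<exists>p. \<forall>t. P \<xi> t = poly p t"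
    and q: "\<And>\<xi>. \<xi> \<in> sphere 0 1 \<Longrightarrow> \<exists>p. degree p = 2 \<and> (\<forall>t. q \<xi> t = poly p t)"
    and A: "(\<forall>\<xi>\<in>sphere 0 1. \<forall>t\<in>{h_minus K \<xi><..<h_plus K \<xi>}. q \<xi> t > 0 \<and>
        sectional_volume K \<xi> t = sqrt (q \<xi> t) * P \<xi> t) \<or>
      (\<forall>\<xi>\<in>sphere 0 1. \<forall>t\<in>{h_minus K \<xi><..<h_plus K \<xi>}. q \<xi> t > 0 \<and>
        sectional_volume K \<xi> t = P \<xi> t / sqrt (q \<xi> t))"
  shows "is_ellipsoid K"
proof (rule ellipsoid_if_polynomial_hilbert_transform)
  fix \<xi> :: 'a assume \<xi>: "norm \<xi> = 1"
  have squares: "q \<xi> t > 0 \<and>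
        ((sectional_volume K \<xi> t)\<^sup>2 = q \<xi> t * (P \<xi> t)\<^sup>2 \<or> (sectional_volume K \<xi> t)\<^sup>2 = (P \<xi> t)\<^sup>2 / q \<xi> t)"
    if "\<xi> \<in> sphere 0 1" "t \<in> {h_minus K \<xi><..<h_plus K \<xi>}" for \<xi> t
    using A
  proof
    assume H: "\<forall>\<xi>\<in>sphere 0 1. \<forall>t\<in>{h_minus K \<xi><..<h_plus K \<xi>}. q \<xi> t > 0 \<and>
        sectional_volume K \<xi> t = sqrt (q \<xi> t) * P \<xi> t"
    have "q \<xi> t > 0" "sectional_volume K \<xi> t = sqrt (q \<xi> t) * P \<xi> t" using H that by blast+
    then show ?thesis by (simp add: power_mult_distrib)
  next
    assume H: "\<forall>\<xi>\<in>sphere 0 1. \<forall>t\<in>{h_minus K \<xi><..<h_plus K \<xi>}. q \<xi> t > 0 \<and>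
        sectional_volume K \<xi> t = P \<xi> t / sqrt (q \<xi> t)"
    have "q \<xi> t > 0" "sectional_volume K \<xi> t = P \<xi> t / sqrt (q \<xi> t)" using H that by blast+
    then show ?thesis by (simp add: power_divide)
  qed
  have ends: "q \<xi> (h_plus K \<xi>) = 0" "q \<xi> (h_minus K \<xi>) = 0"
    using quadratic_vanishes_at_ends[OF smooth even _ cont P q squares \<xi>, of 1]
      quadratic_vanishes_at_ends[OF smooth even _ cont P q squares \<xi>, of "-1"]
    by (simp_all add: h_minus_eq)
  have S: "\<xi> \<in> sphere 0 1" using \<xi> by simp
  obtain p where p: "\<And>t. P \<xi> t = poly p t" using P[OF S] by blast
  obtain r where r: "degree r = 2" "\<And>t. q \<xi> t = poly r t" using q[OF S] by blast
  have r0: "poly r (h_minus K \<xi>) = 0" "poly r (h_plus K \<xi>) = 0" using ends r(2) by auto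
  have rpos: "poly r t > 0" if "t \<in> {h_minus K \<xi><..<h_plus K \<xi>}" for t using squares[OF S that] r(2) by simp
  obtain k where k: "k > 0" "\<And>t. t \<in> {h_minus K \<xi><..<h_plus K \<xi>} \<Longrightarrow>
    sqrt (poly r t) = k * semicircle ((t - mid \<xi>) / half_width \<xi>)"
    using vanishing_quadratic[OF \<xi> r(1) r0 rpos] by blast
  have "\<exists>p'. \<forall>t\<in>{h_minus K \<xi><..<h_plus K \<xi>}.
    sectional_volume K \<xi> t = semicircle ((t - mid \<xi>) / half_width \<xi>) * poly p' t"
    using A
  proof
    assume H: "\<forall>\<xi>\<in>sphere 0 1. \<forall>t\<in>{h_minus K \<xi><..<h_plus K \<xi>}. q \<xi> t > 0 \<and>
        sectional_volume K \<xi> t = sqrt (q \<xi> t) * P \<xi> t"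
    have "sectional_volume K \<xi> t = semicircle ((t - mid \<xi>) / half_width \<xi>) * poly (smult k p) t"
      if t: "t \<in> {h_minus K \<xi><..<h_plus K \<xi>}" for t
      using H[rule_format, OF S t] k(2)[OF t] by (simp add: r(2) p)
    then show ?thesis by blast
  next
    assume *: "\<forall>\<xi>\<in>sphere 0 1. \<forall>t\<in>{h_minus K \<xi><..<h_plus K \<xi>}. q \<xi> t > 0 \<and>
        sectional_volume K \<xi> t = P \<xi> t / sqrt (q \<xi> t)"
    have H: "poly r t > 0 \<and> sectional_volume K \<xi> t = poly p t / sqrt (poly r t)"
      if "t \<in> {h_minus K \<xi><..<h_plus K \<xi>}" for t using bspec[OF bspec[OF * S] that] unfolding r(2) p .
    \<comment> \<open>The numerator vanishes at both simple roots of \<open>r\<close> and is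
      therefore divisible by \<open>r\<close>, which turns the quotient form into the product
      form.\<close>
    have p0: "poly p (h_minus K \<xi>) = 0" "poly p (h_plus K \<xi>) = 0"
      using poly_zero_at_end[OF \<xi> _ _ H] r0 by blast+
    have ab: "h_minus K \<xi> < h_plus K \<xi>" using \<xi> by (intro h_minus_less_h_plus) auto
    obtain p1 where p1: "p = [:- h_minus K \<xi>, 1:] * p1" using p0(1) by (auto simp: poly_eq_0_iff_dvd)
    have "poly p1 (h_plus K \<xi>) = 0" using p0(2) ab by (simp add: p1)
    then obtain p2 where p2: "p1 = [:- h_plus K \<xi>, 1:] * p2" by (auto simp: poly_eq_0_iff_dvd)
    have "r \<noteq> 0" using r(1) by auto
    have r_eq: "poly r t = lead_coeff r * ((t - h_minus K \<xi>) * (t - h_plus K \<xi>))" for t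
      using quadratic_factor[OF r(1) r0] ab by simp
    have *: "poly p t = poly r t * poly (smult (1 / lead_coeff r) p2) t" for t
      using \<open>r \<noteq> 0\<close> unfolding r_eq by (simp add: p1 p2 algebra_simps)
    have "sectional_volume K \<xi> t = sqrt (poly r t) * poly (smult (1 / lead_coeff r) p2) t"
      if t: "t \<in> {h_minus K \<xi><..<h_plus K \<xi>}" for t
    proof -
      have pos: "poly r t > 0" and "sectional_volume K \<xi> t = poly p t / sqrt (poly r t)" using H[OF t] by auto
      then have "sectional_volume K \<xi> t = poly r t / sqrt (poly r t) * poly (smult (1 / lead_coeff r) p2) t"
        unfolding * by simp
      then show ?thesis using real_div_sqrt[of "poly r t"] pos by simp
    qed
    then have "sectional_volume K \<xi> t = semicircle ((t - mid \<xi>) / half_width \<xi>) * poly (smult (k * (1 / lead_coeff r)) p2) t"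
      if t: "t \<in> {h_minus K \<xi><..<h_plus K \<xi>}" for t
      using k(2)[OF t] t by (simp add: algebra_simps)
    then show ?thesis by blast
  qed
  then show "\<exists>B. \<forall>t\<in>{h_minus K \<xi><..<h_plus K \<xi>}. has_hilbert_transform (sectional_volume K \<xi>) t (poly B t)"
    using polynomial_hilbert_transform[OF \<xi>] by blast
qed

section \<open>Explicit representations for an ellipsoid\<close>

definition rescaled_quadratic :: "'a \<Rightarrow> real \<Rightarrow> real" where
  "rescaled_quadratic \<xi> t = 1 - ((t - mid \<xi>) / half_width \<xi>)\<^sup>2"

lemma poly_rescaled:
  "poly (pcompose R [:- mid \<xi> / half_width \<xi>, 1 / half_width \<xi>:]) t = poly R ((t - mid \<xi>) / half_width \<xi>)"
  by (simp add: poly_pcompose diff_divide_distrib)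

lemma half_width_nonzero: "\<forall>\<xi>\<in>sphere 0 1. half_width \<xi> \<noteq> 0"
proof
  fix \<xi> :: 'a assume "\<xi> \<in> sphere 0 1"
  then have "\<xi> \<noteq> 0" by auto
  from half_width_pos[OF this] show "half_width \<xi> \<noteq> 0" by simp
qed

lemma continuous_rescaled:
  "continuous_on (sphere 0 1) (\<lambda>\<xi>. (t - mid \<xi>) / half_width \<xi>)"
  by (intro continuous_intros continuous_mid continuous_half_width half_width_nonzero)

lemma rescaled_quadratic_poly:
  assumes "\<xi> \<in> sphere 0 1"
  shows "\<exists>p :: real poly. degree p = 2 \<and> (\<forall>t. rescaled_quadratic \<xi> t = poly p t)"
proof -
  have w: "half_width \<xi> > 0" using assms by (intro half_width_pos) auto
  define p where "p = pcompose [:1, 0, -1:] [:- mid \<xi> / half_width \<xi>, 1 / half_width \<xi>:]"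
  have "degree p = 2" unfolding p_def degree_pcompose using w by simp
  moreover have "rescaled_quadratic \<xi> t = poly p t" for t
    unfolding p_def poly_rescaled by (simp add: rescaled_quadratic_def power2_eq_square)
  ultimately show ?thesis by blast
qed

lemma rescaled_quadratic_pos:
  assumes "\<xi> \<in> sphere 0 1" "t \<in> {h_minus K \<xi><..<h_plus K \<xi>}"
  shows "rescaled_quadratic \<xi> t > 0" "sqrt (rescaled_quadratic \<xi> t) = semicircle ((t - mid \<xi>) / half_width \<xi>)"
proof -
  define x where "x = (t - mid \<xi>) / half_width \<xi>"
  have "\<xi> \<noteq> 0" using assms(1) by auto
  then have "x \<in> {-1<..<1}" using interval_rescaled[of \<xi> t] assms(2) unfolding x_def by blast
  then have "\<bar>x\<bar> < 1" "x \<in> {-1..1}" by auto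
  then show "rescaled_quadratic \<xi> t > 0" "sqrt (rescaled_quadratic \<xi> t) = semicircle ((t - mid \<xi>) / half_width \<xi>)"
    unfolding rescaled_quadratic_def x_def[symmetric] using abs_square_less_1[of x] semicircle_eq[of x] by auto
qed

text \<open>Here evenness of the dimension enters: \<open>n - 1 = 2 * k + 1\<close> is odd, so the
  power of the semicircle is a single square root times the polynomial
  \<open>(1 - x^2)^k\<close>.\<close>

lemma ellipsoid_odd_power:
  assumes ell: "is_ellipsoid K" and even: "even DIM('a)"
  obtains C k where "\<And>\<xi> t. norm \<xi> = 1 \<Longrightarrow>
     sectional_volume K \<xi> t = C / half_width \<xi> * (semicircle ((t - mid \<xi>) / half_width \<xi>) * poly ([:1, 0, -1:] ^ k) ((t - mid \<xi>) / half_width \<xi>))"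
proof -
  have n2: "DIM('a) \<ge> 2"
  proof -
    have "DIM('a) \<noteq> 1" using even by auto
    then show ?thesis using DIM_positive[where 'a='a] by linarith
  qed
  have "odd (DIM('a) - 1)" using even n2 by simp
  then obtain k where k: "DIM('a) - 1 = 2 * k + 1" by (rule oddE)
  have pow: "semicircle x ^ (2 * k + 1) = semicircle x * poly ([:1, 0, -1:] ^ k) x" for x
  proof (cases "x \<in> {-1..1}")
    case True
    then have "(semicircle x)\<^sup>2 = 1 - x\<^sup>2"
      using semicircle_eq[OF True] by (simp add: abs_le_iff abs_square_le_1)
    then show ?thesis by (simp add: power_mult power2_eq_square)
  next
    case False
    then show ?thesis using semicircle_bounds(3)[OF False] by simp
  qed
  show ?thesis
    using ellipsoid_sectional_volume[OF ell n2] that unfolding k pow by blast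
qed

lemma ellipsoid_sqrt_times_poly:
  assumes ell: "is_ellipsoid K" and even: "even DIM('a)"
  shows "\<exists>P q :: 'a \<Rightarrow> real \<Rightarrow> real.
        (\<forall>t. continuous_on (sphere 0 1) (\<lambda>\<xi>. P \<xi> t)) \<and>
        (\<forall>t. continuous_on (sphere 0 1) (\<lambda>\<xi>. q \<xi> t)) \<and>
        (\<forall>\<xi>\<in>sphere 0 1. (\<exists>p :: real poly. \<forall>t. P \<xi> t = poly p t)) \<and>
        (\<forall>\<xi>\<in>sphere 0 1. (\<exists>p :: real poly. degree p = 2 \<and> (\<forall>t. q \<xi> t = poly p t))) \<and>
        (\<forall>\<xi>\<in>sphere 0 1. \<forall>t\<in>{h_minus K \<xi><..<h_plus K \<xi>}. q \<xi> t > 0 \<and>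
            sectional_volume K \<xi> t = sqrt (q \<xi> t) * P \<xi> t)" (is ?times)
    and "\<exists>P q :: 'a \<Rightarrow> real \<Rightarrow> real.
        (\<forall>t. continuous_on (sphere 0 1) (\<lambda>\<xi>. P \<xi> t)) \<and>
        (\<forall>t. continuous_on (sphere 0 1) (\<lambda>\<xi>. q \<xi> t)) \<and>
        (\<forall>\<xi>\<in>sphere 0 1. (\<exists>p :: real poly. \<forall>t. P \<xi> t = poly p t)) \<and>
        (\<forall>\<xi>\<in>sphere 0 1. (\<exists>p :: real poly. degree p = 2 \<and> (\<forall>t. q \<xi> t = poly p t))) \<and>
        (\<forall>\<xi>\<in>sphere 0 1. \<forall>t\<in>{h_minus K \<xi><..<h_plus K \<xi>}. q \<xi> t > 0 \<and>
            sectional_volume K \<xi> t = P \<xi> t / sqrt (q \<xi> t))" (is ?divide)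
proof -
  obtain C k where Ck: "\<And>\<xi> t. norm \<xi> = 1 \<Longrightarrow>
     sectional_volume K \<xi> t = C / half_width \<xi> * (semicircle ((t - mid \<xi>) / half_width \<xi>) * poly ([:1, 0, -1:] ^ k) ((t - mid \<xi>) / half_width \<xi>))"
    using ellipsoid_odd_power[OF assms] by blast
  \<comment> \<open>The exponent \<open>k\<close> serves the product form; one further factor
    \<open>1 - x^2\<close>, that is \<open>Suc k\<close>, serves the quotient form.\<close>
  define P where "P = (\<lambda>m \<xi> t. C / half_width \<xi> * poly ([:1, 0, -1:] ^ m) ((t - mid \<xi>) / half_width \<xi>))"
  have contP: "continuous_on (sphere 0 1) (\<lambda>\<xi>. P m \<xi> t)" for m t
    unfolding P_def by (intro continuous_intros continuous_rescaled continuous_half_width half_width_nonzero)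
  have contq: "continuous_on (sphere 0 1) (\<lambda>\<xi>. rescaled_quadratic \<xi> t)" for t
    unfolding rescaled_quadratic_def by (intro continuous_intros continuous_rescaled)
  have polyP: "\<exists>p. \<forall>t. P m \<xi> t = poly p t" for m \<xi>
    by (rule exI[of _ "smult (C / half_width \<xi>) (pcompose ([:1, 0, -1:] ^ m) [:- mid \<xi> / half_width \<xi>, 1 / half_width \<xi>:])"])
      (simp only: P_def poly_rescaled poly_smult simp_thms)
  have times: "sectional_volume K \<xi> t = sqrt (rescaled_quadratic \<xi> t) * P k \<xi> t"
    and divide: "sectional_volume K \<xi> t = P (Suc k) \<xi> t / sqrt (rescaled_quadratic \<xi> t)"
    if "\<xi> \<in> sphere 0 1" "t \<in> {h_minus K \<xi><..<h_plus K \<xi>}" for \<xi> t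
  proof -
    show times: "sectional_volume K \<xi> t = sqrt (rescaled_quadratic \<xi> t) * P k \<xi> t"
      using Ck[of \<xi> t] that(1) by (simp add: rescaled_quadratic_pos[OF that] P_def)
    have "P (Suc k) \<xi> t = rescaled_quadratic \<xi> t * P k \<xi> t"
      by (simp add: P_def rescaled_quadratic_def power2_eq_square)
    then have "P (Suc k) \<xi> t / sqrt (rescaled_quadratic \<xi> t)
        = rescaled_quadratic \<xi> t / sqrt (rescaled_quadratic \<xi> t) * P k \<xi> t" by simp
    also have "rescaled_quadratic \<xi> t / sqrt (rescaled_quadratic \<xi> t) = sqrt (rescaled_quadratic \<xi> t)"
      using rescaled_quadratic_pos(1)[OF that] by (intro real_div_sqrt) simp
    finally show "sectional_volume K \<xi> t = P (Suc k) \<xi> t / sqrt (rescaled_quadratic \<xi> t)"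
      using times by simp
  qed
  show ?times
    by (intro exI[of _ "P k"] exI[of _ rescaled_quadratic] conjI allI ballI contP contq polyP
        rescaled_quadratic_poly rescaled_quadratic_pos(1) times)
  show ?divide
    by (intro exI[of _ "P (Suc k)"] exI[of _ rescaled_quadratic] conjI allI ballI contP contq polyP
        rescaled_quadratic_poly rescaled_quadratic_pos(1) divide)
qed

lemma ellipsoid_polynomial_hilbert_transform:
  assumes ell: "is_ellipsoid K" and even: "even DIM('a)"
  shows "\<exists>(N::nat) (b :: nat \<Rightarrow> 'a \<Rightarrow> real).
        (\<forall>j\<le>N. continuous_on (sphere 0 1) (b j)) \<and>
        (\<forall>\<xi>\<in>sphere 0 1. \<forall>t\<in>{h_minus K \<xi><..<h_plus K \<xi>}.
            has_hilbert_transform (sectional_volume K \<xi>) t (\<Sum>j\<le>N. b j \<xi> * t ^ j))"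
proof -
  obtain C k where Ck: "\<And>\<xi> t. norm \<xi> = 1 \<Longrightarrow>
     sectional_volume K \<xi> t = C / half_width \<xi> * (semicircle ((t - mid \<xi>) / half_width \<xi>) * poly ([:1, 0, -1:] ^ k) ((t - mid \<xi>) / half_width \<xi>))"
    using ellipsoid_odd_power[OF assms] by blast
  obtain R where R: "\<And>a c w x. w > 0 \<Longrightarrow> x \<in> {-1<..<1} \<Longrightarrow>
    has_hilbert_transform (\<lambda>t. a * (semicircle ((t - c) / w) * poly ([:1, 0, -1:] ^ k) ((t - c) / w))) (c + w * x) (a * poly R x)"
    using hilbert_transform_semicircle_poly[of "[:1, 0, -1:] ^ k"] by blast
  define Q where "Q = (\<lambda>\<xi>. pcompose R [:- mid \<xi> / half_width \<xi>, 1 / half_width \<xi>:])"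
  define b where "b = (\<lambda>j \<xi>. C / half_width \<xi> * coeff (Q \<xi>) j)"
  show ?thesis
  \<comment> \<open>\<open>R\<close> is the same for all directions and the affine substitution does
    not raise its degree, so this bound is uniform.\<close>
  proof (intro exI[of _ "degree R"] exI[of _ b] conjI allI impI ballI)
    fix j
    show "continuous_on (sphere 0 1) (b j)"
      unfolding b_def Q_def
      by (intro continuous_intros continuous_coeff_pcompose continuous_mid continuous_half_width half_width_nonzero)
  next
    fix \<xi> t assume \<xi>: "\<xi> \<in> sphere 0 1" and t: "t \<in> {h_minus K \<xi><..<h_plus K \<xi>}"
    have \<xi>0: "\<xi> \<noteq> 0" and \<xi>1: "norm \<xi> = 1" using \<xi> by auto
    have wpos: "half_width \<xi> > 0" by (rule half_width_pos[OF \<xi>0])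
    define x where "x = (t - mid \<xi>) / half_width \<xi>"
    have x: "x \<in> {-1<..<1}" using interval_rescaled[OF \<xi>0, of t] t unfolding x_def by blast
    have tx: "mid \<xi> + half_width \<xi> * x = t" using wpos by (simp add: x_def)
    have "degree (Q \<xi>) \<le> degree R" unfolding Q_def degree_pcompose by simp
    then have "poly (Q \<xi>) t = (\<Sum>j\<le>degree R. coeff (Q \<xi>) j * t ^ j)"
      unfolding poly_altdef by (intro sum.mono_neutral_left) (auto intro: coeff_eq_0)
    moreover have "poly (Q \<xi>) t = poly R x" unfolding Q_def poly_rescaled x_def ..
    ultimately have sum: "(\<Sum>j\<le>degree R. b j \<xi> * t ^ j) = C / half_width \<xi> * poly R x"
      by (simp add: b_def sum_distrib_left mult.assoc)
    show "has_hilbert_transform (sectional_volume K \<xi>) t (\<Sum>j\<le>degree R. b j \<xi> * t ^ j)"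
      unfolding sum using R[OF wpos x, of "C / half_width \<xi>" "mid \<xi>"] unfolding tx Ck[OF \<xi>1, symmetric] by simp
  qed
qed

end

theorem theorem1p2:
  fixes K :: "'a::euclidean_space set"
  assumes n_even: "even DIM('a)"
    and K_open: "open K" and K_convex: "convex K" and K_nonempty: "K \<noteq> {}"
    and K_bounded: "bounded K"
    and K_smooth: "smooth_boundary K"
  defines "I \<equiv> (\<lambda>\<xi>. {h_minus K \<xi> <..< h_plus K \<xi>})"
  shows
   "((\<exists>P q :: 'a \<Rightarrow> real \<Rightarrow> real.
        (\<forall>t. continuous_on (sphere 0 1) (\<lambda>\<xi>. P \<xi> t)) \<and>
        (\<forall>t. continuous_on (sphere 0 1) (\<lambda>\<xi>. q \<xi> t)) \<and>
        (\<forall>\<xi>\<in>sphere 0 1. (\<exists>p :: real poly. \<forall>t. P \<xi> t = poly p t)) \<and>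
        (\<forall>\<xi>\<in>sphere 0 1. (\<exists>p :: real poly. degree p = 2 \<and> (\<forall>t. q \<xi> t = poly p t))) \<and>
        (\<forall>\<xi>\<in>sphere 0 1. \<forall>t\<in>I \<xi>. q \<xi> t > 0 \<and>
            sectional_volume K \<xi> t = sqrt (q \<xi> t) * P \<xi> t))
      \<longleftrightarrow> is_ellipsoid K)
  \<and> ((\<exists>P q :: 'a \<Rightarrow> real \<Rightarrow> real.
        (\<forall>t. continuous_on (sphere 0 1) (\<lambda>\<xi>. P \<xi> t)) \<and>
        (\<forall>t. continuous_on (sphere 0 1) (\<lambda>\<xi>. q \<xi> t)) \<and>
        (\<forall>\<xi>\<in>sphere 0 1. (\<exists>p :: real poly. \<forall>t. P \<xi> t = poly p t)) \<and>
        (\<forall>\<xi>\<in>sphere 0 1. (\<exists>p :: real poly. degree p = 2 \<and> (\<forall>t. q \<xi> t = poly p t))) \<and>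
        (\<forall>\<xi>\<in>sphere 0 1. \<forall>t\<in>I \<xi>. q \<xi> t > 0 \<and>
            sectional_volume K \<xi> t = P \<xi> t / sqrt (q \<xi> t)))
      \<longleftrightarrow> is_ellipsoid K)
  \<and> ((\<exists>(N::nat) (b :: nat \<Rightarrow> 'a \<Rightarrow> real).
        (\<forall>j\<le>N. continuous_on (sphere 0 1) (b j)) \<and>
        (\<forall>\<xi>\<in>sphere 0 1. \<forall>t\<in>I \<xi>.
            has_hilbert_transform (sectional_volume K \<xi>) t (\<Sum>j\<le>N. b j \<xi> * t ^ j)))
      \<longleftrightarrow> is_ellipsoid K)"
proof -
  interpret convex_body K by unfold_locales (use assms in auto)
  show ?thesis
    unfolding I_def
  proof (intro conjI iffI)
    assume "is_ellipsoid K"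
    then show "\<exists>P q :: 'a \<Rightarrow> real \<Rightarrow> real.
        (\<forall>t. continuous_on (sphere 0 1) (\<lambda>\<xi>. P \<xi> t)) \<and>
        (\<forall>t. continuous_on (sphere 0 1) (\<lambda>\<xi>. q \<xi> t)) \<and>
        (\<forall>\<xi>\<in>sphere 0 1. (\<exists>p :: real poly. \<forall>t. P \<xi> t = poly p t)) \<and>
        (\<forall>\<xi>\<in>sphere 0 1. (\<exists>p :: real poly. degree p = 2 \<and> (\<forall>t. q \<xi> t = poly p t))) \<and>
        (\<forall>\<xi>\<in>sphere 0 1. \<forall>t\<in>{h_minus K \<xi><..<h_plus K \<xi>}. q \<xi> t > 0 \<and>
            sectional_volume K \<xi> t = sqrt (q \<xi> t) * P \<xi> t)"
      and "\<exists>P q :: 'a \<Rightarrow> real \<Rightarrow> real.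
        (\<forall>t. continuous_on (sphere 0 1) (\<lambda>\<xi>. P \<xi> t)) \<and>
        (\<forall>t. continuous_on (sphere 0 1) (\<lambda>\<xi>. q \<xi> t)) \<and>
        (\<forall>\<xi>\<in>sphere 0 1. (\<exists>p :: real poly. \<forall>t. P \<xi> t = poly p t)) \<and>
        (\<forall>\<xi>\<in>sphere 0 1. (\<exists>p :: real poly. degree p = 2 \<and> (\<forall>t. q \<xi> t = poly p t))) \<and>
        (\<forall>\<xi>\<in>sphere 0 1. \<forall>t\<in>{h_minus K \<xi><..<h_plus K \<xi>}. q \<xi> t > 0 \<and>
            sectional_volume K \<xi> t = P \<xi> t / sqrt (q \<xi> t))"
      and "\<exists>(N::nat) (b :: nat \<Rightarrow> 'a \<Rightarrow> real).
        (\<forall>j\<le>N. continuous_on (sphere 0 1) (b j)) \<and>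
        (\<forall>\<xi>\<in>sphere 0 1. \<forall>t\<in>{h_minus K \<xi><..<h_plus K \<xi>}.
            has_hilbert_transform (sectional_volume K \<xi>) t (\<Sum>j\<le>N. b j \<xi> * t ^ j))"
      using ellipsoid_sqrt_times_poly[OF _ n_even] ellipsoid_polynomial_hilbert_transform[OF _ n_even] by blast+
  next
    assume "\<exists>P q :: 'a \<Rightarrow> real \<Rightarrow> real.
        (\<forall>t. continuous_on (sphere 0 1) (\<lambda>\<xi>. P \<xi> t)) \<and>
        (\<forall>t. continuous_on (sphere 0 1) (\<lambda>\<xi>. q \<xi> t)) \<and>
        (\<forall>\<xi>\<in>sphere 0 1. (\<exists>p :: real poly. \<forall>t. P \<xi> t = poly p t)) \<and>
        (\<forall>\<xi>\<in>sphere 0 1. (\<exists>p :: real poly. degree p = 2 \<and> (\<forall>t. q \<xi> t = poly p t))) \<and>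
        (\<forall>\<xi>\<in>sphere 0 1. \<forall>t\<in>{h_minus K \<xi><..<h_plus K \<xi>}. q \<xi> t > 0 \<and>
            sectional_volume K \<xi> t = sqrt (q \<xi> t) * P \<xi> t)"
    then obtain P q :: "'a \<Rightarrow> real \<Rightarrow> real" where
      "\<forall>t. continuous_on (sphere 0 1) (\<lambda>\<xi>. q \<xi> t)"
      "\<forall>\<xi>\<in>sphere 0 1. (\<exists>p :: real poly. \<forall>t. P \<xi> t = poly p t)"
      "\<forall>\<xi>\<in>sphere 0 1. (\<exists>p :: real poly. degree p = 2 \<and> (\<forall>t. q \<xi> t = poly p t))"
      "\<forall>\<xi>\<in>sphere 0 1. \<forall>t\<in>{h_minus K \<xi><..<h_plus K \<xi>}. q \<xi> t > 0 \<and>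
            sectional_volume K \<xi> t = sqrt (q \<xi> t) * P \<xi> t" by (elim exE conjE)
    then show "is_ellipsoid K" by (intro ellipsoid_if_sqrt_times_poly[of q P] K_smooth n_even) blast+
  next
    assume "\<exists>P q :: 'a \<Rightarrow> real \<Rightarrow> real.
        (\<forall>t. continuous_on (sphere 0 1) (\<lambda>\<xi>. P \<xi> t)) \<and>
        (\<forall>t. continuous_on (sphere 0 1) (\<lambda>\<xi>. q \<xi> t)) \<and>
        (\<forall>\<xi>\<in>sphere 0 1. (\<exists>p :: real poly. \<forall>t. P \<xi> t = poly p t)) \<and>
        (\<forall>\<xi>\<in>sphere 0 1. (\<exists>p :: real poly. degree p = 2 \<and> (\<forall>t. q \<xi> t = poly p t))) \<and>
        (\<forall>\<xi>\<in>sphere 0 1. \<forall>t\<in>{h_minus K \<xi><..<h_plus K \<xi>}. q \<xi> t > 0 \<and>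
            sectional_volume K \<xi> t = P \<xi> t / sqrt (q \<xi> t))"
    then obtain P q :: "'a \<Rightarrow> real \<Rightarrow> real" where
      "\<forall>t. continuous_on (sphere 0 1) (\<lambda>\<xi>. q \<xi> t)"
      "\<forall>\<xi>\<in>sphere 0 1. (\<exists>p :: real poly. \<forall>t. P \<xi> t = poly p t)"
      "\<forall>\<xi>\<in>sphere 0 1. (\<exists>p :: real poly. degree p = 2 \<and> (\<forall>t. q \<xi> t = poly p t))"
      "\<forall>\<xi>\<in>sphere 0 1. \<forall>t\<in>{h_minus K \<xi><..<h_plus K \<xi>}. q \<xi> t > 0 \<and>
            sectional_volume K \<xi> t = P \<xi> t / sqrt (q \<xi> t)" by (elim exE conjE)
    then show "is_ellipsoid K" by (intro ellipsoid_if_sqrt_times_poly[of q P] K_smooth n_even) blast+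
  next
    assume "\<exists>(N::nat) (b :: nat \<Rightarrow> 'a \<Rightarrow> real).
        (\<forall>j\<le>N. continuous_on (sphere 0 1) (b j)) \<and>
        (\<forall>\<xi>\<in>sphere 0 1. \<forall>t\<in>{h_minus K \<xi><..<h_plus K \<xi>}.
            has_hilbert_transform (sectional_volume K \<xi>) t (\<Sum>j\<le>N. b j \<xi> * t ^ j))"
    then obtain N b where b: "\<forall>\<xi>\<in>sphere 0 1. \<forall>t\<in>{h_minus K \<xi><..<h_plus K \<xi>}.
        has_hilbert_transform (sectional_volume K \<xi>) t (\<Sum>j\<le>N. b j \<xi> * t ^ j)" by blast
    show "is_ellipsoid K"
    proof (rule ellipsoid_if_polynomial_hilbert_transform)
      fix \<xi> :: 'a assume "norm \<xi> = 1"
      then have "\<forall>t\<in>{h_minus K \<xi><..<h_plus K \<xi>}. has_hilbert_transform (sectional_volume K \<xi>) t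
          (poly (\<Sum>j\<le>N. monom (b j \<xi>) j) t)"
        using b by (simp add: poly_sum poly_monom)
      then show "\<exists>B. \<forall>t\<in>{h_minus K \<xi><..<h_plus K \<xi>}. has_hilbert_transform (sectional_volume K \<xi>) t (poly B t)"
        by blast
    qed
  qed
qed

end
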